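(* Let $D\subset\mathbb R^3$ be the open unit ball centered at the origin, with elastic parameters $(\tilde\lambda,\tilde\mu,\tilde\rho)$, embedded in the homogeneous elastic medium $(\mathbb R^3\setminus\overline D;\lambda,\mu,\rho)$, and let $B_R\supseteq D$ be the ball of radius $R$ centered at the origin. Assume $\tilde\lambda=\lambda/\delta$, $\tilde\mu=\mu/\delta$, $\tilde\rho=\rho/\epsilon$ with constants $0<\delta\ll1$, $0<\epsilon\ll1$, $\tau=\sqrt{\delta/\epsilon}<1$; $\lambda,\mu,\rho=\mathcal O(1)$; and $\omega=o(1)$. Let the incident wave be $\mathbf u^i(\mathbf x)=f_{n,n}\,j_n(k_s|\mathbf x|)\,\mathcal T_n^n(\theta,\varphi)$ with $f_{n,n}\in\mathbb C\setminus\{0\}$, and let $\mathbf u$ in $D$ and $\mathbf u^s$ in $\mathbb R^3\setminus\overline D$ be the corresponding total field and scattered field of the elastic scattering problem described in the context. Let $\gamma_1\in(0,1)$, $\gamma_2\in(1,R)$. For a fixed sufficiently small boundary localization level $0<\varepsilon\ll1$, if $$n\ge\max\{n_1,n_2,1/\delta^2\},\qquad n_1=\left\lfloor\tfrac12\left(\tfrac{\ln\varepsilon}{\ln\gamma_1}-3\right)\right\rfloor+1,\quad n_2=\left\lfloor\tfrac12\left(1-\tfrac{\ln\varepsilon}{\ln\gamma_2}\right)\right\rfloor+1,$$ then $$\frac{\|\nabla\mathbf u\|_{L^2(\mathcal M_-^{1-\gamma_1}(\partial D))^3}}{\|\mathbf u^i\|_{L^2(D)^3}}\ge\frac{n\delta}{4\sqrt\pi}\gg1,\qquad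 \frac{\|\nabla\mathbf u^s\|_{L^2(\mathcal M_+^{\gamma_2-1}(\partial D))^3}}{\|\mathbf u^i\|_{L^2(D)^3}}\ge\frac{n}{9\sqrt\pi}\gg1,$$ i.e. surface resonance occurs.
   Context: Scattering problem. $\omega>0$ is the angular frequency. $\mathcal L_{\lambda,\mu}=\mu\Delta+(\lambda+\mu)\nabla\nabla\cdot$ is the Lamé operator; $\lambda,\mu$ are real with $\mu>0$, $3\lambda+2\mu>0$, likewise $\tilde\mu>0$, $3\tilde\lambda+2\tilde\mu>0$; the densities $\rho,\tilde\rho$ are positive. The incident field $\mathbf u^i$ is an entire solution of $\mathcal L_{\lambda,\mu}\mathbf u^i+\omega^2\rho\mathbf u^i=0$ in $\mathbb R^3$. The total field $\mathbf u$ (with $\mathbf u=\mathbf u^i+\mathbf u^s$ outside $D$) satisfies $\mathcal L_{\tilde\lambda,\tilde\mu}\mathbf u+\omega^2\tilde\rho\mathbf u=0$ in $D$; $\mathcal L_{\lambda,\mu}\mathbf u+\omega^2\rho\mathbf u=0$ in $\mathbb R^3\setminus\overline D$; $\mathbf u|_-=\mathbf u|_+$ and $\partial_{\nu,\tilde\lambda,\tilde\mu}\mathbf u|_-=\partial_{\nu,\lambda,\mu}\mathbf u|_+$ on $\partial D$ ($\pm$ = limits from outside/inside $D$), where $\partial_{\nu,\lambda,\mu}\mathbf u=\lambda(\nabla\cdot\mathbf u)\nu+\mu(\nabla\mathbf u+\nabla\mathbf u^\top)\nu$ and $\nu$ is the outward unit normal; and $\mathbf u^s$ satisfies the radiation condition,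 as $|\mathbf x|\to\infty$, $(\nabla\times\nabla\times\mathbf u^s)\times\frac{\mathbf x}{|\mathbf x|}-\mathrm i k_s\nabla\times\mathbf u^s=\mathcal O(|\mathbf x|^{-2})$ and $\frac{\mathbf x}{|\mathbf x|}\cdot\nabla(\nabla\cdot\mathbf u^s)-\mathrm i k_p\nabla\cdot\mathbf u^s=\mathcal O(|\mathbf x|^{-2})$. Here $k_s=\omega\sqrt{\rho/\mu}$, $k_p=\omega\sqrt{\rho/(\lambda+2\mu)}$. Special functions. $n\ge1$ is an integer; $(\theta,\varphi)$ are the spherical angles of $\mathbf x$; $j_n$ is the spherical Bessel function of order $n$; $Y_n^m(\theta,\varphi)=C_n^mP_n^{|m|}(\cos\theta)e^{\mathrm i m\varphi}$ with $C_n^m=\sqrt{\frac{2n+1}{4\pi}\frac{(n-|m|)!}{(n+|m|)!}}$ and $P_n^{|m|}$ the associated Legendre functions; $\mathcal T_n^m=\nabla_{\mathbb S^2}Y_n^m\wedge\nu$ ($\wedge$ the cross product, $\nu=\mathbf x/|\mathbf x|$, $\nabla_{\mathbb S^2}$ the surface gradient). Boundary layers. $\mathcal M_-^{\xi}(\partial D)=\{\mathbf x\in D:\ d_{\partial D}(\mathbf x)<\xi\}$ and $\mathcal M_+^{\xi}(\partial D)=\{\mathbf x\in B_R\setminus\overline D:\ d_{\partial D}(\mathbf x)<\xi\}$, with $d_{\partial D}$ the Euclidean distance to $\partial D$. $\lfloor\cdot\rfloor$ is the floor function. The $L^2$ norm of the matrix field $\nabla\mathbf u$ uses the Frobenius norm.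 Surface resonance means that both ratios of gradient norm in the boundary layer to $\|\mathbf u^i\|_{L^2(D)^3}$ are $\gg1$. Asymptotics. $o(\cdot)$ refers to the regime $\omega\to0$; $a\ll1$ (resp. $a\gg1$) means $a$ is sufficiently small (resp. large). $\delta$ is the Lamé contrast and $\epsilon$ the density contrast; $\varepsilon$ (a different symbol) is the boundary localization level. *)

theory Defs
  imports "HOL-Analysis.Analysis" "HOL-Library.Landau_Symbols"
    "HOL-Computational_Algebra.Polynomial"
begin

section \<open>Vector calculus for complex fields on \<open>\<real>\<^sup>3\<close>\<close>

type_synonym cfield = "real^3 \<Rightarrow> complex^3"

definition partial :: "3 \<Rightarrow> (real^3 \<Rightarrow> 'a::real_normed_vector) \<Rightarrow> real^3 \<Rightarrow> 'a" where
  "partial j f x = frechet_derivative f (at x) (axis j 1)"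

text \<open>Only meant for open \<open>S\<close>.\<close>
definition C2_on :: "(real^3) set \<Rightarrow> (real^3 \<Rightarrow> 'a::real_normed_vector) \<Rightarrow> bool" where
  "C2_on S f \<longleftrightarrow>
     (\<forall>x\<in>S. f differentiable (at x)) \<and>
     (\<forall>j. \<forall>x\<in>S. partial j f differentiable (at x)) \<and>
     (\<forall>i j. continuous_on S (partial i (partial j f)))"

definition cgrad :: "(real^3 \<Rightarrow> complex) \<Rightarrow> cfield" where
  "cgrad f x = (\<chi> j. partial j f x)"

text \<open>Row \<open>i\<close> is the gradient of the \<open>i\<close>-th component. The type-class norm of
  \<^typ>\<open>complex^3^3\<close> is the Frobenius norm.\<close>
definition vgrad :: "cfield \<Rightarrow> real^3 \<Rightarrow> complex^3^3" where
  "vgrad u x = (\<chi> i j. partial j (\<lambda>y. u y $ i) x)"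

definition divg :: "cfield \<Rightarrow> real^3 \<Rightarrow> complex" where
  "divg u x = (\<Sum>j\<in>UNIV. partial j (\<lambda>y. u y $ j) x)"

definition curl :: "cfield \<Rightarrow> cfield" where
  "curl u x = vector
     [partial 2 (\<lambda>y. u y $ 3) x - partial 3 (\<lambda>y. u y $ 2) x,
      partial 3 (\<lambda>y. u y $ 1) x - partial 1 (\<lambda>y. u y $ 3) x,
      partial 1 (\<lambda>y. u y $ 2) x - partial 2 (\<lambda>y. u y $ 1) x]"

definition laplacian :: "cfield \<Rightarrow> cfield" where
  "laplacian u x = (\<chi> i. \<Sum>j\<in>UNIV. partial j (partial j (\<lambda>y. u y $ i)) x)"

definition cvec :: "real^3 \<Rightarrow> complex^3" where
  "cvec v = (\<chi> i. of_real (v $ i))"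

text \<open>The library's \<^const>\<open>cross3\<close> is restricted to real vectors.\<close>
definition ccross :: "complex^3 \<Rightarrow> complex^3 \<Rightarrow> complex^3" where
  "ccross a b = vector
     [a$2 * b$3 - a$3 * b$2, a$3 * b$1 - a$1 * b$3, a$1 * b$2 - a$2 * b$1]"

definition cdot :: "complex^3 \<Rightarrow> complex^3 \<Rightarrow> complex" where
  "cdot a b = (\<Sum>i\<in>UNIV. a$i * b$i)"

definition L2norm :: "(real^3) set \<Rightarrow> (real^3 \<Rightarrow> 'a::real_normed_vector) \<Rightarrow> real" where
  "L2norm S f = sqrt (LINT x:S|lborel. (norm (f x))\<^sup>2)"


section \<open>The elastic scattering problem\<close>

definition lame_op :: "real \<Rightarrow> real \<Rightarrow> cfield \<Rightarrow> cfield" where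
  "lame_op lam mu u x = mu *\<^sub>R laplacian u x + (lam + mu) *\<^sub>R cgrad (divg u) x"

definition traction :: "real \<Rightarrow> real \<Rightarrow> real^3 \<Rightarrow> cfield \<Rightarrow> cfield" where
  "traction lam mu nu u x =
     lam *\<^sub>R (divg u x *s cvec nu)
     + mu *\<^sub>R ((vgrad u x + transpose (vgrad u x)) *v cvec nu)"

definition k_s :: "real \<Rightarrow> real \<Rightarrow> real \<Rightarrow> real" where
  "k_s mu rho \<omega> = \<omega> * sqrt (rho / mu)"

definition k_p :: "real \<Rightarrow> real \<Rightarrow> real \<Rightarrow> real \<Rightarrow> real" where
  "k_p lam mu rho \<omega> = \<omega> * sqrt (rho / (lam + 2 * mu))"

definition radiating :: "real \<Rightarrow> real \<Rightarrow> cfield \<Rightarrow> bool" where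
  "radiating kp ks u \<longleftrightarrow>
     (\<lambda>x. norm (ccross (curl (curl u) x) (cvec (x /\<^sub>R norm x))
                 - (\<i> * of_real ks) *s curl u x))
       \<in> O[at_infinity](\<lambda>x. 1 / (norm x)\<^sup>2) \<and>
     (\<lambda>x. norm (cdot (cvec (x /\<^sub>R norm x)) (cgrad (divg u) x)
                 - \<i> * of_real kp * divg u x))
       \<in> O[at_infinity](\<lambda>x. 1 / (norm x)\<^sup>2)"

text \<open>\<open>C\<^sup>2\<close> in the open set \<open>S\<close>, and the field and its gradient extend continuously to the
  boundary.\<close>
definition classical_on :: "(real^3) set \<Rightarrow> cfield \<Rightarrow> bool" where
  "classical_on S u \<longleftrightarrow> C2_on S u \<and>
     (\<forall>y\<in>frontier S. (\<exists>l. (u \<longlongrightarrow> l) (at y within S)) \<and>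
                      (\<exists>L. (vgrad u \<longlongrightarrow> L) (at y within S)))"

text \<open>\<open>nu\<close> is the outward unit normal on \<open>frontier D\<close>; \<open>lam', mu', rho'\<close> are the parameters
  inside \<open>D\<close>, and \<open>u\<close> is the total field on both sides. Its values on \<open>frontier D\<close> itself play
  no role: the transmission conditions equate one-sided limits.\<close>
definition scattering_solution ::
  "(real^3) set \<Rightarrow> (real^3 \<Rightarrow> real^3) \<Rightarrow> real \<Rightarrow> real \<Rightarrow> real \<Rightarrow> real \<Rightarrow> real \<Rightarrow> real
   \<Rightarrow> real \<Rightarrow> cfield \<Rightarrow> cfield \<Rightarrow> bool" where
  "scattering_solution D nu lam mu rho lam' mu' rho' \<omega> ui u \<longleftrightarrow>
     classical_on D u \<and> classical_on (- closure D) u \<and>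
     (\<forall>x\<in>D. lame_op lam' mu' u x + (\<omega>\<^sup>2 * rho') *\<^sub>R u x = 0) \<and>
     (\<forall>x\<in>- closure D. lame_op lam mu u x + (\<omega>\<^sup>2 * rho) *\<^sub>R u x = 0) \<and>
     (\<forall>y\<in>frontier D. \<exists>l. (u \<longlongrightarrow> l) (at y within D) \<and>
                          (u \<longlongrightarrow> l) (at y within (- closure D))) \<and>
     (\<forall>y\<in>frontier D. \<exists>t.
        (traction lam' mu' (nu y) u \<longlongrightarrow> t) (at y within D) \<and>
        (traction lam mu (nu y) u \<longlongrightarrow> t) (at y within (- closure D))) \<and>
     radiating (k_p lam mu rho \<omega>) (k_s mu rho \<omega>) (\<lambda>x. u x - ui x)"


section \<open>Special functions\<close>

text \<open>The everywhere convergent power series of the spherical Bessel function; the finite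
  product is the double factorial \<open>(2(n+p)+1)!!\<close>.\<close>
definition sph_bessel_j :: "nat \<Rightarrow> real \<Rightarrow> real" where
  "sph_bessel_j n t =
     (\<Sum>p. (-1)^p * t^(n + 2*p) / (2^p * fact p * (\<Prod>i\<le>n+p. 2 * real i + 1)))"

text \<open>Rodrigues' formula.\<close>
definition legendre_poly :: "nat \<Rightarrow> real poly" where
  "legendre_poly n = smult (1 / (2^n * fact n)) ((pderiv ^^ n) ([:-1, 0, 1:] ^ n))"

text \<open>Without the Condon-Shortley sign.\<close>
definition assoc_legendre :: "nat \<Rightarrow> nat \<Rightarrow> real \<Rightarrow> real" where
  "assoc_legendre n m t = sqrt (1 - t\<^sup>2) ^ m * poly ((pderiv ^^ m) (legendre_poly n)) t"

definition polar_angle :: "real^3 \<Rightarrow> real" where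
  "polar_angle x = arccos (x$3 / norm x)"

text \<open>On the polar axis the azimuth is set to \<open>0\<close>; there the factor \<^const>\<open>assoc_legendre\<close>
  vanishes unless \<open>m = 0\<close>, so the choice does not matter. Likewise the branch cut of
  \<^const>\<open>Arg\<close> is invisible because the azimuth enters only through \<open>exp (\<i> m \<phi>)\<close>
  with integer \<open>m\<close>.\<close>
definition azimuth :: "real^3 \<Rightarrow> real" where
  "azimuth x = Arg (Complex (x$1) (x$2))"

definition sph_harm_const :: "nat \<Rightarrow> int \<Rightarrow> real" where
  "sph_harm_const n m =
     sqrt ((2 * real n + 1) / (4 * pi) * fact (n - nat \<bar>m\<bar>) / fact (n + nat \<bar>m\<bar>))"

definition sph_harm :: "nat \<Rightarrow> int \<Rightarrow> real^3 \<Rightarrow> complex" where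
  "sph_harm n m x =
     of_real (sph_harm_const n m * assoc_legendre n (nat \<bar>m\<bar>) (cos (polar_angle x)))
     * exp (\<i> * of_int m * of_real (azimuth x))"

text \<open>The surface gradient on the unit sphere at \<open>v\<close> is the Euclidean gradient at \<open>v\<close> of the
  extension that is constant along rays.\<close>
definition sphere_grad :: "(real^3 \<Rightarrow> complex) \<Rightarrow> cfield" where
  "sphere_grad f v = cgrad (\<lambda>x. f (x /\<^sub>R norm x)) v"

definition vsph_harm_T :: "nat \<Rightarrow> int \<Rightarrow> cfield" where
  "vsph_harm_T n m x =
     ccross (sphere_grad (sph_harm n m) (x /\<^sub>R norm x)) (cvec (x /\<^sub>R norm x))"

definition incident_wave :: "complex \<Rightarrow> nat \<Rightarrow> real \<Rightarrow> cfield" where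
  "incident_wave f n ks x =
     (f * of_real (sph_bessel_j n (ks * norm x))) *s vsph_harm_T n (int n) x"


section \<open>Boundary layers and surface resonance\<close>

definition inner_layer :: "(real^3) set \<Rightarrow> real \<Rightarrow> (real^3) set" where
  "inner_layer D \<xi> = {x \<in> D. infdist x (frontier D) < \<xi>}"

definition outer_layer :: "(real^3) set \<Rightarrow> real \<Rightarrow> real \<Rightarrow> (real^3) set" where
  "outer_layer D R \<xi> = {x \<in> ball 0 R - closure D. infdist x (frontier D) < \<xi>}"

definition inner_ratio :: "(real^3) set \<Rightarrow> real \<Rightarrow> cfield \<Rightarrow> cfield \<Rightarrow> real" where
  "inner_ratio D \<xi> ui u = L2norm (inner_layer D \<xi>) (vgrad u) / L2norm D ui"

definition outer_ratio :: "(real^3) set \<Rightarrow> real \<Rightarrow> real \<Rightarrow> cfield \<Rightarrow> cfield \<Rightarrow> real" where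
  "outer_ratio D R \<xi> ui us = L2norm (outer_layer D R \<xi>) (vgrad us) / L2norm D ui"

text \<open>Surface resonance at level \<open>K\<close>; ``\<open>\<gg> 1\<close>'' is expressed by letting \<open>K\<close> be an arbitrary
  prescribed constant.\<close>
definition surface_resonance ::
  "real \<Rightarrow> (real^3) set \<Rightarrow> real \<Rightarrow> real \<Rightarrow> real \<Rightarrow> cfield \<Rightarrow> cfield \<Rightarrow> bool" where
  "surface_resonance K D R \<xi>1 \<xi>2 ui u \<longleftrightarrow>
     inner_ratio D \<xi>1 ui u \<ge> K \<and> outer_ratio D R \<xi>2 ui (\<lambda>x. u x - ui x) \<ge> K"

end

theory Submission
  imports Defs
begin

text \<open>
  Test the field on each sphere \<open>|x| = r\<close> against the conjugate of \<open>T\<^sub>n\<^sup>n\<close>. The rotation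
  invariance of the surface measure gives integration by parts on spheres, under which the Lame
  equation becomes the radial equation of order \<open>n\<close> for the projection \<open>a(r)\<close> of the field.
  Boundedness at the origin and the radiation condition at infinity kill the Wronskians with the
  spherical Bessel and Hankel solutions, so \<open>a\<close> is a multiple of the first inside the ball and, for
  the scattered field, of the second outside; neither existence nor uniqueness of the full solution
  is needed. Continuity of field and traction yields two linear equations for the two multiples.
  At low frequency the solutions behave like \<open>r\<^sup>n\<close> and \<open>r\<^bsup>-n-1\<^esup>\<close>, and the equations bound both
  multiples from below. By the Cauchy-Schwarz inequality on spheres, \<open>|a'|\<^sup>2\<close> is a lower bound for
  the gradient energy on the sphere of radius \<open>r\<close>; it grows like \<open>n\<^sup>2\<close> and, for large \<open>n\<close>, its integral
  concentrates in the layers next to the unit sphere.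
\<close>

section \<open>Partial derivatives\<close>

text \<open>The frequency threshold is fixed before \<open>n\<close>, so every low-frequency
  estimate has to be uniform in \<open>n\<close>. Both radial solutions are therefore split into a
  power of r and a series with value 1 at 0 and coefficients at most 1/k!; for small arguments such
  a series differs from 1 by at most twice its argument, whatever \<open>n\<close> is. The interior
  wave number is bounded by the exterior one because \<delta> < \<epsilon>. With pure powers the
  matching conditions read X = \<Phi> + Y and (n - 1) X = \<delta> ((n - 1) \<Phi> - (n + 2) Y),
  since the traction of the mode is mu (a' - a/r). Hence X is close to 2 \<delta> \<Phi> and Y to
  -\<Phi>. The proof asks only for |X| >= \<delta> |\<Phi>| and |X| <= |\<Phi>| / 4, and this slack
  absorbs the corrections. The transmitted field is of size \<delta>, and n >= 1/\<delta>^2 still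
  makes n \<delta> large. The localization level enters through one demand: the layers must hold 3/4
  of the integrated lower bound.\<close>

lemma partial_eqI: "(f has_derivative f') (at x) \<Longrightarrow> partial j f x = f' (axis j 1)"
  unfolding partial_def using frechet_derivative_at by metis

lemma has_derivative_partials:
  fixes f :: "real^3 \<Rightarrow> 'a::real_normed_vector"
  assumes "f differentiable (at x)"
  shows "(f has_derivative (\<lambda>h. \<Sum>j\<in>UNIV. h $ j *\<^sub>R partial j f x)) (at x)"
proof -
  have d: "(f has_derivative frechet_derivative f (at x)) (at x)"
    using assms frechet_derivative_works by blast
  then have lin: "linear (frechet_derivative f (at x))"
    using has_derivative_linear by blast
  have "frechet_derivative f (at x) h = (\<Sum>j\<in>UNIV. h $ j *\<^sub>R partial j f x)" for h
  proof -
    have "h = (\<Sum>j\<in>UNIV. h $ j *\<^sub>R axis j 1)"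
      using basis_expansion[of h] by (simp add: scalar_mult_eq_scaleR)
    then have "frechet_derivative f (at x) h
        = frechet_derivative f (at x) (\<Sum>j\<in>UNIV. h $ j *\<^sub>R axis j 1)" by simp
    also have "\<dots> = (\<Sum>j\<in>UNIV. h $ j *\<^sub>R partial j f x)"
      by (simp add: linear_sum[OF lin] linear_scale[OF lin] partial_def)
    finally show ?thesis .
  qed
  with d show ?thesis by (metis (no_types, lifting) ext)
qed

text \<open>The form of the chain rule that serves for all curves below: axis-parallel segments,
  rotation orbits and rays.\<close>

lemma curve_derivative:
  fixes f :: "real^3 \<Rightarrow> 'a::real_normed_vector"
  assumes "f differentiable (at (c t))" and "(c has_vector_derivative c') (at t)"
  shows "((\<lambda>t. f (c t)) has_vector_derivative (\<Sum>j\<in>UNIV. c' $ j *\<^sub>R partial j f (c t))) (at t)"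
proof -
  have "(f has_derivative (\<lambda>h. \<Sum>j\<in>UNIV. h $ j *\<^sub>R partial j f (c t))) (at (c t) within range c)"
    using has_derivative_partials[OF assms(1)] has_derivative_at_withinI by blast
  from vector_derivative_diff_chain_within[OF assms(2) this]
  show ?thesis by (simp add: o_def)
qed

text \<open>Differentiability is not assumed: \<open>frechet_derivative\<close> chooses among the
  derivatives at the point, and functions that agree near it have the same ones, if any.\<close>

lemma partial_cong:
  assumes "open S" "x \<in> S" "\<And>y. y \<in> S \<Longrightarrow> f y = g y"
  shows "partial j f x = partial j g x"
proof -
  have "(f has_derivative d) (at x) \<longleftrightarrow> (g has_derivative d) (at x)" for d
    using has_derivative_transform_within_open[of f d x UNIV S g]
      has_derivative_transform_within_open[of g d x UNIV S f] assms by auto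
  then show ?thesis unfolding partial_def frechet_derivative_def by simp
qed

lemma differentiable_cong_open:
  assumes "open S" "x \<in> S" "\<And>y. y \<in> S \<Longrightarrow> f y = g y" "f differentiable (at x)"
  shows "g differentiable (at x)"
  using has_derivative_transform_within_open[of f _ x UNIV S g] assms
  unfolding differentiable_def by blast

lemma partial_linear_comp:
  fixes f :: "real^3 \<Rightarrow> 'a::real_normed_vector"
  assumes "bounded_linear T" "f differentiable (at x)"
  shows "partial j (\<lambda>y. T (f y)) x = T (partial j f x)"
proof -
  have "(f has_derivative frechet_derivative f (at x)) (at x)"
    using assms frechet_derivative_works by blast
  from bounded_linear.has_derivative[OF assms(1) this] show ?thesis
    using partial_eqI by (fastforce simp: partial_def)
qed

lemma differentiable_linear_comp:
  fixes f :: "real^3 \<Rightarrow> 'a::real_normed_vector"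
  assumes "bounded_linear T" "f differentiable (at x)"
  shows "(\<lambda>y. T (f y)) differentiable (at x)"
  using assms bounded_linear.has_derivative unfolding differentiable_def by blast

lemma partial_const [simp]: "partial j (\<lambda>y. c) x = 0"
  using partial_eqI[OF has_derivative_const[of c "at x"]] .

lemma partial_add:
  assumes "f differentiable (at x)" "g differentiable (at x)"
  shows "partial j (\<lambda>y. f y + g y) x = partial j f x + partial j g x"
  using partial_eqI[OF has_derivative_add[OF assms[unfolded frechet_derivative_works]]]
  by (simp add: partial_def)

lemma partial_diff:
  assumes "f differentiable (at x)" "g differentiable (at x)"
  shows "partial j (\<lambda>y. f y - g y) x = partial j f x - partial j g x"
  using partial_eqI[OF has_derivative_diff[OF assms[unfolded frechet_derivative_works]]]
  by (simp add: partial_def)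

lemma partial_minus:
  assumes "f differentiable (at x)"
  shows "partial j (\<lambda>y. - f y) x = - partial j f x"
  using partial_eqI[OF has_derivative_minus[OF assms[unfolded frechet_derivative_works]]]
  by (simp add: partial_def)

lemma partial_mult:
  fixes f g :: "real^3 \<Rightarrow> 'a::real_normed_algebra"
  assumes "f differentiable (at x)" "g differentiable (at x)"
  shows "partial j (\<lambda>y. f y * g y) x = f x * partial j g x + partial j f x * g x"
  using partial_eqI[OF has_derivative_mult[OF assms[unfolded frechet_derivative_works]]]
  by (simp add: partial_def)

lemma partial_power:
  fixes f :: "real^3 \<Rightarrow> complex"
  assumes "f differentiable (at x)"
  shows "partial j (\<lambda>y. f y ^ n) x = of_nat n * f x ^ (n - 1) * partial j f x"
  using partial_eqI[OF has_derivative_power[OF assms[unfolded frechet_derivative_works], of n]]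
  by (simp add: partial_def)

lemma bounded_linear_coord: "bounded_linear (\<lambda>x::real^3. complex_of_real (x $ i))"
  using bounded_linear_compose[OF bounded_linear_of_real bounded_linear_vec_nth] by blast

lemma partial_coord [simp]:
  "partial j (\<lambda>x. complex_of_real (x $ i)) x = (if i = j then 1 else 0)"
  using partial_eqI[OF bounded_linear.has_derivative[OF bounded_linear_coord has_derivative_ident]]
  by (simp add: axis_def)

lemma differentiable_coord [simp]:
  "(\<lambda>x::real^3. complex_of_real (x $ i)) differentiable F"
  by (intro bounded_linear_imp_differentiable bounded_linear_coord)

section \<open>Functions of class C1 and C2 on open sets\<close>

definition C1_on :: "(real^3) set \<Rightarrow> (real^3 \<Rightarrow> 'a::real_normed_vector) \<Rightarrow> bool" where
  "C1_on S f \<longleftrightarrow> (\<forall>x\<in>S. f differentiable (at x)) \<and> (\<forall>j. continuous_on S (partial j f))"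

text \<open>Makes \<open>C2_on\<close> recursive: each closure property of \<open>C2_on\<close>
  reduces to a formula for the partial derivative and the closure properties of
  \<open>C1_on\<close>.\<close>

lemma C2_on_iff_C1:
  "C2_on S f \<longleftrightarrow> (\<forall>x\<in>S. f differentiable (at x)) \<and> (\<forall>j. C1_on S (partial j f))"
  unfolding C2_on_def C1_on_def by auto

lemma C1_on_differentiable: "C1_on S f \<Longrightarrow> x \<in> S \<Longrightarrow> f differentiable (at x)"
  unfolding C1_on_def by blast

lemma C1_on_continuous_partial: "C1_on S f \<Longrightarrow> continuous_on S (partial j f)"
  unfolding C1_on_def by blast

lemma C1_on_continuous: "C1_on S f \<Longrightarrow> continuous_on S f"
  unfolding C1_on_def
  by (meson continuous_at_imp_continuous_on differentiable_imp_continuous_within)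

lemma C2_on_partial: "C2_on S f \<Longrightarrow> C1_on S (partial j f)"
  unfolding C2_on_iff_C1 by blast

lemma C2_on_C1: "C2_on S f \<Longrightarrow> C1_on S f"
  using C1_on_continuous unfolding C2_on_iff_C1 C1_on_def[of S f] by blast

lemma C1_on_subset: "C1_on S f \<Longrightarrow> T \<subseteq> S \<Longrightarrow> C1_on T f"
  unfolding C1_on_def using continuous_on_subset by blast

lemma C2_on_subset: "C2_on S f \<Longrightarrow> T \<subseteq> S \<Longrightarrow> C2_on T f"
  unfolding C2_on_iff_C1 using C1_on_subset by blast

lemma C1_on_cong:
  assumes "open S" "\<And>y. y \<in> S \<Longrightarrow> f y = g y" "C1_on S f"
  shows "C1_on S g"
  unfolding C1_on_def
proof (intro conjI ballI allI)
  show "g differentiable (at x)" if "x \<in> S" for x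
    using differentiable_cong_open[OF assms(1) that, of f g] assms(2,3) that C1_on_differentiable by blast
  show "continuous_on S (partial j g)" for j
    using C1_on_continuous_partial[OF assms(3), of j]
    by (rule continuous_on_eq) (rule partial_cong[OF assms(1) _ assms(2)])
qed

lemma C1_on_const: "C1_on S (\<lambda>x. c)"
proof -
  have "partial j (\<lambda>x. c) = (\<lambda>x. 0)" for j by auto
  then show ?thesis unfolding C1_on_def by simp
qed

lemma C1_on_coord: "C1_on S (\<lambda>x. complex_of_real (x $ i))"
proof -
  have "partial j (\<lambda>x. complex_of_real (x $ i)) = (\<lambda>x. if i = j then 1 else 0)" for j by auto
  then show ?thesis unfolding C1_on_def by simp
qed

lemma C1_on_add:
  assumes "C1_on S f" "C1_on S g"
  shows "C1_on S (\<lambda>x. f x + g x)"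
  unfolding C1_on_def
proof (intro conjI ballI allI)
  show "(\<lambda>x. f x + g x) differentiable (at x)" if "x \<in> S" for x
    using assms C1_on_differentiable that by (blast intro: differentiable_add)
  have "continuous_on S (\<lambda>x. partial j f x + partial j g x)" for j
    using assms C1_on_continuous_partial by (blast intro: continuous_on_add)
  then show "continuous_on S (partial j (\<lambda>x. f x + g x))" for j
    by (rule continuous_on_eq) (simp add: partial_add C1_on_differentiable[OF assms(1)] C1_on_differentiable[OF assms(2)])
qed

lemma C1_on_minus:
  assumes "C1_on S f"
  shows "C1_on S (\<lambda>x. - f x)"
  unfolding C1_on_def
proof (intro conjI ballI allI)
  show "(\<lambda>x. - f x) differentiable (at x)" if "x \<in> S" for x
    using assms C1_on_differentiable that by (blast intro: differentiable_minus)
  have "continuous_on S (\<lambda>x. - partial j f x)" for j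
    using assms C1_on_continuous_partial by (blast intro: continuous_on_minus)
  then show "continuous_on S (partial j (\<lambda>x. - f x))" for j
    by (rule continuous_on_eq) (simp add: partial_minus C1_on_differentiable[OF assms(1)])
qed

lemma C1_on_diff:
  "C1_on S f \<Longrightarrow> C1_on S g \<Longrightarrow> C1_on S (\<lambda>x. f x - g x)"
  using C1_on_add[OF _ C1_on_minus, of S f g] by simp

lemma C1_on_mult:
  fixes f g :: "real^3 \<Rightarrow> complex"
  assumes "C1_on S f" "C1_on S g"
  shows "C1_on S (\<lambda>x. f x * g x)"
  unfolding C1_on_def
proof (intro conjI ballI allI)
  show "(\<lambda>x. f x * g x) differentiable (at x)" if "x \<in> S" for x
    using assms C1_on_differentiable that by (blast intro: differentiable_mult)
  have "continuous_on S (\<lambda>x. f x * partial j g x + partial j f x * g x)" for j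
    by (intro continuous_on_add continuous_on_mult C1_on_continuous_partial C1_on_continuous assms)
  then show "continuous_on S (partial j (\<lambda>x. f x * g x))" for j
    by (rule continuous_on_eq) (simp add: partial_mult C1_on_differentiable[OF assms(1)] C1_on_differentiable[OF assms(2)])
qed

lemma C1_on_sum:
  "(\<And>i. i \<in> I \<Longrightarrow> C1_on S (f i)) \<Longrightarrow> C1_on S (\<lambda>x. \<Sum>i\<in>I. f i x)"
  by (induction I rule: infinite_finite_induct) (auto intro: C1_on_const C1_on_add)

lemma C2_on_const: "C2_on S (\<lambda>x. c)"
proof -
  have "partial j (\<lambda>x. c) = (\<lambda>x. 0)" for j by auto
  then show ?thesis unfolding C2_on_iff_C1 by (simp add: C1_on_const)
qed

lemma C2_on_coord: "C2_on S (\<lambda>x. complex_of_real (x $ i))"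
proof -
  have "partial j (\<lambda>x. complex_of_real (x $ i)) = (\<lambda>x. if i = j then 1 else 0)" for j by auto
  then show ?thesis unfolding C2_on_iff_C1 by (simp add: C1_on_const)
qed

lemma C2_on_add:
  assumes "open S" "C2_on S f" "C2_on S g"
  shows "C2_on S (\<lambda>x. f x + g x)"
  unfolding C2_on_iff_C1
proof (intro conjI ballI allI)
  have d: "f differentiable (at x)" "g differentiable (at x)" if "x \<in> S" for x
    using assms(2,3) that unfolding C2_on_iff_C1 by blast+
  show "(\<lambda>x. f x + g x) differentiable (at x)" if "x \<in> S" for x
    using d[OF that] by (rule differentiable_add)
  have "C1_on S (\<lambda>x. partial j f x + partial j g x)" for j
    using assms C2_on_partial by (blast intro: C1_on_add)
  then show "C1_on S (partial j (\<lambda>x. f x + g x))" for j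
    by (rule C1_on_cong[OF assms(1), rotated]) (simp add: partial_add d)
qed

lemma C2_on_minus:
  assumes "open S" "C2_on S f"
  shows "C2_on S (\<lambda>x. - f x)"
  unfolding C2_on_iff_C1
proof (intro conjI ballI allI)
  have d: "f differentiable (at x)" if "x \<in> S" for x
    using assms(2) that unfolding C2_on_iff_C1 by blast+
  show "(\<lambda>x. - f x) differentiable (at x)" if "x \<in> S" for x
    using d[OF that] by (rule differentiable_minus)
  have "C1_on S (\<lambda>x. - partial j f x)" for j
    using assms C2_on_partial by (blast intro: C1_on_minus)
  then show "C1_on S (partial j (\<lambda>x. - f x))" for j
    by (rule C1_on_cong[OF assms(1), rotated]) (simp add: partial_minus d)
qed

lemma C2_on_diff:
  "open S \<Longrightarrow> C2_on S f \<Longrightarrow> C2_on S g \<Longrightarrow> C2_on S (\<lambda>x. f x - g x)"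
  using C2_on_add[OF _ _ C2_on_minus, of S f g] by simp

lemma C2_on_mult:
  fixes f g :: "real^3 \<Rightarrow> complex"
  assumes "open S" "C2_on S f" "C2_on S g"
  shows "C2_on S (\<lambda>x. f x * g x)"
  unfolding C2_on_iff_C1
proof (intro conjI ballI allI)
  have d: "f differentiable (at x)" "g differentiable (at x)" if "x \<in> S" for x
    using assms(2,3) that unfolding C2_on_iff_C1 by blast+
  show "(\<lambda>x. f x * g x) differentiable (at x)" if "x \<in> S" for x
    using d[OF that] by (rule differentiable_mult)
  have "C1_on S (\<lambda>x. f x * partial j g x + partial j f x * g x)" for j
    by (intro C1_on_mult C1_on_add C2_on_partial C2_on_C1 assms)
  then show "C1_on S (partial j (\<lambda>x. f x * g x))" for j
    by (rule C1_on_cong[OF assms(1), rotated]) (simp add: partial_mult d)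
qed

lemma C2_on_power:
  fixes f :: "real^3 \<Rightarrow> complex"
  shows "open S \<Longrightarrow> C2_on S f \<Longrightarrow> C2_on S (\<lambda>x. f x ^ n)"
  by (induction n) (auto intro: C2_on_const C2_on_mult)

lemma C1_on_linear_comp:
  assumes "bounded_linear T" "C1_on S f"
  shows "C1_on S (\<lambda>x. T (f x))"
  unfolding C1_on_def
proof (intro conjI ballI allI)
  show "(\<lambda>x. T (f x)) differentiable (at x)" if "x \<in> S" for x
    using assms C1_on_differentiable that by (blast intro: differentiable_linear_comp)
  have "continuous_on S (\<lambda>x. T (partial j f x))" for j
    using assms C1_on_continuous_partial by (blast intro: bounded_linear.continuous_on)
  then show "continuous_on S (partial j (\<lambda>x. T (f x)))" for j
    by (rule continuous_on_eq) (simp add: partial_linear_comp[OF assms(1)] C1_on_differentiable[OF assms(2)])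
qed

lemma C2_on_linear_comp:
  assumes "open S" "bounded_linear T" "C2_on S f"
  shows "C2_on S (\<lambda>x. T (f x))"
  unfolding C2_on_iff_C1
proof (intro conjI ballI allI)
  have d: "f differentiable (at x)" if "x \<in> S" for x
    using assms(3) that unfolding C2_on_iff_C1 by blast
  show "(\<lambda>x. T (f x)) differentiable (at x)" if "x \<in> S" for x
    using differentiable_linear_comp[OF assms(2) d[OF that]] .
  show "C1_on S (partial j (\<lambda>x. T (f x)))" for j
    using C1_on_linear_comp[OF assms(2) C2_on_partial[OF assms(3), of j]]
    by (rule C1_on_cong[OF assms(1), rotated]) (simp add: partial_linear_comp[OF assms(2)] d)
qed

lemma C2_on_nth:
  fixes u :: cfield
  shows "open S \<Longrightarrow> C2_on S u \<Longrightarrow> C2_on S (\<lambda>x. u x $ i)"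
  by (rule C2_on_linear_comp[OF _ bounded_linear_vec_nth])

text \<open>Write f(P s t) - f(P s 0) as the integral of \<open>partial j f\<close> over the second
  argument and differentiate in s at 0 by Leibniz's rule. This expresses the increment of
  \<open>partial i f\<close> along the j-axis as an integral of
  \<open>partial i (partial j f)\<close>; its derivative at the starting point gives both orders of
  differentiation.\<close>

lemma partial_commute:
  fixes f :: "real^3 \<Rightarrow> complex"
  assumes S: "open S" and f: "C2_on S f" and x: "x \<in> S"
  shows "partial i (partial j f) x = partial j (partial i f) x"
proof -
  obtain e where e: "e > 0" "ball x e \<subseteq> S"
    using S x open_contains_ball by blast
  \<comment> \<open>Two moves of length at most e/4 stay within distance e/2 of x.\<close>
  define a where "a = e / 4"
  define P where "P s t = x + s *\<^sub>R axis i 1 + t *\<^sub>R axis j 1" for s t :: real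
  have a: "a > 0" using e by (simp add: a_def)
  have PS: "P s t \<in> S" if "\<bar>s\<bar> \<le> a" "\<bar>t\<bar> \<le> a" for s t
  proof -
    have "dist x (P s t) = norm (s *\<^sub>R axis i 1 + t *\<^sub>R axis j 1 :: real^3)"
      by (simp add: P_def dist_norm norm_minus_commute algebra_simps)
    also have "\<dots> \<le> \<bar>s\<bar> + \<bar>t\<bar>"
      by (rule norm_triangle_le) (simp add: norm_axis_1)
    also have "\<dots> < e" using that a e by (simp add: a_def)
    finally show ?thesis using e(2) by auto
  qed
  have P0: "P 0 0 = x" by (simp add: P_def)
  have Pt: "((\<lambda>t. P s t) has_vector_derivative axis j 1) (at t)" for s t
    unfolding P_def by (auto intro!: derivative_eq_intros)
  have Ps: "((\<lambda>s. P s t) has_vector_derivative axis i 1) (at s)" for s t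
    unfolding P_def by (auto intro!: derivative_eq_intros)
  have ax: "(\<Sum>k\<in>UNIV. (axis l 1 :: real^3) $ k *\<^sub>R g k) = g l" for l and g :: "3 \<Rightarrow> complex"
    using exhaust_3[of l] by (auto simp: sum_3 axis_def)
  have dt: "((\<lambda>t. g (P s t)) has_vector_derivative partial j g (P s t)) (at t)"
    if "C1_on S g" "\<bar>s\<bar> \<le> a" "\<bar>t\<bar> \<le> a" for g :: "real^3 \<Rightarrow> complex" and s t
    using curve_derivative[where f = g and c = "P s", OF C1_on_differentiable[OF that(1) PS[OF that(2,3)]] Pt]
    by (simp add: ax)
  have ds: "((\<lambda>s. g (P s t)) has_vector_derivative partial i g (P s t)) (at s)"
    if "C1_on S g" "\<bar>s\<bar> \<le> a" "\<bar>t\<bar> \<le> a" for g :: "real^3 \<Rightarrow> complex" and s t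
    using curve_derivative[where f = g and c = "\<lambda>s. P s t", OF C1_on_differentiable[OF that(1) PS[OF that(2,3)]] Ps]
    by (simp add: ax)
  have C: "C1_on S f" "C1_on S (partial i f)" "C1_on S (partial j f)"
    using f C2_on_C1 C2_on_partial by blast+
  have contP: "continuous_on ({-a..a} \<times> cbox 0 t) (\<lambda>(s, \<tau>). g (P s \<tau>))"
    if "continuous_on S g" "0 \<le> t" "t \<le> a" for g :: "real^3 \<Rightarrow> complex" and t
  proof -
    have "continuous_on ({-a..a} \<times> cbox 0 t) (\<lambda>z. P (fst z) (snd z))"
      unfolding P_def by (intro continuous_intros)
    moreover have "(\<lambda>z. P (fst z) (snd z)) ` ({-a..a} \<times> cbox 0 t) \<subseteq> S"
      using that by (auto intro!: PS)
    ultimately show ?thesis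
      using continuous_on_compose2[OF that(1)] by (simp add: split_beta')
  qed
  have contl: "continuous_on (cbox 0 t) (\<lambda>\<tau>. g (P s \<tau>))"
    if "continuous_on S g" "0 \<le> t" "t \<le> a" "\<bar>s\<bar> \<le> a" for g :: "real^3 \<Rightarrow> complex" and s t
  proof (rule continuous_on_compose2[OF that(1)])
    show "continuous_on (cbox 0 t) (P s)" unfolding P_def by (intro continuous_intros)
    show "P s ` cbox 0 t \<subseteq> S" using that by (auto intro!: PS)
  qed
  have key: "partial i f (P 0 t) - partial i f (P 0 0)
      = integral {0..t} (\<lambda>\<tau>. partial i (partial j f) (P 0 \<tau>))" if t: "0 \<le> t" "t \<le> a" for t
  proof -
    have int: "f (P s t) - f (P s 0) = integral (cbox 0 t) (\<lambda>\<tau>. partial j f (P s \<tau>))"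
      if s: "s \<in> {-a..a}" for s
    proof -
      have "((\<lambda>\<tau>. partial j f (P s \<tau>)) has_integral (f (P s t) - f (P s 0))) {0..t}"
      proof (rule fundamental_theorem_of_calculus)
        show "((\<lambda>\<tau>. f (P s \<tau>)) has_vector_derivative partial j f (P s \<tau>)) (at \<tau> within {0..t})"
          if "\<tau> \<in> {0..t}" for \<tau>
          by (rule has_vector_derivative_at_within, rule dt[OF C(1)]) (use that s t in auto)
      qed (use t in simp)
      then show ?thesis by (simp add: integral_unique)
    qed
    have "((\<lambda>s. integral (cbox 0 t) (\<lambda>\<tau>. partial j f (P s \<tau>))) has_vector_derivative
        integral (cbox 0 t) (\<lambda>\<tau>. partial i (partial j f) (P 0 \<tau>))) (at 0 within {-a..a})"
    proof (rule leibniz_rule_vector_derivative)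
      show "((\<lambda>s. partial j f (P s \<tau>)) has_vector_derivative partial i (partial j f) (P s \<tau>))
          (at s within {-a..a})" if "s \<in> {-a..a}" "\<tau> \<in> cbox 0 t" for s \<tau>
        by (rule has_vector_derivative_at_within, rule ds[OF C(3)]) (use that t in auto)
      show "(\<lambda>\<tau>. partial j f (P s \<tau>)) integrable_on cbox 0 t" if "s \<in> {-a..a}" for s
        by (rule integrable_continuous, rule contl[OF C1_on_continuous[OF C(3)]]) (use that t in auto)
      show "continuous_on ({-a..a} \<times> cbox 0 t) (\<lambda>(s, \<tau>). partial i (partial j f) (P s \<tau>))"
        using t by (rule contP[OF C1_on_continuous_partial[OF C(3)]])
    qed (use a in auto)
    then have "((\<lambda>s. f (P s t) - f (P s 0)) has_vector_derivative
        integral (cbox 0 t) (\<lambda>\<tau>. partial i (partial j f) (P 0 \<tau>))) (at 0 within {-a..a})"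
      by (rule has_vector_derivative_transform[rotated 2]) (use a int in auto)
    moreover have "((\<lambda>s. f (P s t) - f (P s 0)) has_vector_derivative
        (partial i f (P 0 t) - partial i f (P 0 0))) (at 0 within {-a..a})"
      by (rule has_vector_derivative_at_within, rule has_vector_derivative_diff; rule ds[OF C(1)])
        (use t a in auto)
    ultimately show ?thesis
      using vector_derivative_unique_within_closed_interval[of "-a" a 0] a by simp
  qed
  \<comment> \<open>One-sided derivatives at the left end point are unique, so nonnegative t is
    enough.\<close>
  have "((\<lambda>t. integral {0..t} (\<lambda>\<tau>. partial i (partial j f) (P 0 \<tau>))) has_vector_derivative
      partial i (partial j f) (P 0 0)) (at 0 within {0..a})"
    using a contl[of "partial i (partial j f)" a 0] C1_on_continuous_partial[OF C(3)]
    by (intro integral_has_vector_derivative) auto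
  then have "((\<lambda>t. partial i f (P 0 t) - partial i f (P 0 0)) has_vector_derivative
      partial i (partial j f) (P 0 0)) (at 0 within {0..a})"
    by (rule has_vector_derivative_transform[rotated 2]) (use a key in auto)
  moreover have "((\<lambda>t. partial i f (P 0 t) - partial i f (P 0 0)) has_vector_derivative
      (partial j (partial i f) (P 0 0) - 0)) (at 0 within {0..a})"
    by (rule has_vector_derivative_at_within,
        rule has_vector_derivative_diff[OF dt[OF C(2)] has_vector_derivative_const]) (use a in auto)
  ultimately show ?thesis
    using vector_derivative_unique_within_closed_interval[of 0 a 0] a by (simp add: P0)
qed

section \<open>Surface measure on the unit sphere\<close>

lemma ball_borel_measurable [measurable]: "ball (a::real^3) r \<in> sets borel"
  by simp

text \<open>Stated for commutative monoids so that it applies to \<open>ennreal\<close>, where field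
  arithmetic fails.\<close>

lemma mult_regroup:
  fixes a b c d i t F :: "'a::comm_monoid_mult"
  assumes "a * b = c * d"
  shows "a * (i * b * (t * F)) = i * d * (t * c * F)"
proof -
  have "a * (i * b * (t * F)) = (a * b) * (i * (t * F))" by (simp only: mult_ac)
  also have "\<dots> = i * d * (t * c * F)" unfolding assms by (simp only: mult_ac)
  finally show ?thesis .
qed

text \<open>The arbitrary unit vector at 0 makes the map land on the sphere everywhere; the origin
  is a null set.\<close>

definition unit_dir :: "real^3 \<Rightarrow> real^3" where
  "unit_dir x = (if x = 0 then axis 1 1 else x /\<^sub>R norm x)"

text \<open>The surface measure as the radial image of Lebesgue measure on the unit ball; the factor is
  \<open>1 / (\<integral>r\<^sup>2 dr)\<close> over \<open>[0, 1]\<close>.\<close>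

definition sphere_measure :: "(real^3) measure" where
  "sphere_measure = distr (density lborel (\<lambda>x. 3 * indicator (ball 0 1) x))
     (restrict_space borel (sphere 0 1)) unit_dir"

lemma norm_unit_dir [simp]: "norm (unit_dir x) = 1"
  by (simp add: unit_dir_def norm_axis_1)

lemma measurable_unit_dir_borel [measurable]: "unit_dir \<in> borel \<rightarrow>\<^sub>M borel"
  unfolding unit_dir_def by measurable

lemma measurable_unit_dir [measurable]:
  "unit_dir \<in> borel \<rightarrow>\<^sub>M restrict_space borel (sphere 0 1)"
  by (rule measurable_restrict_space2) auto

lemma space_sphere_measure [simp]: "space sphere_measure = sphere 0 1"
  by (simp add: sphere_measure_def space_restrict_space)

lemma sets_sphere_measure [measurable_cong]:
  "sets sphere_measure = sets (restrict_space borel (sphere 0 1))"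
  by (simp add: sphere_measure_def)

lemma measurable_sphere_measureI:
  "f \<in> borel \<rightarrow>\<^sub>M N \<Longrightarrow> f \<in> sphere_measure \<rightarrow>\<^sub>M N"
  using measurable_restrict_space1[of f borel N "sphere 0 1"]
    measurable_cong_sets[OF sets_sphere_measure refl] by blast

lemma continuous_on_sphere_measurable:
  fixes f :: "real^3 \<Rightarrow> 'b::topological_space"
  assumes "continuous_on (sphere 0 1) f"
  shows "f \<in> borel_measurable sphere_measure"
  using borel_measurable_continuous_on_restrict[OF assms]
    measurable_cong_sets[OF sets_sphere_measure refl] by blast

lemma nn_integral_sphere_measure:
  assumes "f \<in> borel_measurable sphere_measure"
  shows "(\<integral>\<^sup>+v. f v \<partial>sphere_measure)
    = (\<integral>\<^sup>+x. 3 * indicator (ball 0 1) x * f (unit_dir x) \<partial>lborel)"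
proof -
  have f[measurable]: "f \<in> borel_measurable (restrict_space borel (sphere 0 1))"
    using assms measurable_cong_sets[OF sets_sphere_measure refl] by blast
  show ?thesis
    unfolding sphere_measure_def
    by (subst nn_integral_distr; (subst nn_integral_density)?) auto
qed

interpretation sphere_measure: finite_measure sphere_measure
proof
  have "emeasure sphere_measure (space sphere_measure)
      = (\<integral>\<^sup>+v. 1 \<partial>sphere_measure)" by simp
  also have "\<dots> = (\<integral>\<^sup>+x. 3 * indicator (ball 0 1) (x::real^3) \<partial>lborel)"
    by (subst nn_integral_sphere_measure) auto
  also have "\<dots> = 3 * emeasure lborel (ball 0 1 :: (real^3) set)"
    by (subst nn_integral_cmult) auto
  also have "\<dots> < top"
    using emeasure_lborel_ball_finite[of "0::real^3" 1] by (simp add: ennreal_mult_less_top)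
  finally show "emeasure sphere_measure (space sphere_measure) \<noteq> \<infinity>" by simp
qed

lemma integrable_sphere_continuous:
  fixes f :: "real^3 \<Rightarrow> 'b::{banach, second_countable_topology}"
  assumes "continuous_on (sphere 0 1) f"
  shows "integrable sphere_measure f"
proof -
  have "bounded (f ` sphere 0 1)"
    by (intro compact_imp_bounded compact_continuous_image assms) simp
  then obtain C where "\<And>v. v \<in> sphere 0 1 \<Longrightarrow> norm (f v) \<le> C"
    unfolding bounded_iff by blast
  then show ?thesis
    using continuous_on_sphere_measurable[OF assms]
    by (intro sphere_measure.integrable_const_bound[where B = C]) auto
qed

text \<open>Lebesgue measure is determined by its values on boxes. The preimage of a box is its
  image under the inverse map, which is again orthogonal and so preserves volume.\<close>

lemma distr_lborel_orthogonal:
  fixes T :: "real^3 \<Rightarrow> real^3"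
  assumes T: "orthogonal_transformation T"
  shows "distr lborel borel T = lborel"
proof (rule lborel_eqI[symmetric])
  have [measurable]: "T \<in> borel \<rightarrow>\<^sub>M borel"
    using T by (intro borel_measurable_continuous_onI linear_continuous_on)
      (simp add: linear_linear orthogonal_transformation_linear)
  define T' where "T' = inv T"
  have T': "orthogonal_transformation T'" unfolding T'_def using orthogonal_transformation_inv[OF T] .
  have bij: "bij T" using orthogonal_transformation_bij[OF T] .
  show "emeasure (distr lborel borel T) (box l u) = (\<Prod>b\<in>Basis. (u - l) \<bullet> b)"
    if lu: "\<And>b. b \<in> Basis \<Longrightarrow> l \<bullet> b \<le> u \<bullet> b" for l u :: "real^3"
  proof -
    have eq: "T -` box l u = T' ` box l u"
      unfolding T'_def using bij_vimage_eq_inv_image[OF bij] .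
    have lm: "T' ` box l u \<in> lmeasurable" by (intro measurable_orthogonal_image T') simp
    have "T -` box l u \<in> sets borel"
      using measurable_sets[of T borel borel "box l u"] by simp
    then have "emeasure (distr lborel borel T) (box l u) = emeasure lebesgue (T -` box l u)"
      by (simp add: emeasure_distr)
    also have "\<dots> = measure lebesgue (T' ` box l u)"
      unfolding eq using lm by (simp add: emeasure_eq_measure2)
    also have "\<dots> = measure lebesgue (box l u)"
      by (subst measure_orthogonal_image[OF T']) auto
    also have "\<dots> = (\<Prod>b\<in>Basis. (u - l) \<bullet> b)"
      using lu by (simp add: measure_lborel_box)
    finally show ?thesis .
  qed
qed simp

text \<open>Off the origin the radial projection commutes with T, and the density depends on the
  norm alone, so the invariance of Lebesgue measure passes to the sphere.\<close>

lemma distr_sphere_measure_orthogonal: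
  assumes T: "orthogonal_transformation T"
  shows "distr sphere_measure sphere_measure T = sphere_measure"
proof -
  let ?N = "restrict_space borel (sphere (0::real^3) 1)"
  define g :: "real^3 \<Rightarrow> ennreal" where "g = (\<lambda>x. 3 * indicator (ball 0 1) x)"
  define M where "M = density lborel g"
  have nT: "norm (T x) = norm x" for x using orthogonal_transformation_norm[OF T] .
  have lin: "linear T" using orthogonal_transformation_linear[OF T] .
  have [measurable]: "T \<in> borel \<rightarrow>\<^sub>M borel"
    using lin by (intro borel_measurable_continuous_onI linear_continuous_on) (simp add: linear_linear)
  have TN[measurable]: "T \<in> ?N \<rightarrow>\<^sub>M ?N"
    by (rule measurable_restrict_space2) (auto simp: nT intro!: measurable_restrict_space1)
  have [measurable]: "g \<in> borel_measurable borel" unfolding g_def by measurable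
  have [measurable_cong]: "sets M = sets borel" by (simp add: M_def)
  have u[measurable]: "unit_dir \<in> M \<rightarrow>\<^sub>M ?N" by measurable
  have S: "sphere_measure = distr M ?N unit_dir" unfolding sphere_measure_def M_def g_def ..
  have gT: "(\<lambda>x. g (T x)) = g" by (auto simp: g_def nT indicator_def)
  have MT: "distr M borel T = M"
  proof -
    have "distr M borel T = distr (density lborel (\<lambda>x. g (T x))) borel T"
      unfolding M_def gT ..
    also have "\<dots> = density (distr lborel borel T) g"
      by (rule density_distr[symmetric]) measurable
    finally show ?thesis unfolding distr_lborel_orthogonal[OF T] M_def .
  qed
  have "distr sphere_measure sphere_measure T = distr (distr M ?N unit_dir) ?N T"
    unfolding S by (rule distr_cong) auto
  also have "\<dots> = distr M ?N (T \<circ> unit_dir)" by (rule distr_distr) measurable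
  also have "\<dots> = distr M ?N (unit_dir \<circ> T)"
  proof (rule distr_cong_AE)
    have "AE x in M. x \<noteq> 0"
      unfolding M_def using AE_lborel_singleton[of "0::real^3"] by (subst AE_density) auto
    then show "AE x in M. (T \<circ> unit_dir) x = (unit_dir \<circ> T) x"
    proof eventually_elim
      case (elim x)
      moreover have "T x \<noteq> 0" using elim nT[of x] by auto
      ultimately show ?case by (simp add: unit_dir_def nT linear_scale[OF lin])
    qed
    show "T \<circ> unit_dir \<in> M \<rightarrow>\<^sub>M ?N" "unit_dir \<circ> T \<in> M \<rightarrow>\<^sub>M ?N" by measurable
  qed auto
  also have "\<dots> = distr (distr M borel T) ?N unit_dir" by (rule distr_distr[symmetric]) measurable
  also have "\<dots> = sphere_measure" unfolding MT S ..
  finally show ?thesis .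
qed

lemma integral_sphere_orthogonal:
  fixes f :: "real^3 \<Rightarrow> complex"
  assumes T: "orthogonal_transformation T" and f: "continuous_on (sphere 0 1) f"
  shows "(\<integral>v. f (T v) \<partial>sphere_measure) = (\<integral>v. f v \<partial>sphere_measure)"
proof -
  have lin: "linear T" using orthogonal_transformation_linear[OF T] .
  have "T \<in> borel \<rightarrow>\<^sub>M borel"
    using lin by (intro borel_measurable_continuous_onI linear_continuous_on) (simp add: linear_linear)
  then have "T \<in> sphere_measure \<rightarrow>\<^sub>M restrict_space borel (sphere 0 1)"
    by (intro measurable_restrict_space2 measurable_sphere_measureI)
      (auto simp: orthogonal_transformation_norm[OF T])
  then have "T \<in> sphere_measure \<rightarrow>\<^sub>M sphere_measure"
    using measurable_cong_sets[OF refl sets_sphere_measure] by blast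
  from integral_distr[OF this continuous_on_sphere_measurable[OF f]]
  show ?thesis unfolding distr_sphere_measure_orthogonal[OF T] by simp
qed

section \<open>Integration in polar coordinates\<close>

lemma nn_integral_scale:
  fixes g :: "real^3 \<Rightarrow> ennreal"
  assumes [measurable]: "g \<in> borel_measurable borel" and "s > 0"
  shows "(\<integral>\<^sup>+x. g x \<partial>lborel) = ennreal (s^3) * (\<integral>\<^sup>+x. g (s *\<^sub>R x) \<partial>lborel)"
  using assms(2)
  by (subst lborel_affine[of s 0])
     (simp_all add: nn_integral_density nn_integral_distr nn_integral_cmult)

text \<open>Unfolding \<open>sphere_measure\<close> turns the right side into a double integral over
  radii r > 0 and points x of the unit ball. The substitution r = |x| s replaces the argument r
  x/|x| by s x. After Fubini and the scaling y = s x there remains the integral of F(y) |y|^3 times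
  that of 3/s^4 over s > |y|, and the latter equals 1/|y|^3.\<close>

lemma nn_integral_polar:
  fixes F :: "real^3 \<Rightarrow> ennreal"
  assumes F[measurable]: "F \<in> borel_measurable borel"
  shows "(\<integral>\<^sup>+x. F x \<partial>lborel)
    = (\<integral>\<^sup>+r. indicator {0<..} r * ennreal (r^2) * (\<integral>\<^sup>+v. F (r *\<^sub>R v) \<partial>sphere_measure) \<partial>lborel)"
proof -
  let ?B = "ball (0::real^3) 1"
  have "(\<integral>\<^sup>+r. indicator {0<..} r * ennreal (r^2) * (\<integral>\<^sup>+v. F (r *\<^sub>R v) \<partial>sphere_measure) \<partial>lborel)
      = (\<integral>\<^sup>+r. (\<integral>\<^sup>+x. indicator {0<..} r * ennreal (r^2) *
          (3 * indicator ?B x * F (r *\<^sub>R unit_dir x)) \<partial>lborel) \<partial>lborel)"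
    by (intro nn_integral_cong, subst nn_integral_sphere_measure)
      (auto intro!: measurable_sphere_measureI nn_integral_cmult[symmetric])
  also have "\<dots> = (\<integral>\<^sup>+x. (\<integral>\<^sup>+r. indicator {0<..} r * ennreal (r^2) *
          (3 * indicator ?B x * F (r *\<^sub>R unit_dir x)) \<partial>lborel) \<partial>lborel)"
    by (rule lborel_pair.Fubini') measurable
  also have "\<dots> = (\<integral>\<^sup>+x. (\<integral>\<^sup>+s. indicator {0<..} s * ennreal (s^2) *
          (3 * indicator ?B x * ennreal (norm x ^ 3) * F (s *\<^sub>R x)) \<partial>lborel) \<partial>lborel)"
  proof (rule nn_integral_cong_AE, use AE_lborel_singleton[of "0::real^3"] in eventually_elim)
    case (elim x)
    then have nx: "norm x > 0" by simp
    have u: "unit_dir x = x /\<^sub>R norm x" using elim by (simp add: unit_dir_def)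
    have "(\<integral>\<^sup>+r. indicator {0<..} r * ennreal (r^2) * (3 * indicator ?B x * F (r *\<^sub>R unit_dir x)) \<partial>lborel)
      = ennreal \<bar>norm x\<bar> * (\<integral>\<^sup>+s. indicator {0<..} (0 + norm x * s) * ennreal ((0 + norm x * s)^2) *
            (3 * indicator ?B x * F ((0 + norm x * s) *\<^sub>R unit_dir x)) \<partial>lborel)"
      by (rule nn_integral_real_affine) (use nx in auto)
    also have "\<dots> = (\<integral>\<^sup>+s. ennreal (norm x) * (indicator {0<..} (norm x * s) * ennreal ((norm x * s)^2) *
            (3 * indicator ?B x * F ((norm x * s) *\<^sub>R unit_dir x))) \<partial>lborel)"
      by (simp add: nn_integral_cmult)
    also have "\<dots> = (\<integral>\<^sup>+s. indicator {0<..} s * ennreal (s^2) *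
          (3 * indicator ?B x * ennreal (norm x ^ 3) * F (s *\<^sub>R x)) \<partial>lborel)"
    proof (rule nn_integral_cong)
      fix s :: real
      have "(norm x * s) *\<^sub>R unit_dir x = s *\<^sub>R x" using elim by (simp add: u)
      moreover have "(indicator {0<..} (norm x * s) :: ennreal) = indicator {0<..} s"
        using nx by (auto simp: indicator_def zero_less_mult_iff)
      moreover have "ennreal (norm x) * ennreal ((norm x * s)^2) = ennreal (norm x ^ 3) * ennreal (s^2)"
        using nx by (simp add: ennreal_mult[symmetric] power_mult_distrib power2_eq_square power3_eq_cube)
      ultimately show "ennreal (norm x) * (indicator {0<..} (norm x * s) * ennreal ((norm x * s)^2) *
            (3 * indicator ?B x * F ((norm x * s) *\<^sub>R unit_dir x)))
          = indicator {0<..} s * ennreal (s^2) *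
          (3 * indicator ?B x * ennreal (norm x ^ 3) * F (s *\<^sub>R x))"
        by (simp only: mult_regroup)
    qed
    finally show ?case .
  qed
  also have "\<dots> = (\<integral>\<^sup>+s. (\<integral>\<^sup>+x. indicator {0<..} s * ennreal (s^2) *
          (3 * indicator ?B x * ennreal (norm x ^ 3) * F (s *\<^sub>R x)) \<partial>lborel) \<partial>lborel)"
    by (rule lborel_pair.Fubini') measurable
  also have "\<dots> = (\<integral>\<^sup>+s. (\<integral>\<^sup>+y. F y * ennreal (norm y ^ 3) *
          (ennreal (3 / s^4) * indicator {norm y<..} s) \<partial>lborel) \<partial>lborel)"
  proof (rule nn_integral_cong)
    fix s :: real
    show "(\<integral>\<^sup>+x. indicator {0<..} s * ennreal (s^2) *
          (3 * indicator ?B x * ennreal (norm x ^ 3) * F (s *\<^sub>R x)) \<partial>lborel)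
        = (\<integral>\<^sup>+y. F y * ennreal (norm y ^ 3) * (ennreal (3 / s^4) * indicator {norm y<..} s) \<partial>lborel)"
    proof (cases "s > 0")
      case True
      have "(\<integral>\<^sup>+y. F y * ennreal (norm y ^ 3) * (ennreal (3 / s^4) * indicator {norm y<..} s) \<partial>lborel)
        = ennreal (s^3) * (\<integral>\<^sup>+x. F (s *\<^sub>R x) * ennreal (norm (s *\<^sub>R x) ^ 3) *
              (ennreal (3 / s^4) * indicator {norm (s *\<^sub>R x)<..} s) \<partial>lborel)"
        by (rule nn_integral_scale) (use True in \<open>auto simp: indicator_def of_bool_def\<close>)
      also have "\<dots> = (\<integral>\<^sup>+x. ennreal (s^3) * (F (s *\<^sub>R x) * ennreal (norm (s *\<^sub>R x) ^ 3) *
              (ennreal (3 / s^4) * indicator {norm (s *\<^sub>R x)<..} s)) \<partial>lborel)"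
        by (rule nn_integral_cmult[symmetric]) (auto simp: indicator_def of_bool_def)
      also have "\<dots> = (\<integral>\<^sup>+x. indicator {0<..} s * ennreal (s^2) *
          (3 * indicator ?B x * ennreal (norm x ^ 3) * F (s *\<^sub>R x)) \<partial>lborel)"
      proof (rule nn_integral_cong)
        fix x :: "real^3"
        have i: "(indicator {norm (s *\<^sub>R x)<..} s :: ennreal) = indicator ?B x"
          using True by (auto simp: indicator_def mult_less_cancel_left2)
        have "ennreal (s^3) * (ennreal (norm (s *\<^sub>R x) ^ 3) * ennreal (3 / s^4))
            = ennreal (s^2) * (3 * ennreal (norm x ^ 3))"
        proof -
          have real_eq: "(s^3) * ((norm (s *\<^sub>R x) ^ 3) * (3 / s^4)) = s^2 * (3 * norm x ^ 3)"
            using True by (simp add: power_mult_distrib field_simps eval_nat_numeral)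
          have e3: "ennreal (a * (b * c)) = ennreal a * (ennreal b * ennreal c)"
            if "0 \<le> a" "0 \<le> b" "0 \<le> c" for a b c :: real
            using that by (simp add: ennreal_mult)
          from real_eq have "ennreal (s^3 * ((norm (s *\<^sub>R x) ^ 3) * (3 / s^4))) = ennreal (s^2 * (3 * norm x ^ 3))"
            by (rule arg_cong)
          then show ?thesis using True
            using e3[of "s^3" "norm (s *\<^sub>R x) ^ 3" "3 / s^4"] e3[of "s^2" 3 "norm x ^ 3"] by simp
        qed
        then have "(ennreal (s^3) * (ennreal (norm (s *\<^sub>R x) ^ 3) * ennreal (3 / s^4))) *
              (F (s *\<^sub>R x) * indicator ?B x)
            = (ennreal (s^2) * (3 * ennreal (norm x ^ 3))) * (F (s *\<^sub>R x) * indicator ?B x)"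
          by (rule arg_cong)
        then show "ennreal (s^3) * (F (s *\<^sub>R x) * ennreal (norm (s *\<^sub>R x) ^ 3) *
              (ennreal (3 / s^4) * indicator {norm (s *\<^sub>R x)<..} s))
            = indicator {0<..} s * ennreal (s^2) *
              (3 * indicator ?B x * ennreal (norm x ^ 3) * F (s *\<^sub>R x))"
          unfolding i using True by (simp only: mult_ac indicator_simps greaterThan_iff) simp
      qed
      finally show ?thesis ..
    next
      case False
      then have "s \<notin> {norm y<..}" for y :: "real^3" using norm_ge_zero[of y] order_trans[of s 0 "norm y"] by (simp add: not_less)
      then show ?thesis using False by simp
    qed
  qed
  also have "\<dots> = (\<integral>\<^sup>+y. (\<integral>\<^sup>+s. F y * ennreal (norm y ^ 3) *
          (ennreal (3 / s^4) * indicator {norm y<..} s) \<partial>lborel) \<partial>lborel)"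
  proof (rule lborel_pair.Fubini')
    show "(\<lambda>(y, s::real). F y * ennreal (norm y ^ 3) * (ennreal (3 / s^4) * indicator {norm y<..} s))
      \<in> borel_measurable (lborel \<Otimes>\<^sub>M lborel)"
      unfolding indicator_def of_bool_def greaterThan_iff by measurable
  qed
  also have "\<dots> = (\<integral>\<^sup>+y. F y \<partial>lborel)"
  proof (rule nn_integral_cong_AE, use AE_lborel_singleton[of "0::real^3"] in eventually_elim)
    case (elim y)
    define a where "a = norm y"
    have a: "a > 0" using elim by (simp add: a_def)
    have "(\<integral>\<^sup>+s. ennreal (3 / s^4) * indicator {a<..} s \<partial>lborel)
        = (\<integral>\<^sup>+s. ennreal (3 / s^4) * indicator {a..} s \<partial>lborel)"
      by (rule nn_integral_cong_AE, use AE_lborel_singleton[of a] in eventually_elim)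
        (auto simp: indicator_def)
    also have "\<dots> = ennreal (0 - (- (1 / a^3)))"
    proof (rule nn_integral_FTC_atLeast)
      show "((\<lambda>s. - (1 / s^3)) has_real_derivative 3 / s^4) (at s)" if "a \<le> s" for s
        using that a by (auto intro!: derivative_eq_intros simp: field_simps eval_nat_numeral)
      show "((\<lambda>s::real. - (1 / s^3)) \<longlongrightarrow> 0) at_top"
        using tendsto_minus[OF tendsto_inverse_0_at_top[OF filterlim_pow_at_top[OF _ filterlim_ident, of 3]]]
        by (simp add: inverse_eq_divide)
      show "0 \<le> 3 / s^4" for s :: real by simp
    qed auto
    finally have "(\<integral>\<^sup>+s. ennreal (3 / s^4) * indicator {a<..} s \<partial>lborel) = ennreal (1 / a^3)" by simp
    then have "(\<integral>\<^sup>+s. F y * ennreal (a ^ 3) * (ennreal (3 / s^4) * indicator {a<..} s) \<partial>lborel)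
        = F y * (ennreal (a ^ 3) * ennreal (1 / a^3))"
      by (subst nn_integral_cmult) (auto simp: mult.assoc)
    also have "ennreal (a ^ 3) * ennreal (1 / a^3) = 1"
      using a by (simp add: ennreal_mult[symmetric])
    finally show ?case by (simp add: a_def)
  qed
  finally show ?thesis ..
qed

section \<open>Integration by parts on spheres\<close>

text \<open>The quotient \<open>q\<close> of the linearization error tends to 0 pointwise, and the
  mean value inequality bounds it by 2 C; dominated convergence along sequences then differentiates
  under the integral sign.\<close>

lemma has_vector_derivative_integral:
  fixes f :: "real \<Rightarrow> 'b \<Rightarrow> complex"
  assumes M: "finite_measure M" and e: "e > 0"
    and int: "\<And>t. t \<in> ball t0 e \<Longrightarrow> integrable M (f t)"
    and der: "\<And>t x. t \<in> ball t0 e \<Longrightarrow> x \<in> space M \<Longrightarrow>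
      ((\<lambda>t. f t x) has_vector_derivative f' t x) (at t)"
    and bd: "\<And>t x. t \<in> ball t0 e \<Longrightarrow> x \<in> space M \<Longrightarrow> norm (f' t x) \<le> C"
    and int': "integrable M (f' t0)"
  shows "((\<lambda>t. \<integral>x. f t x \<partial>M) has_vector_derivative (\<integral>x. f' t0 x \<partial>M)) (at t0)"
proof -
  interpret finite_measure M by fact
  let ?F = "\<lambda>t. \<integral>x. f t x \<partial>M" and ?D = "\<integral>x. f' t0 x \<partial>M"
  define q where "q t x = (1 / norm (t - t0)) *\<^sub>R (f t x - (f t0 x + (t - t0) *\<^sub>R f' t0 x))" for t x
  have t0: "t0 \<in> ball t0 e" using e by simp
  have eq: "(1 / norm (t - t0)) *\<^sub>R (?F t - (?F t0 + (t - t0) *\<^sub>R ?D)) = (\<integral>x. q t x \<partial>M)"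
    if "t \<in> ball t0 e" for t
    using int[OF that] int[OF t0] int' by (simp add: q_def)
  have lim: "((\<lambda>t. \<integral>x. q t x \<partial>M) \<longlongrightarrow> 0) (at t0 within ball t0 e)"
    unfolding tendsto_at_iff_sequentially
  proof (intro allI impI)
    fix X assume X: "\<forall>i. X i \<in> ball t0 e - {t0}" "X \<longlonglongrightarrow> t0"
    have "(\<lambda>i. \<integral>x. q (X i) x \<partial>M) \<longlonglongrightarrow> (\<integral>x. 0 \<partial>M)"
    proof (rule integral_dominated_convergence[where w = "\<lambda>x. 2 * C"])
      show "q (X i) \<in> borel_measurable M" for i
        unfolding q_def using int[of "X i"] int[OF t0] int' X(1) by auto
      show "AE x in M. (\<lambda>i. q (X i) x) \<longlonglongrightarrow> 0"
      proof (rule AE_I2)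
        fix x assume "x \<in> space M"
        from der[OF t0 this] have "((\<lambda>t. q t x) \<longlongrightarrow> 0) (at t0)"
          unfolding has_vector_derivative_def has_derivative_within q_def by blast
        then show "(\<lambda>i. q (X i) x) \<longlonglongrightarrow> 0"
          using X unfolding tendsto_at_iff_sequentially by (force simp: o_def)
      qed
      show "AE x in M. norm (q (X i) x) \<le> 2 * C" for i
      proof (rule AE_I2)
        fix x assume x: "x \<in> space M"
        have Xi: "X i \<in> ball t0 e" "X i \<noteq> t0" using X(1) by auto
        have "norm (f (X i) x - f t0 x - (X i - t0) *\<^sub>R f' t0 x) \<le> norm (X i - t0) * (2 * C)"
        proof (rule vector_differentiable_bound_linearization[where S = "ball t0 e"])
          show "((\<lambda>t. f t x) has_vector_derivative f' t x) (at t within ball t0 e)"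
            if "t \<in> ball t0 e" for t using der[OF that x] has_vector_derivative_at_within by blast
          show "closed_segment t0 (X i) \<subseteq> ball t0 e"
            using closed_segment_subset[OF t0 Xi(1)] by simp
          show "norm (f' t x - f' t0 x) \<le> 2 * C" if "t \<in> ball t0 e" for t
            using norm_triangle_ineq4[of "f' t x" "f' t0 x"] bd[OF that x] bd[OF t0 x] by linarith
        qed (rule t0)
        moreover have "norm (q (X i) x)
            = norm (f (X i) x - f t0 x - (X i - t0) *\<^sub>R f' t0 x) / norm (X i - t0)"
          by (simp only: q_def diff_diff_eq norm_scaleR) simp
        ultimately show "norm (q (X i) x) \<le> 2 * C"
          using Xi(2) by (simp add: divide_le_eq mult.commute)
      qed
    qed auto
    then show "((\<lambda>t. \<integral>x. q t x \<partial>M) \<circ> X) \<longlonglongrightarrow> 0" by (simp add: o_def)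
  qed
  have "((\<lambda>t. (1 / norm (t - t0)) *\<^sub>R (?F t - (?F t0 + (t - t0) *\<^sub>R ?D))) \<longlongrightarrow> 0) (at t0 within ball t0 e)"
    using lim by (rule Lim_transform_within[where d = e]) (use e eq in auto)
  moreover have "at t0 within ball t0 e = at t0" using at_within_open[OF t0] by simp
  ultimately show ?thesis
    unfolding has_vector_derivative_def has_derivative_within
    using bounded_linear_scaleR_left by simp
qed

text \<open>The generators of rotations in the coordinate planes, that is, the components of
  \<open>x \<times> \<nabla>\<close>.\<close>

definition Lop :: "3 \<Rightarrow> 3 \<Rightarrow> (real^3 \<Rightarrow> complex) \<Rightarrow> real^3 \<Rightarrow> complex" where
  "Lop i j F x = of_real (x $ i) * partial j F x - of_real (x $ j) * partial i F x"

text \<open>In polar coordinates, the operator r d/dr.\<close>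

definition euler :: "(real^3 \<Rightarrow> complex) \<Rightarrow> real^3 \<Rightarrow> complex" where
  "euler F x = (\<Sum>j\<in>UNIV. of_real (x $ j) * partial j F x)"

text \<open>Bilinear rather than sesquilinear: the test functions used below are already conjugates.
  Only F sees the radius; p is evaluated on the unit sphere.\<close>

definition ip :: "(real^3 \<Rightarrow> complex) \<Rightarrow> (real^3 \<Rightarrow> complex) \<Rightarrow> real \<Rightarrow> complex" where
  "ip F p r = (\<integral>v. F (r *\<^sub>R v) * p v \<partial>sphere_measure)"

text \<open>For distinct i and j, the rotation by the angle t in the (i, j) plane. Written as a
  perturbation of the identity, it does not have to name the third coordinate.\<close>

definition rot :: "3 \<Rightarrow> 3 \<Rightarrow> real \<Rightarrow> real^3 \<Rightarrow> real^3" where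
  "rot i j t x = x + ((cos t - 1) * x $ i - sin t * x $ j) *\<^sub>R axis i 1
                   + (sin t * x $ i + (cos t - 1) * x $ j) *\<^sub>R axis j 1"

lemma rot_0 [simp]: "rot i j 0 x = x"
  by (simp add: rot_def)

lemma orthogonal_rot:
  assumes "i \<noteq> j"
  shows "orthogonal_transformation (rot i j t)"
  unfolding orthogonal_transformation
proof
  show "linear (rot i j t)"
    by (rule linearI) (simp_all add: rot_def algebra_simps)
  show "\<forall>x. norm (rot i j t x) = norm x"
  proof
    fix x
    define c s where "c = cos t" and "s = sin t"
    have cs: "c * c + s * s = 1"
      using sin_cos_squared_add2[of t] by (simp add: c_def s_def power2_eq_square)
    have "rot i j t x \<bullet> rot i j t x
       = x \<bullet> x + (c * c + s * s - 1) * ((x $ i)\<^sup>2 + (x $ j)\<^sup>2)"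
      unfolding rot_def c_def[symmetric] s_def[symmetric]
      using assms exhaust_3[of i] exhaust_3[of j]
      by (auto simp: inner_vec_def sum_3 axis_def power2_eq_square algebra_simps)
    with cs show "norm (rot i j t x) = norm x" by (simp add: norm_eq_sqrt_inner)
  qed
qed

lemma rot_deriv:
  assumes "i \<noteq> j"
  shows "((\<lambda>t. rot i j t x) has_vector_derivative
     (rot i j t x $ i) *\<^sub>R axis j 1 - (rot i j t x $ j) *\<^sub>R axis i 1) (at t)"
proof -
  have "((\<lambda>t. rot i j t x) has_vector_derivative
     (- sin t * x $ i - cos t * x $ j) *\<^sub>R axis i 1 + (cos t * x $ i - sin t * x $ j) *\<^sub>R axis j 1) (at t)"
    unfolding rot_def
    by (auto intro!: derivative_eq_intros simp: has_real_derivative_iff_has_vector_derivative[symmetric])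
  moreover have c: "rot i j t x $ i = cos t * x $ i - sin t * x $ j"
    "rot i j t x $ j = sin t * x $ i + cos t * x $ j"
    using assms by (simp_all add: rot_def axis_def algebra_simps)
  have "(rot i j t x $ i) *\<^sub>R axis j 1 - (rot i j t x $ j) *\<^sub>R axis i 1
    = (- sin t * x $ i - cos t * x $ j) *\<^sub>R axis i 1
      + (cos t * x $ i - sin t * x $ j) *\<^sub>R (axis j 1 :: real^3)"
    unfolding c by (simp add: algebra_simps)
  ultimately show ?thesis by simp
qed

text \<open>Regularity of fields is assumed on shells, so the same lemmas serve the radii
  \<open>{0<..<1}\<close> inside and \<open>{1<..}\<close> outside.\<close>

definition shell :: "real set \<Rightarrow> (real^3) set" where
  "shell I = {x. norm x \<in> I}"

lemma open_shell: "open I \<Longrightarrow> open (shell I)"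
  unfolding shell_def
  using open_vimage[OF _ continuous_on_norm_id, of I] by (simp add: vimage_def)

lemma scale_sphere_shell: "r > 0 \<Longrightarrow> r \<in> I \<Longrightarrow> v \<in> sphere 0 1 \<Longrightarrow> r *\<^sub>R v \<in> shell I"
  by (simp add: shell_def)

lemma continuous_on_scaled:
  fixes F :: "real^3 \<Rightarrow> 'b::topological_space"
  assumes "continuous_on (shell I) F" "r > 0" "r \<in> I"
  shows "continuous_on (sphere 0 1) (\<lambda>v. F (r *\<^sub>R v))"
  by (rule continuous_on_compose2[OF assms(1)])
    (use assms scale_sphere_shell in \<open>auto intro!: continuous_intros\<close>)

lemma ip_integrable:
  fixes F p :: "real^3 \<Rightarrow> complex"
  assumes "continuous_on (shell I) F" "r > 0" "r \<in> I" "continuous_on (sphere 0 1) p"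
  shows "integrable sphere_measure (\<lambda>v. F (r *\<^sub>R v) * p v)"
  by (intro integrable_sphere_continuous continuous_on_mult continuous_on_scaled[OF assms(1-3)] assms)

lemma Lop_continuous:
  "C1_on S F \<Longrightarrow> continuous_on S (Lop i j F)"
  unfolding Lop_def by (intro continuous_intros C1_on_continuous_partial)

lemma euler_continuous:
  "C1_on S F \<Longrightarrow> continuous_on S (euler F)"
  unfolding euler_def by (intro continuous_intros C1_on_continuous_partial)

text \<open>Differentiate the integral of \<open>F p\<close> along the rotations \<open>rot i j t\<close>, which preserve
  the surface measure.\<close>

lemma ip_Lop:
  assumes ij: "i \<noteq> j" and F: "C1_on (shell I) F" and p: "C1_on UNIV p" and r: "r > 0" "r \<in> I"
  shows "ip (Lop i j F) p r = - ip F (Lop i j p) r"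
proof -
  define f where "f t v = F (r *\<^sub>R rot i j t v) * p (rot i j t v)" for t v
  define g where "g v = Lop i j F (r *\<^sub>R v) * p v + F (r *\<^sub>R v) * Lop i j p v" for v
  have ps: "C1_on S p" for S using C1_on_subset[OF p] by simp
  have cF: "continuous_on (sphere 0 1) (\<lambda>v. F (r *\<^sub>R v) * p v)"
    by (intro continuous_on_mult continuous_on_scaled[OF _ r] C1_on_continuous F ps)
  have g1: "continuous_on (sphere 0 1) (\<lambda>v. Lop i j F (r *\<^sub>R v) * p v)"
    by (intro continuous_on_mult continuous_on_scaled[OF _ r] Lop_continuous C1_on_continuous F ps)
  have g2: "continuous_on (sphere 0 1) (\<lambda>v. F (r *\<^sub>R v) * Lop i j p v)"
    by (intro continuous_on_mult continuous_on_scaled[OF _ r] Lop_continuous C1_on_continuous F ps)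
  have gc: "continuous_on (sphere 0 1) g"
    unfolding g_def by (intro continuous_on_add g1 g2)
  have nr: "rot i j t v \<in> sphere 0 1" if "v \<in> sphere 0 1" for t v
    using that orthogonal_transformation_norm[OF orthogonal_rot[OF ij]] by simp
  have "bounded (g ` sphere 0 1)"
    by (intro compact_imp_bounded compact_continuous_image gc) simp
  then obtain C where C: "\<And>v. v \<in> sphere 0 1 \<Longrightarrow> norm (g v) \<le> C"
    unfolding bounded_iff by blast
  have crot: "continuous_on (sphere 0 1) (rot i j t)" for t
    using orthogonal_transformation_linear[OF orthogonal_rot[OF ij]]
    by (intro linear_continuous_on) (simp add: linear_linear)
  have img: "rot i j t ` sphere 0 1 \<subseteq> sphere 0 1" for t
    using nr by blast
  have cf: "continuous_on (sphere 0 1) (f t)" for t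
    unfolding f_def using continuous_on_compose2[OF cF crot img] .
  have gt: "continuous_on (sphere 0 1) (\<lambda>v. g (rot i j t v))" for t
    using continuous_on_compose2[OF gc crot img] .
  have ax: "(\<Sum>k\<in>UNIV. ((c *\<^sub>R axis j 1 - d *\<^sub>R axis i 1) :: real^3) $ k *\<^sub>R h k) = c *\<^sub>R h j - d *\<^sub>R h i"
    for c d and h :: "3 \<Rightarrow> complex"
    using exhaust_3[of i] exhaust_3[of j] ij by (auto simp: sum_3 axis_def)
  have der: "((\<lambda>t. f t v) has_vector_derivative g (rot i j t v)) (at t)" if v: "v \<in> sphere 0 1" for t v
  proof -
    let ?y = "rot i j t v"
    have "r *\<^sub>R ?y \<in> shell I" using scale_sphere_shell[OF r nr[OF v]] .
    note dF = C1_on_differentiable[OF F this]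
    have dp: "p differentiable (at ?y)" using C1_on_differentiable[OF p] by simp
    have r1: "((\<lambda>t. r *\<^sub>R rot i j t v) has_vector_derivative
        ((r * ?y $ i) *\<^sub>R axis j 1 - (r * ?y $ j) *\<^sub>R axis i 1)) (at t)"
      using bounded_linear.has_vector_derivative[OF bounded_linear_scaleR_right rot_deriv[OF ij], of r v t]
      by (simp add: algebra_simps)
    have 1: "((\<lambda>t. F (r *\<^sub>R rot i j t v)) has_vector_derivative Lop i j F (r *\<^sub>R ?y)) (at t)"
      using curve_derivative[where c = "\<lambda>t. r *\<^sub>R rot i j t v", OF dF r1] unfolding ax
      by (simp add: Lop_def scaleR_conv_of_real[where 'a = complex])
    have 2: "((\<lambda>t. p (rot i j t v)) has_vector_derivative Lop i j p ?y) (at t)"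
      using curve_derivative[where c = "\<lambda>t. rot i j t v", OF dp rot_deriv[OF ij]] unfolding ax
      by (simp add: Lop_def scaleR_conv_of_real[where 'a = complex])
    show ?thesis
      using has_vector_derivative_mult[OF 1 2] unfolding f_def g_def by (simp add: add.commute)
  qed
  have const: "(\<integral>v. f t v \<partial>sphere_measure) = (\<integral>v. f 0 v \<partial>sphere_measure)" for t
    unfolding f_def using integral_sphere_orthogonal[OF orthogonal_rot[OF ij, of t] cF] by simp
  have "((\<lambda>t. \<integral>v. f t v \<partial>sphere_measure) has_vector_derivative
      (\<integral>v. g (rot i j 0 v) \<partial>sphere_measure)) (at 0)"
  proof (rule has_vector_derivative_integral[where e = 1 and C = C and f' = "\<lambda>t v. g (rot i j t v)"])
    show "((\<lambda>t. f t v) has_vector_derivative g (rot i j t v)) (at t)"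
      if "v \<in> space sphere_measure" for t v
      using der that by simp
    show "norm (g (rot i j t v)) \<le> C" if "v \<in> space sphere_measure" for t v
      using C nr that by simp
  qed (rule sphere_measure.finite_measure_axioms zero_less_one
      integrable_sphere_continuous[OF cf] integrable_sphere_continuous[OF gt])+
  then have "((\<lambda>t::real. \<integral>v. f 0 v \<partial>sphere_measure) has_vector_derivative
      (\<integral>v. g v \<partial>sphere_measure)) (at 0)"
    by (subst const[THEN ext, symmetric]) simp
  then have "(\<integral>v. g v \<partial>sphere_measure) = 0"
    using vector_derivative_unique_at has_vector_derivative_const by blast
  moreover have "(\<integral>v. g v \<partial>sphere_measure) = ip (Lop i j F) p r + ip F (Lop i j p) r"
    unfolding g_def ip_def
    by (intro Bochner_Integration.integral_add integrable_sphere_continuous g1 g2)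
  ultimately show ?thesis by (simp add: eq_neg_iff_add_eq_0)
qed

text \<open>The radial derivative of F(r v) is \<open>euler F (r *\<^sub>R v) / r\<close>; on a
  compact interval of radii it is bounded uniformly in v, which permits differentiation under the
  integral.\<close>

lemma ip_deriv:
  assumes I: "open I" and F: "C1_on (shell I) F" and p: "continuous_on (sphere 0 1) p"
    and r: "r > 0" "r \<in> I"
  shows "(ip F p has_vector_derivative ip (euler F) p r / of_real r) (at r)"
proof -
  obtain e0 where e0: "e0 > 0" "cball r e0 \<subseteq> I" using I r open_contains_cball by blast
  \<comment> \<open>The bound r/2 keeps the interval of radii away from 0.\<close>
  define e where "e = min e0 (r / 2)"
  have e: "e > 0" "cball r e \<subseteq> I" using e0 r by (auto simp: e_def)
  have tpos: "t > 0" if "t \<in> cball r e" for t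
  proof -
    have "\<bar>r - t\<bar> \<le> r / 2" using that r by (auto simp: e_def dist_real_def)
    then show "t > 0" using r(1) by linarith
  qed
  define f' where "f' t v = (\<Sum>j\<in>UNIV. of_real (v $ j) * partial j F (t *\<^sub>R v)) * p v" for t v
  let ?K = "cball r e \<times> sphere (0::real^3) 1"
  have sub: "(\<lambda>z. fst z *\<^sub>R snd z) ` ?K \<subseteq> shell I"
    using e tpos by (auto intro!: scale_sphere_shell)
  have cK: "continuous_on ?K (\<lambda>z. partial j F (fst z *\<^sub>R snd z))" for j
    by (rule continuous_on_compose2[OF C1_on_continuous_partial[OF F] _ sub]) (intro continuous_intros)
  have "continuous_on ?K (\<lambda>z. p (snd z))"
    by (rule continuous_on_compose2[OF p]) (auto intro: continuous_intros)
  then have "continuous_on ?K (\<lambda>z. f' (fst z) (snd z))"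
    unfolding f'_def by (intro continuous_intros cK)
  then have "bounded ((\<lambda>z. f' (fst z) (snd z)) ` ?K)"
    by (intro compact_imp_bounded compact_continuous_image compact_Times) auto
  then obtain C where C: "\<And>t v. t \<in> cball r e \<Longrightarrow> v \<in> sphere 0 1 \<Longrightarrow> norm (f' t v) \<le> C"
    unfolding bounded_iff by fastforce
  have f': "f' t v = euler F (t *\<^sub>R v) * p v / of_real t" if "t > 0" for t v
    using that by (simp add: f'_def euler_def sum_divide_distrib sum_distrib_right mult.assoc)
  have "((\<lambda>t. \<integral>v. F (t *\<^sub>R v) * p v \<partial>sphere_measure) has_vector_derivative
      (\<integral>v. f' r v \<partial>sphere_measure)) (at r)"
  proof (rule has_vector_derivative_integral[where e = e and C = C and f' = f'])
    show "integrable sphere_measure (\<lambda>v. F (t *\<^sub>R v) * p v)" if "t \<in> ball r e" for t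
      using that e tpos by (intro ip_integrable[OF C1_on_continuous[OF F]] p) auto
    show "((\<lambda>t. F (t *\<^sub>R v) * p v) has_vector_derivative f' t v) (at t)"
      if t: "t \<in> ball r e" and v: "v \<in> space sphere_measure" for t v
    proof -
      have "t *\<^sub>R v \<in> shell I" using t v e tpos by (intro scale_sphere_shell) auto
      note dF = C1_on_differentiable[OF F this]
      have "((\<lambda>t. t *\<^sub>R v) has_vector_derivative v) (at t)"
        by (auto intro!: derivative_eq_intros)
      from has_vector_derivative_mult_left[OF curve_derivative[where c = "\<lambda>t. t *\<^sub>R v", OF dF this]]
      show ?thesis by (simp add: f'_def scaleR_conv_of_real[where 'a = complex])
    qed
    show "norm (f' t v) \<le> C" if "t \<in> ball r e" "v \<in> space sphere_measure" for t v
      using C that by auto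
    show "integrable sphere_measure (f' r)"
      unfolding f'[OF r(1)]
      by (intro integrable_divide ip_integrable[OF euler_continuous[OF F] r p])
  qed (auto intro: sphere_measure.finite_measure_axioms e)
  moreover have "(\<integral>v. f' r v \<partial>sphere_measure) = ip (euler F) p r / of_real r"
    unfolding f'[OF r(1)] ip_def by simp
  ultimately show ?thesis unfolding ip_def[abs_def] by simp
qed

section \<open>The test field of the toroidal mode\<close>

lemma Lop_mult:
  assumes "f differentiable (at x)" "g differentiable (at x)"
  shows "Lop i j (\<lambda>x. f x * g x) x = f x * Lop i j g x + Lop i j f x * g x"
  by (simp add: Lop_def partial_mult[OF assms] algebra_simps)

lemma Lop_add:
  assumes "f differentiable (at x)" "g differentiable (at x)"
  shows "Lop i j (\<lambda>x. f x + g x) x = Lop i j f x + Lop i j g x"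
  by (simp add: Lop_def partial_add[OF assms] algebra_simps)

lemma Lop_minus:
  assumes "f differentiable (at x)"
  shows "Lop i j (\<lambda>x. - f x) x = - Lop i j f x"
  by (simp add: Lop_def partial_minus[OF assms] algebra_simps)

lemma Lop_power:
  assumes "f differentiable (at x)"
  shows "Lop i j (\<lambda>x. f x ^ n) x = of_nat n * f x ^ (n - 1) * Lop i j f x"
  by (simp add: Lop_def partial_power[OF assms] algebra_simps)

lemma Lop_const [simp]: "Lop i j (\<lambda>x. c) x = 0"
  by (simp add: Lop_def)

lemma Lop_coord:
  "Lop i j (\<lambda>x. of_real (x $ k)) x
     = (if k = j then of_real (x $ i) else 0) - (if k = i then of_real (x $ j) else 0)"
  by (simp add: Lop_def)

lemma C2_on_Lop: "C2_on S f \<Longrightarrow> C1_on S (Lop i j f)"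
  unfolding Lop_def by (intro C1_on_diff C1_on_mult C1_on_coord C2_on_partial)

lemma C2_on_euler: "C2_on S f \<Longrightarrow> C1_on S (euler f)"
  unfolding euler_def by (intro C1_on_sum C1_on_mult C1_on_coord C2_on_partial)

text \<open>The Laplace-Beltrami operator on spheres, as the sum of the squares of the three
  rotation generators.\<close>

definition Lsq :: "(real^3 \<Rightarrow> complex) \<Rightarrow> real^3 \<Rightarrow> complex" where
  "Lsq f x = Lop 2 3 (Lop 2 3 f) x + Lop 3 1 (Lop 3 1 f) x + Lop 1 2 (Lop 1 2 f) x"

lemma Lop_Lop_mult:
  assumes f: "C2_on UNIV f" and g: "C2_on UNIV g"
  shows "Lop i j (Lop i j (\<lambda>x. f x * g x)) x
    = f x * Lop i j (Lop i j g) x + 2 * Lop i j f x * Lop i j g x + Lop i j (Lop i j f) x * g x"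
proof -
  have d: "f differentiable (at x)" "g differentiable (at x)"
    "Lop i j f differentiable (at x)" "Lop i j g differentiable (at x)" for x
    using C1_on_differentiable C2_on_C1 C2_on_Lop f g by blast+
  have "Lop i j (\<lambda>x. f x * g x) = (\<lambda>x. f x * Lop i j g x + Lop i j f x * g x)"
    using Lop_mult d by blast
  then have "Lop i j (Lop i j (\<lambda>x. f x * g x)) x
      = Lop i j (\<lambda>x. f x * Lop i j g x) x + Lop i j (\<lambda>x. Lop i j f x * g x) x"
    by (simp add: Lop_add differentiable_mult d)
  then show ?thesis by (simp add: Lop_mult d algebra_simps)
qed

lemma Lsq_mult:
  assumes f: "C2_on UNIV f" and g: "C2_on UNIV g"
  shows "Lsq (\<lambda>x. f x * g x) x = f x * Lsq g x + Lsq f x * g x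
    + 2 * (Lop 2 3 f x * Lop 2 3 g x + Lop 3 1 f x * Lop 3 1 g x + Lop 1 2 f x * Lop 1 2 g x)"
  by (simp add: Lsq_def Lop_Lop_mult[OF f g] algebra_simps)

text \<open>The conjugate of x1 + i x2. On the unit sphere its n-th power is a multiple of the
  conjugate of Y_n^n.\<close>

definition wb :: "real^3 \<Rightarrow> complex" where
  "wb x = of_real (x $ 1) - \<i> * of_real (x $ 2)"

lemma C2_on_wb: "C2_on UNIV wb"
  unfolding wb_def by (intro C2_on_diff C2_on_mult C2_on_const C2_on_coord open_UNIV)

lemma differentiable_wb [simp]: "wb differentiable (at x)"
  using C1_on_differentiable[OF C2_on_C1[OF C2_on_wb]] by simp

lemma partial_wb: "partial j wb x = (if j = 1 then 1 else 0) - (if j = 2 then \<i> else 0)"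
proof -
  have "partial j (\<lambda>x. of_real (x $ 1) - \<i> * of_real (x $ 2)) x
      = (if j = 1 then 1 else 0) - (if j = 2 then \<i> else 0)"
    by (subst partial_diff) (auto simp: partial_mult differentiable_mult)
  then show ?thesis by (simp add: wb_def[abs_def])
qed

lemma Lop_wb:
  "Lop 2 3 wb = (\<lambda>x. \<i> * of_real (x $ 3))"
  "Lop 3 1 wb = (\<lambda>x. of_real (x $ 3))"
  "Lop 1 2 wb = (\<lambda>x. - \<i> * wb x)"
  by (auto simp: Lop_def partial_wb wb_def algebra_simps)

lemma Lsq_wb: "Lsq wb x = - 2 * wb x"
proof -
  \<comment> \<open>Eliminating the first coordinate in favour of \<open>wb\<close> makes both sides
    polynomials in the same independent quantities.\<close>
  have h: "complex_of_real (x $ 1) = wb x + \<i> * of_real (x $ 2)" by (simp add: wb_def)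
  show ?thesis
    by (simp add: Lsq_def Lop_wb Lop_mult Lop_coord Lop_minus differentiable_mult h algebra_simps)
qed

lemma Lsq_coord3: "Lsq (\<lambda>x. of_real (x $ 3)) x = - 2 * of_real (x $ 3)"
proof -
  have "Lop 2 3 (\<lambda>x. of_real (x $ 3)) = (\<lambda>x. of_real (x $ 2))"
    "Lop 3 1 (\<lambda>x. of_real (x $ 3)) = (\<lambda>x. - 1 * of_real (x $ 1))"
    "Lop 1 2 (\<lambda>x. of_real (x $ 3)) = (\<lambda>x. 0)"
    by (auto simp: Lop_coord)
  then show ?thesis by (simp only: Lsq_def) (simp add: Lop_coord Lop_minus)
qed

lemma C2_on_wb_power: "C2_on UNIV (\<lambda>x. wb x ^ n)"
  by (intro C2_on_power C2_on_wb open_UNIV)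

lemma C2_on_coord_mult: "C2_on UNIV (\<lambda>x. wb x ^ m * of_real (x $ i))"
  by (intro C2_on_mult C2_on_coord C2_on_wb_power open_UNIV)

lemma Lsq_cmult:
  assumes "C2_on UNIV f"
  shows "Lsq (\<lambda>x. c * f x) x = c * Lsq f x"
  by (subst Lsq_mult[OF C2_on_const assms]) (simp add: Lsq_def Lop_const[abs_def])

text \<open>The squares of the generators of \<open>wb\<close> sum to -wb^2, so in the product rule
  the step from n to n + 1 adds -2 from \<open>wb\<close> itself and -2n from the cross terms: n(n +
  1) + 2 + 2n = (n + 1)(n + 2).\<close>

lemma Lsq_wb_power: "Lsq (\<lambda>x. wb x ^ n) x = - of_nat (n * (n + 1)) * wb x ^ n"
proof (induction n)
  case 0
  then show ?case by (simp add: Lsq_def Lop_const[abs_def])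
next
  case (Suc n)
  have "Lsq (\<lambda>x. wb x ^ Suc n) x = Lsq (\<lambda>x. wb x ^ n * wb x) x"
    by (simp add: mult.commute)
  also have "\<dots> = wb x ^ n * (- 2 * wb x) - of_nat (n * (n + 1)) * wb x ^ n * wb x
      + 2 * (of_nat n * wb x ^ (n - 1) * - (wb x)\<^sup>2)"
    by (subst Lsq_mult[OF C2_on_wb_power C2_on_wb])
      (simp add: Suc.IH Lsq_wb Lop_power Lop_wb algebra_simps power2_eq_square)
  also have "of_nat n * wb x ^ (n - 1) * - (wb x)\<^sup>2 = - of_nat n * wb x ^ Suc n"
    by (cases n) (auto simp: power2_eq_square algebra_simps)
  finally show ?case by (simp add: algebra_simps)
qed

text \<open>A spherical harmonic of degree m + 1: the generators of \<open>wb\<close> and of the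
  third coordinate pair to -wb x3, so the eigenvalue is -(m(m + 1) + 2 + 2m).\<close>

lemma Lsq_wb_power_coord3:
  "Lsq (\<lambda>x. wb x ^ m * of_real (x $ 3)) x
     = - of_nat ((m + 1) * (m + 2)) * (wb x ^ m * of_real (x $ 3))"
proof -
  have h: "complex_of_real (x $ 1) = wb x + \<i> * of_real (x $ 2)" by (simp add: wb_def)
  have "Lsq (\<lambda>x. wb x ^ m * of_real (x $ 3)) x
      = wb x ^ m * (- 2 * of_real (x $ 3)) - of_nat (m * (m + 1)) * wb x ^ m * of_real (x $ 3)
      + 2 * (of_nat m * wb x ^ (m - 1) * - (wb x * of_real (x $ 3)))"
    by (subst Lsq_mult[OF C2_on_wb_power C2_on_coord])
      (simp add: Lsq_wb_power Lsq_coord3 Lop_power Lop_wb Lop_coord h algebra_simps)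
  also have "of_nat m * wb x ^ (m - 1) * - (wb x * of_real (x $ 3))
      = - of_nat m * wb x ^ m * of_real (x $ 3)"
    by (cases m) (auto simp: algebra_simps)
  finally show ?thesis by (simp add: algebra_simps)
qed

text \<open>Up to a constant, the conjugate of \<open>T\<^sub>n\<^sup>n\<close> extended to a homogeneous polynomial
  field: \<open>Qv n x = \<nabla>(wb\<^sup>n) \<times> x / n\<close>. Each component is harmonic of degree \<open>n\<close>.\<close>

definition Qv :: "nat \<Rightarrow> real^3 \<Rightarrow> complex^3" where
  "Qv n x = vector [- \<i> * (wb x ^ (n - 1) * of_real (x $ 3)),
     - 1 * (wb x ^ (n - 1) * of_real (x $ 3)), \<i> * wb x ^ n]"

lemma Qv_nth:
  "Qv n x $ 1 = - \<i> * (wb x ^ (n - 1) * of_real (x $ 3))"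
  "Qv n x $ 2 = - 1 * (wb x ^ (n - 1) * of_real (x $ 3))"
  "Qv n x $ 3 = \<i> * wb x ^ n"
  by (simp_all add: Qv_def vector_3)

lemma C2_on_Qv: "C2_on UNIV (\<lambda>x. Qv n x $ i)"
proof -
  have "\<forall>i. C2_on UNIV (\<lambda>x. Qv n x $ i)"
    unfolding forall_3 Qv_nth
    by (intro conjI C2_on_mult C2_on_const C2_on_wb_power C2_on_coord open_UNIV)
  then show ?thesis by blast
qed

lemma C1_on_Qv: "C1_on S (\<lambda>x. Qv n x $ i)"
  using C1_on_subset[OF C2_on_C1[OF C2_on_Qv]] by simp

lemma C1_on_wb_power: "C1_on S (\<lambda>x. wb x ^ n)"
  using C1_on_subset[OF C2_on_C1[OF C2_on_wb_power]] by simp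

lemma Lsq_Qv:
  assumes "n \<ge> 1"
  shows "Lsq (\<lambda>x. Qv n x $ i) x = - of_nat (n * (n + 1)) * (Qv n x $ i)"
proof -
  obtain m where n: "n = Suc m" using assms by (cases n) auto
  have "\<forall>i. Lsq (\<lambda>x. Qv n x $ i) x = - of_nat (n * (n + 1)) * (Qv n x $ i)"
    unfolding forall_3 Qv_nth
    by (simp only: Lsq_cmult[OF C2_on_coord_mult] Lsq_cmult[OF C2_on_wb_power]
        Lsq_wb_power Lsq_wb_power_coord3) (simp add: n algebra_simps)
  then show ?thesis by blast
qed

section \<open>The Laplacian in polar form and integration by parts against test functions\<close>

definition lap :: "(real^3 \<Rightarrow> complex) \<Rightarrow> real^3 \<Rightarrow> complex" where
  "lap f x = (\<Sum>j\<in>UNIV. partial j (partial j f) x)"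

lemma laplacian_nth: "laplacian u x $ i = lap (\<lambda>y. u y $ i) x"
  by (simp add: laplacian_def lap_def)

lemma of_real_norm_sq:
  "complex_of_real ((norm x)\<^sup>2)
     = of_real (x $ 1) ^ 2 + of_real (x $ 2) ^ 2 + of_real (x $ 3) ^ 2"
  for x :: "real^3"
proof -
  have "(norm x)\<^sup>2 = (x $ 1)\<^sup>2 + (x $ 2)\<^sup>2 + (x $ 3)\<^sup>2"
    unfolding power2_norm_eq_inner inner_vec_def sum_3 by (simp add: power2_eq_square)
  then show ?thesis by (simp only: of_real_add of_real_power)
qed

text \<open>The mixed second derivatives of \<open>euler (euler f)\<close> cancel those in
  \<open>Lsq f\<close>, and the pure ones combine to |x|^2 times the trace of the Hessian.\<close>

lemma lap_polar:
  assumes S: "open S" and f: "C2_on S f" and x: "x \<in> S"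
  shows "of_real ((norm x)\<^sup>2) * lap f x = euler (euler f) x + euler f x + Lsq f x"
proof -
  have d: "f differentiable (at x)" "partial j f differentiable (at x)" for j
    using f x unfolding C2_on_iff_C1 C1_on_def by blast+
  have e: "partial k (euler f) x = (\<Sum>j\<in>UNIV. of_real (x $ j) * partial k (partial j f) x) + partial k f x" for k
  proof -
    have "partial k (\<lambda>x. of_real (x $ 1) * partial 1 f x + of_real (x $ 2) * partial 2 f x
        + of_real (x $ 3) * partial 3 f x) x
        = (\<Sum>j\<in>UNIV. of_real (x $ j) * partial k (partial j f) x) + partial k f x"
      using exhaust_3[of k]
      by (auto simp: partial_add partial_mult differentiable_mult differentiable_add d sum_3)
    then show ?thesis by (simp add: euler_def[abs_def] sum_3)
  qed
  have l: "partial k (Lop i j f) x = of_real (x $ i) * partial k (partial j f) x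
      + (if i = k then partial j f x else 0)
      - (of_real (x $ j) * partial k (partial i f) x + (if j = k then partial i f x else 0))" for i j k
    unfolding Lop_def[abs_def]
    by (subst partial_diff) (auto simp: partial_mult differentiable_mult d)
  show ?thesis
    unfolding Lsq_def Lop_def[of _ _ "Lop _ _ f"] l euler_def[of "euler f"] e
      of_real_norm_sq
    by (simp add: lap_def euler_def sum_3 Lop_def algebra_simps power2_eq_square)
qed

lemma ip_cong:
  "(\<And>v. norm v = 1 \<Longrightarrow> F (r *\<^sub>R v) * p v = G (r *\<^sub>R v) * q v) \<Longrightarrow> ip F p r = ip G q r"
  unfolding ip_def by (rule Bochner_Integration.integral_cong) auto

lemma ip_cmult: "ip (\<lambda>x. c * F x) p r = c * ip F p r"
  by (simp add: ip_def mult.assoc)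

lemma ip_cmult_right: "ip F (\<lambda>v. c * p v) r = c * ip F p r"
  by (simp add: ip_def mult.left_commute)

lemma ip_add:
  assumes "continuous_on (shell I) F" "continuous_on (shell I) G" "continuous_on (sphere 0 1) p"
    "r > 0" "r \<in> I"
  shows "ip (\<lambda>x. F x + G x) p r = ip F p r + ip G p r"
  unfolding ip_def distrib_right
  by (intro Bochner_Integration.integral_add ip_integrable[OF _ assms(4,5)] assms)

lemma ip_diff:
  assumes "continuous_on (shell I) F" "continuous_on (shell I) G" "continuous_on (sphere 0 1) p"
    "r > 0" "r \<in> I"
  shows "ip (\<lambda>x. F x - G x) p r = ip F p r - ip G p r"
  unfolding ip_def left_diff_distrib
  by (intro Bochner_Integration.integral_diff ip_integrable[OF _ assms(4,5)] assms)

lemma ip_add_right: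
  assumes "continuous_on (shell I) F" "r > 0" "r \<in> I"
    "continuous_on (sphere 0 1) p" "continuous_on (sphere 0 1) q"
  shows "ip F (\<lambda>v. p v + q v) r = ip F p r + ip F q r"
  unfolding ip_def distrib_left
  by (intro Bochner_Integration.integral_add ip_integrable[OF assms(1-3)] assms)

lemma ip_diff_right:
  assumes "continuous_on (shell I) F" "r > 0" "r \<in> I"
    "continuous_on (sphere 0 1) p" "continuous_on (sphere 0 1) q"
  shows "ip F (\<lambda>v. p v - q v) r = ip F p r - ip F q r"
  unfolding ip_def right_diff_distrib
  by (intro Bochner_Integration.integral_diff ip_integrable[OF assms(1-3)] assms)

text \<open>Two integrations by parts move the spherical part of the Laplacian onto the
  eigenfunction p, so only radial derivatives of f remain.\<close>

lemma ip_lap: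
  assumes I: "open I" and f: "C2_on (shell I) f" and p: "C2_on UNIV p" and r: "r > 0" "r \<in> I"
    and c: "\<And>x. Lsq p x = c * p x"
  shows "(of_real r)\<^sup>2 * ip (lap f) p r
    = ip (euler (euler f)) p r + ip (euler f) p r + c * ip f p r"
proof -
  note S = open_shell[OF I]
  have p1: "C1_on UNIV p" using C2_on_C1[OF p] .
  have pc: "continuous_on (sphere 0 1) p" using C1_on_continuous[OF p1] continuous_on_subset by blast
  have f1: "C1_on (shell I) f" using C2_on_C1[OF f] .
  have cont: "continuous_on (shell I) (euler (euler f))" "continuous_on (shell I) (euler f)"
    "continuous_on (shell I) (Lop i j (Lop i j f))" for i j
    by (intro euler_continuous Lop_continuous C2_on_euler C2_on_Lop f f1)+
  have "(of_real r)\<^sup>2 * ip (lap f) p r = ip (\<lambda>x. (of_real r)\<^sup>2 * lap f x) p r"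
    by (simp add: ip_cmult)
  also have "\<dots> = ip (\<lambda>x. euler (euler f) x + euler f x + (Lop 2 3 (Lop 2 3 f) x
      + Lop 3 1 (Lop 3 1 f) x + Lop 1 2 (Lop 1 2 f) x)) p r"
  proof (rule ip_cong)
    fix v :: "real^3" assume v: "norm v = 1"
    then have "r *\<^sub>R v \<in> shell I" using scale_sphere_shell[OF r] by simp
    from lap_polar[OF S f this] show "(of_real r)\<^sup>2 * lap f (r *\<^sub>R v) * p v
      = (euler (euler f) (r *\<^sub>R v) + euler f (r *\<^sub>R v) + (Lop 2 3 (Lop 2 3 f) (r *\<^sub>R v)
      + Lop 3 1 (Lop 3 1 f) (r *\<^sub>R v) + Lop 1 2 (Lop 1 2 f) (r *\<^sub>R v))) * p v"
      using v by (simp add: Lsq_def)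
  qed
  also have "\<dots> = ip (euler (euler f)) p r + ip (euler f) p r + (ip (Lop 2 3 (Lop 2 3 f)) p r
      + ip (Lop 3 1 (Lop 3 1 f)) p r + ip (Lop 1 2 (Lop 1 2 f)) p r)"
    by (simp add: ip_add[OF _ _ pc r] continuous_on_add cont)
  also have "ip (Lop i j (Lop i j f)) p r = ip f (Lop i j (Lop i j p)) r" if "i \<noteq> j" for i j
    using ip_Lop[OF that C2_on_Lop[OF f] p1 r] ip_Lop[OF that f1 C2_on_Lop[OF p] r] by simp
  then have "ip (Lop 2 3 (Lop 2 3 f)) p r + ip (Lop 3 1 (Lop 3 1 f)) p r + ip (Lop 1 2 (Lop 1 2 f)) p r
      = ip f (Lop 2 3 (Lop 2 3 p)) r + ip f (Lop 3 1 (Lop 3 1 p)) r + ip f (Lop 1 2 (Lop 1 2 p)) r"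
    by simp
  also have "\<dots> = ip f (Lsq p) r"
  proof -
    have "continuous_on (sphere 0 1) (Lop i j (Lop i j p))" for i j
      using continuous_on_subset[OF Lop_continuous[OF C2_on_Lop[OF p]]] by simp
    then show ?thesis
      unfolding Lsq_def[abs_def]
      by (simp add: ip_add_right[OF C1_on_continuous[OF f1] r] continuous_on_add)
  qed
  also have "ip f (Lsq p) r = c * ip f p r"
    by (simp add: c[THEN ext] ip_cmult_right)
  finally show ?thesis .
qed

text \<open>On a sphere, the gradient of F paired with \<open>Qv n\<close> is wb^(n-1)
  (\<open>Lop 2 3 F\<close> - i \<open>Lop 3 1 F\<close>) up to the factor r. When the generators
  are moved to the other side, the derivatives of wb^(n-1) cancel, because \<open>Lop 2 3 wb\<close>
  = i \<open>Lop 3 1 wb\<close>. The weight p is 1 for gradients and a coordinate for transposed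
  gradients.\<close>

lemma ip_tangential:
  assumes n: "n \<ge> 1" and F: "C1_on (shell I) F" and p: "C1_on UNIV p" and r: "r > 0" "r \<in> I"
  shows "of_real r * (\<Sum>i\<in>UNIV. ip (partial i F) (\<lambda>v. p v * Qv n v $ i) r)
    = - ip F (\<lambda>v. wb v ^ (n - 1) * (Lop 2 3 p v - \<i> * Lop 3 1 p v)) r"
proof -
  define q where "q v = wb v ^ (n - 1)" for v
  have q: "C1_on S q" for S unfolding q_def by (rule C1_on_wb_power)
  have pS: "C1_on S p" for S using C1_on_subset[OF p] by simp
  have qp: "C1_on S (\<lambda>v. q v * p v)" for S by (intro C1_on_mult q pS)
  have int: "integrable sphere_measure (\<lambda>v. partial i F (r *\<^sub>R v) * (p v * Qv n v $ i))" for i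
    by (intro ip_integrable[OF _ r] C1_on_continuous_partial[OF F] continuous_on_mult
        C1_on_continuous[OF pS] C1_on_continuous[OF C1_on_Qv])
  have wbn: "wb v ^ n = q v * wb v" for v
    using n by (cases n) (auto simp: q_def)
  have qn: "wb v ^ (n - Suc 0) = q v" for v by (simp add: q_def)
  have h: "complex_of_real (v $ 1) = wb v + \<i> * of_real (v $ 2)" for v by (simp add: wb_def)
  have "of_real r * (\<Sum>i\<in>UNIV. ip (partial i F) (\<lambda>v. p v * Qv n v $ i) r)
      = (\<integral>v. of_real r * (\<Sum>i\<in>UNIV. partial i F (r *\<^sub>R v) * (p v * Qv n v $ i)) \<partial>sphere_measure)"
    by (simp add: ip_def Bochner_Integration.integral_sum int)
  also have "\<dots> = ip (\<lambda>x. Lop 2 3 F x - \<i> * Lop 3 1 F x) (\<lambda>v. q v * p v) r"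
    unfolding ip_def
    by (intro Bochner_Integration.integral_cong)
      (simp_all add: sum_3 Qv_nth Lop_def wbn qn h algebra_simps)
  also have "\<dots> = ip (Lop 2 3 F) (\<lambda>v. q v * p v) r - \<i> * ip (Lop 3 1 F) (\<lambda>v. q v * p v) r"
  proof -
    have "continuous_on (shell I) (\<lambda>x. \<i> * Lop 3 1 F x)"
      by (intro continuous_on_mult continuous_on_const Lop_continuous F)
    from ip_diff[OF Lop_continuous[OF F] this C1_on_continuous[OF qp] r]
    show ?thesis by (simp add: ip_cmult)
  qed
  also have "\<dots> = - ip F (Lop 2 3 (\<lambda>v. q v * p v)) r + \<i> * ip F (Lop 3 1 (\<lambda>v. q v * p v)) r"
    by (simp add: ip_Lop[OF _ F qp r])
  also have "\<dots> = - ip F (\<lambda>v. Lop 2 3 (\<lambda>v. q v * p v) v - \<i> * Lop 3 1 (\<lambda>v. q v * p v) v) r"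
  proof -
    have "continuous_on (sphere 0 1) (Lop i j (\<lambda>v. q v * p v))" for i j
      by (intro Lop_continuous qp)
    then have "ip F (\<lambda>v. Lop 2 3 (\<lambda>v. q v * p v) v - \<i> * Lop 3 1 (\<lambda>v. q v * p v) v) r
        = ip F (Lop 2 3 (\<lambda>v. q v * p v)) r - ip F (\<lambda>v. \<i> * Lop 3 1 (\<lambda>v. q v * p v) v) r"
      by (intro ip_diff_right[OF C1_on_continuous[OF F] r] continuous_on_mult continuous_on_const)
    then show ?thesis by (simp add: ip_cmult_right)
  qed
  also have "(\<lambda>v. Lop 2 3 (\<lambda>v. q v * p v) v - \<i> * Lop 3 1 (\<lambda>v. q v * p v) v)
      = (\<lambda>v. wb v ^ (n - 1) * (Lop 2 3 p v - \<i> * Lop 3 1 p v))"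
  proof
    fix v
    have d: "q differentiable (at v)" "p differentiable (at v)"
      using C1_on_differentiable[OF q[of UNIV]] C1_on_differentiable[OF p] by auto
    have L: "Lop 2 3 q v = \<i> * Lop 3 1 q v"
      unfolding q_def[abs_def] by (simp add: Lop_power Lop_wb)
    show "Lop 2 3 (\<lambda>v. q v * p v) v - \<i> * Lop 3 1 (\<lambda>v. q v * p v) v
      = wb v ^ (n - 1) * (Lop 2 3 p v - \<i> * Lop 3 1 p v)"
      unfolding Lop_mult[OF d] L q_def[symmetric] by (simp add: algebra_simps)
  qed
  finally show ?thesis .
qed

section \<open>Projection onto the toroidal mode\<close>

definition proj :: "nat \<Rightarrow> cfield \<Rightarrow> real \<Rightarrow> complex" where
  "proj n u r = (\<Sum>i\<in>UNIV. ip (\<lambda>x. u x $ i) (\<lambda>v. Qv n v $ i) r)"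

text \<open>The derivative of \<open>proj n u\<close> as an explicit spherical integral, so that it
  can be differentiated again, estimated and taken to the boundary.\<close>

definition proj' :: "nat \<Rightarrow> cfield \<Rightarrow> real \<Rightarrow> complex" where
  "proj' n u r = (\<Sum>i\<in>UNIV. ip (euler (\<lambda>x. u x $ i)) (\<lambda>v. Qv n v $ i) r) / of_real r"

lemma continuous_Qv: "continuous_on S (\<lambda>v. Qv n v $ i)"
  by (rule C1_on_continuous[OF C1_on_Qv])

lemma proj_deriv:
  assumes "open I" "\<And>i. C1_on (shell I) (\<lambda>x. u x $ i)" "r > 0" "r \<in> I"
  shows "(proj n u has_vector_derivative proj' n u r) (at r)"
  unfolding proj_def[abs_def] proj'_def sum_divide_distrib
  by (intro has_vector_derivative_sum) (use ip_deriv[OF assms(1,2) continuous_Qv assms(3,4)] in \<open>simp add: ip_def[abs_def]\<close>)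

text \<open>With r a' = A and r A' = B one has r^2 a'' = B - A; inserting this into
  \<open>ip_lap\<close> produces the radial operator. The second derivative d is used only through
  the displayed equation.\<close>

lemma proj'_deriv:
  assumes n: "n \<ge> 1" and I: "open I" and u: "\<And>i. C2_on (shell I) (\<lambda>x. u x $ i)"
    and r: "r > 0" "r \<in> I"
  obtains d where "(proj' n u has_vector_derivative d) (at r)"
    "(of_real r)\<^sup>2 * (\<Sum>i\<in>UNIV. ip (\<lambda>x. laplacian u x $ i) (\<lambda>v. Qv n v $ i) r)
      = (of_real r)\<^sup>2 * d + 2 * of_real r * proj' n u r - of_nat (n * (n + 1)) * proj n u r"
proof -
  define A where "A i = ip (euler (\<lambda>x. u x $ i)) (\<lambda>v. Qv n v $ i)" for i
  define B where "B i = ip (euler (euler (\<lambda>x. u x $ i))) (\<lambda>v. Qv n v $ i)" for i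
  define d where "d = (\<Sum>i\<in>UNIV. B i r) / (of_real r)\<^sup>2 - (\<Sum>i\<in>UNIV. A i r) / (of_real r)\<^sup>2"
  have A: "(A i has_vector_derivative B i r / of_real r) (at r)" for i
    unfolding A_def B_def by (rule ip_deriv[OF I C2_on_euler[OF u] continuous_Qv r])
  have inv: "((\<lambda>s. complex_of_real (1 / s)) has_vector_derivative - of_real (1 / r\<^sup>2)) (at r)"
    using r(1)
    by (intro has_vector_derivative_eq_rhs[OF has_vector_derivative_of_real])
      (auto intro!: derivative_eq_intros simp: power2_eq_square)
  have "((\<lambda>s. (\<Sum>i\<in>UNIV. A i s) * complex_of_real (1 / s)) has_vector_derivative
      ((\<Sum>i\<in>UNIV. A i r) * - of_real (1 / r\<^sup>2) + (\<Sum>i\<in>UNIV. B i r / of_real r) * of_real (1 / r))) (at r)"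
    by (rule has_vector_derivative_mult[OF has_vector_derivative_sum inv]) (rule A)
  moreover have "((\<Sum>i\<in>UNIV. A i r) * - of_real (1 / r\<^sup>2) + (\<Sum>i\<in>UNIV. B i r / of_real r) * of_real (1 / r)) = d"
    by (simp add: d_def sum_divide_distrib[symmetric] power2_eq_square)
  moreover have "(\<lambda>s. (\<Sum>i\<in>UNIV. A i s) * complex_of_real (1 / s)) = proj' n u"
    by (simp add: proj'_def A_def fun_eq_iff)
  ultimately have 1: "(proj' n u has_vector_derivative d) (at r)" by simp
  have "(of_real r)\<^sup>2 * (\<Sum>i\<in>UNIV. ip (\<lambda>x. laplacian u x $ i) (\<lambda>v. Qv n v $ i) r)
      = (\<Sum>i\<in>UNIV. B i r + A i r + - of_nat (n * (n + 1)) * ip (\<lambda>x. u x $ i) (\<lambda>v. Qv n v $ i) r)"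
    unfolding sum_distrib_left laplacian_nth
  proof (rule sum.cong)
    fix i
    show "(of_real r)\<^sup>2 * ip (\<lambda>x. lap (\<lambda>y. u y $ i) x) (\<lambda>v. Qv n v $ i) r
      = B i r + A i r + - of_nat (n * (n + 1)) * ip (\<lambda>x. u x $ i) (\<lambda>v. Qv n v $ i) r"
      unfolding A_def B_def by (rule ip_lap[OF I u C2_on_Qv r Lsq_Qv[OF n]])
  qed simp
  also have "\<dots> = (\<Sum>i\<in>UNIV. B i r) + (\<Sum>i\<in>UNIV. A i r) - of_nat (n * (n + 1)) * proj n u r"
    unfolding proj_def sum_3 by (simp add: algebra_simps)
  also have "\<dots> = (of_real r)\<^sup>2 * d + 2 * of_real r * proj' n u r - of_nat (n * (n + 1)) * proj n u r"
    using r by (simp add: d_def proj'_def A_def[symmetric] field_simps)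
  finally show ?thesis using that 1 by blast
qed

text \<open>Since \<open>Qv n\<close> is tangential and divergence free on spheres, gradients are invisible to the
  projection, so the Lame operator acts on it through its Laplacian part only.\<close>

lemma proj_gradient:
  assumes n: "n \<ge> 1" and F: "C1_on (shell I) F" and r: "r > 0" "r \<in> I"
  shows "(\<Sum>i\<in>UNIV. ip (partial i F) (\<lambda>v. Qv n v $ i) r) = 0"
  using ip_tangential[OF n F C1_on_const[of UNIV 1] r] r(1) by (simp add: ip_def)

text \<open>The transposed-gradient part of the traction. With the coordinate v_j as weight, the
  expression wb^(n-1) (\<open>Lop 2 3\<close> - i \<open>Lop 3 1\<close>) v_j left by
  \<open>ip_tangential\<close> is exactly the j-th component of \<open>Qv n\<close>.\<close>

lemma proj_swap:
  assumes n: "n \<ge> 1" and u: "\<And>i. C1_on (shell I) (\<lambda>x. u x $ i)" and r: "r > 0" "r \<in> I"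
  shows "(\<Sum>j\<in>UNIV. \<Sum>i\<in>UNIV. ip (partial i (\<lambda>x. u x $ j)) (\<lambda>v. of_real (v $ j) * Qv n v $ i) r)
     = - proj n u r / of_real r"
proof -
  have wbn: "wb v ^ n = wb v ^ (n - 1) * wb v" for v using n by (cases n) auto
  have "of_real r * (\<Sum>i\<in>UNIV. ip (partial i (\<lambda>x. u x $ j)) (\<lambda>v. of_real (v $ j) * Qv n v $ i) r)
      = - ip (\<lambda>x. u x $ j) (\<lambda>v. Qv n v $ j) r" for j
    unfolding ip_tangential[OF n u C1_on_coord r]
    using exhaust_3[of j]
    by (intro arg_cong[where f = uminus] ip_cong)
      (auto simp: Lop_coord Qv_nth wbn, auto simp: wb_def algebra_simps)
  then have "of_real r * (\<Sum>j\<in>UNIV. \<Sum>i\<in>UNIV. ip (partial i (\<lambda>x. u x $ j)) (\<lambda>v. of_real (v $ j) * Qv n v $ i) r)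
      = - proj n u r"
    unfolding sum_distrib_left[of _ _ UNIV] proj_def by (simp add: sum_distrib_left sum_negf)
  then show ?thesis using r(1) by (simp add: field_simps)
qed

text \<open>The left side is the radial component of curl u, up to the factor r, tested with wb^n.
  Integration by parts puts the generators on wb^n, where they give -n times the components of
  \<open>Qv n\<close>.\<close>

lemma proj_xcurl:
  assumes n: "n \<ge> 1" and u: "\<And>i. C1_on (shell I) (\<lambda>x. u x $ i)" and r: "r > 0" "r \<in> I"
  shows "ip (Lop 2 3 (\<lambda>x. u x $ 1)) (\<lambda>v. wb v ^ n) r + ip (Lop 3 1 (\<lambda>x. u x $ 2)) (\<lambda>v. wb v ^ n) r
     + ip (Lop 1 2 (\<lambda>x. u x $ 3)) (\<lambda>v. wb v ^ n) r = of_nat n * proj n u r"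
proof -
  obtain m where m: "n = Suc m" using n by (cases n) auto
  have "ip F (Lop i j (\<lambda>v. wb v ^ n)) r = - of_nat n * ip F (\<lambda>v. Qv n v $ k) r"
    if "(i, j, k) \<in> {(2, 3, 1), (3, 1, 2), (1, 2, 3)}" for i j k F
    unfolding ip_cmult_right[symmetric]
    by (rule ip_cong) (use that in \<open>auto simp: Lop_power Lop_wb Qv_nth m simp del: power_Suc, auto simp: algebra_simps\<close>)
  then show ?thesis
    by (simp add: ip_Lop[OF _ u C1_on_wb_power r] proj_def sum_3 algebra_simps)
qed

lemma Qv_radial: "(\<Sum>i\<in>UNIV. of_real (v $ i) * Qv n v $ i) = 0" if "n \<ge> 1"
proof -
  have wbn: "wb v ^ n = wb v ^ (n - 1) * wb v" using that by (cases n) auto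
  show ?thesis
    by (simp only: sum_3 Qv_nth wbn) (simp add: wb_def algebra_simps)
qed

lemma ip_sum_integral:
  assumes "\<And>i. continuous_on (shell I) (F i)" "\<And>i. continuous_on (sphere 0 1) (p i)" "r > 0" "r \<in> I"
  shows "(\<Sum>i\<in>UNIV. ip (F i) (p i) r) = (\<integral>v. (\<Sum>i\<in>UNIV. F i (r *\<^sub>R v) * p i v) \<partial>sphere_measure)"
  unfolding ip_def
  by (rule Bochner_Integration.integral_sum[symmetric]) (intro ip_integrable[where I = I] assms)

lemma sphere_sum_integrable:
  fixes F p :: "3 \<Rightarrow> real^3 \<Rightarrow> complex"
  assumes "\<And>i. continuous_on (shell I) (F i)" "\<And>i. continuous_on (sphere 0 1) (p i)" "r > 0" "r \<in> I"
  shows "integrable sphere_measure (\<lambda>v. \<Sum>i\<in>UNIV. F i (r *\<^sub>R v) * p i v)"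
  by (intro Bochner_Integration.integrable_sum ip_integrable[where I = I] assms)

lemma swap_integral:
  assumes u: "\<And>i. C1_on (shell I) (\<lambda>x. u x $ i)" and r: "r > 0" "r \<in> I"
  shows "integrable sphere_measure (\<lambda>v. \<Sum>j\<in>UNIV. \<Sum>i\<in>UNIV.
      partial i (\<lambda>x. u x $ j) (r *\<^sub>R v) * (of_real (v $ j) * Qv n v $ i))" (is ?A)
    and "(\<Sum>j\<in>UNIV. \<Sum>i\<in>UNIV. ip (partial i (\<lambda>x. u x $ j)) (\<lambda>v. of_real (v $ j) * Qv n v $ i) r)
      = (\<integral>v. (\<Sum>j\<in>UNIV. \<Sum>i\<in>UNIV.
          partial i (\<lambda>x. u x $ j) (r *\<^sub>R v) * (of_real (v $ j) * Qv n v $ i)) \<partial>sphere_measure)" (is ?B)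
proof -
  have 1: "continuous_on (sphere 0 1) (\<lambda>v. complex_of_real (v $ j) * Qv n v $ i)" for i j
    by (intro continuous_on_mult C1_on_continuous C1_on_coord C1_on_Qv)
  have 2: "continuous_on (shell I) (partial i (\<lambda>x. u x $ j))" for i j
    by (rule C1_on_continuous_partial[OF u])
  show ?A by (intro Bochner_Integration.integrable_sum ip_integrable[where I = I] 1 2 r)
  show ?B
    unfolding ip_def
    by (simp add: Bochner_Integration.integral_sum Bochner_Integration.integrable_sum ip_integrable[OF 2 r 1])
qed

text \<open>The divergence term is normal to the sphere and drops out against the tangential
  \<open>Qv n\<close>. The gradient contributes a', its transpose -a/r.\<close>

lemma proj_traction:
  assumes n: "n \<ge> 1" and u: "\<And>i. C1_on (shell I) (\<lambda>x. u x $ i)" and r: "r > 0" "r \<in> I"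
  shows "(\<integral>v. (\<Sum>i\<in>UNIV. traction lam mu v u (r *\<^sub>R v) $ i * Qv n v $ i) \<partial>sphere_measure)
     = of_real mu * (proj' n u r - proj n u r / of_real r)"
proof -
  let ?E = "\<lambda>v. \<Sum>i\<in>UNIV. euler (\<lambda>x. u x $ i) (r *\<^sub>R v) * Qv n v $ i"
  let ?S = "\<lambda>v. \<Sum>j\<in>UNIV. \<Sum>i\<in>UNIV. partial i (\<lambda>x. u x $ j) (r *\<^sub>R v) * (of_real (v $ j) * Qv n v $ i)"
  have E: "integrable sphere_measure ?E"
    by (rule sphere_sum_integrable[OF euler_continuous[OF u] continuous_Qv r])
  have tr: "(\<Sum>i\<in>UNIV. traction lam mu v u (r *\<^sub>R v) $ i * Qv n v $ i)
      = of_real mu * (?E v / of_real r + ?S v)" for v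
  proof -
    define D where "D = divg u (r *\<^sub>R v)"
    define G where "G i j = partial j (\<lambda>x. u x $ i) (r *\<^sub>R v)" for i j
    define c where "c i = complex_of_real (v $ i)" for i
    define Q where "Q i = Qv n v $ i" for i
    have 0: "(\<Sum>i\<in>UNIV. c i * Q i) = 0" unfolding c_def Q_def by (rule Qv_radial[OF n])
    have "(\<Sum>i\<in>UNIV. traction lam mu v u (r *\<^sub>R v) $ i * Qv n v $ i)
        = (\<Sum>i\<in>UNIV. (of_real lam * D * c i + of_real mu * (\<Sum>j\<in>UNIV. (G i j + G j i) * c j)) * Q i)"
      by (simp add: traction_def D_def G_def c_def Q_def vgrad_def transpose_def matrix_vector_mult_def
          cvec_def vector_scalar_mult_def scaleR_conv_of_real[where 'a = complex] mult.assoc)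
    also have "\<dots> = of_real lam * D * (\<Sum>i\<in>UNIV. c i * Q i) + of_real mu *
        ((\<Sum>i\<in>UNIV. (\<Sum>j\<in>UNIV. c j * G i j) * Q i) + (\<Sum>j\<in>UNIV. \<Sum>i\<in>UNIV. G j i * (c j * Q i)))"
      unfolding sum_3 by (simp add: algebra_simps)
    also have "\<dots> = of_real mu * (?E v / of_real r + ?S v)"
      unfolding 0 using r
      by (simp add: G_def c_def Q_def euler_def sum_divide_distrib sum_distrib_right mult.assoc)
    finally show ?thesis .
  qed
  have "(\<integral>v. ?E v \<partial>sphere_measure) / of_real r = proj' n u r"
    unfolding proj'_def ip_sum_integral[OF euler_continuous[OF u] continuous_Qv r] ..
  moreover have "(\<integral>v. ?S v \<partial>sphere_measure) = - proj n u r / of_real r"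
    using proj_swap[OF n u r] swap_integral(2)[OF u r] by simp
  moreover have "(\<integral>v. of_real mu * (?E v / of_real r + ?S v) \<partial>sphere_measure)
      = of_real mu * ((\<integral>v. ?E v \<partial>sphere_measure) / of_real r + (\<integral>v. ?S v \<partial>sphere_measure))"
    using E swap_integral(1)[OF u r] by simp
  ultimately show ?thesis unfolding tr by simp
qed

section \<open>The shear radiation condition under the projection\<close>

lemma curl_nth:
  "curl u x $ 1 = partial 2 (\<lambda>y. u y $ 3) x - partial 3 (\<lambda>y. u y $ 2) x"
  "curl u x $ 2 = partial 3 (\<lambda>y. u y $ 1) x - partial 1 (\<lambda>y. u y $ 3) x"
  "curl u x $ 3 = partial 1 (\<lambda>y. u y $ 2) x - partial 2 (\<lambda>y. u y $ 1) x"
  by (simp_all add: curl_def vector_3)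

lemma C1_on_divg:
  "(\<And>i. C2_on S (\<lambda>x. u x $ i)) \<Longrightarrow> C1_on S (divg u)"
  unfolding divg_def by (intro C1_on_sum C2_on_partial)

lemma curl_curl:
  assumes S: "open S" and u: "\<And>i. C2_on S (\<lambda>x. u x $ i)" and x: "x \<in> S"
  shows "curl (curl u) x $ i = partial i (divg u) x - laplacian u x $ i"
proof -
  have d: "partial j (\<lambda>x. u x $ k) differentiable (at x)" for j k
    using C1_on_differentiable[OF C2_on_partial[OF u] x] .
  have div: "partial i (divg u) x = (\<Sum>j\<in>UNIV. partial i (partial j (\<lambda>x. u x $ j)) x)" for i
    unfolding divg_def[abs_def] sum_3 by (simp add: partial_add d differentiable_add)
  have sym: "partial j (partial k (\<lambda>x. u x $ i)) x = partial k (partial j (\<lambda>x. u x $ i)) x" for i j k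
    by (rule partial_commute[OF S u x])
  have "\<forall>i. curl (curl u) x $ i = partial i (divg u) x - laplacian u x $ i"
    unfolding forall_3 curl_nth[of "curl u"] unfolding curl_nth div laplacian_def
    by (simp add: partial_diff d sum_3 sym[of 2 1] sym[of 3 1] sym[of 3 2])
  then show ?thesis by blast
qed

lemma ccross_nth:
  "ccross a b $ 1 = a$2 * b$3 - a$3 * b$2"
  "ccross a b $ 2 = a$3 * b$1 - a$1 * b$3"
  "ccross a b $ 3 = a$1 * b$2 - a$2 * b$1"
  by (simp_all add: ccross_def vector_3)

definition radiation_defect :: "real \<Rightarrow> cfield \<Rightarrow> cfield" where
  "radiation_defect k u x = ccross (curl (curl u) x) (cvec (x /\<^sub>R norm x)) - (\<i> * of_real k) *s curl u x"

lemma radiation_defect_sphere: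
  assumes "norm v = 1" "r > 0"
  shows "radiation_defect k u (r *\<^sub>R v) = ccross (curl (curl u) (r *\<^sub>R v)) (cvec v)
     - (\<i> * of_real k) *s curl u (r *\<^sub>R v)"
  using assms by (simp add: radiation_defect_def)

text \<open>The radiation condition bounds only derivatives of the field. Its radial component, tested
  with \<open>wb\<^sup>n\<close>, is what bounds the projection itself; the tangential component then gives the
  Sommerfeld condition for the radial function.\<close>

lemma proj_defect_radial:
  assumes n: "n \<ge> 1" and u: "\<And>i. C2_on (shell I) (\<lambda>x. u x $ i)" and r: "r > 0" "r \<in> I"
  shows "(\<integral>v. (\<Sum>i\<in>UNIV. radiation_defect k u (r *\<^sub>R v) $ i * of_real (v $ i)) * wb v ^ n \<partial>sphere_measure)
     = - (\<i> * of_real k * of_nat n * proj n u r / of_real r)"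
proof -
  have u1: "C1_on (shell I) (\<lambda>x. u x $ i)" for i using C2_on_C1[OF u] .
  have int: "integrable sphere_measure (\<lambda>v. Lop i j (\<lambda>x. u x $ k) (r *\<^sub>R v) * wb v ^ n)" for i j k
    by (intro ip_integrable[OF Lop_continuous[OF u1] r] C1_on_continuous[OF C1_on_wb_power])
  have "(\<integral>v. (\<Sum>i\<in>UNIV. radiation_defect k u (r *\<^sub>R v) $ i * of_real (v $ i)) * wb v ^ n \<partial>sphere_measure)
    = (\<integral>v. - (\<i> * of_real k / of_real r) * (Lop 2 3 (\<lambda>x. u x $ 1) (r *\<^sub>R v) * wb v ^ n
        + Lop 3 1 (\<lambda>x. u x $ 2) (r *\<^sub>R v) * wb v ^ n + Lop 1 2 (\<lambda>x. u x $ 3) (r *\<^sub>R v) * wb v ^ n) \<partial>sphere_measure)"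
  proof (rule Bochner_Integration.integral_cong)
    fix v :: "real^3" assume "v \<in> space sphere_measure"
    then have v: "norm v = 1" by simp
    define c where "c i = curl (curl u) (r *\<^sub>R v) $ i" for i
    define G where "G j i = partial j (\<lambda>x. u x $ i) (r *\<^sub>R v)" for i j
    have "(\<Sum>i\<in>UNIV. radiation_defect k u (r *\<^sub>R v) $ i * of_real (v $ i))
      = - (\<i> * of_real k) * (of_real (v $ 1) * (G 2 3 - G 3 2) + of_real (v $ 2) * (G 3 1 - G 1 3)
          + of_real (v $ 3) * (G 1 2 - G 2 1))"
      unfolding radiation_defect_sphere[OF v r(1)] sum_3 vector_minus_component ccross_nth
        vector_smult_component curl_nth[of u] c_def[symmetric] G_def[symmetric]
      by (simp add: cvec_def algebra_simps)
    also have "\<dots> = - (\<i> * of_real k / of_real r) * (Lop 2 3 (\<lambda>x. u x $ 1) (r *\<^sub>R v)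
        + Lop 3 1 (\<lambda>x. u x $ 2) (r *\<^sub>R v) + Lop 1 2 (\<lambda>x. u x $ 3) (r *\<^sub>R v))"
      using r(1) unfolding Lop_def G_def[symmetric] by (simp add: field_simps)
    finally show "(\<Sum>i\<in>UNIV. radiation_defect k u (r *\<^sub>R v) $ i * of_real (v $ i)) * wb v ^ n
      = - (\<i> * of_real k / of_real r) * (Lop 2 3 (\<lambda>x. u x $ 1) (r *\<^sub>R v) * wb v ^ n
        + Lop 3 1 (\<lambda>x. u x $ 2) (r *\<^sub>R v) * wb v ^ n + Lop 1 2 (\<lambda>x. u x $ 3) (r *\<^sub>R v) * wb v ^ n)"
      by (simp only: distrib_right mult.assoc)
  qed simp
  also have "\<dots> = - (\<i> * of_real k / of_real r) * (of_nat n * proj n u r)"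
    unfolding proj_xcurl[OF n u1 r, symmetric] ip_def
    by (subst integral_mult_right_zero) (simp add: int)
  finally show ?thesis by simp
qed

text \<open>Testing with v x Qv converts the tangential part of curl curl u into -curl curl u paired
  with Qv. Since curl curl = grad div - Laplacian and gradients project to 0, the Laplacian remains;
  the curl term yields the radial derivative minus the swapped gradient of
  \<open>proj_swap\<close>.\<close>

lemma proj_defect_tangential:
  assumes n: "n \<ge> 1" and I: "open I" and u: "\<And>i. C2_on (shell I) (\<lambda>x. u x $ i)" and r: "r > 0" "r \<in> I"
  shows "(\<integral>v. (\<Sum>i\<in>UNIV. radiation_defect k u (r *\<^sub>R v) $ i * ccross (cvec v) (Qv n v) $ i) \<partial>sphere_measure)
     = (\<Sum>i\<in>UNIV. ip (\<lambda>x. laplacian u x $ i) (\<lambda>v. Qv n v $ i) r)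
        - \<i> * of_real k * (proj' n u r + proj n u r / of_real r)"
proof -
  note S = open_shell[OF I]
  have u1: "C1_on (shell I) (\<lambda>x. u x $ i)" for i using C2_on_C1[OF u] .
  have cl: "continuous_on (shell I) (\<lambda>x. laplacian u x $ i)" for i
    unfolding laplacian_def by (simp, intro continuous_intros C1_on_continuous_partial C2_on_partial u)
  have cd: "continuous_on (shell I) (partial i (divg u))" for i
    by (intro C1_on_continuous_partial C1_on_divg u)
  let ?L = "\<lambda>v. \<Sum>i\<in>UNIV. laplacian u (r *\<^sub>R v) $ i * Qv n v $ i"
  let ?D = "\<lambda>v. \<Sum>i\<in>UNIV. partial i (divg u) (r *\<^sub>R v) * Qv n v $ i"
  let ?E = "\<lambda>v. \<Sum>i\<in>UNIV. euler (\<lambda>x. u x $ i) (r *\<^sub>R v) * Qv n v $ i"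
  let ?S = "\<lambda>v. \<Sum>j\<in>UNIV. \<Sum>i\<in>UNIV. partial i (\<lambda>x. u x $ j) (r *\<^sub>R v) * (of_real (v $ j) * Qv n v $ i)"
  have int: "integrable sphere_measure ?L" "integrable sphere_measure ?D"
    "integrable sphere_measure ?E" "integrable sphere_measure ?S"
    by (intro sphere_sum_integrable[OF _ continuous_Qv r] cl cd euler_continuous[OF u1]
        swap_integral(1)[OF u1 r])+
  have "(\<integral>v. (\<Sum>i\<in>UNIV. radiation_defect k u (r *\<^sub>R v) $ i * ccross (cvec v) (Qv n v) $ i) \<partial>sphere_measure)
    = (\<integral>v. ?L v - ?D v - \<i> * of_real k * (?E v / of_real r - ?S v) \<partial>sphere_measure)"
  proof (rule Bochner_Integration.integral_cong)
    fix v :: "real^3" assume "v \<in> space sphere_measure"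
    then have v: "norm v = 1" by simp
    then have x: "r *\<^sub>R v \<in> shell I" using scale_sphere_shell[OF r] by simp
    define c where "c i = curl (curl u) (r *\<^sub>R v) $ i" for i
    define G where "G j i = partial j (\<lambda>x. u x $ i) (r *\<^sub>R v)" for i j
    define w where "w i = complex_of_real (v $ i)" for i
    define Q where "Q i = Qv n v $ i" for i
    have 0: "w 3 * Q 3 = - w 1 * Q 1 - w 2 * Q 2"
      using Qv_radial[OF n, of v] unfolding sum_3 w_def Q_def by (simp add: eq_neg_iff_add_eq_0 algebra_simps)
    have w1: "w 1 * w 1 + w 2 * w 2 + w 3 * w 3 = 1"
      using of_real_norm_sq[of v] v by (simp add: w_def power2_eq_square)
    have eu: "euler (\<lambda>x. u x $ i) (r *\<^sub>R v) = of_real r * (\<Sum>j\<in>UNIV. w j * G j i)" for i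
      by (simp add: euler_def w_def G_def sum_distrib_left mult.assoc)
    have cross: "ccross (cvec v) (Qv n v) $ 1 = w 2 * Q 3 - w 3 * Q 2"
      "ccross (cvec v) (Qv n v) $ 2 = w 3 * Q 1 - w 1 * Q 3"
      "ccross (cvec v) (Qv n v) $ 3 = w 1 * Q 2 - w 2 * Q 1"
      by (simp_all add: ccross_nth cvec_def w_def Q_def)
    \<comment> \<open>The identity (c x w).(w x Q) = (c.w)(w.Q) - (w.w)(c.Q), with w a unit vector
      orthogonal to Q.\<close>
    have cc: "(c 2 * w 3 - c 3 * w 2) * (w 2 * Q 3 - w 3 * Q 2)
        + (c 3 * w 1 - c 1 * w 3) * (w 3 * Q 1 - w 1 * Q 3)
        + (c 1 * w 2 - c 2 * w 1) * (w 1 * Q 2 - w 2 * Q 1) = - (\<Sum>i\<in>UNIV. c i * Q i)"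
    proof -
      have "(c 2 * w 3 - c 3 * w 2) * (w 2 * Q 3 - w 3 * Q 2)
        + (c 3 * w 1 - c 1 * w 3) * (w 3 * Q 1 - w 1 * Q 3)
        + (c 1 * w 2 - c 2 * w 1) * (w 1 * Q 2 - w 2 * Q 1)
        = (c 1 * w 1 + c 2 * w 2 + c 3 * w 3) * (w 1 * Q 1 + w 2 * Q 2 + w 3 * Q 3)
          - (w 1 * w 1 + w 2 * w 2 + w 3 * w 3) * (c 1 * Q 1 + c 2 * Q 2 + c 3 * Q 3)"
        by (simp add: algebra_simps)
      then show ?thesis unfolding w1 by (simp add: 0 sum_3)
    qed
    \<comment> \<open>curl u paired with w x Q equals the derivative of u in direction w paired with
      Q, minus the same with the gradient transposed.\<close>
    have ce: "(G 2 3 - G 3 2) * (w 2 * Q 3 - w 3 * Q 2) + (G 3 1 - G 1 3) * (w 3 * Q 1 - w 1 * Q 3)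
        + (G 1 2 - G 2 1) * (w 1 * Q 2 - w 2 * Q 1)
      = (\<Sum>i\<in>UNIV. (\<Sum>j\<in>UNIV. w j * G j i) * Q i) - (\<Sum>j\<in>UNIV. \<Sum>i\<in>UNIV. G i j * (w j * Q i))"
      unfolding sum_3 by (simp add: algebra_simps)
    have "(\<Sum>i\<in>UNIV. radiation_defect k u (r *\<^sub>R v) $ i * ccross (cvec v) (Qv n v) $ i)
      = ((c 2 * w 3 - c 3 * w 2) * (w 2 * Q 3 - w 3 * Q 2)
        + (c 3 * w 1 - c 1 * w 3) * (w 3 * Q 1 - w 1 * Q 3)
        + (c 1 * w 2 - c 2 * w 1) * (w 1 * Q 2 - w 2 * Q 1))
        - \<i> * of_real k * ((G 2 3 - G 3 2) * (w 2 * Q 3 - w 3 * Q 2)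
          + (G 3 1 - G 1 3) * (w 3 * Q 1 - w 1 * Q 3) + (G 1 2 - G 2 1) * (w 1 * Q 2 - w 2 * Q 1))"
      unfolding radiation_defect_sphere[OF v r(1)] sum_3 vector_minus_component cross
        vector_smult_component curl_nth[of u] ccross_nth[of "curl (curl u) _"]
        c_def[symmetric] G_def[symmetric]
      by (simp add: cvec_def w_def[symmetric] algebra_simps)
    also have "\<dots> = - (\<Sum>i\<in>UNIV. c i * Q i) - \<i> * of_real k *
        ((\<Sum>i\<in>UNIV. (\<Sum>j\<in>UNIV. w j * G j i) * Q i) - (\<Sum>j\<in>UNIV. \<Sum>i\<in>UNIV. G i j * (w j * Q i)))"
      unfolding cc ce ..
    also have "\<dots> = ?L v - ?D v - \<i> * of_real k * (?E v / of_real r - ?S v)"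
    proof -
      have "- (\<Sum>i\<in>UNIV. c i * Q i) = ?L v - ?D v"
        unfolding c_def curl_curl[OF S u x] Q_def by (simp add: sum_3 algebra_simps)
      moreover have "(\<Sum>i\<in>UNIV. (\<Sum>j\<in>UNIV. w j * G j i) * Q i) = ?E v / of_real r"
        using r(1) unfolding eu Q_def by (simp add: sum_divide_distrib)
      ultimately show ?thesis unfolding w_def G_def Q_def by simp
    qed
    finally show "(\<Sum>i\<in>UNIV. radiation_defect k u (r *\<^sub>R v) $ i * ccross (cvec v) (Qv n v) $ i)
      = ?L v - ?D v - \<i> * of_real k * (?E v / of_real r - ?S v)" .
  qed simp
  also have "\<dots> = (\<integral>v. ?L v \<partial>sphere_measure) - (\<integral>v. ?D v \<partial>sphere_measure)
      - \<i> * of_real k * ((\<integral>v. ?E v \<partial>sphere_measure) / of_real r - (\<integral>v. ?S v \<partial>sphere_measure))"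
    using int by simp
  also have "(\<integral>v. ?L v \<partial>sphere_measure) = (\<Sum>i\<in>UNIV. ip (\<lambda>x. laplacian u x $ i) (\<lambda>v. Qv n v $ i) r)"
    by (rule ip_sum_integral[OF cl continuous_Qv r, symmetric])
  also have "(\<integral>v. ?D v \<partial>sphere_measure) = 0"
    by (rule trans[OF ip_sum_integral[OF cd continuous_Qv r, symmetric] proj_gradient[OF n C1_on_divg[OF u] r]])
  also have "(\<integral>v. ?E v \<partial>sphere_measure) / of_real r = proj' n u r"
    unfolding proj'_def ip_sum_integral[OF euler_continuous[OF u1] continuous_Qv r] ..
  also have "(\<integral>v. ?S v \<partial>sphere_measure) = - proj n u r / of_real r"
    using proj_swap[OF n u1 r] swap_integral(2)[OF u1 r] by simp
  finally show ?thesis by simp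
qed

section \<open>Bessel and Hankel series\<close>

definition powser :: "(nat \<Rightarrow> 'a) \<Rightarrow> 'a::{real_normed_field,banach} \<Rightarrow> 'a" where
  "powser c z = (\<Sum>k. c k * z ^ k)"

text \<open>One bound with three uses: it gives convergence everywhere, passes to the derivative
  series, and yields estimates near 0 whose constants are free of the order n.\<close>

definition fact_bounded :: "(nat \<Rightarrow> 'a::{real_normed_field,banach}) \<Rightarrow> bool" where
  "fact_bounded c \<longleftrightarrow> (\<forall>k. norm (c k) \<le> 1 / fact k)"

lemma fact_bounded_diffs:
  assumes "fact_bounded c"
  shows "fact_bounded (diffs c)"
  unfolding fact_bounded_def
proof
  fix k
  have "norm (diffs c k) = real (Suc k) * norm (c (Suc k))"
    by (simp add: diffs_def norm_mult del: of_nat_Suc)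
  also have "\<dots> \<le> real (Suc k) * (1 / fact (Suc k))"
    using assms unfolding fact_bounded_def by (intro mult_left_mono) (blast, simp)
  also have "\<dots> = 1 / fact k" by (simp add: fact_Suc del: of_nat_Suc)
  finally show "norm (diffs c k) \<le> 1 / fact k" .
qed

lemma fact_bounded_term:
  assumes "fact_bounded c"
  shows "norm (c k * z ^ k) \<le> norm z ^ k / fact k"
proof -
  have "norm (c k) * norm z ^ k \<le> 1 / fact k * norm z ^ k"
    using assms by (intro mult_right_mono) (auto simp: fact_bounded_def)
  then show ?thesis by (simp add: norm_mult norm_power)
qed

lemma powser_summable_norm:
  assumes "fact_bounded c"
  shows "summable (\<lambda>k. norm (c k * z ^ k))"
proof (rule summable_comparison_test'[where g = "\<lambda>k. norm z ^ k / fact k" and N = 0])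
  show "summable (\<lambda>k. norm z ^ k / fact k)"
    using summable_exp[of "norm z"] by (simp add: divide_inverse mult.commute)
qed (use fact_bounded_term[OF assms] in simp)

lemma powser_summable: "fact_bounded c \<Longrightarrow> summable (\<lambda>k. c k * z ^ k)"
  by (rule summable_norm_cancel) (rule powser_summable_norm)

lemma powser_deriv:
  assumes "fact_bounded c"
  shows "(powser c has_field_derivative powser (diffs c) z) (at z)"
  unfolding powser_def[abs_def]
  by (rule termdiffs_strong_converges_everywhere) (rule powser_summable[OF assms])

lemma powser_mult_diffs_sums:
  assumes "fact_bounded c"
  shows "(\<lambda>k. of_nat k * c k * z ^ k) sums (z * powser (diffs c) z)"
proof -
  have "(\<lambda>k. of_nat k * c k * z ^ (k - Suc 0)) sums powser (diffs c) z"
    unfolding powser_def by (rule diffs_equiv) (rule powser_summable[OF fact_bounded_diffs[OF assms]])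
  then have "(\<lambda>k. z * (of_nat k * c k * z ^ (k - Suc 0))) sums (z * powser (diffs c) z)"
    by (rule sums_mult)
  moreover have "z * (of_nat k * c k * z ^ (k - Suc 0)) = of_nat k * c k * z ^ k" for k
    by (cases k) auto
  ultimately show ?thesis by simp
qed

text \<open>Comparison of the coefficients of z^k. The shape A z y'' + (B + C z) y' + D y covers the
  Bessel factor (4, 4n + 6, 0, 1) as well as the Hankel factor (1, -2n, -2, 2n).\<close>

lemma powser_ode:
  assumes c: "fact_bounded c"
    and rec: "\<And>k. of_nat (Suc k) * (A * of_nat k + B) * c (Suc k) + (C * of_nat k + D) * c k = 0"
  shows "A * z * powser (diffs (diffs c)) z + (B + C * z) * powser (diffs c) z + D * powser c z = 0"
proof -
  note d = fact_bounded_diffs[OF c]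
  have "(\<lambda>k. A * (of_nat k * diffs c k * z ^ k) + B * (diffs c k * z ^ k)
      + C * (of_nat k * c k * z ^ k) + D * (c k * z ^ k))
    sums (A * (z * powser (diffs (diffs c)) z) + B * powser (diffs c) z
      + C * (z * powser (diffs c) z) + D * powser c z)"
    unfolding powser_def[of "diffs c"] powser_def[of c]
    by (intro sums_add sums_mult summable_sums powser_summable c d
        powser_mult_diffs_sums[OF d] powser_mult_diffs_sums[OF c, unfolded powser_def])
  moreover have "A * (of_nat k * diffs c k * z ^ k) + B * (diffs c k * z ^ k)
      + C * (of_nat k * c k * z ^ k) + D * (c k * z ^ k) = 0" for k
  proof -
    have "A * (of_nat k * diffs c k * z ^ k) + B * (diffs c k * z ^ k)
      + C * (of_nat k * c k * z ^ k) + D * (c k * z ^ k)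
      = (of_nat (Suc k) * (A * of_nat k + B) * c (Suc k) + (C * of_nat k + D) * c k) * z ^ k"
      by (simp add: diffs_def algebra_simps)
    then show ?thesis by (simp only: rec) simp
  qed
  ultimately have "(\<lambda>k. 0) sums (A * (z * powser (diffs (diffs c)) z) + B * powser (diffs c) z
      + C * (z * powser (diffs c) z) + D * powser c z)" by simp
  then have "A * (z * powser (diffs (diffs c)) z) + B * powser (diffs c) z
      + C * (z * powser (diffs c) z) + D * powser c z = 0"
    using sums_unique2 sums_zero by blast
  then show ?thesis by (simp add: algebra_simps)
qed

lemma powser_bound:
  assumes c: "fact_bounded c" and z: "norm z \<le> 1 / 2"
  shows "norm (powser c z) \<le> 2"
proof -
  have t: "norm (c k * z ^ k) \<le> (1 / 2) ^ k" for k
  proof -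
    have "norm z ^ k / fact k \<le> (1 / 2) ^ k / 1"
      using z by (intro frac_le power_mono) (auto simp: fact_ge_1)
    then show ?thesis using fact_bounded_term[OF c, of k z] by simp
  qed
  have g: "(\<lambda>k. (1 / 2 :: real) ^ k) sums 2" using geometric_sums[of "1/2::real"] by simp
  have "norm (powser c z) \<le> (\<Sum>k. (1 / 2 :: real) ^ k)"
    unfolding powser_def using t g by (intro norm_suminf_le) (auto simp: sums_iff)
  then show ?thesis using g by (simp add: sums_iff)
qed

text \<open>Without its constant term the series is z times the series of the shifted coefficients,
  which are again \<open>fact_bounded\<close>.\<close>

lemma powser_near_one:
  assumes c: "fact_bounded c" "c 0 = 1" and z: "norm z \<le> 1 / 2"
  shows "norm (powser c z - 1) \<le> 2 * norm z"
proof -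
  have f: "powser c z = (\<Sum>k. c (Suc k) * z ^ k) * z + c 0"
    unfolding powser_def using powser_split_head(1)[OF powser_summable[OF c(1)]] by simp
  have "fact_bounded (\<lambda>k. c (Suc k))"
    unfolding fact_bounded_def
  proof
    fix k
    have "norm (c (Suc k)) \<le> 1 / fact (Suc k)" using c(1) unfolding fact_bounded_def by blast
    also have "\<dots> \<le> 1 / fact k" by (intro divide_left_mono fact_mono) auto
    finally show "norm (c (Suc k)) \<le> 1 / fact k" .
  qed
  from powser_bound[OF this z] have "norm (\<Sum>k. c (Suc k) * z ^ k) \<le> 2" unfolding powser_def .
  then show ?thesis using f c(2) by (simp add: norm_mult mult_right_mono)
qed

text \<open>Coefficients of (2n + 1)!! j_n(t) / t^n as a series in t^2; the product is the quotient
  (2(n + p) + 1)!! / (2n + 1)!!.\<close>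

definition bessel_coeff :: "nat \<Rightarrow> nat \<Rightarrow> real" where
  "bessel_coeff n p = (-1) ^ p / (2 ^ p * fact p * (\<Prod>i<p. 2 * real (n + 1 + i) + 1))"

lemma bessel_coeff_0 [simp]: "bessel_coeff n 0 = 1"
  by (simp add: bessel_coeff_def)

lemma bessel_prod_ge_1: "(\<Prod>i<p. 2 * real (n + 1 + i) + 1) \<ge> 1"
  by (rule prod_ge_1) simp

lemma fact_bounded_bessel: "fact_bounded (bessel_coeff n)"
  unfolding fact_bounded_def
proof
  fix p
  have 1: "(2::real) ^ p * (\<Prod>i<p. 2 * real (n + 1 + i) + 1) \<ge> 1 * 1"
    by (intro mult_mono bessel_prod_ge_1) (auto simp: one_le_power)
  have "norm (bessel_coeff n p) = 1 / (fact p * (2 ^ p * (\<Prod>i<p. 2 * real (n + 1 + i) + 1)))"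
    using bessel_prod_ge_1[of n p]
    by (simp add: bessel_coeff_def abs_mult power_abs abs_prod mult_ac)
  also have "\<dots> \<le> 1 / (fact p * 1)"
    using 1 by (intro divide_left_mono mult_left_mono) auto
  finally show "norm (bessel_coeff n p) \<le> 1 / fact p" by simp
qed

definition bessel_h :: "nat \<Rightarrow> real \<Rightarrow> real" where
  "bessel_h n = powser (bessel_coeff n)"

lemma sph_bessel_j_eq:
  "sph_bessel_j n t = t ^ n / (\<Prod>i\<le>n. 2 * real i + 1) * bessel_h n (t\<^sup>2)"
proof -
  have pr: "(\<Prod>i\<le>n + p. 2 * real i + 1) = (\<Prod>i\<le>n. 2 * real i + 1) * (\<Prod>i<p. 2 * real (n + 1 + i) + 1)" for p
    by (induction p) (simp_all add: algebra_simps)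
  have pw: "t ^ (n + 2 * p) = t ^ n * (t\<^sup>2) ^ p" for p
    by (simp add: power_add power_mult)
  have "sph_bessel_j n t = (\<Sum>p. t ^ n / (\<Prod>i\<le>n. 2 * real i + 1) * (bessel_coeff n p * (t\<^sup>2) ^ p))"
    unfolding sph_bessel_j_def pr pw
    by (simp add: bessel_coeff_def mult_ac)
  also have "\<dots> = t ^ n / (\<Prod>i\<le>n. 2 * real i + 1) * bessel_h n (t\<^sup>2)"
    unfolding bessel_h_def powser_def
    by (rule suminf_mult) (rule powser_summable[OF fact_bounded_bessel])
  finally show ?thesis .
qed

text \<open>The spherical Bessel equation after removing the factor t^n and passing to the variable
  s = t^2.\<close>

lemma bessel_h_ode:
  "4 * s * powser (diffs (diffs (bessel_coeff n))) s
    + (4 * real n + 6) * powser (diffs (bessel_coeff n)) s + bessel_h n s = 0"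
proof -
  have "real (Suc k) * (4 * real k + (4 * real n + 6)) * bessel_coeff n (Suc k)
      + (0 * real k + 1) * bessel_coeff n k = 0" for k
  proof -
    define P where "P = (\<Prod>i<k. 2 * real (n + 1 + i) + 1)"
    have P: "P > 0" using bessel_prod_ge_1[of n k] unfolding P_def by linarith
    define a where "a = real (Suc k)"
    define b where "b = 2 * real n + 2 * real k + 3"
    have ab: "a > 0" "b > 0" by (simp_all add: a_def b_def)
    have "bessel_coeff n (Suc k) = - ((-1) ^ k / (2 ^ k * fact k * P)) / (2 * a * b)"
      by (simp add: bessel_coeff_def P_def a_def b_def fact_Suc algebra_simps)
    moreover have "bessel_coeff n k = (-1) ^ k / (2 ^ k * fact k * P)"
      by (simp add: bessel_coeff_def P_def)
    moreover have "a * (4 * real k + (4 * real n + 6)) = 2 * a * b"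
      by (simp add: b_def algebra_simps)
    ultimately show ?thesis using ab by (simp add: a_def[symmetric] del: of_nat_Suc)
  qed
  from powser_ode[OF fact_bounded_bessel this, of s]
  show ?thesis by (simp add: bessel_h_def)
qed

text \<open>Coefficients of the reverse Bessel polynomial \<open>\<theta>\<^sub>n\<close> scaled to \<open>\<theta>\<^sub>n(0) = 1\<close>. The outgoing
  spherical Hankel function \<open>h\<^sub>n(t)\<close> is a multiple of \<open>exp (\<i> t) \<theta>\<^sub>n(-\<i> t) / t\<^bsup>n+1\<^esup>\<close>.\<close>

primrec hankel_coeff :: "nat \<Rightarrow> nat \<Rightarrow> real" where
  "hankel_coeff n 0 = 1"
| "hankel_coeff n (Suc k)
     = 2 * (real n - real k) / (real (Suc k) * (2 * real n - real k)) * hankel_coeff n k"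

lemma hankel_coeff_0: "k > n \<Longrightarrow> hankel_coeff n k = 0"
proof (induction k)
  case (Suc k)
  then show ?case by (cases "k = n") auto
qed simp

text \<open>For k < n the factor 2(n - k)/(2n - k) lies between 0 and 1, and the remaining factors
  1/(k + 1) multiply to the factorial. Beyond k = n the coefficients vanish.\<close>

lemma hankel_coeff_bounds:
  assumes "n \<ge> 1"
  shows "0 \<le> hankel_coeff n k \<and> hankel_coeff n k \<le> 1 / fact k"
proof (induction k)
  case (Suc k)
  show ?case
  proof (cases "k < n")
    case False
    then show ?thesis using hankel_coeff_0[of n "Suc k"] by (simp del: hankel_coeff.simps)
  next
    case True
    have q: "0 \<le> 2 * (real n - real k) / (2 * real n - real k)"
      "2 * (real n - real k) / (2 * real n - real k) \<le> 1"
      using True by (auto simp: divide_le_eq)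
    have eq: "hankel_coeff n (Suc k)
        = 2 * (real n - real k) / (2 * real n - real k) * (hankel_coeff n k / real (Suc k))"
      by simp
    have "hankel_coeff n (Suc k) \<le> 1 * ((1 / fact k) / real (Suc k))"
      unfolding eq using q Suc by (intro mult_mono divide_right_mono) auto
    also have "\<dots> = 1 / fact (Suc k)" by (simp add: fact_Suc)
    finally have "hankel_coeff n (Suc k) \<le> 1 / fact (Suc k)" .
    moreover have "0 \<le> hankel_coeff n (Suc k)"
      unfolding eq using q(1) Suc by (intro mult_nonneg_nonneg[OF q(1)] divide_nonneg_nonneg) auto
    ultimately show ?thesis by blast
  qed
qed simp

definition hankel_c :: "nat \<Rightarrow> nat \<Rightarrow> complex" where
  "hankel_c n k = of_real (hankel_coeff n k)"

lemma fact_bounded_hankel: "n \<ge> 1 \<Longrightarrow> fact_bounded (hankel_c n)"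
  using hankel_coeff_bounds[of n] unfolding fact_bounded_def hankel_c_def by simp

definition hankel_q :: "nat \<Rightarrow> complex \<Rightarrow> complex" where
  "hankel_q n = powser (hankel_c n)"

lemma hankel_q_ode:
  assumes n: "n \<ge> 1"
  shows "z * powser (diffs (diffs (hankel_c n))) z
    - 2 * (z + of_nat n) * powser (diffs (hankel_c n)) z + 2 * of_nat n * hankel_q n z = 0"
proof -
  have real: "real (Suc k) * (1 * real k + (- 2 * real n)) * hankel_coeff n (Suc k)
      + (- 2 * real k + 2 * real n) * hankel_coeff n k = 0" for k
  \<comment> \<open>At k = 2n the recursion divides by 0. There the first summand has the factor 0
    and the second a coefficient of index above n.\<close>
  proof (cases "k = 2 * n")
    case True
    then show ?thesis using n hankel_coeff_0[of n k] by simp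
  next
    case False
    then have "real k \<noteq> 2 * real n"
      by (metis of_nat_eq_iff of_nat_mult of_nat_numeral)
    then have ne: "2 * real n - real k \<noteq> 0" by simp
    have "real (Suc k) * (1 * real k + (- 2 * real n)) * hankel_coeff n (Suc k)
      = - (real (Suc k) * (2 * real n - real k)) *
        (2 * (real n - real k) / (real (Suc k) * (2 * real n - real k)) * hankel_coeff n k)"
      by (simp add: algebra_simps)
    also have "\<dots> = - (2 * (real n - real k)) * hankel_coeff n k"
    proof -
      have "real (Suc k) * (2 * real n - real k) \<noteq> 0" using ne by (simp del: of_nat_Suc)
      then have "- d * (x / d * y) = - x * y" if "d = real (Suc k) * (2 * real n - real k)" for x y d :: real
        using that by simp
      then show ?thesis by blast
    qed
    finally have eq: "real (Suc k) * (1 * real k + (- 2 * real n)) * hankel_coeff n (Suc k)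
      = - (2 * (real n - real k)) * hankel_coeff n k" .
    show ?thesis unfolding eq by algebra
  qed
  have "of_nat (Suc k) * (1 * of_nat k + (- 2 * of_nat n)) * hankel_c n (Suc k)
      + (- 2 * of_nat k + 2 * of_nat n) * hankel_c n k = 0" for k
    using arg_cong[OF real[of k], of complex_of_real]
    by (simp add: hankel_c_def del: of_nat_Suc hankel_coeff.simps)
  from powser_ode[OF fact_bounded_hankel[OF n] this, of z]
  show ?thesis by (simp add: hankel_q_def algebra_simps)
qed

text \<open>The polynomial form controls the growth for large arguments, which
  \<open>powser_bound\<close> does not reach.\<close>

lemma hankel_q_sum: "hankel_q n z = (\<Sum>k\<le>n. hankel_c n k * z ^ k)"
  unfolding hankel_q_def powser_def
  by (rule suminf_finite) (auto simp: hankel_c_def hankel_coeff_0)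

lemma hankel_q'_sum: "powser (diffs (hankel_c n)) z = (\<Sum>k\<le>n. of_nat k * hankel_c n k * z ^ (k - 1))"
proof -
  have 1: "powser (diffs (hankel_c n)) z = (\<Sum>k\<le>n. diffs (hankel_c n) k * z ^ k)"
    unfolding powser_def by (rule suminf_finite) (auto simp: diffs_def hankel_c_def hankel_coeff_0)
  have "(\<Sum>k\<le>Suc n. of_nat k * hankel_c n k * z ^ (k - 1))
     = (\<Sum>k\<le>n. diffs (hankel_c n) k * z ^ k)"
    by (subst sum.atMost_Suc_shift) (simp add: diffs_def)
  then show ?thesis using 1 hankel_coeff_0[of n "Suc n"] by (simp add: hankel_c_def del: hankel_coeff.simps)
qed

section \<open>The radial equation\<close>

text \<open>The spherical Bessel equation r^2 a'' + 2 r a' + (K r^2 - n(n + 1)) a = 0 with squared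
  wave number K. The first derivative is carried as a function because the matching at r = 1 uses
  it; the second is only asserted to exist.\<close>

definition radial_solution ::
  "nat \<Rightarrow> real \<Rightarrow> real set \<Rightarrow> (real \<Rightarrow> complex) \<Rightarrow> (real \<Rightarrow> complex) \<Rightarrow> bool" where
  "radial_solution n K I a a' \<longleftrightarrow> (\<forall>r\<in>I. (a has_vector_derivative a' r) (at r) \<and>
     (\<exists>d. (a' has_vector_derivative d) (at r) \<and>
        (of_real r)\<^sup>2 * d = (of_nat (n * (n + 1)) - of_real (K * r\<^sup>2)) * a r - 2 * of_real r * a' r))"

lemma radial_solution_subset: "radial_solution n K I a a' \<Longrightarrow> J \<subseteq> I \<Longrightarrow> radial_solution n K J a a'"
  unfolding radial_solution_def by blast

lemma radial_solution_diff:
  assumes "radial_solution n K I a a'" "radial_solution n K I b b'"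
  shows "radial_solution n K I (\<lambda>r. a r - b r) (\<lambda>r. a' r - b' r)"
  unfolding radial_solution_def
proof (intro ballI conjI)
  fix r assume r: "r \<in> I"
  from assms r obtain d e where *:
    "(a has_vector_derivative a' r) (at r)" "(b has_vector_derivative b' r) (at r)"
    "(a' has_vector_derivative d) (at r)" "(b' has_vector_derivative e) (at r)"
    "(of_real r)\<^sup>2 * d = (of_nat (n * (n + 1)) - of_real (K * r\<^sup>2)) * a r - 2 * of_real r * a' r"
    "(of_real r)\<^sup>2 * e = (of_nat (n * (n + 1)) - of_real (K * r\<^sup>2)) * b r - 2 * of_real r * b' r"
    unfolding radial_solution_def by blast
  show "((\<lambda>r. a r - b r) has_vector_derivative a' r - b' r) (at r)"
    by (intro has_vector_derivative_diff *)
  have "((\<lambda>r. a' r - b' r) has_vector_derivative d - e) (at r)"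
    by (intro has_vector_derivative_diff *)
  moreover have "(of_real r)\<^sup>2 * (d - e) = (of_nat (n * (n + 1)) - of_real (K * r\<^sup>2)) * (a r - b r)
      - 2 * of_real r * (a' r - b' r)"
    unfolding right_diff_distrib *(5,6) by simp
  ultimately show "\<exists>d. ((\<lambda>r. a' r - b' r) has_vector_derivative d) (at r) \<and>
        (of_real r)\<^sup>2 * d = (of_nat (n * (n + 1)) - of_real (K * r\<^sup>2)) * (a r - b r)
          - 2 * of_real r * (a' r - b' r)" by blast
qed

lemma radial_solution_cmult:
  assumes "radial_solution n K I b b'"
  shows "radial_solution n K I (\<lambda>r. c * b r) (\<lambda>r. c * b' r)"
  unfolding radial_solution_def
proof (intro ballI conjI)
  fix r assume r: "r \<in> I"
  from assms r obtain e where *: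
    "(b has_vector_derivative b' r) (at r)" "(b' has_vector_derivative e) (at r)"
    "(of_real r)\<^sup>2 * e = (of_nat (n * (n + 1)) - of_real (K * r\<^sup>2)) * b r - 2 * of_real r * b' r"
    unfolding radial_solution_def by blast
  show "((\<lambda>r. c * b r) has_vector_derivative c * b' r) (at r)"
    by (intro has_vector_derivative_mult_right *)
  have "((\<lambda>r. c * b' r) has_vector_derivative c * e) (at r)"
    by (intro has_vector_derivative_mult_right *)
  moreover have "(of_real r)\<^sup>2 * (c * e) = (of_nat (n * (n + 1)) - of_real (K * r\<^sup>2)) * (c * b r)
      - 2 * of_real r * (c * b' r)"
    unfolding mult.left_commute[of _ c] *(3) by (simp add: algebra_simps)
  ultimately show "\<exists>d. ((\<lambda>r. c * b' r) has_vector_derivative d) (at r) \<and>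
        (of_real r)\<^sup>2 * d = (of_nat (n * (n + 1)) - of_real (K * r\<^sup>2)) * (c * b r)
          - 2 * of_real r * (c * b' r)" by blast
qed

text \<open>Abel's identity: the weight r^2 absorbs the first-order term of the equation.\<close>

lemma wronskian_const:
  assumes I: "convex I"
    and a: "radial_solution n K I a a'" and b: "radial_solution n K I b b'"
  obtains c where "\<And>r. r \<in> I \<Longrightarrow> (of_real r)\<^sup>2 * (a' r * b r - a r * b' r) = c"
proof -
  have "((\<lambda>r. (of_real r)\<^sup>2 * (a' r * b r - a r * b' r)) has_vector_derivative 0) (at r within I)"
    if r: "r \<in> I" for r
  proof -
    from a b r obtain d e where *:
      "(a has_vector_derivative a' r) (at r)" "(b has_vector_derivative b' r) (at r)"
      "(a' has_vector_derivative d) (at r)" "(b' has_vector_derivative e) (at r)"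
      "(of_real r)\<^sup>2 * d = (of_nat (n * (n + 1)) - of_real (K * r\<^sup>2)) * a r - 2 * of_real r * a' r"
      "(of_real r)\<^sup>2 * e = (of_nat (n * (n + 1)) - of_real (K * r\<^sup>2)) * b r - 2 * of_real r * b' r"
      unfolding radial_solution_def by blast
    have sq: "((\<lambda>r. (complex_of_real r)\<^sup>2) has_vector_derivative 2 * of_real r) (at r)"
    proof -
      have "((\<lambda>r::real. r\<^sup>2) has_real_derivative 2 * r) (at r)"
        by (auto intro!: derivative_eq_intros)
      from has_vector_derivative_of_real[OF this, where 'a = complex] show ?thesis by simp
    qed
    have "((\<lambda>r. (of_real r)\<^sup>2 * (a' r * b r - a r * b' r)) has_vector_derivative
        ((of_real r)\<^sup>2 * ((a' r * b' r + d * b r) - (a r * e + a' r * b' r))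
         + 2 * of_real r * (a' r * b r - a r * b' r))) (at r)"
      by (intro has_vector_derivative_mult has_vector_derivative_diff sq *)
    moreover have "(of_real r)\<^sup>2 * ((a' r * b' r + d * b r) - (a r * e + a' r * b' r))
        = ((of_real r)\<^sup>2 * d) * b r - a r * ((of_real r)\<^sup>2 * e)"
      by (simp add: algebra_simps)
    ultimately show ?thesis
      unfolding *(5,6) by (simp add: algebra_simps has_vector_derivative_at_within)
  qed
  from has_vector_derivative_zero_constant[OF I this] that show ?thesis by blast
qed

text \<open>The derivative of a/b is the Wronskian divided by b^2.\<close>

lemma wronskian_zero_proportional:
  assumes I: "convex I"
    and a: "radial_solution n K I a a'" and b: "radial_solution n K I b b'"
    and W: "\<And>r. r \<in> I \<Longrightarrow> a' r * b r - a r * b' r = 0" and nz: "\<And>r. r \<in> I \<Longrightarrow> b r \<noteq> 0"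
  obtains c where "\<And>r. r \<in> I \<Longrightarrow> a r = c * b r \<and> a' r = c * b' r"
proof -
  have "((\<lambda>r. a r * inverse (b r)) has_vector_derivative 0) (at r within I)" if r: "r \<in> I" for r
  proof -
    from a b r have *: "(a has_vector_derivative a' r) (at r)" "(b has_vector_derivative b' r) (at r)"
      unfolding radial_solution_def by blast+
    have "(inverse has_field_derivative - (inverse (b r) * inverse (b r))) (at (b r))"
      using DERIV_inverse[OF nz[OF r], of UNIV] by (simp add: power2_eq_square)
    from field_vector_diff_chain_at[OF *(2) this]
    have "((\<lambda>r. inverse (b r)) has_vector_derivative b' r * - (inverse (b r) * inverse (b r))) (at r)"
      by (simp add: o_def)
    from has_vector_derivative_mult[OF *(1) this]
    have "((\<lambda>r. a r * inverse (b r)) has_vector_derivative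
      (a' r * b r - a r * b' r) * (inverse (b r) * inverse (b r))) (at r)"
      using nz[OF r] by (simp add: algebra_simps)
    then show ?thesis using W[OF r] by (simp add: has_vector_derivative_at_within)
  qed
  from has_vector_derivative_zero_constant[OF I this]
  obtain c where c: "\<And>r. r \<in> I \<Longrightarrow> a r * inverse (b r) = c" by blast
  show ?thesis
  proof (rule that[of c])
    fix r assume r: "r \<in> I"
    have 1: "a r = c * b r" using c[OF r] nz[OF r] by (simp add: field_simps)
    have "a' r * b r = c * b' r * b r" using W[OF r] unfolding 1 by (simp add: mult_ac)
    then show "a r = c * b r \<and> a' r = c * b' r" using 1 nz[OF r] by simp
  qed
qed

section \<open>Regular and outgoing solutions\<close>

definition bessel_h' :: "nat \<Rightarrow> real \<Rightarrow> real" where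
  "bessel_h' n = powser (diffs (bessel_coeff n))"

text \<open>For K > 0 a multiple of j_n(sqrt(K) r), normalised to behave like r^n at the
  origin.\<close>

definition regular_sol :: "nat \<Rightarrow> real \<Rightarrow> real \<Rightarrow> real" where
  "regular_sol n K r = r ^ n * bessel_h n (K * r\<^sup>2)"

definition regular_sol' :: "nat \<Rightarrow> real \<Rightarrow> real \<Rightarrow> real" where
  "regular_sol' n K r = r ^ n * (real n * bessel_h n (K * r\<^sup>2) / r + 2 * K * r * bessel_h' n (K * r\<^sup>2))"

lemma bessel_h_deriv: "(bessel_h n has_real_derivative bessel_h' n s) (at s)"
  unfolding bessel_h_def bessel_h'_def by (rule powser_deriv[OF fact_bounded_bessel])

lemma bessel_h'_deriv:
  "(bessel_h' n has_real_derivative powser (diffs (diffs (bessel_coeff n))) s) (at s)"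
  unfolding bessel_h'_def by (rule powser_deriv[OF fact_bounded_diffs[OF fact_bounded_bessel]])

lemma regular_solution:
  assumes pos: "\<And>r. r \<in> I \<Longrightarrow> r > 0"
  shows "radial_solution n K I (\<lambda>r. of_real (regular_sol n K r)) (\<lambda>r. of_real (regular_sol' n K r))"
  unfolding radial_solution_def
proof (intro ballI conjI)
  fix r assume "r \<in> I"
  then have r: "r > 0" by (rule pos)
  define h h1 h2 where "h = bessel_h n (K * r\<^sup>2)" and "h1 = bessel_h' n (K * r\<^sup>2)"
    and "h2 = powser (diffs (diffs (bessel_coeff n))) (K * r\<^sup>2)"
  have ode: "4 * (K * r\<^sup>2) * h2 + (4 * real n + 6) * h1 + h = 0"
    unfolding h_def h1_def h2_def bessel_h'_def by (rule bessel_h_ode)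
  have arg: "((\<lambda>r. K * r\<^sup>2) has_real_derivative 2 * K * r) (at r)"
    by (auto intro!: derivative_eq_intros)
  have dh: "((\<lambda>r. bessel_h n (K * r\<^sup>2)) has_real_derivative h1 * (2 * K * r)) (at r)"
    unfolding h1_def by (rule DERIV_chain2[OF bessel_h_deriv arg])
  have dh1: "((\<lambda>r. bessel_h' n (K * r\<^sup>2)) has_real_derivative h2 * (2 * K * r)) (at r)"
    unfolding h2_def by (rule DERIV_chain2[OF bessel_h'_deriv arg])
  have pw: "((\<lambda>r. r ^ n) has_real_derivative real n * r ^ n / r) (at r)"
    using r by (auto intro!: derivative_eq_intros) (cases n; simp)
  have "(regular_sol n K has_real_derivative (real n * r ^ n / r * h + h1 * (2 * K * r) * r ^ n)) (at r)"
    unfolding regular_sol_def[abs_def] h_def by (rule DERIV_mult[OF pw dh])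
  moreover have "real n * r ^ n / r * h + h1 * (2 * K * r) * r ^ n = regular_sol' n K r"
    unfolding regular_sol'_def h_def h1_def by (simp add: algebra_simps)
  ultimately have "(regular_sol n K has_real_derivative regular_sol' n K r) (at r)" by simp
  then show "((\<lambda>r. complex_of_real (regular_sol n K r)) has_vector_derivative of_real (regular_sol' n K r)) (at r)"
    by (rule has_vector_derivative_of_real)
  define g where "g = real n * h / r + 2 * K * r * h1"
  define g' where "g' = real n * (h1 * (2 * K * r) / r - h / r\<^sup>2) + (2 * K * h1 + h2 * (2 * K * r) * (2 * K * r))"
  have dg: "((\<lambda>r. real n * bessel_h n (K * r\<^sup>2) / r + 2 * K * r * bessel_h' n (K * r\<^sup>2)) has_real_derivative g') (at r)"
    unfolding g'_def h_def h1_def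
    using r
    by (intro DERIV_cong[OF DERIV_add[OF DERIV_divide[OF DERIV_cmult[OF dh, of "real n"] DERIV_ident]
          DERIV_mult[OF DERIV_cmult[OF DERIV_ident, of "2 * K"] dh1]]])
      (auto simp: field_simps power2_eq_square h_def h1_def)
  define d where "d = real n * r ^ n / r * g + g' * r ^ n"
  have "(regular_sol' n K has_real_derivative d) (at r)"
    unfolding regular_sol'_def[abs_def] d_def g_def h_def h1_def by (rule DERIV_mult[OF pw dg])
  then have "((\<lambda>r. complex_of_real (regular_sol' n K r)) has_vector_derivative of_real d) (at r)"
    by (rule has_vector_derivative_of_real)
  moreover have "r\<^sup>2 * d = (real (n * (n + 1)) - K * r\<^sup>2) * regular_sol n K r - 2 * r * regular_sol' n K r"
  proof -
    \<comment> \<open>The residual of the radial equation is a multiple of the left side of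
      \<open>ode\<close>.\<close>
    have "r\<^sup>2 * d - (real (n * (n + 1)) - K * r\<^sup>2) * regular_sol n K r + 2 * r * regular_sol' n K r
      = r ^ n * K * r\<^sup>2 * (4 * (K * r\<^sup>2) * h2 + (4 * real n + 6) * h1 + h)"
      using r unfolding d_def g_def g'_def regular_sol_def regular_sol'_def h_def[symmetric] h1_def[symmetric]
      by (simp add: field_simps power2_eq_square)
    then show ?thesis unfolding ode by simp
  qed
  then have "(complex_of_real r)\<^sup>2 * of_real d = (of_nat (n * (n + 1)) - of_real (K * r\<^sup>2)) * of_real (regular_sol n K r)
      - 2 * of_real r * of_real (regular_sol' n K r)"
    by (metis (no_types, opaque_lifting) of_real_diff of_real_mult of_real_numeral of_real_of_nat_eq of_real_power)
  ultimately show "\<exists>d. ((\<lambda>r. complex_of_real (regular_sol' n K r)) has_vector_derivative d) (at r) \<and>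
    (of_real r)\<^sup>2 * d = (of_nat (n * (n + 1)) - of_real (K * r\<^sup>2)) * of_real (regular_sol n K r)
      - 2 * of_real r * of_real (regular_sol' n K r)" by blast
qed

definition hankel_q' :: "nat \<Rightarrow> complex \<Rightarrow> complex" where
  "hankel_q' n = powser (diffs (hankel_c n))"

text \<open>A multiple of the outgoing spherical Hankel function of k r, normalised to behave like
  r^(-n-1) for small k r.\<close>

definition outgoing_sol :: "nat \<Rightarrow> real \<Rightarrow> real \<Rightarrow> complex" where
  "outgoing_sol n k r = exp (\<i> * of_real k * of_real r) / of_real r ^ (n + 1)
     * hankel_q n (- \<i> * of_real k * of_real r)"

definition outgoing_sol' :: "nat \<Rightarrow> real \<Rightarrow> real \<Rightarrow> complex" where
  "outgoing_sol' n k r = exp (\<i> * of_real k * of_real r) / of_real r ^ (n + 1)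
     * (- \<i> * of_real k * hankel_q' n (- \<i> * of_real k * of_real r)
        + (\<i> * of_real k - of_nat (n + 1) / of_real r) * hankel_q n (- \<i> * of_real k * of_real r))"

lemma outgoing_solution:
  assumes n: "n \<ge> 1" and pos: "\<And>r. r \<in> I \<Longrightarrow> r > 0"
  shows "radial_solution n (k\<^sup>2) I (outgoing_sol n k) (outgoing_sol' n k)"
  unfolding radial_solution_def
proof (intro ballI conjI)
  fix r assume "r \<in> I"
  then have r: "r > 0" by (rule pos)
  define z K where "z = complex_of_real r" and "K = complex_of_real k"
  have z: "z \<noteq> 0" using r by (simp add: z_def)
  define m where "m = complex_of_nat (n + 1)"
  define X where "X = - \<i> * K * z"
  define P Q1 Q2 where "P = hankel_q n X" and "Q1 = hankel_q' n X"
    and "Q2 = powser (diffs (diffs (hankel_c n))) X"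
  have ode: "X * Q2 - 2 * (X + of_nat n) * Q1 + 2 * of_nat n * P = 0"
    unfolding P_def Q1_def Q2_def hankel_q'_def by (rule hankel_q_ode[OF n])
  have arg: "((\<lambda>z. - \<i> * K * z) has_field_derivative - \<i> * K) (at z)"
    by (auto intro!: derivative_eq_intros)
  have dP: "((\<lambda>z. hankel_q n (- \<i> * K * z)) has_field_derivative Q1 * (- \<i> * K)) (at z)"
    unfolding Q1_def X_def hankel_q'_def hankel_q_def
    by (rule DERIV_chain2[OF powser_deriv[OF fact_bounded_hankel[OF n]] arg])
  have dQ: "((\<lambda>z. hankel_q' n (- \<i> * K * z)) has_field_derivative Q2 * (- \<i> * K)) (at z)"
    unfolding Q2_def X_def hankel_q'_def
    by (rule DERIV_chain2[OF powser_deriv[OF fact_bounded_diffs[OF fact_bounded_hankel[OF n]]] arg])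
  define E where "E = exp (\<i> * K * z) / z ^ (n + 1)"
  define g where "g = \<i> * K - m / z"
  have dE: "((\<lambda>z. exp (\<i> * K * z) / z ^ (n + 1)) has_field_derivative E * g) (at z)"
  proof -
    have "((\<lambda>z. exp (\<i> * K * z)) has_field_derivative exp (\<i> * K * z) * (\<i> * K)) (at z)"
      by (auto intro!: derivative_eq_intros)
    from DERIV_divide[OF this DERIV_power[OF DERIV_ident, of "n + 1"]]
    have "((\<lambda>z. exp (\<i> * K * z) / z ^ (n + 1)) has_field_derivative
       (exp (\<i> * K * z) * (\<i> * K) * z ^ (n + 1) - exp (\<i> * K * z) * (of_nat (n + 1) * z ^ (n + 1 - Suc 0)))
        / (z ^ (n + 1) * z ^ (n + 1))) (at z)"
      using z by (simp add: mult.commute)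
    moreover have "(exp (\<i> * K * z) * (\<i> * K) * z ^ (n + 1) - exp (\<i> * K * z) * (of_nat (n + 1) * z ^ (n + 1 - Suc 0)))
        / (z ^ (n + 1) * z ^ (n + 1)) = E * g"
      using z by (simp add: E_def g_def m_def field_simps)
    ultimately show ?thesis by simp
  qed
  have 1: "((\<lambda>z. exp (\<i> * K * z) / z ^ (n + 1) * hankel_q n (- \<i> * K * z)) has_field_derivative
      (E * g * P + Q1 * (- \<i> * K) * E)) (at z)"
    unfolding E_def P_def X_def by (rule DERIV_mult[OF dE[unfolded E_def] dP])
  have e1: "outgoing_sol' n k r = E * g * P + Q1 * (- \<i> * K) * E"
  proof -
    have "outgoing_sol' n k r = E * (- \<i> * K * Q1 + g * P)"
      unfolding outgoing_sol'_def E_def g_def P_def Q1_def X_def m_def z_def K_def ..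
    then show ?thesis by (simp add: algebra_simps)
  qed
  have e0: "outgoing_sol n k r = E * P"
    unfolding outgoing_sol_def E_def P_def X_def z_def K_def ..
  show "(outgoing_sol n k has_vector_derivative outgoing_sol' n k r) (at r)"
    using has_vector_derivative_real_field[OF 1[unfolded z_def], of UNIV] unfolding e1
    by (simp add: outgoing_sol_def[abs_def] K_def)
  have dg: "((\<lambda>z. \<i> * K - m / z) has_field_derivative m / (z * z)) (at z)"
    using z by (auto intro!: derivative_eq_intros)
  define d where "d = E * g * (- \<i> * K * Q1 + g * P)
     + (- \<i> * K * (Q2 * (- \<i> * K)) + (m / (z * z) * P + Q1 * (- \<i> * K) * g)) * E"
  have 2: "((\<lambda>z. exp (\<i> * K * z) / z ^ (n + 1) * (- \<i> * K * hankel_q' n (- \<i> * K * z)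
      + (\<i> * K - m / z) * hankel_q n (- \<i> * K * z))) has_field_derivative d) (at z)"
    unfolding d_def
    using DERIV_mult[OF dE DERIV_add[OF DERIV_cmult[OF dQ, of "- \<i> * K"] DERIV_mult[OF dg dP]]]
    unfolding E_def[symmetric] P_def[symmetric] Q1_def[symmetric] X_def[symmetric] g_def[symmetric] .
  have "(outgoing_sol' n k has_vector_derivative d) (at r)"
    using has_vector_derivative_real_field[OF 2[unfolded z_def], of UNIV]
    by (simp add: outgoing_sol'_def[abs_def] K_def m_def)
  moreover have "z\<^sup>2 * d = (of_nat (n * (n + 1)) - (K * z)\<^sup>2) * (E * P) - 2 * z * (E * g * P + Q1 * (- \<i> * K) * E)"
  proof -
    \<comment> \<open>These two products clear all denominators, so that the rest is a polynomial
      identity.\<close>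
    have gz: "z * g = \<i> * K * z - m" using z by (simp add: g_def field_simps)
    have mz: "z * z * (m / (z * z)) = m" using z by simp
    have "z\<^sup>2 * d = E * ((z * g) * (z * (- \<i> * K * Q1) + (z * g) * P)
       + (- K * K * Q2 * z * z + (z * z * (m / (z * z))) * P + Q1 * (- \<i> * K) * z * (z * g)))"
      unfolding d_def by (simp add: algebra_simps power2_eq_square)
    also have "\<dots> = E * ((\<i> * K * z - m) * (z * (- \<i> * K * Q1) + (\<i> * K * z - m) * P)
       + (- K * K * Q2 * z * z + m * P + Q1 * (- \<i> * K) * z * (\<i> * K * z - m)))"
      unfolding gz mz ..
    finally have z2d: "z\<^sup>2 * d = \<dots>" .
    have "(of_nat (n * (n + 1)) - (K * z)\<^sup>2) * (E * P) - 2 * z * (E * g * P + Q1 * (- \<i> * K) * E)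
      = (of_nat (n * (n + 1)) - (K * z)\<^sup>2) * (E * P) - 2 * (E * (z * g) * P + z * Q1 * (- \<i> * K) * E)"
      by (simp add: algebra_simps)
    also have "\<dots> = (of_nat (n * (n + 1)) - (K * z)\<^sup>2) * (E * P)
        - 2 * (E * (\<i> * K * z - m) * P + z * Q1 * (- \<i> * K) * E)"
      unfolding gz ..
    finally have rhs: "(of_nat (n * (n + 1)) - (K * z)\<^sup>2) * (E * P) - 2 * z * (E * g * P + Q1 * (- \<i> * K) * E) = \<dots>" .
    \<comment> \<open>Again the residual is a multiple of the left side of \<open>ode\<close>, the
      equation for the Hankel factor.\<close>
    have "z\<^sup>2 * d - ((of_nat (n * (n + 1)) - (K * z)\<^sup>2) * (E * P) - 2 * z * (E * g * P + Q1 * (- \<i> * K) * E))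
        = E * z * (- \<i> * K) * (X * Q2 - 2 * (X + of_nat n) * Q1 + 2 * of_nat n * P)"
      unfolding z2d rhs X_def m_def by (simp add: algebra_simps power2_eq_square)
    then show ?thesis unfolding ode by simp
  qed
  moreover have "of_real (k\<^sup>2 * r\<^sup>2) = (K * z)\<^sup>2" by (simp add: K_def z_def power_mult_distrib)
  ultimately show "\<exists>d. (outgoing_sol' n k has_vector_derivative d) (at r) \<and>
    (of_real r)\<^sup>2 * d = (of_nat (n * (n + 1)) - of_real (k\<^sup>2 * r\<^sup>2)) * outgoing_sol n k r
       - 2 * of_real r * outgoing_sol' n k r"
    unfolding e0 e1 z_def by metis
qed


text \<open>In the second bound the terms with i k cancel, and the expression becomes exp(i k r)
  r^(-n-2) (X q'(X) - n q(X)) with X = -i k r. The operator multiplies the coefficient of X^j by j -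
  n, which removes the top power: r^(n-1) is left, hence the decay r^(-3).\<close>

lemma outgoing_bounds:
  assumes k: "k > 0"
  obtains C where "\<And>r. r \<ge> 1 \<Longrightarrow> norm (outgoing_sol n k r) \<le> C / r"
    "\<And>r. r \<ge> 1 \<Longrightarrow> norm (outgoing_sol' n k r + outgoing_sol n k r / of_real r
        - \<i> * of_real k * outgoing_sol n k r) \<le> C / r ^ 3"
proof -
  define S where "S = (\<Sum>j\<le>n. norm (hankel_c n j) * k ^ j)"
  have S: "S \<ge> 0" unfolding S_def using k by (intro sum_nonneg) auto
  have nz: "norm (- \<i> * complex_of_real k * of_real r) = k * r" if "r \<ge> 1" for r
    using that k by (simp add: norm_mult)
  have E: "norm (exp (\<i> * complex_of_real k * of_real r) / complex_of_real r ^ (n + 1)) = 1 / r ^ (n + 1)"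
    if "r \<ge> 1" for r :: real
    using that by (simp add: norm_divide norm_mult norm_power norm_exp_eq_Re)
  have 1: "norm (outgoing_sol n k r) \<le> S / r" if r: "r \<ge> 1" for r
  proof -
    have "norm (hankel_q n (- \<i> * of_real k * of_real r)) \<le> (\<Sum>j\<le>n. norm (hankel_c n j) * (k * r) ^ j)"
      unfolding hankel_q_sum
      by (rule sum_norm_le, subst norm_mult, subst norm_power, subst nz[OF r], rule order_refl)
    also have "\<dots> \<le> (\<Sum>j\<le>n. norm (hankel_c n j) * k ^ j * r ^ n)"
      unfolding power_mult_distrib mult.assoc[symmetric]
      using r k by (intro sum_mono mult_left_mono power_increasing) auto
    also have "\<dots> = S * r ^ n" by (simp add: S_def sum_distrib_right)
    finally have "norm (outgoing_sol n k r) \<le> 1 / r ^ (n + 1) * (S * r ^ n)"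
      unfolding outgoing_sol_def norm_mult E[OF r] using r by (intro mult_left_mono) auto
    also have "\<dots> = S / r" using r by simp
    finally show ?thesis .
  qed
  have 2: "norm (outgoing_sol' n k r + outgoing_sol n k r / of_real r
        - \<i> * of_real k * outgoing_sol n k r) \<le> real n * S / r ^ 3" if r: "r \<ge> 1" for r
  proof -
    define X where "X = - \<i> * complex_of_real k * of_real r"
    define E where "E = exp (\<i> * complex_of_real k * of_real r) / complex_of_real r ^ (n + 1)"
    have eq: "outgoing_sol' n k r + outgoing_sol n k r / of_real r - \<i> * of_real k * outgoing_sol n k r
        = E / of_real r * (X * hankel_q' n X - of_nat n * hankel_q n X)"
      using r unfolding outgoing_sol_def outgoing_sol'_def E_def[symmetric] X_def[symmetric]
      by (simp add: X_def[of] field_simps)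
    have "X * hankel_q' n X = (\<Sum>j\<le>n. of_nat j * hankel_c n j * X ^ j)"
      unfolding hankel_q'_def hankel_q'_sum sum_distrib_left
      by (intro sum.cong refl) (case_tac x; simp add: mult_ac)
    then have "X * hankel_q' n X - of_nat n * hankel_q n X
        = (\<Sum>j\<le>n. (of_nat j - of_nat n) * hankel_c n j * X ^ j)"
      unfolding hankel_q_sum by (simp add: sum_distrib_left sum_subtractf[symmetric] algebra_simps)
    also have "norm \<dots> \<le> (\<Sum>j\<le>n. real n * (norm (hankel_c n j) * k ^ j * (r ^ n / r)))"
    proof (rule sum_norm_le)
      fix j assume "j \<in> {..n}"
      then have j: "j \<le> n" by simp
      have nX: "norm X = k * r" using nz[OF r] by (simp add: X_def)
      have e: "norm ((of_nat j - of_nat n) * hankel_c n j * X ^ j)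
          = (real n - real j) * r ^ j * (norm (hankel_c n j) * k ^ j)"
      proof -
        have "norm (complex_of_nat j - of_nat n) = real n - real j"
          using j by (metis norm_minus_commute norm_of_nat of_nat_diff)
        then show ?thesis by (simp add: norm_mult norm_power nX power_mult_distrib)
      qed
      have "(real n - real j) * r ^ j \<le> real n * (r ^ n / r)"
      proof (cases "j = n")
        case True
        then show ?thesis using r by simp
      next
        case False
        then have "r ^ Suc j \<le> r ^ n" using j r by (intro power_increasing) auto
        then have "r ^ j \<le> r ^ n / r" using r by (simp add: field_simps)
        then show ?thesis using j r by (intro mult_mono) auto
      qed
      then have "(real n - real j) * r ^ j * (norm (hankel_c n j) * k ^ j)
          \<le> real n * (r ^ n / r) * (norm (hankel_c n j) * k ^ j)"
        using k by (intro mult_right_mono) auto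
      then show "norm ((of_nat j - of_nat n) * hankel_c n j * X ^ j)
          \<le> real n * (norm (hankel_c n j) * k ^ j * (r ^ n / r))"
        unfolding e by (simp only: mult_ac)
    qed
    also have "\<dots> = real n * S * (r ^ n / r)"
      by (simp add: S_def sum_distrib_left sum_distrib_right sum_divide_distrib mult.assoc)
    finally have "norm (X * hankel_q' n X - of_nat n * hankel_q n X) \<le> real n * S * (r ^ n / r)" .
    then have "norm (E / of_real r * (X * hankel_q' n X - of_nat n * hankel_q n X))
        \<le> 1 / r ^ (n + 1) / r * (real n * S * (r ^ n / r))"
      unfolding norm_mult norm_divide[of E] using E[OF r] r by (intro mult_mono) (auto simp: E_def)
    also have "\<dots> = real n * S / r ^ 3" using r by (simp add: power3_eq_cube)
    finally show ?thesis unfolding eq .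
  qed
  show ?thesis
  proof (rule that[of "S + real n * S"])
    fix r :: real assume r: "r \<ge> 1"
    have "S / r \<le> (S + real n * S) / r" "real n * S / r ^ 3 \<le> (S + real n * S) / r ^ 3"
      using S r by (auto intro!: divide_right_mono)
    then show "norm (outgoing_sol n k r) \<le> (S + real n * S) / r"
      "norm (outgoing_sol' n k r + outgoing_sol n k r / of_real r
        - \<i> * of_real k * outgoing_sol n k r) \<le> (S + real n * S) / r ^ 3"
      using 1[OF r] 2[OF r] by linarith+
  qed
qed

lemma outgoing_near:
  assumes n: "n \<ge> 1" and k: "0 < k" and r: "0 < r" "k * r \<le> 1 / 2"
  shows "norm (hankel_q n (- \<i> * of_real k * of_real r) - 1) \<le> 2 * (k * r)"
    and "norm (hankel_q' n (- \<i> * of_real k * of_real r)) \<le> 2"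
proof -
  have nz: "norm (- \<i> * complex_of_real k * of_real r) = k * r"
    using r k by (simp add: norm_mult)
  have c0: "hankel_c n 0 = 1" by (simp add: hankel_c_def)
  show "norm (hankel_q n (- \<i> * of_real k * of_real r) - 1) \<le> 2 * (k * r)"
    using powser_near_one[OF fact_bounded_hankel[OF n] c0, of "- \<i> * of_real k * of_real r"] r(2)
    unfolding nz hankel_q_def by simp
  show "norm (hankel_q' n (- \<i> * of_real k * of_real r)) \<le> 2"
    using powser_bound[OF fact_bounded_diffs[OF fact_bounded_hankel[OF n]], of "- \<i> * of_real k * of_real r"] r(2)
    unfolding nz hankel_q'_def by simp
qed

lemma bessel_near:
  assumes "0 \<le> s" "s \<le> 1 / 2"
  shows "\<bar>bessel_h n s - 1\<bar> \<le> 2 * s" "\<bar>bessel_h' n s\<bar> \<le> 2"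
  using powser_near_one[OF fact_bounded_bessel bessel_coeff_0, of s n]
    powser_bound[OF fact_bounded_diffs[OF fact_bounded_bessel], of s n] assms
  by (simp_all add: bessel_h_def bessel_h'_def)

text \<open>The quantity \<open>r\<^sup>2 (a' b - a b')\<close> is constant for two radial solutions. Against the regular
  solution it vanishes because it tends to \<open>0\<close> at the origin.\<close>

lemma interior_match:
  assumes n: "n \<ge> 1" and K: "0 \<le> K" "K \<le> 1 / 8"
    and a: "radial_solution n K {0<..<1} a a'"
    and bd: "\<And>r. r \<in> {0<..<1/2} \<Longrightarrow> norm (a r) \<le> C \<and> norm (a' r) \<le> C"
  obtains c where "\<And>r. r \<in> {0<..<1} \<Longrightarrow> a r = c * of_real (regular_sol n K r)
    \<and> a' r = c * of_real (regular_sol' n K r)"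
proof -
  let ?b = "\<lambda>r. complex_of_real (regular_sol n K r)" and ?b' = "\<lambda>r. complex_of_real (regular_sol' n K r)"
  have b: "radial_solution n K {0<..<1} ?b ?b'" by (rule regular_solution) simp
  have s: "0 \<le> K * r\<^sup>2" "K * r\<^sup>2 \<le> 1 / 8" if "r \<in> {0<..<1}" for r
  proof -
    have "r\<^sup>2 \<le> 1" using that by (simp add: power_le_one)
    then show "K * r\<^sup>2 \<le> 1 / 8" using mult_mono[OF K(2), of "r\<^sup>2" 1] by simp
  qed (use K in simp)
  have h: "\<bar>bessel_h n (K * r\<^sup>2) - 1\<bar> \<le> 1 / 4" "\<bar>bessel_h' n (K * r\<^sup>2)\<bar> \<le> 2" if "r \<in> {0<..<1}" for r
    using bessel_near[of "K * r\<^sup>2" n] s[OF that] by auto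
  obtain c where c: "\<And>r. r \<in> {0<..<1} \<Longrightarrow> (of_real r)\<^sup>2 * (a' r * ?b r - a r * ?b' r) = c"
    using wronskian_const[OF convex_real_interval(8) a b] by blast
  have C: "C \<ge> 0" using bd[of "1/4"] order_trans[OF norm_ge_zero, of "a (1/4)" C] by simp
  \<comment> \<open>a, a', b and r b' are all bounded near 0, so one of the two factors r is left
    over.\<close>
  have cb: "norm c \<le> r * (2 * (C * (real n + 10)))" if r: "r \<in> {0<..<1/2}" for r
  proof -
    have r1: "r \<in> {0<..<1}" using r by simp
    have rn: "r ^ n \<le> 1" using r1 by (simp add: power_le_one)
    have bb: "\<bar>regular_sol n K r\<bar> \<le> 2"
    proof -
      have "\<bar>bessel_h n (K * r\<^sup>2)\<bar> \<le> 2" using h(1)[OF r1] by linarith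
      then have "r ^ n * \<bar>bessel_h n (K * r\<^sup>2)\<bar> \<le> 1 * 2"
        using rn r by (intro mult_mono) auto
      then show ?thesis using r by (simp add: regular_sol_def abs_mult)
    qed
    have bb': "r * \<bar>regular_sol' n K r\<bar> \<le> 2 * real n + 4"
    proof -
      have "r * regular_sol' n K r = r ^ n * (real n * bessel_h n (K * r\<^sup>2) + 2 * (K * r\<^sup>2) * bessel_h' n (K * r\<^sup>2))"
        using r by (simp add: regular_sol'_def field_simps power2_eq_square)
      then have "r * \<bar>regular_sol' n K r\<bar> = r ^ n * \<bar>real n * bessel_h n (K * r\<^sup>2) + 2 * (K * r\<^sup>2) * bessel_h' n (K * r\<^sup>2)\<bar>"
        using r by (metis abs_mult abs_of_pos abs_power_minus greaterThanLessThan_iff power_abs)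
      also have "\<dots> \<le> 1 * (2 * real n + 4)"
      proof (intro mult_mono rn)
        have "\<bar>real n * bessel_h n (K * r\<^sup>2)\<bar> \<le> real n * 2"
          proof -
          have "\<bar>bessel_h n (K * r\<^sup>2)\<bar> \<le> 2" using h(1)[OF r1] by linarith
          then show ?thesis unfolding abs_mult by (intro mult_mono) auto
        qed
        moreover have "\<bar>2 * (K * r\<^sup>2) * bessel_h' n (K * r\<^sup>2)\<bar> \<le> 2 * 2"
          unfolding abs_mult using h(2)[OF r1] s[OF r1] by (intro mult_mono) auto
        ultimately show "\<bar>real n * bessel_h n (K * r\<^sup>2) + 2 * (K * r\<^sup>2) * bessel_h' n (K * r\<^sup>2)\<bar> \<le> 2 * real n + 4"
          by linarith
      qed auto
      finally show ?thesis by simp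
    qed
    have "norm c = norm ((of_real r)\<^sup>2 * (a' r * ?b r - a r * ?b' r))" using c[OF r1] by simp
    also have "\<dots> = r * norm (of_real r * a' r * ?b r - a r * (of_real r * ?b' r))"
    proof -
      have "(of_real r)\<^sup>2 * (a' r * ?b r - a r * ?b' r) = of_real r * (of_real r * a' r * ?b r - a r * (of_real r * ?b' r))"
        by (simp add: power2_eq_square algebra_simps)
      then show ?thesis using r by (simp add: norm_mult)
    qed
    also have "\<dots> \<le> r * (C * 2 + C * (2 * real n + 4))"
    proof (intro mult_left_mono order_trans[OF norm_triangle_ineq4] add_mono)
      have "r * norm (a' r) * \<bar>regular_sol n K r\<bar> \<le> (1 * C) * 2"
        using r bd[OF r] bb C by (intro mult_mono) auto
      then show "norm (of_real r * a' r * ?b r) \<le> C * 2" using r by (simp add: norm_mult)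
      have "norm (a r) * (r * \<bar>regular_sol' n K r\<bar>) \<le> C * (2 * real n + 4)"
        using r bd[OF r] bb' C by (intro mult_mono) auto
      then show "norm (a r * (of_real r * ?b' r)) \<le> C * (2 * real n + 4)" using r by (simp add: norm_mult)
    qed (use r in auto)
    also have "\<dots> \<le> r * (2 * (C * (real n + 10)))"
      using r C by (intro mult_left_mono) (auto simp: algebra_simps)
    finally show ?thesis .
  qed
  have "c = 0"
  proof (rule ccontr)
    assume "c \<noteq> 0"
    \<comment> \<open>The summand 1 makes M positive even if C = 0.\<close>
    define M where "M = 2 * (C * (real n + 10)) + 1"
    have M: "M > 0" using C by (simp add: M_def add_nonneg_pos)
    define r where "r = min (1 / 4) (norm c / (2 * M))"
    have r: "r > 0" "r \<le> 1 / 4" "r \<le> norm c / (2 * M)" using \<open>c \<noteq> 0\<close> M by (auto simp: r_def)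
    have "norm c \<le> r * (2 * (C * (real n + 10)))" using cb[of r] r by simp
    also have "\<dots> \<le> r * M" unfolding M_def using r by (intro mult_left_mono) auto
    also have "\<dots> \<le> norm c / (2 * M) * M" using r(3) M by (intro mult_right_mono) auto
    also have "\<dots> = norm c / 2" using M by simp
    finally show False using \<open>c \<noteq> 0\<close> by simp
  qed
  have W: "a' r * ?b r - a r * ?b' r = 0" if "r \<in> {0<..<1}" for r
    using c[OF that] that \<open>c = 0\<close> by auto
  \<comment> \<open>K <= 1/8 keeps the Bessel factor within 1/4 of 1, so the regular solution has no
    zero in the ball except at the origin.\<close>
  have nz: "?b r \<noteq> 0" if "r \<in> {0<..<1}" for r
    using h(1)[OF that] that by (auto simp: regular_sol_def)
  from wronskian_zero_proportional[OF convex_real_interval(8) a b W nz] that show ?thesis by blast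
qed

text \<open>Here the radiation condition makes \<open>r\<^sup>2 (a' b - a b')\<close> vanish at infinity; this replaces a
  uniqueness theorem for the exterior problem.\<close>

lemma exterior_match:
  assumes n: "n \<ge> 1" and k: "0 < k" "k \<le> 1 / 16"
    and a: "radial_solution n (k\<^sup>2) {1<..} a a'"
    and bd: "\<And>r. r \<ge> R0 \<Longrightarrow> norm (a r) \<le> C / r"
      "\<And>r. r \<ge> R0 \<Longrightarrow> norm (a' r + a r / of_real r - \<i> * of_real k * a r) \<le> C / r\<^sup>2"
  obtains c where "\<And>r. r \<in> {1<..<2} \<Longrightarrow> a r = c * outgoing_sol n k r \<and> a' r = c * outgoing_sol' n k r"
proof -
  let ?b = "outgoing_sol n k" and ?b' = "outgoing_sol' n k"
  have b: "radial_solution n (k\<^sup>2) {1<..} ?b ?b'" by (rule outgoing_solution[OF n]) simp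
  obtain c where c: "\<And>r. r \<in> {1<..} \<Longrightarrow> (of_real r)\<^sup>2 * (a' r * ?b r - a r * ?b' r) = c"
    using wronskian_const[OF convex_real_interval(3) a b] by blast
  obtain C' where C': "\<And>r. r \<ge> 1 \<Longrightarrow> norm (?b r) \<le> C' / r"
    "\<And>r. r \<ge> 1 \<Longrightarrow> norm (?b' r + ?b r / of_real r - \<i> * of_real k * ?b r) \<le> C' / r ^ 3"
    using outgoing_bounds[OF k(1), of n] by blast
  have cb: "norm c \<le> 2 * (C * C') / r" if r: "r > 1" "r \<ge> R0" for r
  proof -
    have C: "C \<ge> 0" "C' \<ge> 0"
      using order_trans[OF norm_ge_zero bd(1)[OF r(2)]] order_trans[OF norm_ge_zero C'(1)[of r]] r
      by (auto simp: zero_le_divide_iff)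
    define x y where "x = a' r + a r / of_real r - \<i> * of_real k * a r"
      and "y = ?b' r + ?b r / of_real r - \<i> * of_real k * ?b r"
    have "c = (of_real r)\<^sup>2 * (a' r * ?b r - a r * ?b' r)" using c r by simp
    \<comment> \<open>Adding (1/r - i k) a b to both products leaves their difference unchanged and
      replaces a' and b' by their Sommerfeld defects.\<close>
    also have "\<dots> = (of_real r)\<^sup>2 * (x * ?b r - a r * y)" by (simp add: x_def y_def algebra_simps)
    also have "norm \<dots> = r\<^sup>2 * norm (x * ?b r - a r * y)" by (simp add: norm_mult norm_power)
    also have "\<dots> \<le> r\<^sup>2 * (C / r\<^sup>2 * (C' / r) + C / r * (C' / r ^ 3))"
    proof (intro mult_left_mono order_trans[OF norm_triangle_ineq4] add_mono)
      show "norm (x * ?b r) \<le> C / r\<^sup>2 * (C' / r)"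
        unfolding norm_mult x_def using bd(2)[OF r(2)] C'(1)[of r] r C by (intro mult_mono) auto
      show "norm (a r * y) \<le> C / r * (C' / r ^ 3)"
        unfolding norm_mult y_def using bd(1)[OF r(2)] C'(2)[of r] r C by (intro mult_mono) auto
    qed simp
    also have "\<dots> = C * C' / r + C * C' / r\<^sup>2"
      using r by (simp add: field_simps power2_eq_square power3_eq_cube)
    also have "\<dots> \<le> C * C' / r + C * C' / r"
      using r C by (intro add_left_mono divide_left_mono) (auto simp: power2_eq_square)
    finally show ?thesis by simp
  qed
  have "c = 0"
  proof (rule ccontr)
    assume "c \<noteq> 0"
    define r where "r = max (max R0 2) (2 * (2 * (C * C')) / norm c)"
    have r: "r > 1" "r \<ge> R0" "2 * (2 * (C * C')) / norm c \<le> r" by (auto simp: r_def)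
    have "2 * (2 * (C * C')) \<le> r * norm c" using r(3) \<open>c \<noteq> 0\<close> by (simp add: field_simps)
    moreover have "norm c * r \<le> 2 * (C * C')" using cb[OF r(1,2)] r(1) by (simp add: field_simps)
    moreover have "norm c * r > 0" using \<open>c \<noteq> 0\<close> r by simp
    ultimately show False by (simp add: mult.commute)
  qed
  have W: "a' r * ?b r - a r * ?b' r = 0" if "r \<in> {1<..<2}" for r
    using c[of r] that \<open>c = 0\<close> by auto
  \<comment> \<open>Zeros are excluded by k r <= 1/8; this is why the conclusion stops at radius
    2.\<close>
  have nz: "?b r \<noteq> 0" if r: "r \<in> {1<..<2}" for r
  proof -
    have "k * r \<le> 1 / 16 * 2" using r k by (intro mult_mono) auto
    then have "norm (hankel_q n (- \<i> * of_real k * of_real r) - 1) \<le> 1 / 4"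
      using outgoing_near(1)[OF n k(1), of r] r by simp
    then have "hankel_q n (- \<i> * of_real k * of_real r) \<noteq> 0" by auto
    then show ?thesis using r by (simp add: outgoing_sol_def)
  qed
  have sub: "{1<..<2::real} \<subseteq> {1<..}" by auto
  from wronskian_zero_proportional[OF convex_real_interval(8) radial_solution_subset[OF a sub]
      radial_solution_subset[OF b sub] W nz] that
  show ?thesis by blast
qed

section \<open>The incident wave\<close>

text \<open>The direction field of the incident wave; paired with \<open>Qv n\<close> on the sphere
  it gives the squared norm.\<close>

definition cQv :: "nat \<Rightarrow> cfield" where
  "cQv n x = (\<chi> i. cnj (Qv n x $ i))"

lemma wb_scale: "wb (r *\<^sub>R x) = of_real r * wb x"
  by (simp add: wb_def algebra_simps)

lemma Qv_scale:
  assumes "n \<ge> 1"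
  shows "Qv n (r *\<^sub>R x) $ i = of_real r ^ n * (Qv n x $ i)"
proof -
  obtain m where m: "n = Suc m" using assms by (cases n) auto
  have "\<forall>i. Qv n (r *\<^sub>R x) $ i = of_real r ^ n * (Qv n x $ i)"
    unfolding forall_3 Qv_nth wb_scale by (simp add: m power_mult_distrib)
  then show ?thesis by blast
qed

lemma cQv_scale: "n \<ge> 1 \<Longrightarrow> cQv n (r *\<^sub>R x) $ i = of_real r ^ n * (cQv n x $ i)"
  by (simp add: cQv_def Qv_scale)

section \<open>Spherical harmonics of top order\<close>

lemma higher_pderiv_degree:
  fixes p :: "real poly"
  shows "degree p = m \<Longrightarrow> (pderiv ^^ m) p = [: fact m * lead_coeff p :]"
proof (induction m arbitrary: p)
  case 0
  then obtain a where "p = [:a:]" by (rule degree_eq_zeroE)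
  then show ?case by simp
next
  case (Suc m)
  have d: "degree (pderiv p) = m" using Suc.prems by (simp add: degree_pderiv)
  have "lead_coeff (pderiv p) = real (Suc m) * lead_coeff p"
    unfolding d using Suc.prems by (simp add: coeff_pderiv)
  with Suc.IH[OF d] show ?case
    by (simp add: funpow_swap1 fact_Suc mult_ac del: of_nat_Suc)
qed

text \<open>The 2n derivatives in Rodrigues' formula act on the monic polynomial (t^2 - 1)^n of
  degree 2n and leave the constant (2n)!.\<close>

lemma assoc_legendre_top:
  obtains c where "c \<noteq> 0" "\<And>t. assoc_legendre n n t = c * sqrt (1 - t\<^sup>2) ^ n"
proof -
  define p where "p = ([:-1, 0, 1:] :: real poly) ^ n"
  have deg: "degree p = n + n" by (simp add: p_def degree_power_eq)
  have lc: "lead_coeff p = 1" unfolding p_def by (simp add: lead_coeff_power)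
  have "(pderiv ^^ n) (legendre_poly n) = smult (1 / (2 ^ n * fact n)) ((pderiv ^^ (n + n)) p)"
    unfolding legendre_poly_def p_def[symmetric] by (simp add: higher_pderiv_smult funpow_add)
  also have "\<dots> = smult (1 / (2 ^ n * fact n)) [: fact (n + n) :]"
    unfolding higher_pderiv_degree[OF deg] lc by simp
  finally have "assoc_legendre n n t = fact (n + n) / (2 ^ n * fact n) * sqrt (1 - t\<^sup>2) ^ n" for t
    by (simp add: assoc_legendre_def)
  then show ?thesis by (intro that[of "fact (n + n) / (2 ^ n * fact n)"]) auto
qed

definition wc :: "real^3 \<Rightarrow> complex" where
  "wc x = of_real (x $ 1) + \<i> * of_real (x $ 2)"

lemma norm_sq_3: "(norm x)\<^sup>2 = (x $ 1)\<^sup>2 + (x $ 2)\<^sup>2 + (x $ 3)\<^sup>2" for x :: "real^3"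
  unfolding power2_norm_eq_inner inner_vec_def sum_3 by (simp add: power2_eq_square)

text \<open>The sine of the polar angle is |wc x| / |x| and exp(i \<phi>) is the phase of
  \<open>wc x\<close>, so their n-th powers multiply to (wc x / |x|)^n. On the polar axis both sides
  vanish because n >= 1.\<close>

lemma sph_harm_top:
  assumes n: "n \<ge> 1"
  obtains K :: real where "K \<noteq> 0"
    "\<And>x. x \<noteq> 0 \<Longrightarrow> sph_harm n (int n) x = of_real K * wc x ^ n * of_real (1 / norm x ^ n)"
proof -
  obtain c where c: "c \<noteq> 0" "\<And>t. assoc_legendre n n t = c * sqrt (1 - t\<^sup>2) ^ n"
    using assoc_legendre_top[of n] by blast
  define K where "K = sph_harm_const n (int n) * c"
  have "sph_harm_const n (int n) \<noteq> 0" by (simp add: sph_harm_const_def)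
  then have K: "K \<noteq> 0" using c(1) by (simp add: K_def)
  have "sph_harm n (int n) x = of_real K * wc x ^ n * of_real (1 / norm x ^ n)" if x: "x \<noteq> 0" for x
  proof -
    have nx: "norm x > 0" using x by simp
    have "\<bar>x $ 3\<bar> \<le> norm x" by (rule component_le_norm_cart)
    then have "\<bar>x $ 3 / norm x\<bar> \<le> 1" using nx by (simp add: abs_divide)
    then have cosp: "cos (polar_angle x) = x $ 3 / norm x"
      unfolding polar_angle_def by (intro cos_arccos_abs)
    have wx: "Complex (x $ 1) (x $ 2) = wc x" by (simp add: wc_def complex_eq_iff)
    have cm: "(cmod (wc x))\<^sup>2 = (x $ 1)\<^sup>2 + (x $ 2)\<^sup>2"
      unfolding wx[symmetric] by (simp add: cmod_power2)
    have "1 - (x $ 3 / norm x)\<^sup>2 = (cmod (wc x) / norm x)\<^sup>2"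
    proof -
      have "1 - (x $ 3 / norm x)\<^sup>2 = ((norm x)\<^sup>2 - (x $ 3)\<^sup>2) / (norm x)\<^sup>2"
        using nx by (simp add: power_divide diff_divide_distrib)
      also have "(norm x)\<^sup>2 - (x $ 3)\<^sup>2 = (cmod (wc x))\<^sup>2" unfolding cm norm_sq_3 by simp
      finally show ?thesis by (simp add: power_divide)
    qed
    then have sq: "sqrt (1 - (x $ 3 / norm x)\<^sup>2) = cmod (wc x) / norm x"
      using nx by simp
    have ex: "exp (\<i> * of_int (int n) * of_real (azimuth x)) = cis (Arg (wc x)) ^ n"
      unfolding azimuth_def wx
      by (simp add: cis_conv_exp exp_of_nat_mult[symmetric] mult_ac)
    have pol: "of_real (cmod (wc x)) * cis (Arg (wc x)) = wc x"
      using rcis_cmod_Arg[of "wc x"] by (simp add: rcis_def)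
    have "sph_harm n (int n) x = of_real K * (of_real (cmod (wc x) / norm x)) ^ n * cis (Arg (wc x)) ^ n"
      unfolding sph_harm_def ex by (simp add: c(2) cosp sq K_def)
    also have "\<dots> = of_real K * (of_real (cmod (wc x)) * cis (Arg (wc x))) ^ n * of_real (1 / norm x ^ n)"
      by (simp add: power_mult_distrib power_divide)
    finally show ?thesis unfolding pol .
  qed
  with K that show ?thesis by blast
qed

lemma C2_on_wc: "C2_on UNIV wc"
  unfolding wc_def by (intro C2_on_add C2_on_mult C2_on_const C2_on_coord open_UNIV)

lemma differentiable_wc [simp]: "wc differentiable (at x)"
  using C1_on_differentiable[OF C2_on_C1[OF C2_on_wc]] by simp

lemma partial_wc: "partial j wc x = (if j = 1 then 1 else 0) + (if j = 2 then \<i> else 0)"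
proof -
  have "partial j (\<lambda>x. of_real (x $ 1) + \<i> * of_real (x $ 2)) x
      = (if j = 1 then 1 else 0) + (if j = 2 then \<i> else 0)"
    by (subst partial_add) (auto simp: partial_mult differentiable_mult)
  then show ?thesis by (simp add: wc_def[abs_def])
qed

text \<open>Radial profiles are taken as functions of |x|^2 rather than |x|, so that the origin is
  no exception.\<close>

lemma radial_function_derivative:
  fixes g :: "real \<Rightarrow> real"
  assumes "(g has_real_derivative g') (at ((norm x)\<^sup>2))"
  shows "(\<lambda>x::real^3. complex_of_real (g ((norm x)\<^sup>2))) differentiable (at x)"
    and "partial j (\<lambda>x::real^3. complex_of_real (g ((norm x)\<^sup>2))) x = of_real (2 * x $ j * g')"
proof -
  have 1: "((\<lambda>x::real^3. (norm x)\<^sup>2) has_derivative (\<lambda>h. 2 * (x \<bullet> h))) (at x)"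
    unfolding power2_norm_eq_inner by (auto intro!: derivative_eq_intros simp: inner_commute)
  have "(g has_derivative (*) g') (at ((norm x)\<^sup>2))"
    using assms unfolding has_field_derivative_def .
  from has_derivative_of_real[OF has_derivative_compose[OF 1 this]]
  have 2: "((\<lambda>x::real^3. complex_of_real (g ((norm x)\<^sup>2))) has_derivative (\<lambda>h. of_real (g' * (2 * (x \<bullet> h))))) (at x)" .
  then show "(\<lambda>x::real^3. complex_of_real (g ((norm x)\<^sup>2))) differentiable (at x)"
    using differentiable_def by blast
  show "partial j (\<lambda>x::real^3. complex_of_real (g ((norm x)\<^sup>2))) x = of_real (2 * x $ j * g')"
    unfolding partial_eqI[OF 2] by (simp add: inner_axis mult.commute)
qed

lemma C1_on_radial:
  fixes g :: "real \<Rightarrow> real"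
  assumes "\<And>s. (g has_real_derivative g' s) (at s)" "\<And>s. isCont g' s"
  shows "C1_on UNIV (\<lambda>x::real^3. complex_of_real (g ((norm x)\<^sup>2)))"
proof -
  have "partial j (\<lambda>x::real^3. complex_of_real (g ((norm x)\<^sup>2))) = (\<lambda>x. of_real (2 * x $ j * g' ((norm x)\<^sup>2)))" for j
    using radial_function_derivative(2)[OF assms(1)] by blast
  moreover have "continuous_on UNIV (\<lambda>x::real^3. g' ((norm x)\<^sup>2))"
  proof (rule continuous_on_compose2[of UNIV g'])
    show "continuous_on UNIV g'" using assms(2) continuous_at_imp_continuous_on by blast
  qed (auto intro: continuous_intros)
  ultimately show ?thesis
    unfolding C1_on_def using radial_function_derivative(1)[OF assms(1)]
    by (auto intro!: continuous_intros)
qed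

lemma C2_on_radial:
  fixes g :: "real \<Rightarrow> real"
  assumes g: "\<And>s. (g has_real_derivative g' s) (at s)" and g': "\<And>s. (g' has_real_derivative g'' s) (at s)"
    and g'': "\<And>s. isCont g'' s"
  shows "C2_on UNIV (\<lambda>x::real^3. complex_of_real (g ((norm x)\<^sup>2)))"
  unfolding C2_on_iff_C1
proof (intro conjI ballI allI)
  show "(\<lambda>x::real^3. complex_of_real (g ((norm x)\<^sup>2))) differentiable (at x)" for x
    by (rule radial_function_derivative(1)[OF g])
  have "partial j (\<lambda>x::real^3. complex_of_real (g ((norm x)\<^sup>2)))
      = (\<lambda>x. 2 * of_real (x $ j) * of_real (g' ((norm x)\<^sup>2)))" for j
    using radial_function_derivative(2)[OF g] by auto
  then show "C1_on UNIV (partial j (\<lambda>x::real^3. complex_of_real (g ((norm x)\<^sup>2))))" for j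
    by (simp, intro C1_on_mult C1_on_const C1_on_coord C1_on_radial[OF g' g''])
qed

text \<open>Near the unit sphere the extension constant along rays is K wc^n / |x|^n. The gradient
  of 1/|x|^n is radial and disappears in the cross product, leaving grad(wc^n) x v, which is n times
  the conjugate of \<open>Qv n\<close>.\<close>

lemma vsph_harm_T_top:
  assumes n: "n \<ge> 1"
  obtains K :: real where "K \<noteq> 0"
    "\<And>x. x \<noteq> 0 \<Longrightarrow> vsph_harm_T n (int n) x = of_real (K / norm x ^ n) *s cQv n x"
proof -
  obtain K where K: "K \<noteq> 0"
    "\<And>x. x \<noteq> 0 \<Longrightarrow> sph_harm n (int n) x = of_real K * wc x ^ n * of_real (1 / norm x ^ n)"
    using sph_harm_top[OF n] by blast
  have T: "ccross (sphere_grad (sph_harm n (int n)) v) (cvec v) = of_real (K * real n) *s cQv n v"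
    if v: "norm v = 1" for v
  proof -
    have v0: "v \<noteq> 0" using v by auto
    define \<rho> where "\<rho> x = complex_of_real (1 / norm x ^ n)" for x :: "real^3"
    have eq: "sph_harm n (int n) (x /\<^sub>R norm x) = of_real K * (wc x ^ n * \<rho> x)" if "x \<in> - {0}" for x
    proof -
      have nz: "x /\<^sub>R norm x \<noteq> 0" using that by simp
      have "wc (x /\<^sub>R norm x) = wc x / of_real (norm x)"
        by (simp add: wc_def divide_inverse algebra_simps)
      then show ?thesis unfolding K(2)[OF nz] using that by (simp add: \<rho>_def power_divide)
    qed
    have "((\<lambda>t::real. 1 / t ^ n) has_real_derivative - real n) (at (norm v))"
      unfolding v by (auto intro!: derivative_eq_intros)
    then have "((\<lambda>t::real. 1 / t ^ n) has_derivative (*) (- real n)) (at (norm v))"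
      unfolding has_field_derivative_def .
    from has_derivative_of_real[OF has_derivative_compose[OF has_derivative_norm[OF v0] this], where 'a = complex]
    have d\<rho>: "(\<rho> has_derivative (\<lambda>h. of_real (- real n * (v \<bullet> h)))) (at v)"
      unfolding \<rho>_def[abs_def] using v by (simp add: sgn_div_norm inner_commute)
    then have \<rho>diff: "\<rho> differentiable (at v)" using differentiable_def by blast
    have p\<rho>: "partial j \<rho> v = - of_nat n * of_real (v $ j)" for j
      unfolding partial_eqI[OF d\<rho>] by (simp add: inner_axis)
    have \<rho>v: "\<rho> v = 1" using v by (simp add: \<rho>_def)
    have g: "sphere_grad (sph_harm n (int n)) v $ j
        = of_real K * of_nat n * (wc v ^ (n - 1) * partial j wc v - wc v ^ n * of_real (v $ j))" for j
    proof -
      have "sphere_grad (sph_harm n (int n)) v $ j = partial j (\<lambda>x. of_real K * (wc x ^ n * \<rho> x)) v"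
        unfolding sphere_grad_def cgrad_def
        unfolding vec_lambda_beta by (rule partial_cong[where S = "- {0}"]) (use v0 eq in auto)
      also have "\<dots> = of_real K * (wc v ^ n * (- of_nat n * of_real (v $ j)) + (of_nat n * wc v ^ (n - 1) * partial j wc v) * \<rho> v)"
        by (simp add: partial_mult partial_power differentiable_mult differentiable_power \<rho>diff p\<rho>)
      finally show ?thesis by (simp add: \<rho>v algebra_simps)
    qed
    obtain m where m: "n = Suc m" using n by (cases n) auto
    have c: "cnj (wb v) = wc v" by (simp add: wb_def wc_def)
    have "\<forall>i. ccross (sphere_grad (sph_harm n (int n)) v) (cvec v) $ i = (of_real (K * real n) *s cQv n v) $ i"
      unfolding forall_3 ccross_nth g partial_wc
      by (simp add: cvec_def cQv_def Qv_nth c m) (simp add: wc_def algebra_simps)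
    then show ?thesis by (simp add: vec_eq_iff)
  qed
  have "vsph_harm_T n (int n) x = of_real (K * real n / norm x ^ n) *s cQv n x" if x: "x \<noteq> 0" for x
  proof -
    have "vsph_harm_T n (int n) x = of_real (K * real n) *s cQv n (x /\<^sub>R norm x)"
      unfolding vsph_harm_T_def using x by (intro T) simp
    then show ?thesis using x by (simp add: vec_eq_iff cQv_scale[OF n] field_simps)
  qed
  then show ?thesis using that[of "K * real n"] K(1) n by simp
qed

text \<open>The factor |x|^n of j_n cancels the denominator of T_n^n, so the wave is an entire
  radial function times a polynomial field; this shows its smoothness at the origin.\<close>

lemma incident_wave_eq:
  assumes n: "n \<ge> 1" and k: "k > 0"
  obtains c :: real where "c \<noteq> 0"
    "\<And>f x. incident_wave f n k x = (f * of_real (c * bessel_h n (k\<^sup>2 * (norm x)\<^sup>2))) *s cQv n x"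
proof -
  obtain K where K: "K \<noteq> 0"
    "\<And>x. x \<noteq> 0 \<Longrightarrow> vsph_harm_T n (int n) x = of_real (K / norm x ^ n) *s cQv n x"
    using vsph_harm_T_top[OF n] by blast
  define d where "d = (\<Prod>i\<le>n. 2 * real i + 1)"
  have d: "d > 0" unfolding d_def by (rule prod_pos) simp
  define c where "c = K * k ^ n / d"
  have "incident_wave f n k x = (f * of_real (c * bessel_h n (k\<^sup>2 * (norm x)\<^sup>2))) *s cQv n x" for f x
  proof (cases "x = 0")
    \<comment> \<open>At the origin both sides vanish, since j_n(0) = 0 and \<open>cQv n 0\<close> =
      0 for n >= 1.\<close>
    case True
    have "cQv n 0 $ i = 0" for i using cQv_scale[OF n, of 0 0 i] n by (simp add: power_0_left)
    then show ?thesis unfolding True using n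
      by (simp add: vec_eq_iff incident_wave_def sph_bessel_j_eq power_0_left)
  next
    case False
    then have "norm x \<noteq> 0" by simp
    then show ?thesis
      unfolding incident_wave_def sph_bessel_j_eq K(2)[OF False] d_def[symmetric] c_def
      using d by (intro vec_eq_iff[THEN iffD2] allI) (simp add: power_mult_distrib field_simps del: norm_eq_zero)
  qed
  moreover have "c \<noteq> 0" using K(1) k d by (simp add: c_def)
  ultimately show ?thesis using that by blast
qed

lemma C2_on_cQv: "C2_on UNIV (\<lambda>x. cQv n x $ i)"
  unfolding cQv_def by (simp, rule C2_on_linear_comp[OF open_UNIV bounded_linear_cnj C2_on_Qv])

lemma C2_on_bessel_radial: "C2_on UNIV (\<lambda>x::real^3. complex_of_real (bessel_h n (K * (norm x)\<^sup>2)))"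
proof (rule C2_on_radial[where g = "\<lambda>s. bessel_h n (K * s)" and g' = "\<lambda>s. bessel_h' n (K * s) * K"
      and g'' = "\<lambda>s. powser (diffs (diffs (bessel_coeff n))) (K * s) * K * K"])
  have arg: "((\<lambda>s. K * s) has_real_derivative K) (at s)" for s
    by (auto intro!: derivative_eq_intros)
  show "((\<lambda>s. bessel_h n (K * s)) has_real_derivative bessel_h' n (K * s) * K) (at s)" for s
    by (rule DERIV_chain2[OF bessel_h_deriv arg])
  show "((\<lambda>s. bessel_h' n (K * s) * K) has_real_derivative powser (diffs (diffs (bessel_coeff n))) (K * s) * K * K) (at s)" for s
    by (rule DERIV_cmult_right[OF DERIV_chain2[OF bessel_h'_deriv arg]])
  have "isCont (powser (diffs (diffs (bessel_coeff n)))) s" for s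
    using DERIV_isCont[OF powser_deriv[OF fact_bounded_diffs[OF fact_bounded_diffs[OF fact_bounded_bessel]]]] .
  then have "isCont (\<lambda>s. powser (diffs (diffs (bessel_coeff n))) (K * s)) s" for s
    by (rule isCont_o2[rotated]) (intro continuous_intros)
  then show "isCont (\<lambda>s. powser (diffs (diffs (bessel_coeff n))) (K * s) * K * K) s" for s
    by (intro continuous_intros)
qed

text \<open>The incident wave with the constants of j_n and T_n^n absorbed into the amplitude f,
  which cancels in the ratios of the theorem.\<close>

definition regular_wave :: "complex \<Rightarrow> nat \<Rightarrow> real \<Rightarrow> cfield" where
  "regular_wave f n k x = (f * of_real (bessel_h n (k\<^sup>2 * (norm x)\<^sup>2))) *s cQv n x"

lemma C2_on_regular_wave: "C2_on UNIV (\<lambda>x. regular_wave f n k x $ i)"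
  unfolding regular_wave_def
  by (simp, intro C2_on_mult C2_on_const C2_on_bessel_radial C2_on_cQv open_UNIV)

definition Qnorm :: "nat \<Rightarrow> real" where
  "Qnorm n = (\<integral>v. (norm (Qv n v))\<^sup>2 \<partial>sphere_measure)"

lemma norm_sq_complex_vec: "complex_of_real ((norm u)\<^sup>2) = (\<Sum>i\<in>UNIV. u $ i * cnj (u $ i))" for u :: "complex^3"
proof -
  have "(norm u)\<^sup>2 = (\<Sum>i\<in>UNIV. (norm (u $ i))\<^sup>2)"
    by (simp add: norm_vec_def L2_set_def sum_nonneg)
  then show ?thesis by (simp only: of_real_sum complex_norm_square)
qed

lemma continuous_Qv_vec: "continuous_on S (Qv n)"
proof -
  have "continuous_on S (\<lambda>v. \<chi> i. Qv n v $ i)"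
    by (intro continuous_on_vec_lambda continuous_Qv)
  then show ?thesis by simp
qed

lemma proj_regular_wave:
  assumes n: "n \<ge> 1" and r: "r > 0"
  shows "proj n (regular_wave f n k) r = f * of_real (Qnorm n) * of_real (regular_sol n (k\<^sup>2) r)"
proof -
  have ic: "continuous_on (sphere 0 1) (\<lambda>v. Qv n v $ i * cnj (Qv n v $ i))" for i
    by (intro continuous_intros continuous_Qv)
  have "ip (\<lambda>x. regular_wave f n k x $ i) (\<lambda>v. Qv n v $ i) r
      = f * of_real (regular_sol n (k\<^sup>2) r) * (\<integral>v. Qv n v $ i * cnj (Qv n v $ i) \<partial>sphere_measure)" for i
    unfolding ip_def integral_mult_right_zero[symmetric]
    using r by (intro Bochner_Integration.integral_cong)
      (auto simp: regular_wave_def cQv_scale[OF n] Qv_scale[OF n] regular_sol_def cQv_def mult_ac)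
  then have "proj n (regular_wave f n k) r = f * of_real (regular_sol n (k\<^sup>2) r) *
      (\<Sum>i\<in>UNIV. \<integral>v. Qv n v $ i * cnj (Qv n v $ i) \<partial>sphere_measure)"
    by (simp add: proj_def sum_distrib_left)
  also have "(\<Sum>i\<in>UNIV. \<integral>v. Qv n v $ i * cnj (Qv n v $ i) \<partial>sphere_measure)
      = (\<integral>v. of_real ((norm (Qv n v))\<^sup>2) \<partial>sphere_measure)"
    unfolding norm_sq_complex_vec
    by (rule Bochner_Integration.integral_sum[symmetric]) (intro integrable_sphere_continuous ic)
  also have "\<dots> = of_real (Qnorm n)" unfolding Qnorm_def by (rule integral_complex_of_real)
  finally show ?thesis by (simp add: mult_ac)
qed

section \<open>Projection of the scattering problem\<close>

text \<open>At every point of the compact set \<open>closure S \<inter> cball 0 R\<close> the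
  function has a limit along S and hence a local bound; finitely many of these neighbourhoods cover
  the set. This turns the pointwise boundary limits in \<open>classical_on\<close> into the uniform
  bounds that dominated convergence needs.\<close>

lemma bounded_by_boundary_limits:
  fixes f :: "'a::euclidean_space \<Rightarrow> 'b::real_normed_vector"
  assumes S: "open S" and f: "continuous_on S f"
    and lim: "\<And>y. y \<in> frontier S \<Longrightarrow> \<exists>l. (f \<longlongrightarrow> l) (at y within S)"
  obtains B where "\<And>x. x \<in> S \<Longrightarrow> norm x \<le> R \<Longrightarrow> norm (f x) \<le> B"
proof -
  let ?C = "closure S \<inter> cball 0 R"
  have "\<exists>U M. open U \<and> y \<in> U \<and> (\<forall>x\<in>U \<inter> S. norm (f x) \<le> M)" if y: "y \<in> ?C" for y
  proof -
    have "\<exists>l. (f \<longlongrightarrow> l) (at y within S)"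
    proof (cases "y \<in> S")
      case True
      then show ?thesis using f continuous_on_def by blast
    next
      case False
      then have "y \<in> frontier S" using y S by (simp add: frontier_def interior_open)
      then show ?thesis by (rule lim)
    qed
    then obtain l where l: "(f \<longlongrightarrow> l) (at y within S)" by blast
    have "eventually (\<lambda>x. dist (f x) l < 1) (at y within S)" using tendstoD[OF l, of 1] by simp
    then obtain U where U: "open U" "y \<in> U" "\<And>x. x \<in> U \<Longrightarrow> x \<noteq> y \<Longrightarrow> x \<in> S \<Longrightarrow> dist (f x) l < 1"
      unfolding eventually_at_topological by blast
    \<comment> \<open>The limit says nothing about the value at y itself, so \<open>f y\<close>
      joins the bound.\<close>
    have "norm (f x) \<le> max (norm l + 1) (norm (f y))" if "x \<in> U \<inter> S" for x
    proof (cases "x = y")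
      case False
      then have "dist (f x) l < 1" using U(3) that by blast
      then have "norm (f x) \<le> norm l + 1"
        using norm_triangle_ineq2[of "f x" l] by (simp add: dist_norm)
      then show ?thesis by simp
    qed simp
    then show ?thesis using U by blast
  qed
  then obtain U M where U: "\<And>y. y \<in> ?C \<Longrightarrow> open (U y) \<and> y \<in> U y \<and> (\<forall>x\<in>U y \<inter> S. norm (f x) \<le> M y)"
    by metis
  have "compact ?C" by (simp add: closed_Int_compact)
  then obtain C' where C': "C' \<subseteq> ?C" "finite C'" "?C \<subseteq> (\<Union>c\<in>C'. U c)"
    by (rule compactE_image[of ?C ?C U]) (use U in auto)
  show ?thesis
  proof (rule that[of "\<Sum>c\<in>C'. \<bar>M c\<bar>"])
    fix x assume x: "x \<in> S" "norm x \<le> R"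
    then have "x \<in> ?C" using closure_subset by auto
    then obtain c where c: "c \<in> C'" "x \<in> U c" using C'(3) by blast
    then have "norm (f x) \<le> M c" using U[of c] C'(1) x by blast
    also have "\<dots> \<le> \<bar>M c\<bar>" by simp
    also have "\<dots> \<le> (\<Sum>c\<in>C'. \<bar>M c\<bar>)" using c C'(2) by (intro member_le_sum) auto
    finally show "norm (f x) \<le> (\<Sum>c\<in>C'. \<bar>M c\<bar>)" .
  qed
qed

text \<open>The boundary limits are known in each direction v separately; a uniform bound takes the
  place of uniform convergence.\<close>

lemma sphere_integral_tendsto:
  fixes G :: "real \<Rightarrow> real^3 \<Rightarrow> complex"
  assumes G: "\<And>r. r \<in> J \<Longrightarrow> continuous_on (sphere 0 1) (G r)"
    and B: "\<And>r v. r \<in> J \<Longrightarrow> norm v = 1 \<Longrightarrow> norm (G r v) \<le> B"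
    and l: "\<And>v. norm v = 1 \<Longrightarrow> ((\<lambda>r. G r v) \<longlongrightarrow> l v) (at a within J)"
  shows "((\<lambda>r. \<integral>v. G r v \<partial>sphere_measure) \<longlongrightarrow> (\<integral>v. l v \<partial>sphere_measure)) (at a within J)"
  unfolding tendsto_at_iff_sequentially
proof (intro allI impI)
  fix X assume X: "\<forall>i. X i \<in> J - {a}" "X \<longlonglongrightarrow> a"
  have lim: "(\<lambda>i. G (X i) v) \<longlonglongrightarrow> l v" if "norm v = 1" for v
    using l[OF that] X unfolding tendsto_at_iff_sequentially by (force simp: o_def)
  have meas: "G (X i) \<in> borel_measurable sphere_measure" for i
    using X(1) by (intro continuous_on_sphere_measurable G) auto
  have "(\<lambda>i. \<integral>v. G (X i) v \<partial>sphere_measure) \<longlonglongrightarrow> (\<integral>v. l v \<partial>sphere_measure)"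
  proof (rule integral_dominated_convergence[where w = "\<lambda>_. B"])
    show "l \<in> borel_measurable sphere_measure"
      by (rule borel_measurable_LIMSEQ_metric[OF meas]) (use lim in simp)
    show "AE v in sphere_measure. (\<lambda>i. G (X i) v) \<longlonglongrightarrow> l v" using lim by (intro AE_I2) simp
    show "AE v in sphere_measure. norm (G (X i) v) \<le> B" for i using B X(1) by (intro AE_I2) auto
  qed (use meas in auto)
  then show "((\<lambda>r. \<integral>v. G r v \<partial>sphere_measure) \<circ> X) \<longlonglongrightarrow> (\<integral>v. l v \<partial>sphere_measure)"
    by (simp add: o_def)
qed

text \<open>Since 1 is outside J, the point r v never equals v, and the punctured limit at v
  applies.\<close>

lemma radial_tendsto:
  assumes f: "(f \<longlongrightarrow> l) (at v within S)" and v: "norm v = 1"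
    and J: "\<And>r. r \<in> J \<Longrightarrow> r *\<^sub>R v \<in> S" "1 \<notin> J"
  shows "((\<lambda>r. f (r *\<^sub>R v)) \<longlongrightarrow> l) (at 1 within J)"
proof (rule filterlim_compose[OF f])
  have "((\<lambda>r. r *\<^sub>R v) \<longlongrightarrow> 1 *\<^sub>R v) (at 1 within J)" by (intro tendsto_intros)
  moreover have "eventually (\<lambda>r. r *\<^sub>R v \<in> S \<and> r *\<^sub>R v \<noteq> v) (at 1 within J)"
    unfolding eventually_at_topological
  proof (intro exI[of _ UNIV] conjI ballI impI)
    fix r assume "r \<in> J"
    then show "r *\<^sub>R v \<in> S" using J by blast
    have "r \<noteq> 1" "v \<noteq> 0" using J(2) \<open>r \<in> J\<close> v by auto
    then show "r *\<^sub>R v \<noteq> v" by (metis scaleR_cancel_right scaleR_one)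
  qed auto
  ultimately show "filterlim (\<lambda>r. r *\<^sub>R v) (at v within S) (at 1 within J)"
    unfolding filterlim_at by simp
qed

text \<open>The grad div term projects to 0, so c / mu, the squared shear wave number, is the only
  parameter left.\<close>

lemma pde_radial_solution:
  assumes n: "n \<ge> 1" and I: "open I" "\<And>r. r \<in> I \<Longrightarrow> r > 0"
    and u: "\<And>i. C2_on (shell I) (\<lambda>x. u x $ i)" and mu: "mu \<noteq> 0"
    and pde: "\<And>x. x \<in> shell I \<Longrightarrow> lame_op lam mu u x + c *\<^sub>R u x = 0"
  shows "radial_solution n (c / mu) I (proj n u) (proj' n u)"
  unfolding radial_solution_def
proof (intro ballI conjI)
  fix r assume rI: "r \<in> I"
  then have r: "r > 0" by (rule I(2))
  have u1: "C1_on (shell I) (\<lambda>x. u x $ i)" for i using C2_on_C1[OF u] .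
  show "(proj n u has_vector_derivative proj' n u r) (at r)"
    by (rule proj_deriv[OF I(1) u1 r rI])
  obtain d where d: "(proj' n u has_vector_derivative d) (at r)"
    "(of_real r)\<^sup>2 * (\<Sum>i\<in>UNIV. ip (\<lambda>x. laplacian u x $ i) (\<lambda>v. Qv n v $ i) r)
      = (of_real r)\<^sup>2 * d + 2 * of_real r * proj' n u r - of_nat (n * (n + 1)) * proj n u r"
    using proj'_deriv[OF n I(1) u r rI] by blast
  have cdiv: "continuous_on (shell I) (partial i (divg u))" for i
    by (intro C1_on_continuous_partial C1_on_divg u)
  have "ip (\<lambda>x. laplacian u x $ i) (\<lambda>v. Qv n v $ i) r
      = - of_real (c / mu) * ip (\<lambda>x. u x $ i) (\<lambda>v. Qv n v $ i) r
        - of_real ((lam + mu) / mu) * ip (partial i (divg u)) (\<lambda>v. Qv n v $ i) r" for i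
  proof -
    have "ip (\<lambda>x. laplacian u x $ i) (\<lambda>v. Qv n v $ i) r
      = ip (\<lambda>x. - of_real (c / mu) * u x $ i - of_real ((lam + mu) / mu) * partial i (divg u) x) (\<lambda>v. Qv n v $ i) r"
    proof (rule ip_cong)
      fix v :: "real^3" assume v: "norm v = 1"
      then have "r *\<^sub>R v \<in> shell I" using scale_sphere_shell[OF r rI] by simp
      from pde[OF this] have "of_real mu * laplacian u (r *\<^sub>R v) $ i
          + of_real (lam + mu) * partial i (divg u) (r *\<^sub>R v) + of_real c * u (r *\<^sub>R v) $ i = 0"
        by (auto simp: lame_op_def vec_eq_iff cgrad_def scaleR_conv_of_real[where 'a = complex])
      then have "laplacian u (r *\<^sub>R v) $ i
          = - of_real (c / mu) * u (r *\<^sub>R v) $ i - of_real ((lam + mu) / mu) * partial i (divg u) (r *\<^sub>R v)"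
        using mu by (simp add: field_simps eq_neg_iff_add_eq_0)
      then show "laplacian u (r *\<^sub>R v) $ i * Qv n v $ i
          = (- of_real (c / mu) * u (r *\<^sub>R v) $ i - of_real ((lam + mu) / mu) * partial i (divg u) (r *\<^sub>R v)) * Qv n v $ i"
        by simp
    qed
    also have "\<dots> = ip (\<lambda>x. - of_real (c / mu) * u x $ i) (\<lambda>v. Qv n v $ i) r
        - ip (\<lambda>x. of_real ((lam + mu) / mu) * partial i (divg u) x) (\<lambda>v. Qv n v $ i) r"
      by (intro ip_diff[OF _ _ continuous_Qv r rI] continuous_on_mult continuous_on_const
          C1_on_continuous[OF u1] cdiv)
    finally show ?thesis by (simp only: ip_cmult)
  qed
  then have "(\<Sum>i\<in>UNIV. ip (\<lambda>x. laplacian u x $ i) (\<lambda>v. Qv n v $ i) r)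
      = - of_real (c / mu) * proj n u r - of_real ((lam + mu) / mu) * (\<Sum>i\<in>UNIV. ip (partial i (divg u)) (\<lambda>v. Qv n v $ i) r)"
    by (simp add: proj_def sum_subtractf sum_distrib_left sum_negf)
  also have "\<dots> = - of_real (c / mu) * proj n u r"
    by (simp add: proj_gradient[OF n C1_on_divg[OF u] r rI])
  finally have L: "(\<Sum>i\<in>UNIV. ip (\<lambda>x. laplacian u x $ i) (\<lambda>v. Qv n v $ i) r) = - of_real (c / mu) * proj n u r" .
  have "(of_real r)\<^sup>2 * d = (of_nat (n * (n + 1)) - of_real (c / mu * r\<^sup>2)) * proj n u r - 2 * of_real r * proj' n u r"
    using d(2) unfolding L by (simp add: algebra_simps)
  with d(1) show "\<exists>d. (proj' n u has_vector_derivative d) (at r) \<and> (of_real r)\<^sup>2 * d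
      = (of_nat (n * (n + 1)) - of_real (c / mu * r\<^sup>2)) * proj n u r - 2 * of_real r * proj' n u r" by blast
qed

text \<open>Recovers the projected Laplacian from the radial equation. It serves the scattered
  field, whose radial equation arises as the difference of those of the total and the incident
  field.\<close>

lemma radial_solution_laplacian:
  assumes n: "n \<ge> 1" and I: "open I" "r \<in> I" "r > 0"
    and u: "\<And>i. C2_on (shell I) (\<lambda>x. u x $ i)"
    and sol: "radial_solution n K I (proj n u) (proj' n u)"
  shows "(\<Sum>i\<in>UNIV. ip (\<lambda>x. laplacian u x $ i) (\<lambda>v. Qv n v $ i) r) = - of_real K * proj n u r"
proof -
  obtain d where d: "(proj' n u has_vector_derivative d) (at r)"
    "(of_real r)\<^sup>2 * (\<Sum>i\<in>UNIV. ip (\<lambda>x. laplacian u x $ i) (\<lambda>v. Qv n v $ i) r)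
      = (of_real r)\<^sup>2 * d + 2 * of_real r * proj' n u r - of_nat (n * (n + 1)) * proj n u r"
    using proj'_deriv[OF n I(1) u I(3,2)] by blast
  obtain e where e: "(proj' n u has_vector_derivative e) (at r)"
    "(of_real r)\<^sup>2 * e = (of_nat (n * (n + 1)) - of_real (K * r\<^sup>2)) * proj n u r - 2 * of_real r * proj' n u r"
    using sol I(2) unfolding radial_solution_def by blast
  have "d = e" using vector_derivative_unique_at[OF d(1) e(1)] .
  have "(of_real r)\<^sup>2 * (\<Sum>i\<in>UNIV. ip (\<lambda>x. laplacian u x $ i) (\<lambda>v. Qv n v $ i) r)
      = (of_real r)\<^sup>2 * (- of_real K * proj n u r)"
    unfolding d(2) \<open>d = e\<close> e(2) by (simp add: algebra_simps)
  moreover have "(complex_of_real r)\<^sup>2 \<noteq> 0" using I(3) by simp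
  ultimately show ?thesis using mult_left_cancel by blast
qed

lemma radial_solution_cong:
  assumes I: "open I" and sol: "radial_solution n K I a a'"
    and eq: "\<And>r. r \<in> I \<Longrightarrow> a r = b r" "\<And>r. r \<in> I \<Longrightarrow> a' r = b' r"
  shows "radial_solution n K I b b'"
  unfolding radial_solution_def
proof (intro ballI conjI)
  fix r assume r: "r \<in> I"
  obtain d where d: "(a has_vector_derivative a' r) (at r)" "(a' has_vector_derivative d) (at r)"
    "(of_real r)\<^sup>2 * d = (of_nat (n * (n + 1)) - of_real (K * r\<^sup>2)) * a r - 2 * of_real r * a' r"
    using sol r unfolding radial_solution_def by blast
  show "(b has_vector_derivative b' r) (at r)"
    using has_vector_derivative_transform_within_open[OF d(1) I r eq(1)] eq(2)[OF r] by simp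
  have "(b' has_vector_derivative d) (at r)"
    using has_vector_derivative_transform_within_open[OF d(2) I r eq(2)] .
  then show "\<exists>d. (b' has_vector_derivative d) (at r) \<and>
      (of_real r)\<^sup>2 * d = (of_nat (n * (n + 1)) - of_real (K * r\<^sup>2)) * b r - 2 * of_real r * b' r"
    using d(3) unfolding eq(1)[OF r] eq(2)[OF r] by blast
qed

lemma proj_diff:
  assumes u: "\<And>i. C1_on (shell I) (\<lambda>x. u x $ i)" and w: "\<And>i. C1_on (shell I) (\<lambda>x. w x $ i)"
    and r: "r > 0" "r \<in> I"
  shows "proj n (\<lambda>x. u x - w x) r = proj n u r - proj n w r"
    and "proj' n (\<lambda>x. u x - w x) r = proj' n u r - proj' n w r"
proof -
  have "ip (\<lambda>x. (u x - w x) $ i) (\<lambda>v. Qv n v $ i) r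
      = ip (\<lambda>x. u x $ i) (\<lambda>v. Qv n v $ i) r - ip (\<lambda>x. w x $ i) (\<lambda>v. Qv n v $ i) r" for i
    by (simp, rule ip_diff[OF C1_on_continuous[OF u] C1_on_continuous[OF w] continuous_Qv r])
  then show "proj n (\<lambda>x. u x - w x) r = proj n u r - proj n w r"
    by (simp add: proj_def sum_subtractf)
  have "ip (euler (\<lambda>x. (u x - w x) $ i)) (\<lambda>v. Qv n v $ i) r
      = ip (euler (\<lambda>x. u x $ i)) (\<lambda>v. Qv n v $ i) r - ip (euler (\<lambda>x. w x $ i)) (\<lambda>v. Qv n v $ i) r" for i
  proof -
    have "ip (euler (\<lambda>x. (u x - w x) $ i)) (\<lambda>v. Qv n v $ i) r
        = ip (\<lambda>x. euler (\<lambda>x. u x $ i) x - euler (\<lambda>x. w x $ i) x) (\<lambda>v. Qv n v $ i) r"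
    proof (rule ip_cong)
      fix v :: "real^3" assume "norm v = 1"
      then have x: "r *\<^sub>R v \<in> shell I" using scale_sphere_shell[OF r] by simp
      have pd: "partial j (\<lambda>x. u x $ i - w x $ i) (r *\<^sub>R v)
          = partial j (\<lambda>x. u x $ i) (r *\<^sub>R v) - partial j (\<lambda>x. w x $ i) (r *\<^sub>R v)" for j
        by (rule partial_diff[OF C1_on_differentiable[OF u x] C1_on_differentiable[OF w x]])
      show "euler (\<lambda>x. (u x - w x) $ i) (r *\<^sub>R v) * Qv n v $ i
          = (euler (\<lambda>x. u x $ i) (r *\<^sub>R v) - euler (\<lambda>x. w x $ i) (r *\<^sub>R v)) * Qv n v $ i"
        unfolding euler_def vector_minus_component pd by (simp add: sum_subtractf algebra_simps)
    qed
    also have "\<dots> = ip (euler (\<lambda>x. u x $ i)) (\<lambda>v. Qv n v $ i) r - ip (euler (\<lambda>x. w x $ i)) (\<lambda>v. Qv n v $ i) r"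
      by (rule ip_diff[OF euler_continuous[OF u] euler_continuous[OF w] continuous_Qv r])
    finally show ?thesis .
  qed
  then show "proj' n (\<lambda>x. u x - w x) r = proj' n u r - proj' n w r"
    by (simp add: proj'_def sum_subtractf diff_divide_distrib)
qed

text \<open>By uniqueness of derivatives from the formula for \<open>proj\<close>, without
  differentiating the wave in space.\<close>

lemma proj'_regular_wave:
  assumes n: "n \<ge> 1" and r: "r > 0"
  shows "proj' n (regular_wave f n k) r = f * of_real (Qnorm n) * of_real (regular_sol' n (k\<^sup>2) r)"
proof -
  have C1: "C1_on (shell {0<..}) (\<lambda>x. regular_wave f n k x $ i)" for i
    using C1_on_subset[OF C2_on_C1[OF C2_on_regular_wave]] by simp
  have "(proj n (regular_wave f n k) has_vector_derivative proj' n (regular_wave f n k) r) (at r)"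
    by (rule proj_deriv[OF _ C1]) (use r in auto)
  moreover have sol: "radial_solution n (k\<^sup>2) {0<..} (\<lambda>r. f * of_real (Qnorm n) * of_real (regular_sol n (k\<^sup>2) r))
      (\<lambda>r. f * of_real (Qnorm n) * of_real (regular_sol' n (k\<^sup>2) r))"
    by (intro radial_solution_cmult regular_solution) simp
  have "(proj n (regular_wave f n k) has_vector_derivative
      f * of_real (Qnorm n) * of_real (regular_sol' n (k\<^sup>2) r)) (at r)"
  proof (rule has_vector_derivative_transform_within_open[where S = "{0<..}"])
    show "((\<lambda>r. f * of_real (Qnorm n) * of_real (regular_sol n (k\<^sup>2) r)) has_vector_derivative
      f * of_real (Qnorm n) * of_real (regular_sol' n (k\<^sup>2) r)) (at r)"
      using sol r unfolding radial_solution_def by simp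
  qed (use r proj_regular_wave[OF n] in auto)
  ultimately show ?thesis using vector_derivative_unique_at by blast
qed

lemma regular_wave_radial_solution:
  assumes n: "n \<ge> 1" and I: "open I" "\<And>r. r \<in> I \<Longrightarrow> r > 0"
  shows "radial_solution n (k\<^sup>2) I (proj n (regular_wave f n k)) (proj' n (regular_wave f n k))"
  by (rule radial_solution_cong[OF I(1) radial_solution_cmult[OF regular_solution[OF I(2)], where c = "f * of_real (Qnorm n)"]])
    (simp_all add: proj_regular_wave[OF n I(2)] proj'_regular_wave[OF n I(2)])

lemma sphere_integral_bound:
  fixes f :: "real^3 \<Rightarrow> complex"
  assumes "\<And>v. norm v = 1 \<Longrightarrow> norm (f v) \<le> B" "B \<ge> 0"
  shows "norm (\<integral>v. f v \<partial>sphere_measure) \<le> B * measure sphere_measure (space sphere_measure)"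
proof (cases "integrable sphere_measure f")
  case True
  have "norm (\<integral>v. f v \<partial>sphere_measure) \<le> (\<integral>v. norm (f v) \<partial>sphere_measure)" by simp
  also have "\<dots> \<le> (\<integral>v. B \<partial>sphere_measure)"
    using True assms by (intro integral_mono) auto
  finally show ?thesis by (simp add: mult.commute)
next
  \<comment> \<open>The Bochner integral of a non-integrable function is 0 by convention.\<close>
  case False
  then show ?thesis using assms(2) by (simp add: not_integrable_integral_eq)
qed

lemma sum_mult_bound:
  fixes a :: "complex^3"
  assumes "\<And>i. norm (b i) \<le> M"
  shows "norm (\<Sum>i\<in>UNIV. a $ i * b i) \<le> 3 * (norm a * M)"
proof -
  have "norm (\<Sum>i\<in>UNIV. a $ i * b i) \<le> (\<Sum>i\<in>(UNIV::3 set). norm a * M)"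
    by (rule sum_norm_le)
      (auto simp: norm_mult intro!: mult_mono assms component_le_norm_cart[THEN order_trans[OF _ order_refl]] Finite_Cartesian_Product.norm_nth_le)
  then show ?thesis by simp
qed

text \<open>Integrals of the radiation defect against bounded test fields are O(r^(-2)). The radial
  test gives a with the factor k n / r, hence a = O(1/r); the tangential test gives -i k times the
  Sommerfeld defect of a.\<close>

lemma radiating_proj_bounds:
  assumes n: "n \<ge> 1" and k: "k > 0"
    and u: "\<And>i. C2_on (shell {1<..}) (\<lambda>x. u x $ i)"
    and sol: "radial_solution n (k\<^sup>2) {1<..} (proj n u) (proj' n u)"
    and rad: "radiating kp k u"
  obtains C R0 where "\<And>r. r \<ge> R0 \<Longrightarrow> norm (proj n u r) \<le> C / r"
    "\<And>r. r \<ge> R0 \<Longrightarrow> norm (proj' n u r + proj n u r / of_real r - \<i> * of_real k * proj n u r) \<le> C / r\<^sup>2"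
proof -
  have "(\<lambda>x. norm (radiation_defect k u x)) \<in> O[at_infinity](\<lambda>x. 1 / (norm x)\<^sup>2)"
    using rad unfolding radiating_def radiation_defect_def by blast
  then obtain c where c: "c > 0"
    "eventually (\<lambda>x. norm (norm (radiation_defect k u x)) \<le> c * norm (1 / (norm x)\<^sup>2)) at_infinity"
    by (rule landau_o.bigE)
  from c(2) obtain b where b: "\<And>x. norm x \<ge> b \<Longrightarrow> norm (radiation_defect k u x) \<le> c / (norm x)\<^sup>2"
    unfolding eventually_at_infinity by auto
  define R0 where "R0 = max b 2"
  define \<Sigma> where "\<Sigma> = measure sphere_measure (space sphere_measure)"
  have \<Sigma>: "\<Sigma> \<ge> 0" by (simp add: \<Sigma>_def)
  have df: "norm (radiation_defect k u (r *\<^sub>R v)) \<le> c / r\<^sup>2" if "r \<ge> R0" "norm v = 1" for r v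
    using b[of "r *\<^sub>R v"] that by (simp add: R0_def)
  have bounded: "\<exists>M. \<forall>v. norm v = 1 \<longrightarrow> norm (g v) \<le> M" if "continuous_on (sphere 0 1) g" for g :: "real^3 \<Rightarrow> complex"
  proof -
    have "bounded (g ` sphere 0 1)"
      by (intro compact_imp_bounded compact_continuous_image that) simp
    then show ?thesis unfolding bounded_iff by (force simp: sphere_def dist_norm)
  qed
  have "continuous_on (sphere 0 1) (\<lambda>v. wb v ^ n)" by (rule C1_on_continuous[OF C1_on_wb_power])
  from bounded[OF this] obtain M1 where M1: "\<And>v. norm v = 1 \<Longrightarrow> norm (wb v ^ n) \<le> M1" by blast
  have "\<exists>M. \<forall>v. norm v = 1 \<longrightarrow> norm (ccross (cvec v) (Qv n v) $ i) \<le> M" for i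
  proof (rule bounded)
    have "\<forall>i. continuous_on (sphere 0 1) (\<lambda>v. ccross (cvec v) (Qv n v) $ i)"
      unfolding forall_3 ccross_nth cvec_def
      by (simp, intro conjI continuous_on_diff continuous_on_mult continuous_Qv C1_on_continuous[OF C1_on_coord])
    then show "continuous_on (sphere 0 1) (\<lambda>v. ccross (cvec v) (Qv n v) $ i)" by blast
  qed
  then obtain m where m: "\<And>i v. norm v = 1 \<Longrightarrow> norm (ccross (cvec v) (Qv n v) $ i) \<le> m i" by metis
  define M2 where "M2 = (\<Sum>i\<in>UNIV. \<bar>m i\<bar>)"
  have M2: "norm (ccross (cvec v) (Qv n v) $ i) \<le> M2" if "norm v = 1" for v i
  proof -
    have "m i \<le> \<bar>m i\<bar>" by simp
    also have "\<dots> \<le> M2" unfolding M2_def by (rule member_le_sum) auto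
    finally show ?thesis using m[OF that, of i] by linarith
  qed
  obtain v0 :: "real^3" where v0: "norm v0 = 1" using norm_axis_1 by blast
  have M0: "M1 \<ge> 0" "M2 \<ge> 0"
    using order_trans[OF norm_ge_zero M1[OF v0]] order_trans[OF norm_ge_zero M2[OF v0]] by auto
  have A: "norm (proj n u r) \<le> (3 * c * M1 * \<Sigma> / k) / r" if r: "r \<ge> R0" for r
  proof -
    have r1: "r > 1" using r by (simp add: R0_def)
    let ?f = "\<lambda>v. (\<Sum>i\<in>UNIV. radiation_defect k u (r *\<^sub>R v) $ i * of_real (v $ i)) * wb v ^ n"
    have "norm (\<integral>v. ?f v \<partial>sphere_measure) \<le> (3 * (c / r\<^sup>2 * 1) * M1) * \<Sigma>"
      unfolding \<Sigma>_def
    proof (rule sphere_integral_bound)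
      fix v :: "real^3" assume v: "norm v = 1"
      have "norm (complex_of_real (v $ i)) \<le> 1" for i
        using component_le_norm_cart[of v i] v by simp
      from sum_mult_bound[of "\<lambda>i. complex_of_real (v $ i)" 1 "radiation_defect k u (r *\<^sub>R v)", OF this]
      have "norm (\<Sum>i\<in>UNIV. radiation_defect k u (r *\<^sub>R v) $ i * of_real (v $ i)) \<le> 3 * (c / r\<^sup>2 * 1)"
        using df[OF r v] by simp
      then show "norm (?f v) \<le> 3 * (c / r\<^sup>2 * 1) * M1"
        unfolding norm_mult using M1[OF v] c(1) by (intro mult_mono) auto
    qed (use c(1) M0 in auto)
    moreover have "norm (\<integral>v. ?f v \<partial>sphere_measure) = k * real n * norm (proj n u r) / r"
      using proj_defect_radial[OF n u, of r k] r1 k by (simp add: norm_mult norm_divide)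
    ultimately have "k * real n * norm (proj n u r) / r \<le> 3 * c * M1 * \<Sigma> / r\<^sup>2" by simp
    then have "k * real n * norm (proj n u r) \<le> 3 * c * M1 * \<Sigma> / r"
      using r1 by (simp add: field_simps power2_eq_square)
    moreover have "k * norm (proj n u r) \<le> k * real n * norm (proj n u r)"
      using n k by (simp add: mult_right_mono mult_le_cancel_left)
    ultimately have "k * norm (proj n u r) \<le> 3 * c * M1 * \<Sigma> / r" by linarith
    then show ?thesis using k r1 by (simp add: field_simps)
  qed
  have B: "norm (proj' n u r + proj n u r / of_real r - \<i> * of_real k * proj n u r)
      \<le> (3 * c * M2 * \<Sigma> / k) / r\<^sup>2" if r: "r \<ge> R0" for r
  proof -
    have r1: "r > 1" using r by (simp add: R0_def)
    let ?f = "\<lambda>v. \<Sum>i\<in>UNIV. radiation_defect k u (r *\<^sub>R v) $ i * ccross (cvec v) (Qv n v) $ i"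
    have "norm (\<integral>v. ?f v \<partial>sphere_measure) \<le> (3 * (c / r\<^sup>2 * M2)) * \<Sigma>"
      unfolding \<Sigma>_def
    proof (rule sphere_integral_bound)
      fix v :: "real^3" assume v: "norm v = 1"
      have "norm (?f v) \<le> 3 * (norm (radiation_defect k u (r *\<^sub>R v)) * M2)"
        by (rule sum_mult_bound[OF M2[OF v]])
      also have "\<dots> \<le> 3 * (c / r\<^sup>2 * M2)" using df[OF r v] M0 by (intro mult_left_mono mult_right_mono) auto
      finally show "norm (?f v) \<le> 3 * (c / r\<^sup>2 * M2)" .
    qed (use c(1) M0 in auto)
    moreover have "(\<integral>v. ?f v \<partial>sphere_measure)
        = - \<i> * of_real k * (proj' n u r + proj n u r / of_real r - \<i> * of_real k * proj n u r)"
    proof -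
      \<comment> \<open>The Laplacian contributes -k^2 a = (-i k)(-i k a), the missing third term of
        the Sommerfeld defect.\<close>
      have eq: "(\<integral>v. ?f v \<partial>sphere_measure) = - of_real (k\<^sup>2) * proj n u r
          - \<i> * of_real k * (proj' n u r + proj n u r / of_real r)"
        using proj_defect_tangential[OF n open_greaterThan u, of r k]
          radial_solution_laplacian[OF n open_greaterThan _ _ u sol, of r] r1 by simp
      show ?thesis unfolding eq by (simp add: algebra_simps power2_eq_square)
    qed
    ultimately have "k * norm (proj' n u r + proj n u r / of_real r - \<i> * of_real k * proj n u r)
        \<le> 3 * c * M2 * \<Sigma> / r\<^sup>2" using k by (simp add: norm_mult)
    then show ?thesis using k r1 by (simp add: field_simps)
  qed
  define C where "C = max (3 * c * M1 * \<Sigma> / k) (3 * c * M2 * \<Sigma> / k)"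
  show ?thesis
  proof (rule that[of R0 C])
    fix r assume r: "r \<ge> R0"
    then have "r > 0" by (simp add: R0_def)
    have "(3 * c * M1 * \<Sigma> / k) / r \<le> C / r"
      unfolding C_def by (rule divide_right_mono[OF max.cobounded1]) (use \<open>r > 0\<close> in simp)
    moreover have "(3 * c * M2 * \<Sigma> / k) / r\<^sup>2 \<le> C / r\<^sup>2"
      unfolding C_def by (rule divide_right_mono[OF max.cobounded2]) simp
    ultimately show "norm (proj n u r) \<le> C / r"
      "norm (proj' n u r + proj n u r / of_real r - \<i> * of_real k * proj n u r) \<le> C / r\<^sup>2"
      using A[OF r] B[OF r] by linarith+
  qed
qed

section \<open>Gradient bounds and boundary values of the projections\<close>

lemma vgrad_nth: "vgrad u x $ i $ j = partial j (\<lambda>y. u y $ i) x"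
  by (simp add: vgrad_def)

lemma traction_nth:
  "traction lam mu v u x $ i = of_real lam * (divg u x * of_real (v $ i))
     + of_real mu * (\<Sum>j\<in>UNIV. (vgrad u x $ i $ j + vgrad u x $ j $ i) * of_real (v $ j))"
  by (simp add: traction_def transpose_def matrix_vector_mult_def cvec_def
      scaleR_conv_of_real[where 'a = complex])

lemma divg_vgrad: "divg u x = (\<Sum>j\<in>UNIV. vgrad u x $ j $ j)"
  by (simp add: divg_def vgrad_nth)

lemma norm_nth_nth_le: "norm (A $ i $ j) \<le> norm A" for A :: "complex^3^3"
  using Finite_Cartesian_Product.norm_nth_le[of "A $ i" j] Finite_Cartesian_Product.norm_nth_le[of A i] by linarith

lemma norm_sum_mult_le:
  fixes a b :: "3 \<Rightarrow> complex"
  shows "norm (\<Sum>i\<in>UNIV. a i * b i) \<le> L2_set (\<lambda>i. norm (a i)) UNIV * L2_set (\<lambda>i. norm (b i)) UNIV"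
proof -
  have "norm (\<Sum>i\<in>UNIV. a i * b i) \<le> (\<Sum>i\<in>UNIV. \<bar>norm (a i)\<bar> * \<bar>norm (b i)\<bar>)"
    by (rule order_trans[OF norm_sum]) (simp add: norm_mult)
  then show ?thesis using L2_set_mult_ineq[of "\<lambda>i. norm (a i)" "\<lambda>i. norm (b i)" UNIV] by linarith
qed

text \<open>Cauchy-Schwarz within each row against the unit vector v, then across the rows. The
  constant 1, sharper than in \<open>sum_mult_bound\<close>, goes into the final energy
  bounds.\<close>

lemma radial_derivative_bound:
  fixes A :: "complex^3^3" and q :: "complex^3" and v :: "real^3"
  assumes "norm v = 1"
  shows "norm (\<Sum>i\<in>UNIV. (\<Sum>j\<in>UNIV. A $ i $ j * of_real (v $ j)) * q $ i) \<le> norm A * norm q"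
proof -
  have v: "L2_set (\<lambda>j. norm (complex_of_real (v $ j))) UNIV = 1"
    using assms by (simp add: norm_vec_def)
  have row: "norm (\<Sum>j\<in>UNIV. A $ i $ j * of_real (v $ j)) \<le> norm (A $ i)" for i
    using norm_sum_mult_le[of "\<lambda>j. A $ i $ j" "\<lambda>j. of_real (v $ j)"] unfolding v
    by (simp add: norm_vec_def[of "A $ i"])
  have "L2_set (\<lambda>i. norm (\<Sum>j\<in>UNIV. A $ i $ j * of_real (v $ j))) UNIV \<le> L2_set (\<lambda>i. norm (A $ i)) UNIV"
    by (rule L2_set_mono) (use row in auto)
  then have "L2_set (\<lambda>i. norm (\<Sum>j\<in>UNIV. A $ i $ j * of_real (v $ j))) UNIV \<le> norm A"
    unfolding norm_vec_def[of A] .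
  moreover have "norm (\<Sum>i\<in>UNIV. (\<Sum>j\<in>UNIV. A $ i $ j * of_real (v $ j)) * q $ i)
      \<le> L2_set (\<lambda>i. norm (\<Sum>j\<in>UNIV. A $ i $ j * of_real (v $ j))) UNIV * norm q"
    using norm_sum_mult_le[of "\<lambda>i. \<Sum>j\<in>UNIV. A $ i $ j * of_real (v $ j)" "\<lambda>i. q $ i"]
    by (simp add: norm_vec_def[of q])
  ultimately show ?thesis using mult_right_mono[OF _ norm_ge_zero[of q]] order_trans by blast
qed

lemma proj_integral:
  assumes u: "\<And>i. C1_on (shell I) (\<lambda>x. u x $ i)" and r: "r > 0" "r \<in> I"
  shows "proj n u r = (\<integral>v. (\<Sum>i\<in>UNIV. u (r *\<^sub>R v) $ i * Qv n v $ i) \<partial>sphere_measure)"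
  unfolding proj_def by (rule ip_sum_integral[OF C1_on_continuous[OF u] continuous_Qv r])

lemma proj'_integral:
  assumes u: "\<And>i. C1_on (shell I) (\<lambda>x. u x $ i)" and r: "r > 0" "r \<in> I"
  shows "proj' n u r = (\<integral>v. (\<Sum>i\<in>UNIV. (\<Sum>j\<in>UNIV. vgrad u (r *\<^sub>R v) $ i $ j * of_real (v $ j)) * Qv n v $ i)
    \<partial>sphere_measure)"
proof -
  have "proj' n u r = (\<integral>v. (\<Sum>i\<in>UNIV. euler (\<lambda>x. u x $ i) (r *\<^sub>R v) * Qv n v $ i) \<partial>sphere_measure) / of_real r"
    unfolding proj'_def by (subst ip_sum_integral[OF euler_continuous[OF u] continuous_Qv r]) (rule refl)
  also have "\<dots> = (\<integral>v. (\<Sum>i\<in>UNIV. euler (\<lambda>x. u x $ i) (r *\<^sub>R v) * Qv n v $ i) / of_real r \<partial>sphere_measure)"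
    by simp
  also have "\<dots> = (\<integral>v. (\<Sum>i\<in>UNIV. (\<Sum>j\<in>UNIV. vgrad u (r *\<^sub>R v) $ i $ j * of_real (v $ j)) * Qv n v $ i)
    \<partial>sphere_measure)"
  proof (rule Bochner_Integration.integral_cong)
    fix v :: "real^3"
    have "euler (\<lambda>x. u x $ i) (r *\<^sub>R v) = of_real r * (\<Sum>j\<in>UNIV. vgrad u (r *\<^sub>R v) $ i $ j * of_real (v $ j))" for i
      by (simp add: euler_def vgrad_nth sum_distrib_left mult_ac)
    then show "(\<Sum>i\<in>UNIV. euler (\<lambda>x. u x $ i) (r *\<^sub>R v) * Qv n v $ i) / of_real r
        = (\<Sum>i\<in>UNIV. (\<Sum>j\<in>UNIV. vgrad u (r *\<^sub>R v) $ i $ j * of_real (v $ j)) * Qv n v $ i)"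
      using r(1) by (simp add: sum_divide_distrib)
  qed simp
  finally show ?thesis .
qed

lemma continuous_vgrad:
  assumes "\<And>i. C1_on S (\<lambda>x. u x $ i)"
  shows "continuous_on S (vgrad u)"
proof -
  have "continuous_on S (\<lambda>x. \<chi> i j. partial j (\<lambda>y. u y $ i) x)"
    by (intro continuous_on_vec_lambda C1_on_continuous_partial assms)
  then show ?thesis by (simp add: vgrad_def[abs_def])
qed

lemma Qv_bounded: obtains M where "M \<ge> 0" "\<And>v. norm v = 1 \<Longrightarrow> norm (Qv n v) \<le> M"
proof -
  have "bounded (Qv n ` sphere 0 1)"
    by (intro compact_imp_bounded compact_continuous_image continuous_Qv_vec) simp
  then obtain M where M: "\<And>v. v \<in> sphere 0 1 \<Longrightarrow> norm (Qv n v) \<le> M" unfolding bounded_iff by blast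
  show ?thesis by (rule that[of "max M 0"]) (use M in \<open>auto simp: le_max_iff_disj\<close>)
qed

lemma proj_bounds:
  assumes u: "\<And>i. C1_on (shell I) (\<lambda>x. u x $ i)" and r: "\<And>r. r \<in> I \<Longrightarrow> r > 0"
    and B: "\<And>x. x \<in> shell I \<Longrightarrow> norm (u x) \<le> B" "\<And>x. x \<in> shell I \<Longrightarrow> norm (vgrad u x) \<le> B" "B \<ge> 0"
  obtains C where "\<And>r. r \<in> I \<Longrightarrow> norm (proj n u r) \<le> C \<and> norm (proj' n u r) \<le> C"
proof -
  obtain M where M: "M \<ge> 0" "\<And>v. norm v = 1 \<Longrightarrow> norm (Qv n v) \<le> M"
    using Qv_bounded[of n] by blast
  have "norm (proj n u r) \<le> (3 * (B * M)) * measure sphere_measure (space sphere_measure)" if rI: "r \<in> I" for r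
    unfolding proj_integral[OF u r[OF rI] rI]
  proof (rule sphere_integral_bound)
    fix v :: "real^3" assume v: "norm v = 1"
    then have x: "r *\<^sub>R v \<in> shell I" using scale_sphere_shell[OF r[OF rI] rI] by simp
    have "norm (\<Sum>i\<in>UNIV. u (r *\<^sub>R v) $ i * Qv n v $ i) \<le> 3 * (norm (u (r *\<^sub>R v)) * M)"
      by (rule sum_mult_bound) (rule order_trans[OF Finite_Cartesian_Product.norm_nth_le M(2)[OF v]])
    also have "\<dots> \<le> 3 * (B * M)" using B(1)[OF x] M(1) by (simp add: mult_right_mono)
    finally show "norm (\<Sum>i\<in>UNIV. u (r *\<^sub>R v) $ i * Qv n v $ i) \<le> 3 * (B * M)" .
  qed (use B(3) M(1) in simp)
  moreover have "norm (proj' n u r) \<le> (3 * (B * M)) * measure sphere_measure (space sphere_measure)" if rI: "r \<in> I" for r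
    unfolding proj'_integral[OF u r[OF rI] rI]
  proof (rule sphere_integral_bound)
    fix v :: "real^3" assume v: "norm v = 1"
    then have x: "r *\<^sub>R v \<in> shell I" using scale_sphere_shell[OF r[OF rI] rI] by simp
    have "norm (\<Sum>i\<in>UNIV. (\<Sum>j\<in>UNIV. vgrad u (r *\<^sub>R v) $ i $ j * of_real (v $ j)) * Qv n v $ i)
        \<le> norm (vgrad u (r *\<^sub>R v)) * norm (Qv n v)"
      by (rule radial_derivative_bound[OF v])
    also have "\<dots> \<le> B * M" using B(2)[OF x] M(2)[OF v] B(3) by (intro mult_mono) auto
    also have "\<dots> \<le> 3 * (B * M)" using B(3) M(1) by simp
    finally show "norm (\<Sum>i\<in>UNIV. (\<Sum>j\<in>UNIV. vgrad u (r *\<^sub>R v) $ i $ j * of_real (v $ j)) * Qv n v $ i)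
        \<le> 3 * (B * M)" .
  qed (use B(3) M(1) in simp)
  ultimately show ?thesis using that by blast
qed

lemma proj_boundary_limit:
  assumes u: "\<And>i. C1_on (shell J) (\<lambda>x. u x $ i)" and J: "\<And>r. r \<in> J \<Longrightarrow> r > 0" "1 \<notin> J"
    and B: "\<And>x. x \<in> shell J \<Longrightarrow> norm (u x) \<le> B" and B0: "B \<ge> 0"
    and S: "shell J \<subseteq> S" and l: "\<And>y. norm y = 1 \<Longrightarrow> (u \<longlongrightarrow> l y) (at y within S)"
  shows "(proj n u \<longlongrightarrow> (\<integral>v. (\<Sum>i\<in>UNIV. l v $ i * Qv n v $ i) \<partial>sphere_measure)) (at 1 within J)"
proof -
  obtain M where M: "M \<ge> 0" "\<And>v. norm v = 1 \<Longrightarrow> norm (Qv n v) \<le> M"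
    using Qv_bounded[of n] by blast
  have "((\<lambda>r. \<integral>v. (\<Sum>i\<in>UNIV. u (r *\<^sub>R v) $ i * Qv n v $ i) \<partial>sphere_measure)
      \<longlongrightarrow> (\<integral>v. (\<Sum>i\<in>UNIV. l v $ i * Qv n v $ i) \<partial>sphere_measure)) (at 1 within J)"
  proof (rule sphere_integral_tendsto[where B = "3 * (B * M)"])
    fix r assume r: "r \<in> J"
    show "continuous_on (sphere 0 1) (\<lambda>v. \<Sum>i\<in>UNIV. u (r *\<^sub>R v) $ i * Qv n v $ i)"
      by (intro continuous_on_sum continuous_on_mult continuous_Qv
          continuous_on_scaled[OF C1_on_continuous[OF u] J(1)[OF r] r])
    fix v :: "real^3" assume v: "norm v = 1"
    then have x: "r *\<^sub>R v \<in> shell J" using scale_sphere_shell[OF J(1)[OF r] r] by simp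
    have "norm (\<Sum>i\<in>UNIV. u (r *\<^sub>R v) $ i * Qv n v $ i) \<le> 3 * (norm (u (r *\<^sub>R v)) * M)"
      by (rule sum_mult_bound) (rule order_trans[OF Finite_Cartesian_Product.norm_nth_le M(2)[OF v]])
    also have "\<dots> \<le> 3 * (B * M)" using B[OF x] M(1) by (simp add: mult_right_mono)
    finally show "norm (\<Sum>i\<in>UNIV. u (r *\<^sub>R v) $ i * Qv n v $ i) \<le> 3 * (B * M)" .
  next
    fix v :: "real^3" assume v: "norm v = 1"
    have "((\<lambda>r. u (r *\<^sub>R v)) \<longlongrightarrow> l v) (at 1 within J)"
      by (rule radial_tendsto[OF l[OF v] v]) (use S J v scale_sphere_shell in auto)
    then show "((\<lambda>r. \<Sum>i\<in>UNIV. u (r *\<^sub>R v) $ i * Qv n v $ i) \<longlongrightarrow> (\<Sum>i\<in>UNIV. l v $ i * Qv n v $ i)) (at 1 within J)"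
      by (intro tendsto_intros)
  qed
  then show ?thesis
    by (rule Lim_transform_within[where d = 1]) (use proj_integral[OF u J(1)] in auto)
qed

lemma traction_boundary_limit:
  assumes n: "n \<ge> 1" and u: "\<And>i. C1_on (shell J) (\<lambda>x. u x $ i)" and J: "\<And>r. r \<in> J \<Longrightarrow> r > 0" "1 \<notin> J"
    and B: "\<And>x. x \<in> shell J \<Longrightarrow> norm (vgrad u x) \<le> B" and B0: "B \<ge> 0"
    and S: "shell J \<subseteq> S" and t: "\<And>y. norm y = 1 \<Longrightarrow> (traction lam mu y u \<longlongrightarrow> t y) (at y within S)"
  shows "((\<lambda>r. of_real mu * (proj' n u r - proj n u r / of_real r))
    \<longlongrightarrow> (\<integral>v. (\<Sum>i\<in>UNIV. t v $ i * Qv n v $ i) \<partial>sphere_measure)) (at 1 within J)"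
proof -
  obtain M where M: "M \<ge> 0" "\<And>v. norm v = 1 \<Longrightarrow> norm (Qv n v) \<le> M"
    using Qv_bounded[of n] by blast
  \<comment> \<open>The divergence has three entries bounded by B, and a row of the symmetrised
    gradient three entries bounded by 2 B.\<close>
  define T where "T = \<bar>lam\<bar> * (3 * B) + \<bar>mu\<bar> * (6 * B)"
  have T0: "T \<ge> 0" using B0 by (simp add: T_def)
  have "((\<lambda>r. \<integral>v. (\<Sum>i\<in>UNIV. traction lam mu v u (r *\<^sub>R v) $ i * Qv n v $ i) \<partial>sphere_measure)
      \<longlongrightarrow> (\<integral>v. (\<Sum>i\<in>UNIV. t v $ i * Qv n v $ i) \<partial>sphere_measure)) (at 1 within J)"
  proof (rule sphere_integral_tendsto[where B = "\<Sum>i\<in>(UNIV::3 set). T * M"])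
    fix r assume r: "r \<in> J"
    have cv: "continuous_on (sphere 0 1) (\<lambda>v. vgrad u (r *\<^sub>R v) $ i $ j)" for i j
      by (intro continuous_on_component continuous_on_scaled[OF continuous_vgrad[OF u] J(1)[OF r] r])
    show "continuous_on (sphere 0 1) (\<lambda>v. \<Sum>i\<in>UNIV. traction lam mu v u (r *\<^sub>R v) $ i * Qv n v $ i)"
      unfolding traction_nth divg_vgrad
      by (intro continuous_on_sum continuous_on_mult continuous_on_add continuous_on_const continuous_Qv cv
          C1_on_continuous[OF C1_on_coord])
    fix v :: "real^3" assume v: "norm v = 1"
    then have x: "r *\<^sub>R v \<in> shell J" using scale_sphere_shell[OF J(1)[OF r] r] by simp
    have G: "norm (vgrad u (r *\<^sub>R v) $ i $ j) \<le> B" for i j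
      using order_trans[OF norm_nth_nth_le B[OF x]] .
    have vi: "norm (complex_of_real (v $ i)) \<le> 1" for i using component_le_norm_cart[of v i] v by simp
    have "norm (traction lam mu v u (r *\<^sub>R v) $ i) \<le> T" for i
    proof -
      have "norm (divg u (r *\<^sub>R v)) \<le> (\<Sum>j\<in>(UNIV::3 set). B)"
        unfolding divg_vgrad by (intro sum_norm_le G)
      then have 1: "norm (divg u (r *\<^sub>R v) * of_real (v $ i)) \<le> 3 * B * 1"
        unfolding norm_mult using vi B0 by (intro mult_mono) auto
      have "norm (\<Sum>j\<in>UNIV. (vgrad u (r *\<^sub>R v) $ i $ j + vgrad u (r *\<^sub>R v) $ j $ i) * of_real (v $ j))
          \<le> (\<Sum>j\<in>(UNIV::3 set). (B + B) * 1)"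
        by (intro sum_norm_le) (unfold norm_mult, intro mult_mono order_trans[OF norm_triangle_ineq] add_mono G vi, use B0 in auto)
      then have 2: "norm (\<Sum>j\<in>UNIV. (vgrad u (r *\<^sub>R v) $ i $ j + vgrad u (r *\<^sub>R v) $ j $ i) * of_real (v $ j)) \<le> 6 * B"
        by simp
      show ?thesis
        unfolding traction_nth T_def
        by (rule order_trans[OF norm_triangle_ineq], rule add_mono)
          (use 1 2 in \<open>auto simp: norm_mult intro!: mult_left_mono\<close>)
    qed
    then show "norm (\<Sum>i\<in>UNIV. traction lam mu v u (r *\<^sub>R v) $ i * Qv n v $ i) \<le> (\<Sum>i\<in>(UNIV::3 set). T * M)"
      by (intro sum_norm_le) (unfold norm_mult, intro mult_mono order_trans[OF Finite_Cartesian_Product.norm_nth_le M(2)[OF v]], use T0 in auto)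
  next
    fix v :: "real^3" assume v: "norm v = 1"
    have "((\<lambda>r. traction lam mu v u (r *\<^sub>R v)) \<longlongrightarrow> t v) (at 1 within J)"
      by (rule radial_tendsto[OF t[OF v] v]) (use S J v scale_sphere_shell in auto)
    then show "((\<lambda>r. \<Sum>i\<in>UNIV. traction lam mu v u (r *\<^sub>R v) $ i * Qv n v $ i)
        \<longlongrightarrow> (\<Sum>i\<in>UNIV. t v $ i * Qv n v $ i)) (at 1 within J)"
      by (intro tendsto_intros)
  qed
  then show ?thesis
    by (rule Lim_transform_within[where d = 1]) (use proj_traction[OF n u J(1)] in auto)
qed

lemma radial_solution_continuous:
  assumes "radial_solution n K {0<..} a a'" "r > 0"
  shows "(a \<longlongrightarrow> a r) (at r within J)" "(a' \<longlongrightarrow> a' r) (at r within J)"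
proof -
  obtain d where "(a has_vector_derivative a' r) (at r)" "(a' has_vector_derivative d) (at r)"
    using assms unfolding radial_solution_def by blast
  then have "isCont a r" "isCont a' r" using has_vector_derivative_continuous by blast+
  then show "(a \<longlongrightarrow> a r) (at r within J)" "(a' \<longlongrightarrow> a' r) (at r within J)"
    using tendsto_within_subset[of _ _ r UNIV J] by (auto simp: isCont_def)
qed

lemma at_1_within_not_bot: "at (1::real) within {0<..<1} \<noteq> bot" "at (1::real) within {1<..<2} \<noteq> bot"
  by (auto simp: trivial_limit_within islimpt_greaterThanLessThan1 islimpt_greaterThanLessThan2)

lemma scattering_solution_regularity:
  assumes "scattering_solution (ball 0 1) nu lam mu rho lam' mu' rho' \<omega> ui u"
  shows "C2_on (ball 0 1) (\<lambda>x. u x $ i)" "C2_on (- cball 0 1) (\<lambda>x. u x $ i)"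
    and "\<exists>B\<ge>0. \<forall>x\<in>ball 0 1. norm (u x) \<le> B \<and> norm (vgrad u x) \<le> B"
    and "\<exists>B\<ge>0. \<forall>x\<in>- cball 0 1. norm x \<le> R \<longrightarrow> norm (u x) \<le> B \<and> norm (vgrad u x) \<le> B"
proof -
  have cl: "classical_on (ball 0 1) u" "classical_on (- cball 0 1) u"
    using assms unfolding scattering_solution_def by auto
  have ob: "open (ball (0::real^3) 1)" "open (- cball (0::real^3) 1)" by auto
  show c1: "C2_on (ball 0 1) (\<lambda>x. u x $ i)" and c2: "C2_on (- cball 0 1) (\<lambda>x. u x $ i)" for i
    using cl ob C2_on_nth unfolding classical_on_def by blast+
  have bd: "\<exists>B\<ge>0. \<forall>x\<in>S. norm x \<le> R \<longrightarrow> norm (u x) \<le> B \<and> norm (vgrad u x) \<le> B"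
    if S: "open S" "classical_on S u" for S R
  proof -
    have C2: "C2_on S u" using S(2) unfolding classical_on_def by blast
    obtain B1 where B1: "\<And>x. x \<in> S \<Longrightarrow> norm x \<le> R \<Longrightarrow> norm (u x) \<le> B1"
      using bounded_by_boundary_limits[OF S(1) C1_on_continuous[OF C2_on_C1[OF C2]]] S(2)
      unfolding classical_on_def by metis
    obtain B2 where B2: "\<And>x. x \<in> S \<Longrightarrow> norm x \<le> R \<Longrightarrow> norm (vgrad u x) \<le> B2"
      using bounded_by_boundary_limits[OF S(1) continuous_vgrad[OF C2_on_C1[OF C2_on_nth[OF S(1) C2]]]] S(2)
      unfolding classical_on_def by metis
    show ?thesis
      by (rule exI[of _ "max 0 (max B1 B2)"]) (use B1 B2 in \<open>auto simp: le_max_iff_disj\<close>)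
  qed
  show "\<exists>B\<ge>0. \<forall>x\<in>ball 0 1. norm (u x) \<le> B \<and> norm (vgrad u x) \<le> B"
    using bd[OF ob(1) cl(1), of 1] by force
  show "\<exists>B\<ge>0. \<forall>x\<in>- cball 0 1. norm x \<le> R \<longrightarrow> norm (u x) \<le> B \<and> norm (vgrad u x) \<le> B"
    by (rule bd[OF ob(2) cl(2)])
qed

text \<open>The shell inside the ball misses the origin, hence only an inclusion.\<close>

lemma shell_ball: "shell {0<..<1} \<subseteq> ball 0 1" "shell {1<..} = - cball 0 1"
  by (auto simp: shell_def)

text \<open>Reduces the boundary value problem to two numbers a and b with two linear equations. The
  equations come from computing the limits of the projected field and traction at r = 1 twice: as
  integrals of the common boundary limits, and from the explicit radial solutions on either
  side.\<close>

lemma scattering_projection: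
  assumes n: "n \<ge> 1" and mu: "mu > 0" "mu' > 0"
    and k: "k = k_s mu rho \<omega>" "0 < k" "k \<le> 1 / 16" "k\<^sup>2 = \<omega>\<^sup>2 * rho / mu"
    and K: "K = \<omega>\<^sup>2 * rho' / mu'" "0 \<le> K" "K \<le> 1 / 8"
    and sol: "scattering_solution (ball 0 1) (\<lambda>y. y) lam mu rho lam' mu' rho' \<omega> (regular_wave f n k) u"
  defines "F \<equiv> f * of_real (Qnorm n)"
  obtains a b where
    "\<And>r. r \<in> {0<..<1} \<Longrightarrow> proj' n u r = a * of_real (regular_sol' n K r)"
    "\<And>r. r \<in> {1<..<2} \<Longrightarrow> proj' n (\<lambda>x. u x - regular_wave f n k x) r = b * outgoing_sol' n k r"
    "a * of_real (regular_sol n K 1) = F * of_real (regular_sol n (k\<^sup>2) 1) + b * outgoing_sol n k 1"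
    "of_real mu' * (a * (of_real (regular_sol' n K 1) - of_real (regular_sol n K 1)))
      = of_real mu * (F * (of_real (regular_sol' n (k\<^sup>2) 1) - of_real (regular_sol n (k\<^sup>2) 1))
         + b * (outgoing_sol' n k 1 - outgoing_sol n k 1))"
proof -
  let ?ui = "regular_wave f n k" and ?I = "{0<..<1::real}" and ?E = "{1::real<..}" and ?J = "{1<..<2::real}"
  let ?us = "\<lambda>x. u x - ?ui x"
  note reg = scattering_solution_regularity[OF sol]
  have uI: "C2_on (shell ?I) (\<lambda>x. u x $ i)" for i using C2_on_subset[OF reg(1) shell_ball(1)] .
  have uE: "C2_on (shell ?E) (\<lambda>x. u x $ i)" for i using reg(2) unfolding shell_ball(2) .
  have wE: "C2_on (shell ?E) (\<lambda>x. ?ui x $ i)" for i using C2_on_subset[OF C2_on_regular_wave] by simp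
  have sE: "C2_on (shell ?E) (\<lambda>x. ?us x $ i)" for i
    using C2_on_diff[OF open_shell[OF open_greaterThan] uE wE] by simp
  have uI1: "C1_on (shell ?I) (\<lambda>x. u x $ i)" and uE1: "C1_on (shell ?E) (\<lambda>x. u x $ i)"
    and wE1: "C1_on (shell ?E) (\<lambda>x. ?ui x $ i)" for i
    using C2_on_C1 uI uE wE by blast+
  have JE: "shell ?J \<subseteq> shell ?E" by (auto simp: shell_def)
  have uJ1: "C1_on (shell ?J) (\<lambda>x. u x $ i)" for i using C1_on_subset[OF uE1 JE] .
  have pde: "\<forall>x\<in>ball 0 1. lame_op lam' mu' u x + (\<omega>\<^sup>2 * rho') *\<^sub>R u x = 0"
    "\<forall>x\<in>- cball 0 1. lame_op lam mu u x + (\<omega>\<^sup>2 * rho) *\<^sub>R u x = 0"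
    using sol unfolding scattering_solution_def by auto
  have rI: "radial_solution n K ?I (proj n u) (proj' n u)"
    unfolding K(1)
    by (rule pde_radial_solution[OF n _ _ uI]) (use mu pde(1) shell_ball(1) in auto)
  have rE: "radial_solution n (k\<^sup>2) ?E (proj n u) (proj' n u)"
    unfolding k(4)
    by (rule pde_radial_solution[OF n _ _ uE]) (use mu pde(2) shell_ball(2) in auto)
  have rw: "radial_solution n (k\<^sup>2) ?E (proj n ?ui) (proj' n ?ui)"
    by (rule regular_wave_radial_solution[OF n]) auto
  have ps: "proj n ?us r = proj n u r - proj n ?ui r" "proj' n ?us r = proj' n u r - proj' n ?ui r"
    if "r \<in> ?E" for r
    using proj_diff[OF uE1 wE1, of r] that by simp_all
  have rs: "radial_solution n (k\<^sup>2) ?E (proj n ?us) (proj' n ?us)"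
    by (rule radial_solution_cong[OF open_greaterThan radial_solution_diff[OF rE rw]]) (simp_all add: ps)
  obtain B where B: "B \<ge> 0" "\<And>x. x \<in> ball 0 1 \<Longrightarrow> norm (u x) \<le> B" "\<And>x. x \<in> ball 0 1 \<Longrightarrow> norm (vgrad u x) \<le> B"
    using reg(3) by blast
  obtain B2 where B2: "B2 \<ge> 0" "\<And>x. x \<in> - cball 0 1 \<Longrightarrow> norm x \<le> 2 \<Longrightarrow> norm (u x) \<le> B2"
    "\<And>x. x \<in> - cball 0 1 \<Longrightarrow> norm x \<le> 2 \<Longrightarrow> norm (vgrad u x) \<le> B2"
    using reg(4)[of 2] by blast
  have BI: "norm (u x) \<le> B" "norm (vgrad u x) \<le> B" if "x \<in> shell ?I" for x
    using B(2,3) that shell_ball(1) by blast+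
  have BJ: "norm (u x) \<le> B2" "norm (vgrad u x) \<le> B2" if "x \<in> shell ?J" for x
    using B2(2,3)[of x] that by (auto simp: shell_def)
  obtain C where C: "\<And>r. r \<in> ?I \<Longrightarrow> norm (proj n u r) \<le> C \<and> norm (proj' n u r) \<le> C"
    using proj_bounds[OF uI1 _ BI B(1)] by auto
  obtain a where a: "\<And>r. r \<in> ?I \<Longrightarrow> proj n u r = a * of_real (regular_sol n K r)
      \<and> proj' n u r = a * of_real (regular_sol' n K r)"
    using interior_match[OF n K(2,3) rI, of C] C by auto
  have rad: "radiating (k_p lam mu rho \<omega>) k ?us"
    using sol unfolding scattering_solution_def k(1) by blast
  obtain C' R0 where bd: "\<And>r. r \<ge> R0 \<Longrightarrow> norm (proj n ?us r) \<le> C' / r"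
    "\<And>r. r \<ge> R0 \<Longrightarrow> norm (proj' n ?us r + proj n ?us r / of_real r - \<i> * of_real k * proj n ?us r) \<le> C' / r\<^sup>2"
    by (rule radiating_proj_bounds[OF n k(2) sE rs rad]) (rule that)
  obtain b where b: "\<And>r. r \<in> ?J \<Longrightarrow> proj n ?us r = b * outgoing_sol n k r \<and> proj' n ?us r = b * outgoing_sol' n k r"
    by (rule exterior_match[where ?R0.0 = R0 and C = C', OF n k(2,3) rs],
        rule bd(1), assumption, rule bd(2), assumption) (rule that)
  have uJ: "proj n u r = F * of_real (regular_sol n (k\<^sup>2) r) + b * outgoing_sol n k r"
    "proj' n u r = F * of_real (regular_sol' n (k\<^sup>2) r) + b * outgoing_sol' n k r" if r: "r \<in> ?J" for r
    using b[OF r] ps[of r] proj_regular_wave[OF n, of r f k] proj'_regular_wave[OF n, of r f k] r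
    unfolding F_def by (auto simp: algebra_simps)
  have pos: "\<And>r. r \<in> {0<..} \<Longrightarrow> 0 < (r::real)" by simp
  note cR = radial_solution_continuous[OF regular_solution[OF pos] zero_less_one]
  note cO = radial_solution_continuous[OF outgoing_solution[OF n pos] zero_less_one]
  have fr: "frontier (ball (0::real^3) 1) = sphere 0 1" "closure (ball (0::real^3) 1) = cball 0 1" by auto
  have tr: "\<forall>y\<in>sphere 0 1. \<exists>l. (u \<longlongrightarrow> l) (at y within ball 0 1) \<and> (u \<longlongrightarrow> l) (at y within - cball 0 1)"
    "\<forall>y\<in>sphere 0 1. \<exists>t. (traction lam' mu' y u \<longlongrightarrow> t) (at y within ball 0 1)
        \<and> (traction lam mu y u \<longlongrightarrow> t) (at y within - cball 0 1)"
    using sol unfolding scattering_solution_def fr by blast+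
  from bchoice[OF tr(1)] obtain l where l': "\<forall>y\<in>sphere 0 1. (u \<longlongrightarrow> l y) (at y within ball 0 1)
      \<and> (u \<longlongrightarrow> l y) (at y within - cball 0 1)" ..
  have l: "(u \<longlongrightarrow> l y) (at y within ball 0 1)" "(u \<longlongrightarrow> l y) (at y within - cball 0 1)" if "norm y = 1" for y
    using bspec[OF l', of y] that by auto
  from bchoice[OF tr(2)] obtain t where t': "\<forall>y\<in>sphere 0 1. (traction lam' mu' y u \<longlongrightarrow> t y) (at y within ball 0 1)
      \<and> (traction lam mu y u \<longlongrightarrow> t y) (at y within - cball 0 1)" ..
  have t: "(traction lam' mu' y u \<longlongrightarrow> t y) (at y within ball 0 1)"
    "(traction lam mu y u \<longlongrightarrow> t y) (at y within - cball 0 1)" if "norm y = 1" for y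
    using bspec[OF t', of y] that by auto
  have JS: "shell ?J \<subseteq> - cball 0 1" using JE shell_ball(2) by simp
  \<comment> \<open>Each of these integrals is the limit from both sides; equating its two explicit
    values gives one matching equation.\<close>
  let ?L = "\<integral>v. (\<Sum>i\<in>UNIV. l v $ i * Qv n v $ i) \<partial>sphere_measure"
  let ?T = "\<integral>v. (\<Sum>i\<in>UNIV. t v $ i * Qv n v $ i) \<partial>sphere_measure"
  have L1: "(proj n u \<longlongrightarrow> ?L) (at 1 within ?I)"
    by (rule proj_boundary_limit[OF uI1 _ _ BI(1) B(1) shell_ball(1) l(1)]) auto
  have L2: "(proj n u \<longlongrightarrow> ?L) (at 1 within ?J)"
    by (rule proj_boundary_limit[OF uJ1 _ _ BJ(1) B2(1) JS l(2)]) auto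
  have T1: "((\<lambda>r. of_real mu' * (proj' n u r - proj n u r / of_real r)) \<longlongrightarrow> ?T) (at 1 within ?I)"
    by (rule traction_boundary_limit[OF n uI1 _ _ BI(2) B(1) shell_ball(1) t(1)]) auto
  have T2: "((\<lambda>r. of_real mu * (proj' n u r - proj n u r / of_real r)) \<longlongrightarrow> ?T) (at 1 within ?J)"
    by (rule traction_boundary_limit[OF n uJ1 _ _ BJ(2) B2(1) JS t(2)]) auto
  have "(proj n u \<longlongrightarrow> a * of_real (regular_sol n K 1)) (at 1 within ?I)"
    by (rule Lim_transform_within[OF tendsto_mult[OF tendsto_const cR(1)], where d = 1]) (use a in auto)
  then have 1: "?L = a * of_real (regular_sol n K 1)" using tendsto_unique[OF at_1_within_not_bot(1) L1] by blast
  have "(proj n u \<longlongrightarrow> F * of_real (regular_sol n (k\<^sup>2) 1) + b * outgoing_sol n k 1) (at 1 within ?J)"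
    by (rule Lim_transform_within[OF tendsto_add[OF tendsto_mult[OF tendsto_const cR(1)]
          tendsto_mult[OF tendsto_const cO(1)]], where d = 1]) (use uJ in auto)
  then have 2: "?L = F * of_real (regular_sol n (k\<^sup>2) 1) + b * outgoing_sol n k 1"
    using tendsto_unique[OF at_1_within_not_bot(2) L2] by blast
  have "((\<lambda>r. of_real mu' * (a * of_real (regular_sol' n K r) - a * of_real (regular_sol n K r) / of_real r))
      \<longlongrightarrow> of_real mu' * (a * of_real (regular_sol' n K 1) - a * of_real (regular_sol n K 1) / of_real 1)) (at 1 within ?I)"
    by (intro tendsto_intros cR) auto
  then have "((\<lambda>r. of_real mu' * (proj' n u r - proj n u r / of_real r))
      \<longlongrightarrow> of_real mu' * (a * of_real (regular_sol' n K 1) - a * of_real (regular_sol n K 1) / of_real 1)) (at 1 within ?I)"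
    by (rule Lim_transform_within[where d = 1]) (use a in auto)
  then have 3: "?T = of_real mu' * (a * of_real (regular_sol' n K 1) - a * of_real (regular_sol n K 1) / of_real 1)"
    using tendsto_unique[OF at_1_within_not_bot(1) T1] by blast
  have "((\<lambda>r. of_real mu * (F * of_real (regular_sol' n (k\<^sup>2) r) + b * outgoing_sol' n k r
        - (F * of_real (regular_sol n (k\<^sup>2) r) + b * outgoing_sol n k r) / of_real r))
      \<longlongrightarrow> of_real mu * (F * of_real (regular_sol' n (k\<^sup>2) 1) + b * outgoing_sol' n k 1
        - (F * of_real (regular_sol n (k\<^sup>2) 1) + b * outgoing_sol n k 1) / of_real 1)) (at 1 within ?J)"
    by (intro tendsto_intros cR cO) auto
  then have "((\<lambda>r. of_real mu * (proj' n u r - proj n u r / of_real r))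
      \<longlongrightarrow> of_real mu * (F * of_real (regular_sol' n (k\<^sup>2) 1) + b * outgoing_sol' n k 1
        - (F * of_real (regular_sol n (k\<^sup>2) 1) + b * outgoing_sol n k 1) / of_real 1)) (at 1 within ?J)"
    by (rule Lim_transform_within[where d = 1]) (use uJ in auto)
  then have 4: "?T = of_real mu * (F * of_real (regular_sol' n (k\<^sup>2) 1) + b * outgoing_sol' n k 1
        - (F * of_real (regular_sol n (k\<^sup>2) 1) + b * outgoing_sol n k 1) / of_real 1)"
    using tendsto_unique[OF at_1_within_not_bot(2) T2] by blast
  show ?thesis
  proof (rule that[of a b])
    show "proj' n u r = a * of_real (regular_sol' n K r)" if "r \<in> ?I" for r using a[OF that] by blast
    show "proj' n ?us r = b * outgoing_sol' n k r" if "r \<in> ?J" for r using b[OF that] by blast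
    show "a * of_real (regular_sol n K 1) = F * of_real (regular_sol n (k\<^sup>2) 1) + b * outgoing_sol n k 1"
      using 1 2 by simp
    show "of_real mu' * (a * (of_real (regular_sol' n K 1) - of_real (regular_sol n K 1)))
      = of_real mu * (F * (of_real (regular_sol' n (k\<^sup>2) 1) - of_real (regular_sol n (k\<^sup>2) 1))
         + b * (outgoing_sol' n k 1 - outgoing_sol n k 1))"
      using trans[OF 3[symmetric] 4] by (simp add: algebra_simps)
  qed
qed

section \<open>Gradient energy in spherical shells\<close>

text \<open>Integrability is essential: otherwise \<open>L2norm\<close> would be 0 by convention and
  no lower bound could hold.\<close>

lemma L2norm_nn_integral:
  assumes "set_integrable lborel S (\<lambda>x. (norm (f x))\<^sup>2)"
  shows "ennreal ((L2norm S f)\<^sup>2) = (\<integral>\<^sup>+x. ennreal (indicator S x * (norm (f x))\<^sup>2) \<partial>lborel)"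
proof -
  have "(LINT x:S|lborel. (norm (f x))\<^sup>2) \<ge> 0"
    unfolding set_lebesgue_integral_def by (rule Bochner_Integration.integral_nonneg) simp
  then have "(L2norm S f)\<^sup>2 = (\<integral>x. indicator S x * (norm (f x))\<^sup>2 \<partial>lborel)"
    by (simp add: L2norm_def set_lebesgue_integral_def)
  moreover have "(\<integral>\<^sup>+x. ennreal (indicator S x * (norm (f x))\<^sup>2) \<partial>lborel)
      = ennreal (\<integral>x. indicator S x * (norm (f x))\<^sup>2 \<partial>lborel)"
    using assms unfolding set_integrable_def by (intro nn_integral_eq_integral) auto
  ultimately show ?thesis by simp
qed

lemma set_integrable_bounded_norm_sq:
  fixes f :: "real^3 \<Rightarrow> 'b::real_normed_vector"
  assumes S: "open S" "bounded S" and f: "continuous_on S f" and B: "\<And>x. x \<in> S \<Longrightarrow> norm (f x) \<le> B"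
  shows "set_integrable lborel S (\<lambda>x. (norm (f x))\<^sup>2)"
proof -
  have Sm: "S \<in> sets borel" using S(1) by simp
  have fin: "emeasure lborel S < \<infinity>" using emeasure_bounded_finite[OF S(2)] .
  have "continuous_on S (\<lambda>x. (norm (f x))\<^sup>2)" by (intro continuous_intros f)
  from borel_measurable_continuous_on_indicator[OF Sm this]
  have meas: "(\<lambda>x. indicator S x *\<^sub>R (norm (f x))\<^sup>2) \<in> borel_measurable lborel" by simp
  have "integrable lborel (\<lambda>x. B\<^sup>2 * indicator S x :: real)"
    using fin Sm by (intro integrable_mult_right integrable_real_indicator) auto
  then show ?thesis
    unfolding set_integrable_def
  proof (rule Bochner_Integration.integrable_bound[OF _ meas])
    show "AE x in lborel. norm (indicator S x *\<^sub>R (norm (f x))\<^sup>2) \<le> norm (B\<^sup>2 * indicator S x :: real)"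
      using B by (intro AE_I2) (auto simp: indicator_def intro!: power_mono)
  qed
qed

lemma Qv_norm_integrable: "integrable sphere_measure (\<lambda>v. (norm (Qv n v))\<^sup>2)"
  by (intro integrable_sphere_continuous continuous_intros continuous_Qv_vec)

lemma Qnorm_nn_integral: "(\<integral>\<^sup>+v. ennreal ((norm (Qv n v))\<^sup>2) \<partial>sphere_measure) = ennreal (Qnorm n)"
  unfolding Qnorm_def by (rule nn_integral_eq_integral[OF Qv_norm_integrable]) simp

lemma proj'_cauchy_schwarz:
  assumes u: "\<And>i. C1_on (shell I) (\<lambda>x. u x $ i)" and r: "r > 0" "r \<in> I"
  shows "ennreal ((norm (proj' n u r))\<^sup>2)
    \<le> (\<integral>\<^sup>+v. ennreal ((norm (vgrad u (r *\<^sub>R v)))\<^sup>2) \<partial>sphere_measure) * ennreal (Qnorm n)"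
proof -
  let ?g = "\<lambda>v. ennreal (norm (vgrad u (r *\<^sub>R v)))" and ?q = "\<lambda>v. ennreal (norm (Qv n v))"
  have cg: "continuous_on (sphere 0 1) (\<lambda>v. vgrad u (r *\<^sub>R v))"
    by (rule continuous_on_scaled[OF continuous_vgrad[OF u] r])
  have m: "(\<lambda>v. norm (vgrad u (r *\<^sub>R v))) \<in> borel_measurable sphere_measure"
    "(\<lambda>v. norm (Qv n v)) \<in> borel_measurable sphere_measure"
    by (intro continuous_on_sphere_measurable continuous_on_norm cg continuous_Qv_vec)+
  have "ennreal (norm (proj' n u r)) \<le> (\<integral>\<^sup>+v. ennreal (norm (\<Sum>i\<in>UNIV.
      (\<Sum>j\<in>UNIV. vgrad u (r *\<^sub>R v) $ i $ j * of_real (v $ j)) * Qv n v $ i)) \<partial>sphere_measure)"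
    unfolding proj'_integral[OF u r]
  proof (rule integral_norm_bound_ennreal, rule integrable_sphere_continuous)
    show "continuous_on (sphere 0 1) (\<lambda>v. \<Sum>i\<in>UNIV.
      (\<Sum>j\<in>UNIV. vgrad u (r *\<^sub>R v) $ i $ j * of_real (v $ j)) * Qv n v $ i)"
      by (intro continuous_on_sum continuous_on_mult continuous_on_component cg continuous_Qv
          C1_on_continuous[OF C1_on_coord])
  qed
  also have "\<dots> \<le> (\<integral>\<^sup>+v. ?g v * ?q v \<partial>sphere_measure)"
    by (intro nn_integral_mono, subst ennreal_mult[symmetric])
      (auto intro!: ennreal_leI radial_derivative_bound)
  finally have "(ennreal (norm (proj' n u r)))\<^sup>2 \<le> (\<integral>\<^sup>+v. ?g v * ?q v \<partial>sphere_measure)\<^sup>2"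
    by (rule power_mono) simp
  also have "\<dots> \<le> (\<integral>\<^sup>+v. (?g v)\<^sup>2 \<partial>sphere_measure) * (\<integral>\<^sup>+v. (?q v)\<^sup>2 \<partial>sphere_measure)"
    using m by (intro Cauchy_Schwarz_nn_integral) auto
  finally show ?thesis by (simp add: ennreal_power Qnorm_nn_integral)
qed

text \<open>Polar coordinates and \<open>proj'_cauchy_schwarz\<close> on each sphere. The pointwise
  lower bound f enters with an antiderivative G, so that the profiles r^(2n) inside and r^(-2n-2)
  outside are both integrated by the fundamental theorem.\<close>

lemma shell_gradient_lower:
  assumes ab: "0 < a" "a \<le> b" and u: "\<And>i. C1_on (shell {a<..<b}) (\<lambda>x. u x $ i)"
    and S: "shell {a<..<b} \<subseteq> S" "set_integrable lborel S (\<lambda>x. (norm (vgrad u x))\<^sup>2)"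
    and f: "f \<in> borel_measurable borel" "\<And>r. r \<in> {a..b} \<Longrightarrow> (G has_real_derivative f r) (at r)"
      "\<And>r. r \<in> {a..b} \<Longrightarrow> 0 \<le> f r"
    and lower: "\<And>r. r \<in> {a<..<b} \<Longrightarrow> f r \<le> r\<^sup>2 * (norm (proj' n u r))\<^sup>2"
  shows "G b - G a \<le> (L2norm S (vgrad u))\<^sup>2 * Qnorm n"
proof -
  let ?I = "{a<..<b}"
  define g where "g x = (norm (vgrad u x))\<^sup>2" for x
  have Sh: "shell ?I \<in> sets borel" using open_shell[of ?I] by simp
  have "continuous_on (shell ?I) g"
    unfolding g_def by (intro continuous_intros continuous_vgrad u)
  from borel_measurable_continuous_on_indicator[OF Sh this]
  have m[measurable]: "(\<lambda>x. indicator (shell ?I) x * g x) \<in> borel_measurable borel" by simp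
  have Qn: "Qnorm n \<ge> 0" unfolding Qnorm_def by (rule Bochner_Integration.integral_nonneg) simp
  have mS: "(\<lambda>v. ennreal (g (r *\<^sub>R v))) \<in> borel_measurable sphere_measure" if "r \<in> ?I" for r
  proof -
    have "continuous_on (sphere 0 1) (\<lambda>v. g (r *\<^sub>R v))"
      unfolding g_def using that ab
      by (intro continuous_intros continuous_on_scaled[OF continuous_vgrad[OF u]]) auto
    from continuous_on_sphere_measurable[OF this] show ?thesis by simp
  qed
  have "ennreal (G b - G a) = (\<integral>\<^sup>+r. ennreal (f r) * indicator {a..b} r \<partial>lborel)"
    using nn_integral_FTC_Icc[OF f ab(2)] by simp
  also have "\<dots> \<le> (\<integral>\<^sup>+r. indicator {0<..} r * ennreal (r\<^sup>2) *
      (\<integral>\<^sup>+v. ennreal (indicator (shell ?I) (r *\<^sub>R v) * g (r *\<^sub>R v)) \<partial>sphere_measure) * ennreal (Qnorm n) \<partial>lborel)"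
  \<comment> \<open>The assumption \<open>lower\<close> covers the open interval; the two end points
    are a null set.\<close>
  proof (rule nn_integral_mono_AE, use AE_lborel_singleton[of a] AE_lborel_singleton[of b] in eventually_elim)
    case (elim r)
    show ?case
    proof (cases "r \<in> ?I")
      case False
      then show ?thesis using elim by (auto simp: indicator_def)
    next
      case True
      then have r: "r > 0" using ab by simp
      have eq: "(\<integral>\<^sup>+v. ennreal (indicator (shell ?I) (r *\<^sub>R v) * g (r *\<^sub>R v)) \<partial>sphere_measure)
          = (\<integral>\<^sup>+v. ennreal (g (r *\<^sub>R v)) \<partial>sphere_measure)"
        using scale_sphere_shell[OF r True] by (intro nn_integral_cong) (simp add: indicator_def)
      have "ennreal (f r) \<le> ennreal (r\<^sup>2) * ennreal ((norm (proj' n u r))\<^sup>2)"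
        using lower[OF True] by (simp add: ennreal_mult[symmetric] ennreal_leI)
      also have "\<dots> \<le> ennreal (r\<^sup>2) * ((\<integral>\<^sup>+v. ennreal (g (r *\<^sub>R v)) \<partial>sphere_measure) * ennreal (Qnorm n))"
        unfolding g_def by (intro mult_left_mono proj'_cauchy_schwarz[OF u r True]) simp
      finally show ?thesis using True r unfolding eq by (simp add: indicator_def mult.assoc)
    qed
  qed
  also have "\<dots> = (\<integral>\<^sup>+r. indicator {0<..} r * ennreal (r\<^sup>2) *
      (\<integral>\<^sup>+v. ennreal (indicator (shell ?I) (r *\<^sub>R v) * g (r *\<^sub>R v)) \<partial>sphere_measure) \<partial>lborel) * ennreal (Qnorm n)"
  proof (rule nn_integral_multc)
    \<comment> \<open>Measurability in r is seen after rewriting the spherical integral as an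
      integral over the ball.\<close>
    define \<phi> where "\<phi> x = ennreal (indicator (shell ?I) x * g x)" for x
    have [measurable]: "\<phi> \<in> borel_measurable borel" unfolding \<phi>_def by measurable
    have "(\<lambda>r. \<integral>\<^sup>+x. 3 * indicator (ball 0 1) x * \<phi> (r *\<^sub>R unit_dir x) \<partial>lborel) \<in> borel_measurable borel"
      by (rule lborel.borel_measurable_nn_integral) measurable
    moreover have "(\<integral>\<^sup>+v. \<phi> (r *\<^sub>R v) \<partial>sphere_measure)
        = (\<integral>\<^sup>+x. 3 * indicator (ball 0 1) x * \<phi> (r *\<^sub>R unit_dir x) \<partial>lborel)" for r
      by (rule nn_integral_sphere_measure) (rule measurable_sphere_measureI, measurable)
    ultimately show "(\<lambda>r. indicator {0<..} r * ennreal (r\<^sup>2) *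
      (\<integral>\<^sup>+v. ennreal (indicator (shell ?I) (r *\<^sub>R v) * g (r *\<^sub>R v)) \<partial>sphere_measure)) \<in> borel_measurable lborel"
      unfolding \<phi>_def[symmetric] by simp
  qed
  also have "\<dots> = (\<integral>\<^sup>+x. ennreal (indicator (shell ?I) x * g x) \<partial>lborel) * ennreal (Qnorm n)"
    by (subst nn_integral_polar[of "\<lambda>x. ennreal (indicator (shell ?I) x * g x)"]) auto
  also have "\<dots> \<le> (\<integral>\<^sup>+x. ennreal (indicator S x * g x) \<partial>lborel) * ennreal (Qnorm n)"
    using S(1) by (intro mult_right_mono nn_integral_mono ennreal_leI) (auto simp: indicator_def g_def)
  also have "\<dots> = ennreal ((L2norm S (vgrad u))\<^sup>2) * ennreal (Qnorm n)"
    unfolding g_def L2norm_nn_integral[OF S(2)] ..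
  also have "\<dots> = ennreal ((L2norm S (vgrad u))\<^sup>2 * Qnorm n)"
    using Qn by (simp add: ennreal_mult)
  finally show ?thesis using Qn by (subst (asm) ennreal_le_iff) auto
qed

lemma norm_cQv: "norm (cQv n x) = norm (Qv n x)"
  by (simp add: norm_vec_def cQv_def)

lemma norm_Qv_scale:
  assumes "n \<ge> 1" "r \<ge> 0"
  shows "norm (Qv n (r *\<^sub>R v)) = r ^ n * norm (Qv n v)"
proof -
  have "Qv n (r *\<^sub>R v) = (r ^ n) *\<^sub>R Qv n v"
    using Qv_scale[OF assms(1)] by (simp add: vec_eq_iff scaleR_conv_of_real[where 'a = complex])
  then show ?thesis using assms(2) by simp
qed

text \<open>The third component i wb^n vanishes only where the first two coordinates do. A vanishing
  norm would therefore put the unit ball, outside the null plane x1 = 0, into a null set.\<close>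

lemma Qnorm_pos:
  assumes n: "n \<ge> 1"
  shows "Qnorm n > 0"
proof (rule ccontr)
  assume "\<not> Qnorm n > 0"
  then have "(\<integral>\<^sup>+v. ennreal ((norm (Qv n v))\<^sup>2) \<partial>sphere_measure) = 0"
    unfolding Qnorm_nn_integral by (simp add: ennreal_neg)
  moreover have [measurable]: "Qv n \<in> borel_measurable borel"
    by (rule borel_measurable_continuous_onI[OF continuous_Qv_vec])
  have "(\<integral>\<^sup>+v. ennreal ((norm (Qv n v))\<^sup>2) \<partial>sphere_measure)
      = (\<integral>\<^sup>+x. 3 * indicator (ball 0 1) x * ennreal ((norm (Qv n (unit_dir x)))\<^sup>2) \<partial>lborel)"
    by (rule nn_integral_sphere_measure) (rule measurable_sphere_measureI, measurable)
  ultimately have "(\<integral>\<^sup>+x. 3 * indicator (ball 0 1) x * ennreal ((norm (Qv n (unit_dir x)))\<^sup>2) \<partial>lborel) = 0"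
    by simp
  then have "AE x in lborel. 3 * indicator (ball 0 1) x * ennreal ((norm (Qv n (unit_dir x)))\<^sup>2) = 0"
    by (subst (asm) nn_integral_0_iff_AE) auto
  moreover have "AE x in lborel. x \<bullet> (axis 1 1 :: real^3) \<noteq> 0"
    by (rule AE_lborel_inner_neq) (simp add: axis_in_Basis_iff)
  ultimately have "AE x in lborel. x \<notin> ball (0::real^3) 1"
  proof eventually_elim
    case (elim x)
    have x1: "x $ 1 \<noteq> 0" using elim(2) by (simp add: inner_axis)
    then have "x \<noteq> 0" by auto
    then have "unit_dir x $ 1 \<noteq> 0" using x1 by (simp add: unit_dir_def)
    then have "wb (unit_dir x) \<noteq> 0" by (auto simp: wb_def complex_eq_iff)
    then have "Qv n (unit_dir x) $ 3 \<noteq> 0" by (simp add: Qv_nth)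
    then have "Qv n (unit_dir x) \<noteq> 0" by auto
    then show ?case using elim(1) by (auto simp: indicator_def)
  qed
  then have "ball (0::real^3) 1 \<in> null_sets lborel"
    by (subst AE_iff_null_sets) auto
  then have "emeasure lborel (ball (0::real^3) 1) = 0" by (rule null_setsD1)
  then have "measure lborel (ball (0::real^3) 1) = 0" by (simp add: measure_def)
  then show False using content_ball_pos[of 1 "0::real^3"] by simp
qed

text \<open>On the sphere of radius r the squared norm is |f|^2 h^2 r^(2n) times that of
  \<open>Qv n\<close>, with h the Bessel factor. Since h lies between 9/10 and 11/10, the radial
  integral is at most 121/100 and at least 1/2 times 1/(2n + 3), up to the common factor; the lower
  bound yields positivity.\<close>

lemma L2norm_regular_wave:
  assumes n: "n \<ge> 1" and k: "0 \<le> k" "k\<^sup>2 \<le> 1 / 40" and f: "f \<noteq> 0"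
  shows "0 < L2norm (ball 0 1) (regular_wave f n k)"
    and "(L2norm (ball 0 1) (regular_wave f n k))\<^sup>2 \<le> 121 / 100 * (norm f)\<^sup>2 * Qnorm n / (2 * real n + 3)"
proof -
  let ?B = "ball (0::real^3) 1" and ?w = "regular_wave f n k"
  have cw: "continuous_on UNIV ?w"
  proof -
    have "continuous_on UNIV (\<lambda>x. \<chi> i. ?w x $ i)"
      by (intro continuous_on_vec_lambda C1_on_continuous[OF C2_on_C1[OF C2_on_regular_wave]])
    then show ?thesis by simp
  qed
  have [measurable]: "?w \<in> borel_measurable borel" by (rule borel_measurable_continuous_onI[OF cw])
  have "bounded (?w ` cball 0 1)"
    by (intro compact_imp_bounded compact_continuous_image continuous_on_subset[OF cw]) auto
  then obtain C where C: "\<And>x. x \<in> cball 0 1 \<Longrightarrow> norm (?w x) \<le> C" unfolding bounded_iff by blast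
  have int: "set_integrable lborel ?B (\<lambda>x. (norm (?w x))\<^sup>2)"
    by (rule set_integrable_bounded_norm_sq[where B = C]) (use C continuous_on_subset[OF cw] in auto)
  have h: "9 / 10 \<le> bessel_h n (k\<^sup>2 * r\<^sup>2) \<and> bessel_h n (k\<^sup>2 * r\<^sup>2) \<le> 11 / 10" if "0 \<le> r" "r \<le> 1" for r
  proof -
    have "r\<^sup>2 \<le> 1" using that by (simp add: power_le_one)
    then have "k\<^sup>2 * r\<^sup>2 \<le> 1 / 40 * 1" using k by (intro mult_mono) auto
    then show ?thesis using bessel_near(1)[of "k\<^sup>2 * r\<^sup>2" n] by auto
  qed
  have Q: "Qnorm n > 0" by (rule Qnorm_pos[OF n])
  define c where "c = (norm f)\<^sup>2 * Qnorm n"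
  have c: "c > 0" using f Q by (simp add: c_def)
  have "ennreal ((L2norm ?B ?w)\<^sup>2) = (\<integral>\<^sup>+x. ennreal (indicator ?B x * (norm (?w x))\<^sup>2) \<partial>lborel)"
    by (rule L2norm_nn_integral[OF int])
  also have "\<dots> = (\<integral>\<^sup>+r. indicator {0<..} r * ennreal (r\<^sup>2) *
      (\<integral>\<^sup>+v. ennreal (indicator ?B (r *\<^sub>R v) * (norm (?w (r *\<^sub>R v)))\<^sup>2) \<partial>sphere_measure) \<partial>lborel)"
    by (rule nn_integral_polar) measurable
  also have "\<dots> = (\<integral>\<^sup>+r. ennreal (indicator {0<..<1} r * (c * (bessel_h n (k\<^sup>2 * r\<^sup>2))\<^sup>2 * r ^ (2 * n + 2))) \<partial>lborel)"
  proof (rule nn_integral_cong)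
    fix r :: real
    show "indicator {0<..} r * ennreal (r\<^sup>2) *
      (\<integral>\<^sup>+v. ennreal (indicator ?B (r *\<^sub>R v) * (norm (?w (r *\<^sub>R v)))\<^sup>2) \<partial>sphere_measure)
      = ennreal (indicator {0<..<1} r * (c * (bessel_h n (k\<^sup>2 * r\<^sup>2))\<^sup>2 * r ^ (2 * n + 2)))"
    proof (cases "r > 0")
      case True
      define d where "d = indicator {0<..<1} r * ((norm f)\<^sup>2 * (bessel_h n (k\<^sup>2 * r\<^sup>2))\<^sup>2 * r ^ (2 * n))"
      have d: "d \<ge> 0" using True by (simp add: d_def)
      have "(\<integral>\<^sup>+v. ennreal (indicator ?B (r *\<^sub>R v) * (norm (?w (r *\<^sub>R v)))\<^sup>2) \<partial>sphere_measure)
          = (\<integral>\<^sup>+v. ennreal d * ennreal ((norm (Qv n v))\<^sup>2) \<partial>sphere_measure)"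
      proof (rule nn_integral_cong)
        fix v assume "v \<in> space sphere_measure"
        then have v: "norm v = 1" by simp
        have "norm (?w (r *\<^sub>R v)) = norm f * \<bar>bessel_h n (k\<^sup>2 * r\<^sup>2)\<bar> * (r ^ n * norm (Qv n v))"
        proof -
          have "norm (a *s x) = norm a * norm x" for a :: complex and x :: "complex^3"
            by (simp add: norm_vec_def norm_mult L2_set_right_distrib)
          then show ?thesis
            using True v by (simp add: regular_wave_def norm_mult norm_cQv norm_Qv_scale[OF n])
        qed
        then have "(norm (?w (r *\<^sub>R v)))\<^sup>2 = (norm f)\<^sup>2 * (bessel_h n (k\<^sup>2 * r\<^sup>2))\<^sup>2 * r ^ (2 * n) * (norm (Qv n v))\<^sup>2"
          by (simp add: power_mult_distrib power_mult[symmetric] mult.commute[of n])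
        moreover have "(indicator ?B (r *\<^sub>R v) :: real) = indicator {0<..<1} r"
          using True v by (simp add: indicator_def)
        ultimately have "indicator ?B (r *\<^sub>R v) * (norm (?w (r *\<^sub>R v)))\<^sup>2 = d * (norm (Qv n v))\<^sup>2"
          by (simp add: d_def)
        then show "ennreal (indicator ?B (r *\<^sub>R v) * (norm (?w (r *\<^sub>R v)))\<^sup>2) = ennreal d * ennreal ((norm (Qv n v))\<^sup>2)"
          using d by (simp add: ennreal_mult)
      qed
      also have "\<dots> = ennreal d * ennreal (Qnorm n)"
        unfolding Qnorm_nn_integral[symmetric]
        by (rule nn_integral_cmult) (use borel_measurable_integrable[OF Qv_norm_integrable] in simp)
      finally have "indicator {0<..} r * ennreal (r\<^sup>2) *
        (\<integral>\<^sup>+v. ennreal (indicator ?B (r *\<^sub>R v) * (norm (?w (r *\<^sub>R v)))\<^sup>2) \<partial>sphere_measure)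
        = ennreal (r\<^sup>2 * (d * Qnorm n))"
        using True d Q by (simp add: ennreal_mult)
      also have "r\<^sup>2 * (d * Qnorm n) = indicator {0<..<1} r * (c * (bessel_h n (k\<^sup>2 * r\<^sup>2))\<^sup>2 * r ^ (2 * n + 2))"
        by (simp add: d_def c_def power_add power2_eq_square mult_ac)
      finally show ?thesis .
    qed simp
  qed
  finally have eq: "ennreal ((L2norm ?B ?w)\<^sup>2)
      = (\<integral>\<^sup>+r. ennreal (indicator {0<..<1} r * (c * (bessel_h n (k\<^sup>2 * r\<^sup>2))\<^sup>2 * r ^ (2 * n + 2))) \<partial>lborel)" .
  have ftc: "(\<integral>\<^sup>+r. ennreal (e * c * r ^ (2 * n + 2)) * indicator {0..1} r \<partial>lborel)
      = ennreal (e * c / (2 * real n + 3))" if "e > 0" for e :: real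
  proof -
    have "(\<integral>\<^sup>+r. ennreal (e * c * r ^ (2 * n + 2)) * indicator {0..1} r \<partial>lborel)
      = ennreal (e * c / (2 * real n + 3) * 1 ^ (2 * n + 3) - e * c / (2 * real n + 3) * 0 ^ (2 * n + 3))"
    proof (rule nn_integral_FTC_Icc)
      fix r :: real assume "r \<in> {0..1}"
      have 1: "((\<lambda>r. e * c / (2 * real n + 3) * r ^ (2 * n + 3)) has_real_derivative
          e * c / (2 * real n + 3) * (real (2 * n + 3) * r ^ (2 * n + 3 - 1))) (at r)"
        by (intro DERIV_cmult) (auto intro!: derivative_eq_intros)
      have 2: "e * c / (2 * real n + 3) * (real (2 * n + 3) * r ^ (2 * n + 3 - 1)) = e * c * r ^ (2 * n + 2)"
      proof -
        have "2 * n + 3 - 1 = 2 * n + 2" by simp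
        moreover have "real (2 * n + 3) = 2 * real n + 3" by simp
        ultimately show ?thesis by (simp only:) (simp add: add_pos_nonneg)
      qed
      show "((\<lambda>r. e * c / (2 * real n + 3) * r ^ (2 * n + 3)) has_real_derivative
          e * c * r ^ (2 * n + 2)) (at r)" by (rule DERIV_cong[OF 1 2])
      show "0 \<le> e * c * r ^ (2 * n + 2)" using \<open>r \<in> {0..1}\<close> that c by simp
    qed auto
    then show ?thesis by (simp add: power_0_left)
  qed
  have f1: "(\<integral>\<^sup>+r. ennreal (121 / 100 * c * r ^ (2 * n + 2)) * indicator {0..1} r \<partial>lborel)
      = ennreal (121 / 100 * c / (2 * real n + 3))" by (rule ftc) simp
  have f2: "(\<integral>\<^sup>+r. ennreal (1 / 2 * c * r ^ (2 * n + 2)) * indicator {0..1} r \<partial>lborel)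
      = ennreal (1 / 2 * c / (2 * real n + 3))" by (rule ftc) simp
  have "ennreal ((L2norm ?B ?w)\<^sup>2) \<le> ennreal (121 / 100 * c / (2 * real n + 3))"
    unfolding eq f1[symmetric]
  proof (rule nn_integral_mono)
    fix r :: real
    have "(bessel_h n (k\<^sup>2 * r\<^sup>2))\<^sup>2 \<le> 121 / 100" if "r \<in> {0<..<1}"
    proof -
      have "(bessel_h n (k\<^sup>2 * r\<^sup>2))\<^sup>2 \<le> (11 / 10)\<^sup>2" using h[of r] that by (intro power_mono) auto
      then show ?thesis by (simp add: power2_eq_square)
    qed
    then have "c * (bessel_h n (k\<^sup>2 * r\<^sup>2))\<^sup>2 * r ^ (2 * n + 2) \<le> c * (121 / 100) * r ^ (2 * n + 2)"
      if "r \<in> {0<..<1}" using that c by (intro mult_right_mono mult_left_mono) auto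
    then show "ennreal (indicator {0<..<1} r * (c * (bessel_h n (k\<^sup>2 * r\<^sup>2))\<^sup>2 * r ^ (2 * n + 2)))
        \<le> ennreal (121 / 100 * c * r ^ (2 * n + 2)) * indicator {0..1} r"
      by (auto simp: indicator_def mult_ac intro!: ennreal_leI)
  qed
  then show "(L2norm ?B ?w)\<^sup>2 \<le> 121 / 100 * (norm f)\<^sup>2 * Qnorm n / (2 * real n + 3)"
    using c by (subst (asm) ennreal_le_iff) (auto simp: c_def mult.assoc)
  have "ennreal (1 / 2 * c / (2 * real n + 3)) \<le> ennreal ((L2norm ?B ?w)\<^sup>2)"
    unfolding eq f2[symmetric]
  proof (rule nn_integral_mono_AE, use AE_lborel_singleton[of "0::real"] AE_lborel_singleton[of "1::real"] in eventually_elim)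
    case (elim r)
    have "1 / 2 \<le> (bessel_h n (k\<^sup>2 * r\<^sup>2))\<^sup>2" if "r \<in> {0<..<1}"
    proof -
      have "(9 / 10)\<^sup>2 \<le> (bessel_h n (k\<^sup>2 * r\<^sup>2))\<^sup>2" using h[of r] that by (intro power_mono) auto
      then show ?thesis by (simp add: power2_eq_square)
    qed
    then have "c * (1 / 2) * r ^ (2 * n + 2) \<le> c * (bessel_h n (k\<^sup>2 * r\<^sup>2))\<^sup>2 * r ^ (2 * n + 2)"
      if "r \<in> {0<..<1}" using that c by (intro mult_right_mono mult_left_mono) auto
    then show ?case using elim
      by (auto simp: indicator_def mult_ac intro!: ennreal_leI)
  qed
  moreover have "ennreal (1 / 2 * c / (2 * real n + 3)) > 0" using c by simp
  ultimately have "L2norm ?B ?w \<noteq> 0" by auto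
  moreover have "L2norm ?B ?w \<ge> 0"
    unfolding L2norm_def by (simp add: set_lebesgue_integral_def Bochner_Integration.integral_nonneg)
  ultimately show "0 < L2norm ?B ?w" by simp
qed

section \<open>Surface resonance\<close>

text \<open>\<open>X\<close>, \<open>\<Phi>\<close>, \<open>Y\<close> are the boundary values of the projected total, incident and scattered fields,
  and \<open>p\<close>, \<open>q\<close>, \<open>s\<close> the low-frequency corrections to \<open>r a' = n a\<close> and \<open>r a' = -(n + 1) a\<close>.\<close>

lemma transmission_estimate:
  fixes X \<Phi> Y p q s :: complex and n \<delta> :: real
  assumes n: "n \<ge> 100" and \<delta>: "0 < \<delta>" "\<delta> \<le> 1 / 10"
    and eq1: "X = \<Phi> + Y"
    and eq2: "of_real (n - 1) * X + p = of_real \<delta> * (of_real (n - 1) * \<Phi> + q - of_real (n + 2) * Y + s)"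
    and p: "norm p \<le> norm X / 100" and q: "norm q \<le> norm \<Phi> / 100" and s: "norm s \<le> 12 / 100 * norm Y"
  shows "\<delta> * norm \<Phi> \<le> norm X" "norm X \<le> norm \<Phi> / 4"
proof -
  define x \<phi> where "x = norm X" and "\<phi> = norm \<Phi>"
  have nn: "x \<ge> 0" "\<phi> \<ge> 0" by (simp_all add: x_def \<phi>_def)
  have Y: "Y = X - \<Phi>" using eq1 by simp
  have y: "norm Y \<le> x + \<phi>" unfolding Y x_def \<phi>_def by (rule norm_triangle_ineq4)
  have s': "norm s \<le> 12 / 100 * (x + \<phi>)"
    by (rule order_trans[OF s]) (use y in \<open>simp add: mult_left_mono\<close>)
  \<comment> \<open>Inserting Y = X - \<Phi> collects the coefficients (n - 1) + (n + 2) = 2n + 1 at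
    \<Phi> and n - 1 + \<delta> (n + 2) at X.\<close>
  have key: "of_real (\<delta> * (2 * n + 1)) * \<Phi>
      = of_real (n - 1) * X + p + of_real (\<delta> * (n + 2)) * X - of_real \<delta> * q - of_real \<delta> * s"
    using eq2 unfolding Y by (simp add: algebra_simps)
  have "norm (of_real (n - 1) * X + p + of_real (\<delta> * (n + 2)) * X - of_real \<delta> * q - of_real \<delta> * s)
      \<le> (n - 1) * x + x / 100 + \<delta> * (n + 2) * x + \<delta> * (\<phi> / 100) + \<delta> * (12 / 100 * (x + \<phi>))"
    using n \<delta> p q s'
    by (intro order_trans[OF norm_triangle_ineq4] order_trans[OF norm_triangle_ineq] add_mono)
      (auto simp: norm_mult x_def \<phi>_def simp del: of_real_diff of_real_add of_real_mult intro!: mult_left_mono)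
  then have A: "\<delta> * (2 * n + 1) * \<phi>
      \<le> (n - 1) * x + x / 100 + \<delta> * (n + 2) * x + \<delta> * (\<phi> / 100) + \<delta> * (12 / 100 * (x + \<phi>))"
    unfolding key[symmetric] using n \<delta> by (simp add: norm_mult \<phi>_def del: of_real_diff of_real_add of_real_mult)
  have dx: "\<delta> * x \<le> x / 10" using mult_right_mono[OF \<delta>(2) nn(1)] by simp
  have dx': "n * (\<delta> * x) \<le> n * (x / 10)" using dx n by (intro mult_left_mono) auto
  show "\<delta> * norm \<Phi> \<le> norm X"
  proof (rule ccontr)
    assume "\<not> \<delta> * norm \<Phi> \<le> norm X"
    then have c: "x < \<delta> * \<phi>" by (simp add: x_def \<phi>_def)
    \<comment> \<open>The leading terms would require 2 n \<delta> \<phi> <= 1.1 n \<delta> \<phi>;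
      with n >= 100 the gap exceeds all lower-order terms.\<close>
    have nx: "n * x \<le> n * (\<delta> * \<phi>)" using c n by (intro mult_left_mono) auto
    have n100: "100 * (\<delta> * \<phi>) \<le> n * (\<delta> * \<phi>)" using n \<delta> nn by (intro mult_right_mono) auto
    have "2 * (n * (\<delta> * \<phi>)) + \<delta> * \<phi> \<le> n * x - x + x / 100 + n * (\<delta> * x) + 2 * (\<delta> * x) + \<delta> * \<phi> / 100
        + 12 / 100 * (\<delta> * x) + 12 / 100 * (\<delta> * \<phi>)"
    proof -
      have "\<delta> * (2 * n + 1) * \<phi> = 2 * (n * (\<delta> * \<phi>)) + \<delta> * \<phi>"
        "(n - 1) * x + x / 100 + \<delta> * (n + 2) * x + \<delta> * (\<phi> / 100) + \<delta> * (12 / 100 * (x + \<phi>))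
        = n * x - x + x / 100 + n * (\<delta> * x) + 2 * (\<delta> * x) + \<delta> * \<phi> / 100
          + 12 / 100 * (\<delta> * x) + 12 / 100 * (\<delta> * \<phi>)"
        by (simp_all add: field_simps)
      then show ?thesis using A by simp
    qed
    then show False using c nx n100 dx dx' nn by linarith
  qed
  have key2: "of_real (n - 1) * X = of_real (\<delta> * (2 * n + 1)) * \<Phi>
      - (p + of_real (\<delta> * (n + 2)) * X) + of_real \<delta> * q + of_real \<delta> * s"
    using key by (simp add: algebra_simps)
  have "norm (of_real (\<delta> * (2 * n + 1)) * \<Phi> - (p + of_real (\<delta> * (n + 2)) * X) + of_real \<delta> * q + of_real \<delta> * s)
      \<le> \<delta> * (2 * n + 1) * \<phi> + (x / 100 + \<delta> * (n + 2) * x) + \<delta> * (\<phi> / 100) + \<delta> * (12 / 100 * (x + \<phi>))"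
    using n \<delta> p q s'
    by (intro order_trans[OF norm_triangle_ineq4] order_trans[OF norm_triangle_ineq] add_mono)
      (auto simp: norm_mult x_def \<phi>_def simp del: of_real_diff of_real_add of_real_mult intro!: mult_left_mono)
  then have B: "(n - 1) * x \<le> \<delta> * (2 * n + 1) * \<phi> + (x / 100 + \<delta> * (n + 2) * x) + \<delta> * (\<phi> / 100)
      + \<delta> * (12 / 100 * (x + \<phi>))"
    unfolding key2[symmetric] using n by (simp add: norm_mult x_def del: of_real_diff of_real_add of_real_mult)
  have dp: "\<delta> * \<phi> \<le> \<phi> / 10" using mult_right_mono[OF \<delta>(2) nn(2)] by simp
  have dp': "n * (\<delta> * \<phi>) \<le> n * (\<phi> / 10)" using dp n by (intro mult_left_mono) auto
  show "norm X \<le> norm \<Phi> / 4"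
  proof (rule ccontr)
    assume "\<not> norm X \<le> norm \<Phi> / 4"
    then have c: "\<phi> < 4 * x" by (simp add: x_def \<phi>_def)
    \<comment> \<open>With \<delta> <= 1/10 the leading terms on the right are at most 0.8 n x + 0.1
      n x, so a gap of 0.1 n x >= 10 x is left for the rest.\<close>
    have np: "n * \<phi> \<le> n * (4 * x)" using c n by (intro mult_left_mono) auto
    have n100: "100 * x \<le> n * x" using n nn by (intro mult_right_mono) auto
    have "n * x - x \<le> 2 * (n * (\<delta> * \<phi>)) + \<delta> * \<phi> + x / 100 + n * (\<delta> * x) + 2 * (\<delta> * x) + \<delta> * \<phi> / 100
        + 12 / 100 * (\<delta> * x) + 12 / 100 * (\<delta> * \<phi>)"
    proof -
      have "(n - 1) * x = n * x - x"
        "\<delta> * (2 * n + 1) * \<phi> + (x / 100 + \<delta> * (n + 2) * x) + \<delta> * (\<phi> / 100) + \<delta> * (12 / 100 * (x + \<phi>))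
        = 2 * (n * (\<delta> * \<phi>)) + \<delta> * \<phi> + x / 100 + n * (\<delta> * x) + 2 * (\<delta> * x) + \<delta> * \<phi> / 100
          + 12 / 100 * (\<delta> * x) + 12 / 100 * (\<delta> * \<phi>)"
        by (simp_all add: field_simps)
      then show ?thesis using B by simp
    qed
    then show False using c np n100 dx dx' dp dp' nn by linarith
  qed
qed

text \<open>Compare squares: n^2/(2n + 1) in the energy against 1/(2n + 3) in the norm of the
  incident wave leaves a factor of at least n^2. The number 121/100 is that of
  \<open>L2norm_regular_wave\<close>.\<close>

lemma ratio_lower_bound:
  fixes n t \<kappa> c Q V U :: real
  assumes n: "n \<ge> 0" and Q: "Q > 0" and V: "V \<ge> 0" and U: "U > 0" and t: "t \<ge> 0" and c: "c \<ge> 0"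
    and lower: "\<kappa> * c * Q\<^sup>2 * n\<^sup>2 / (2 * n + 1) \<le> V\<^sup>2 * Q"
    and upper: "U\<^sup>2 \<le> 121 / 100 * c * Q / (2 * n + 3)" and \<kappa>: "121 / 100 * t\<^sup>2 \<le> \<kappa>"
  shows "n * t \<le> V / U"
proof -
  have "(n * t * U)\<^sup>2 = (n\<^sup>2 * t\<^sup>2) * U\<^sup>2" by (simp add: power_mult_distrib)
  also have "\<dots> \<le> (n\<^sup>2 * t\<^sup>2) * (121 / 100 * c * Q / (2 * n + 3))"
    using upper by (intro mult_left_mono) auto
  also have "\<dots> = (121 / 100 * t\<^sup>2) * (c * Q * n\<^sup>2) / (2 * n + 3)" by simp
  also have "\<dots> \<le> \<kappa> * (c * Q * n\<^sup>2) / (2 * n + 1)"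
    using n Q c \<kappa> order_trans[OF _ \<kappa>, of 0] by (intro frac_le mult_right_mono mult_nonneg_nonneg) auto
  also have "\<dots> \<le> V\<^sup>2"
  proof -
    have "\<kappa> * (c * Q * n\<^sup>2) / (2 * n + 1) * Q \<le> V\<^sup>2 * Q"
      using lower by (simp add: power2_eq_square mult_ac)
    then show ?thesis using Q by (rule mult_right_le_imp_le)
  qed
  finally have "n * t * U \<le> V" using V by (rule power2_le_imp_le)
  then show ?thesis using U by (simp add: le_divide_eq)
qed

text \<open>The radial projection x/|x| competes for the distance to the sphere and bounds it from
  above; this inclusion is the direction required by a lower energy bound.\<close>

lemma inner_layer_shell:
  assumes "0 < g" "g < 1"
  shows "shell {g<..<1} \<subseteq> inner_layer (ball 0 1) (1 - g)" "open (inner_layer (ball (0::real^3) 1) \<xi>)"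
    "bounded (inner_layer (ball (0::real^3) 1) \<xi>)"
proof -
  show "shell {g<..<1} \<subseteq> inner_layer (ball 0 1) (1 - g)"
  proof
    fix x assume "x \<in> shell {g<..<1}"
    then have x: "g < norm x" "norm x < 1" by (auto simp: shell_def)
    then have x0: "norm x > 0" using assms by linarith
    have "infdist x (sphere 0 1) \<le> dist x (x /\<^sub>R norm x)"
    proof (rule infdist_le)
      have "x \<noteq> 0" using x0 by auto
      then show "x /\<^sub>R norm x \<in> sphere 0 1" by simp
    qed
    also have "x - x /\<^sub>R norm x = (1 - 1 / norm x) *\<^sub>R x"
      by (simp add: algebra_simps inverse_eq_divide)
    then have "dist x (x /\<^sub>R norm x) = \<bar>1 - 1 / norm x\<bar> * norm x"
      unfolding dist_norm by (simp only: norm_scaleR)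
    also have "\<dots> = 1 - norm x"
    proof -
      have "1 - 1 / norm x \<le> 0" using x x0 by (simp add: le_divide_eq)
      then have "\<bar>1 - 1 / norm x\<bar> = 1 / norm x - 1" by simp
      then show ?thesis using x0 by (simp add: field_simps)
    qed
    also have "\<dots> < 1 - g" using x by simp
    finally show "x \<in> inner_layer (ball 0 1) (1 - g)"
      using x by (simp add: inner_layer_def)
  qed
  have "inner_layer (ball (0::real^3) 1) \<xi> = ball 0 1 \<inter> {x. infdist x (frontier (ball 0 1)) < \<xi>}"
    unfolding inner_layer_def by blast
  moreover have "open {x. infdist x (frontier (ball (0::real^3) 1)) < \<xi>}"
    by (intro open_Collect_less continuous_intros)
  ultimately show "open (inner_layer (ball (0::real^3) 1) \<xi>)" by auto
  show "bounded (inner_layer (ball (0::real^3) 1) \<xi>)"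
    by (rule bounded_subset[OF bounded_ball[of 0 1]]) (auto simp: inner_layer_def)
qed

lemma outer_layer_shell:
  assumes "1 < g" "g < R"
  shows "shell {1<..<g} \<subseteq> outer_layer (ball 0 1) R (g - 1)" "open (outer_layer (ball (0::real^3) 1) R \<xi>)"
    "bounded (outer_layer (ball (0::real^3) 1) R \<xi>)"
proof -
  show "shell {1<..<g} \<subseteq> outer_layer (ball 0 1) R (g - 1)"
  proof
    fix x assume "x \<in> shell {1<..<g}"
    then have x: "1 < norm x" "norm x < g" by (auto simp: shell_def)
    then have x0: "norm x > 0" by linarith
    have "infdist x (sphere 0 1) \<le> dist x (x /\<^sub>R norm x)"
    proof (rule infdist_le)
      have "x \<noteq> 0" using x0 by auto
      then show "x /\<^sub>R norm x \<in> sphere 0 1" by simp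
    qed
    also have "x - x /\<^sub>R norm x = (1 - 1 / norm x) *\<^sub>R x"
      by (simp add: algebra_simps inverse_eq_divide)
    then have "dist x (x /\<^sub>R norm x) = \<bar>1 - 1 / norm x\<bar> * norm x"
      unfolding dist_norm by (simp only: norm_scaleR)
    also have "\<dots> = norm x - 1"
    proof -
      have "1 - 1 / norm x \<ge> 0" using x x0 by simp
      then have "\<bar>1 - 1 / norm x\<bar> = 1 - 1 / norm x" by simp
      then show ?thesis using x0 by (simp add: field_simps)
    qed
    also have "\<dots> < g - 1" using x by simp
    finally show "x \<in> outer_layer (ball 0 1) R (g - 1)"
      using x assms by (simp add: outer_layer_def)
  qed
  have "outer_layer (ball (0::real^3) 1) R \<xi>
      = (ball 0 R - cball 0 1) \<inter> {x. infdist x (frontier (ball 0 1)) < \<xi>}"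
    unfolding outer_layer_def by auto
  moreover have "open {x. infdist x (frontier (ball (0::real^3) 1)) < \<xi>}"
    by (intro open_Collect_less continuous_intros)
  ultimately show "open (outer_layer (ball (0::real^3) 1) R \<xi>)" by (auto simp: open_Diff)
  show "bounded (outer_layer (ball (0::real^3) 1) R \<xi>)"
    by (rule bounded_subset[OF bounded_ball[of 0 R]]) (auto simp: outer_layer_def)
qed

lemma vgrad_diff:
  assumes "\<And>i. C1_on S (\<lambda>x. u x $ i)" "\<And>i. C1_on S (\<lambda>x. w x $ i)" "x \<in> S"
  shows "vgrad (\<lambda>x. u x - w x) x = vgrad u x - vgrad w x"
proof -
  have "partial j (\<lambda>x. (u x - w x) $ i) x = partial j (\<lambda>x. u x $ i) x - partial j (\<lambda>x. w x $ i) x" for i j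
    unfolding vector_minus_component
    by (rule partial_diff[OF C1_on_differentiable[OF assms(1,3)] C1_on_differentiable[OF assms(2,3)]])
  then show ?thesis by (simp add: vec_eq_iff vgrad_nth)
qed

text \<open>The constants multiply as follows. The amplitudes satisfy |a| >= 4/5 \<delta> \<phi> and
  |b| >= 2/5 \<phi>, the radial derivatives contribute (4/5 n)^2, and the layers keep 3/4 of the
  integral. This gives 192/625 \<delta>^2 inside and 48/625 outside, well above the required 121/100
  (\<delta>/4)^2 and 121/100 (1/9)^2.\<close>

lemma resonance_bounds:
  assumes n: "n \<ge> 100" and pos: "mu > 0" "rho > 0"
    and \<delta>: "0 < \<delta>" "\<delta> \<le> 1 / 10" and \<epsilon>: "0 < \<epsilon>" "\<delta> \<le> \<epsilon>"
    and \<omega>: "0 < \<omega>" "k_s mu rho \<omega> \<le> 1 / 40" and f: "f \<noteq> 0"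
    and g1: "0 < g1" "g1 < 1" "g1 ^ (2 * n + 1) \<le> 1 / 4"
    and g2: "1 < g2" "g2 < R" "(1 / g2) ^ (2 * n + 1) \<le> 1 / 4"
    and sol: "scattering_solution (ball 0 1) (\<lambda>y. y) lam mu rho lam' (mu / \<delta>) (rho / \<epsilon>) \<omega>
      (incident_wave f n (k_s mu rho \<omega>)) u"
  shows "inner_ratio (ball 0 1) (1 - g1) (incident_wave f n (k_s mu rho \<omega>)) u \<ge> real n * (\<delta> / 4)"
    and "outer_ratio (ball 0 1) R (g2 - 1) (incident_wave f n (k_s mu rho \<omega>))
      (\<lambda>x. u x - incident_wave f n (k_s mu rho \<omega>) x) \<ge> real n * (1 / 9)"
proof -
  define k where "k = k_s mu rho \<omega>"
  have n1: "n \<ge> 1" and nr: "real n \<ge> 100" using n by simp_all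
  have kpos: "k > 0" using pos \<omega> by (simp add: k_def k_s_def)
  have k40: "k \<le> 1 / 40" using \<omega> by (simp add: k_def)
  have k2: "k\<^sup>2 = \<omega>\<^sup>2 * rho / mu" using pos by (simp add: k_def k_s_def power_mult_distrib)
  have ksq: "k\<^sup>2 \<le> 1 / 1600"
    using power_mono[OF k40, of 2] kpos by (simp add: power2_eq_square)
  define K where "K = \<omega>\<^sup>2 * (rho / \<epsilon>) / (mu / \<delta>)"
  have Kk: "K = k\<^sup>2 * (\<delta> / \<epsilon>)" using pos by (simp add: K_def k2 field_simps)
  have K0: "0 \<le> K" using kpos \<delta> \<epsilon> by (simp add: Kk)
  have K1: "K \<le> 1 / 1600"
  proof -
    \<comment> \<open>Here \<delta> <= \<epsilon> bounds the interior wave number by the exterior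
      one.\<close>
    have "K \<le> k\<^sup>2 * 1" unfolding Kk using \<delta> \<epsilon> by (intro mult_left_mono) auto
    then show ?thesis using ksq by simp
  qed
  obtain c where c: "c \<noteq> 0"
    "\<And>f x. incident_wave f n k x = (f * of_real (c * bessel_h n (k\<^sup>2 * (norm x)\<^sup>2))) *s cQv n x"
    using incident_wave_eq[OF n1 kpos] by blast
  define F0 where "F0 = f * of_real c"
  have F0: "F0 \<noteq> 0" using c(1) f by (simp add: F0_def)
  have inc: "incident_wave f n k = regular_wave F0 n k"
    by (rule ext) (simp add: c(2) regular_wave_def F0_def mult.assoc)
  define Q where "Q = Qnorm n"
  have Q: "Q > 0" unfolding Q_def by (rule Qnorm_pos[OF n1])
  note sol' = sol[folded k_def, unfolded inc]
  have mu': "mu / \<delta> > 0" using pos \<delta> by simp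
  have k16: "k \<le> 1 / 16" and K8: "K \<le> 1 / 8" using k40 K1 by simp_all
  obtain a b where ab:
    "\<And>r. r \<in> {0<..<1} \<Longrightarrow> proj' n u r = a * of_real (regular_sol' n K r)"
    "\<And>r. r \<in> {1<..<2} \<Longrightarrow> proj' n (\<lambda>x. u x - regular_wave F0 n k x) r = b * outgoing_sol' n k r"
    "a * of_real (regular_sol n K 1) = F0 * of_real Q * of_real (regular_sol n (k\<^sup>2) 1) + b * outgoing_sol n k 1"
    "of_real (mu / \<delta>) * (a * (of_real (regular_sol' n K 1) - of_real (regular_sol n K 1)))
      = of_real mu * (F0 * of_real Q * (of_real (regular_sol' n (k\<^sup>2) 1) - of_real (regular_sol n (k\<^sup>2) 1))
         + b * (outgoing_sol' n k 1 - outgoing_sol n k 1))"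
    by (rule scattering_projection[OF n1 pos(1) mu' k_def kpos k16 k2 K_def K0 K8 sol']) (rule that, unfold Q_def)
  define \<Phi> X Y where "\<Phi> = F0 * of_real Q * of_real (bessel_h n (k\<^sup>2))"
    and "X = a * of_real (bessel_h n K)" and "Y = b * outgoing_sol n k 1"
  define z where "z = - \<i> * complex_of_real k"
  define E where "E = exp (\<i> * complex_of_real k)"
  have nE: "norm E = 1" unfolding E_def by (simp add: norm_exp_eq_Re)
  have hk: "\<bar>bessel_h n s - 1\<bar> \<le> 1 / 100" "\<bar>bessel_h' n s\<bar> \<le> 2" if "0 \<le> s" "s \<le> 1 / 200" for s
    using bessel_near[of s n] that by auto
  have qz: "norm (hankel_q n z - 1) \<le> 1 / 20" "norm (hankel_q' n z) \<le> 2"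
    using outgoing_near[OF n1 kpos, of 1] k40 by (simp_all add: z_def)
  have qb: "19 / 20 \<le> norm (hankel_q n z)" "norm (hankel_q n z) \<le> 21 / 20"
    using qz(1) norm_triangle_ineq3[of "hankel_q n z" 1] by auto
  have out1: "outgoing_sol n k 1 = E * hankel_q n z"
    by (simp add: outgoing_sol_def E_def z_def)
  \<comment> \<open>In a' - a/r at r = 1 the power r^(-n-1) gives the factor -(n + 2); the remainder
    is of order k and becomes \<open>s\<close>.\<close>
  have out1': "outgoing_sol' n k 1 - outgoing_sol n k 1
      = - of_nat (n + 2) * (E * hankel_q n z) + E * (\<i> * of_real k * (hankel_q n z - hankel_q' n z))"
    by (simp add: outgoing_sol'_def outgoing_sol_def E_def z_def algebra_simps)
  define p q s where "p = a * of_real (2 * K * bessel_h' n K)"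
    and "q = F0 * of_real Q * of_real (2 * k\<^sup>2 * bessel_h' n (k\<^sup>2))"
    and "s = b * (E * (\<i> * of_real k * (hankel_q n z - hankel_q' n z)))"
  have eq1: "X = \<Phi> + Y" using ab(3) by (simp add: X_def \<Phi>_def Y_def regular_sol_def)
  have eq2: "of_real (real n - 1) * X + p
      = of_real \<delta> * (of_real (real n - 1) * \<Phi> + q - of_real (real n + 2) * Y + s)"
  proof -
    have l: "a * (of_real (regular_sol' n K 1) - of_real (regular_sol n K 1)) = of_real (real n - 1) * X + p"
      by (simp add: regular_sol_def regular_sol'_def X_def p_def algebra_simps)
    have r: "F0 * of_real Q * (of_real (regular_sol' n (k\<^sup>2) 1) - of_real (regular_sol n (k\<^sup>2) 1))
         + b * (outgoing_sol' n k 1 - outgoing_sol n k 1)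
       = of_real (real n - 1) * \<Phi> + q - of_real (real n + 2) * Y + s"
      unfolding out1' by (simp add: regular_sol_def regular_sol'_def \<Phi>_def q_def s_def Y_def out1 algebra_simps)
    have "of_real mu * (of_real (real n - 1) * X + p)
        = of_real mu * (of_real \<delta> * (of_real (real n - 1) * \<Phi> + q - of_real (real n + 2) * Y + s))"
      using ab(4) \<delta>(1) unfolding l r by (simp add: field_simps)
    then show ?thesis using pos(1) by simp
  qed
  have small: "norm (w * complex_of_real (2 * t * bessel_h' n t)) \<le> norm (w * complex_of_real (bessel_h n t)) / 100"
    if "0 \<le> t" "t \<le> 1 / 1600" for w t
  proof -
    have "\<bar>2 * t * bessel_h' n t\<bar> \<le> 2 * (1 / 1600) * 2"
      unfolding abs_mult using that hk(2)[of t] by (intro mult_mono) auto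
    also have "\<dots> \<le> \<bar>bessel_h n t\<bar> / 100" using hk(1)[of t] that by linarith
    finally have "norm w * \<bar>2 * t * bessel_h' n t\<bar> \<le> norm w * (\<bar>bessel_h n t\<bar> / 100)"
      by (intro mult_left_mono) auto
    then show ?thesis by (simp only: norm_mult norm_of_real times_divide_eq_right)
  qed
  have pb: "norm p \<le> norm X / 100" unfolding p_def X_def by (rule small[OF K0 K1])
  have qb': "norm q \<le> norm \<Phi> / 100" unfolding q_def \<Phi>_def by (rule small[OF _ ksq]) simp
  \<comment> \<open>Dividing k (21/20 + 2) <= 0.077 by the lower bound 19/20 of the Hankel factor
    stays below 12/100.\<close>
  have sb: "norm s \<le> 12 / 100 * norm Y"
  proof -
    have "norm (hankel_q n z - hankel_q' n z) \<le> 21 / 20 + 2"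
      using norm_triangle_ineq4[of "hankel_q n z" "hankel_q' n z"] qb(2) qz(2) by linarith
    then have "k * norm (hankel_q n z - hankel_q' n z) \<le> 1 / 40 * (21 / 20 + 2)"
      using k40 kpos by (intro mult_mono) auto
    also have "\<dots> \<le> 12 / 100 * norm (hankel_q n z)" using qb(1) by simp
    finally have "norm b * (k * norm (hankel_q n z - hankel_q' n z)) \<le> norm b * (12 / 100 * norm (hankel_q n z))"
      by (intro mult_left_mono) auto
    then show ?thesis using kpos by (simp add: s_def Y_def out1 norm_mult nE)
  qed
  note te = transmission_estimate[OF nr \<delta> eq1 eq2 pb qb' sb]
  define \<phi> where "\<phi> = norm F0 * Q"
  have \<phi>: "\<phi> \<ge> 0" using Q by (simp add: \<phi>_def)
  have \<Phi>b: "99 / 100 * \<phi> \<le> norm \<Phi>"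
  proof -
    have "99 / 100 \<le> \<bar>bessel_h n (k\<^sup>2)\<bar>" using hk(1)[of "k\<^sup>2"] ksq zero_le_power2[of k] by linarith
    then have "\<phi> * (99 / 100) \<le> \<phi> * \<bar>bessel_h n (k\<^sup>2)\<bar>" using \<phi> by (rule mult_left_mono)
    then show ?thesis using Q by (simp add: \<Phi>_def \<phi>_def norm_mult)
  qed
  \<comment> \<open>|X| >= \<delta> |\<Phi>| and two Bessel factors within 1/100 of 1.\<close>
  have ab_lower: "4 / 5 * \<delta> * \<phi> \<le> norm a"
  proof -
    have "\<bar>bessel_h n K\<bar> \<le> 101 / 100" using hk(1)[of K] K0 K1 by linarith
    then have "norm X \<le> norm a * (101 / 100)"
      unfolding X_def norm_mult norm_of_real by (intro mult_left_mono) auto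
    moreover have "\<delta> * (99 / 100 * \<phi>) \<le> \<delta> * norm \<Phi>" using \<Phi>b \<delta> by (intro mult_left_mono) auto
    moreover have "\<delta> * \<phi> \<ge> 0" using \<delta> \<phi> by simp
    ultimately show ?thesis using te(1) by linarith
  qed
  \<comment> \<open>|X| <= |\<Phi>| / 4 forces |Y| >= 3/4 |\<Phi>|; the scattered field nearly
    cancels the incident one at the boundary.\<close>
  have b_lower: "2 / 5 * \<phi> \<le> norm b"
  proof -
    have "norm Y \<le> norm b * (21 / 20)"
      unfolding Y_def out1 norm_mult nE using mult_left_mono[OF qb(2) norm_ge_zero[of b]] by simp
    moreover have "norm \<Phi> \<le> norm X + norm Y"
      using eq1 norm_triangle_ineq4[of X Y] by simp
    ultimately show ?thesis using te(2) \<Phi>b \<phi> by linarith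
  qed
  have L2nn: "L2norm S v \<ge> 0" for S and v :: "real^3 \<Rightarrow> complex^3^3"
    unfolding L2norm_def by (simp add: set_lebesgue_integral_def Bochner_Integration.integral_nonneg)
  have ksq': "k\<^sup>2 \<le> 1 / 40" using ksq by simp
  note wave = L2norm_regular_wave[OF n1 less_imp_le[OF kpos] ksq' F0]
  note reg = scattering_solution_regularity[OF sol']
  have g2': "min g2 2 > 1" using g2 by simp

  have inner: "(norm a)\<^sup>2 * (16 / 25) * (real n)\<^sup>2 / (2 * real n + 1) * (3 / 4)
      \<le> (L2norm (inner_layer (ball 0 1) (1 - g1)) (vgrad u))\<^sup>2 * Q"
  proof -
    let ?S = "inner_layer (ball (0::real^3) 1) (1 - g1)"
    define e where "e = (norm a)\<^sup>2 * (16 / 25) * (real n)\<^sup>2"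
    have e: "e \<ge> 0" by (simp add: e_def)
    obtain B where B: "\<And>x. x \<in> ball 0 1 \<Longrightarrow> norm (vgrad u x) \<le> B" using reg(3) by blast
    have C1: "C1_on (ball 0 1) (\<lambda>x. u x $ i)" for i using C2_on_C1[OF reg(1)] .
    have sub: "?S \<subseteq> ball 0 1" by (auto simp: inner_layer_def)
    have "e / (2 * real n + 1) * 1 ^ (2 * n + 1) - e / (2 * real n + 1) * g1 ^ (2 * n + 1)
        \<le> (L2norm ?S (vgrad u))\<^sup>2 * Qnorm n"
    proof (rule shell_gradient_lower[where G = "\<lambda>r. e / (2 * real n + 1) * r ^ (2 * n + 1)"
          and f = "\<lambda>r. e * r ^ (2 * n)"])
      show "C1_on (shell {g1<..<1}) (\<lambda>x. u x $ i)" for i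
        by (rule C1_on_subset[OF C1]) (auto simp: shell_def)
      show "set_integrable lborel ?S (\<lambda>x. (norm (vgrad u x))\<^sup>2)"
        by (rule set_integrable_bounded_norm_sq[OF inner_layer_shell(2,3)[OF g1(1,2)]
              continuous_on_subset[OF continuous_vgrad[OF C1] sub] B]) (use sub in blast)
      show "((\<lambda>r. e / (2 * real n + 1) * r ^ (2 * n + 1)) has_real_derivative e * r ^ (2 * n)) (at r)" for r
      proof -
        have 1: "((\<lambda>r. e / (2 * real n + 1) * r ^ (2 * n + 1)) has_real_derivative
          e / (2 * real n + 1) * (real (2 * n + 1) * r ^ (2 * n))) (at r)"
          by (intro DERIV_cmult DERIV_cong[OF DERIV_pow[of "2 * n + 1" r]]) simp
        have 2: "e / (2 * real n + 1) * (real (2 * n + 1) * r ^ (2 * n)) = e * r ^ (2 * n)"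
          by (simp add: add_pos_nonneg field_simps)
        show ?thesis by (rule DERIV_cong[OF 1 2])
      qed
      fix r assume r: "r \<in> {g1<..<1}"
      then have r01: "r \<in> {0<..<1}" using g1 by simp
      have Kr: "0 \<le> K * r\<^sup>2" "K * r\<^sup>2 \<le> 1 / 1600"
      proof -
        have "r\<^sup>2 \<le> 1" using r01 by (simp add: power_le_one)
        then show "K * r\<^sup>2 \<le> 1 / 1600" using K0 K1 mult_mono[of K "1/1600" "r\<^sup>2" 1] by simp
      qed (use K0 in simp)
      have "\<bar>2 * (K * r\<^sup>2) * bessel_h' n (K * r\<^sup>2)\<bar> \<le> 2 * (1 / 1600) * 2"
        unfolding abs_mult using Kr hk(2)[of "K * r\<^sup>2"] by (intro mult_mono) auto
      moreover have "real n * (99 / 100) \<le> real n * bessel_h n (K * r\<^sup>2)"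
        using hk(1)[of "K * r\<^sup>2"] Kr by (intro mult_left_mono) linarith+
      ultimately have "4 / 5 * real n \<le> real n * bessel_h n (K * r\<^sup>2) + 2 * (K * r\<^sup>2) * bessel_h' n (K * r\<^sup>2)"
        using nr by linarith
      then have "r ^ n * (4 / 5 * real n) \<le> r ^ n * (real n * bessel_h n (K * r\<^sup>2) + 2 * (K * r\<^sup>2) * bessel_h' n (K * r\<^sup>2))"
        using r01 by (intro mult_left_mono) auto
      also have "\<dots> = r * regular_sol' n K r"
        using r01 by (simp add: regular_sol'_def field_simps power2_eq_square)
      finally have "(r ^ n * (4 / 5 * real n))\<^sup>2 \<le> (r * regular_sol' n K r)\<^sup>2"
        using r01 by (intro power_mono) auto
      then have "(norm a)\<^sup>2 * (r ^ n * (4 / 5 * real n))\<^sup>2 \<le> (norm a)\<^sup>2 * (r * regular_sol' n K r)\<^sup>2"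
        by (intro mult_left_mono) auto
      also have "\<dots> = r\<^sup>2 * (norm (proj' n u r))\<^sup>2"
        unfolding ab(1)[OF r01] by (simp add: norm_mult power_mult_distrib)
      also have "(norm a)\<^sup>2 * (r ^ n * (4 / 5 * real n))\<^sup>2 = e * r ^ (2 * n)"
        by (simp add: e_def power_mult_distrib power_mult[symmetric] mult.commute[of n] power_divide)
      finally show "e * r ^ (2 * n) \<le> r\<^sup>2 * (norm (proj' n u r))\<^sup>2" .
    qed (use g1 e inner_layer_shell(1)[OF g1(1,2)] in auto)
    \<comment> \<open>Radii below g1 hold at most the share g1^(2n+1) <= 1/4 of the integral over
      the whole ball.\<close>
    moreover have "e / (2 * real n + 1) * (3 / 4) \<le> e / (2 * real n + 1) * (1 - g1 ^ (2 * n + 1))"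
      using g1(3) e by (intro mult_left_mono) auto
    ultimately have "e / (2 * real n + 1) * (3 / 4) \<le> (L2norm ?S (vgrad u))\<^sup>2 * Qnorm n"
      unfolding right_diff_distrib power_one mult_1_right by linarith
    then show ?thesis by (simp only: Q_def e_def)
  qed

  have outer: "(norm b)\<^sup>2 * (16 / 25) * (real n)\<^sup>2 / (2 * real n + 1) * (3 / 4)
      \<le> (L2norm (outer_layer (ball 0 1) R (g2 - 1)) (vgrad (\<lambda>x. u x - regular_wave F0 n k x)))\<^sup>2 * Q"
  proof -
    let ?S = "outer_layer (ball (0::real^3) 1) R (g2 - 1)"
    let ?w = "regular_wave F0 n k"
    \<comment> \<open>The outgoing form of the projection is available for radii below 2. If g2 is
      larger, the shell is truncated there, and the share lost, (1/2)^(2n+1), is still at most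
      1/4.\<close>
    define g where "g = min g2 2"
    have g: "1 < g" "g \<le> 2" "g \<le> g2" using g2' by (auto simp: g_def)
    have gp: "(1 / g) ^ (2 * n + 1) \<le> 1 / 4"
    proof (cases "g2 \<le> 2")
      case True
      then show ?thesis using g2(3) by (simp add: g_def min_def)
    next
      case False
      then have "(1 / g) ^ (2 * n + 1) = (1 / 2) ^ (2 * n + 1)" by (simp add: g_def min_def)
      also have "\<dots> \<le> (1 / 2) ^ 2" using n by (intro power_decreasing) auto
      finally show ?thesis by (simp add: power2_eq_square)
    qed
    define e where "e = (norm b)\<^sup>2 * (16 / 25) * (real n)\<^sup>2"
    have e: "e \<ge> 0" by (simp add: e_def)
    obtain B where B: "\<And>x. x \<in> - cball 0 1 \<Longrightarrow> norm x \<le> R \<Longrightarrow> norm (vgrad u x) \<le> B"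
      using reg(4)[of R] by blast
    have C1u: "C1_on (- cball 0 1) (\<lambda>x. u x $ i)" for i using C2_on_C1[OF reg(2)] .
    have C1w: "C1_on S (\<lambda>x. ?w x $ i)" for i S
      using C1_on_subset[OF C2_on_C1[OF C2_on_regular_wave]] by simp
    have C1: "C1_on (- cball 0 1) (\<lambda>x. (u x - ?w x) $ i)" for i
      using C1_on_diff[OF C1u C1w] by simp
    have sub: "?S \<subseteq> - cball 0 1" "?S \<subseteq> cball 0 R" by (auto simp: outer_layer_def)
    have "bounded (vgrad ?w ` cball 0 R)"
      by (intro compact_imp_bounded compact_continuous_image continuous_vgrad C1w) simp
    then obtain B' where B': "\<And>x. x \<in> cball 0 R \<Longrightarrow> norm (vgrad ?w x) \<le> B'"
      unfolding bounded_iff by blast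
    have "- (e / (2 * real n + 1) * (1 / g) ^ (2 * n + 1)) - - (e / (2 * real n + 1) * (1 / 1) ^ (2 * n + 1))
        \<le> (L2norm ?S (vgrad (\<lambda>x. u x - ?w x)))\<^sup>2 * Qnorm n"
    proof (rule shell_gradient_lower[where G = "\<lambda>r. - (e / (2 * real n + 1) * (1 / r) ^ (2 * n + 1))"
          and f = "\<lambda>r. e * (1 / r) ^ (2 * n + 2)"])
      show "C1_on (shell {1<..<g}) (\<lambda>x. (u x - ?w x) $ i)" for i
        by (rule C1_on_subset[OF C1]) (auto simp: shell_def)
      show "shell {1<..<g} \<subseteq> ?S"
        using outer_layer_shell(1)[OF g2(1,2)] g by (auto simp: shell_def)
      show "set_integrable lborel ?S (\<lambda>x. (norm (vgrad (\<lambda>x. u x - ?w x) x))\<^sup>2)"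
      proof (rule set_integrable_bounded_norm_sq[OF outer_layer_shell(2,3)[OF g2(1,2)]
              continuous_on_subset[OF continuous_vgrad[OF C1] sub(1)]])
        fix x assume x: "x \<in> ?S"
        have xR: "x \<in> - cball 0 1" "x \<in> cball 0 R" "norm x \<le> R" using x sub by auto
        have "vgrad (\<lambda>x. u x - ?w x) x = vgrad u x - vgrad ?w x"
          by (rule vgrad_diff[OF C1u C1w xR(1)])
        also have "norm \<dots> \<le> B + B'"
          by (intro order_trans[OF norm_triangle_ineq4] add_mono B B' xR)
        finally show "norm (vgrad (\<lambda>x. u x - ?w x) x) \<le> B + B'" .
      qed
      show "((\<lambda>r. - (e / (2 * real n + 1) * (1 / r) ^ (2 * n + 1))) has_real_derivative e * (1 / r) ^ (2 * n + 2)) (at r)"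
        if "r \<in> {1..g}" for r
      proof -
        have r: "r \<noteq> 0" using that by auto
        have i: "((\<lambda>r. 1 / r) has_real_derivative - ((1 / r)\<^sup>2)) (at r)"
          using r by (auto intro!: derivative_eq_intros simp: power2_eq_square)
        have 1: "((\<lambda>r. - (e / (2 * real n + 1) * (1 / r) ^ (2 * n + 1))) has_real_derivative
          - (e / (2 * real n + 1) * (real (2 * n + 1) * (- ((1 / r)\<^sup>2) * (1 / r) ^ (2 * n + 1 - Suc 0))))) (at r)"
          by (intro DERIV_minus DERIV_cmult DERIV_power i)
        have "real (2 * n + 1) = 2 * real n + 1" by simp
        then have "e / (2 * real n + 1) * real (2 * n + 1) = e"
          by (simp only:) (simp del: of_nat_add of_nat_mult add: add_pos_nonneg field_simps)
        moreover have "(1 / r) ^ (2 * n + 1 - Suc 0) * (1 / r)\<^sup>2 = (1 / r) ^ (2 * n + 2)"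
          unfolding power_add[symmetric] by simp
        moreover have "- (A * (B * (- C * D))) = A * B * (D * C)" for A B C D :: real by simp
        ultimately have 2: "- (e / (2 * real n + 1) * (real (2 * n + 1) * (- ((1 / r)\<^sup>2) * (1 / r) ^ (2 * n + 1 - Suc 0))))
          = e * (1 / r) ^ (2 * n + 2)"
          by (simp only:)
        show ?thesis by (rule DERIV_cong[OF 1 2])
      qed
      fix r assume r: "r \<in> {1<..<g}"
      then have r12: "r \<in> {1<..<2}" "r > 0" using g by auto
      define zr where "zr = - \<i> * complex_of_real k * of_real r"
      have kr: "k * r \<le> 1 / 20" using k40 kpos r12 mult_mono[of k "1/40" r 2] by simp
      have q1: "norm (hankel_q n zr - 1) \<le> 1 / 10" "norm (hankel_q' n zr) \<le> 2"
        using outgoing_near[OF n1 kpos, of r] kr r12 unfolding zr_def by auto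
      have q2: "9 / 10 \<le> norm (hankel_q n zr)" "norm (hankel_q n zr) \<le> 11 / 10"
        using q1(1) norm_triangle_ineq3[of "hankel_q n zr" 1] by auto
      define W where "W = - (\<i> * of_real (k * r) * hankel_q' n zr) + \<i> * of_real (k * r) * hankel_q n zr
          - of_nat (n + 1) * hankel_q n zr"
      have W: "of_real r * outgoing_sol' n k r = exp (\<i> * of_real k * of_real r) / of_real r ^ (n + 1) * W"
        using r12 unfolding outgoing_sol'_def zr_def[symmetric] W_def by (simp add: field_simps)
      \<comment> \<open>The last term of W has norm at least 9/10 (n + 1); the other two together
        have at most 1/10 + 11/200.\<close>
      have nW: "4 / 5 * real n \<le> norm W"
      proof -
        have nk: "norm (\<i> * complex_of_real (k * r)) \<le> 1 / 20"
          using kr kpos r12 by (simp add: norm_mult)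
        have n1: "norm (\<i> * of_real (k * r) * hankel_q' n zr) \<le> 1 / 20 * 2"
          by (rule order_trans[OF norm_mult_ineq mult_mono[OF nk q1(2)]]) auto
        have n2: "norm (\<i> * of_real (k * r) * hankel_q n zr) \<le> 1 / 20 * (11 / 10)"
          by (rule order_trans[OF norm_mult_ineq mult_mono[OF nk q2(2)]]) auto
        have n3: "norm (of_nat (n + 1) * hankel_q n zr) \<ge> real (n + 1) * (9 / 10)"
          unfolding norm_mult norm_of_nat using q2(1) by (intro mult_left_mono) auto
        have "norm (of_nat (n + 1) * hankel_q n zr)
            = norm (- (\<i> * of_real (k * r) * hankel_q' n zr) + \<i> * of_real (k * r) * hankel_q n zr - W)"
          by (simp add: W_def)
        also have "\<dots> \<le> norm (\<i> * of_real (k * r) * hankel_q' n zr) + norm (\<i> * of_real (k * r) * hankel_q n zr) + norm W"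
          by (intro order_trans[OF norm_triangle_ineq4] add_right_mono order_trans[OF norm_triangle_ineq]) simp
        finally show ?thesis using n1 n2 n3 nr by simp
      qed
      have nr1: "norm (of_real r * outgoing_sol' n k r) = (1 / r) ^ (n + 1) * norm W"
        unfolding W using r12 by (simp add: norm_mult norm_divide norm_power norm_exp_eq_Re power_divide)
      have "(1 / r) ^ (n + 1) * (4 / 5 * real n) \<le> norm (of_real r * outgoing_sol' n k r)"
        unfolding nr1 using nW r12 by (intro mult_left_mono) auto
      then have "((1 / r) ^ (n + 1) * (4 / 5 * real n))\<^sup>2 \<le> (norm (of_real r * outgoing_sol' n k r))\<^sup>2"
        using r12 by (intro power_mono) auto
      then have "(norm b)\<^sup>2 * ((1 / r) ^ (n + 1) * (4 / 5 * real n))\<^sup>2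
          \<le> (norm b)\<^sup>2 * (norm (of_real r * outgoing_sol' n k r))\<^sup>2"
        by (intro mult_left_mono) auto
      also have "\<dots> = r\<^sup>2 * (norm (proj' n (\<lambda>x. u x - ?w x) r))\<^sup>2"
        unfolding ab(2)[OF r12(1)] by (simp add: norm_mult power_mult_distrib)
      also have "(norm b)\<^sup>2 * ((1 / r) ^ (n + 1) * (4 / 5 * real n))\<^sup>2 = e * (1 / r) ^ (2 * n + 2)"
      proof -
        have "((1 / r) ^ (n + 1))\<^sup>2 = (1 / r) ^ (2 * n + 2)"
          unfolding power_mult[symmetric] by (simp add: mult.commute)
        moreover have "(4 / 5 * real n)\<^sup>2 = 16 / 25 * (real n)\<^sup>2"
          by (simp add: power_mult_distrib power_divide)
        ultimately have "((1 / r) ^ (n + 1) * (4 / 5 * real n))\<^sup>2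
            = (1 / r) ^ (2 * n + 2) * (16 / 25 * (real n)\<^sup>2)"
          by (simp only: power_mult_distrib[of "(1 / r) ^ (n + 1)"])
        then show ?thesis by (simp only: e_def mult_ac)
      qed
      finally show "e * (1 / r) ^ (2 * n + 2) \<le> r\<^sup>2 * (norm (proj' n (\<lambda>x. u x - ?w x) r))\<^sup>2" .
    qed (use g e in auto)
    moreover have "e / (2 * real n + 1) * (3 / 4) \<le> e / (2 * real n + 1) * (1 - (1 / g) ^ (2 * n + 1))"
      using gp e by (intro mult_left_mono) auto
    ultimately have "e / (2 * real n + 1) * (3 / 4) \<le> (L2norm ?S (vgrad (\<lambda>x. u x - ?w x)))\<^sup>2 * Qnorm n"
      unfolding right_diff_distrib div_by_1 power_one mult_1_right by linarith
    then show ?thesis by (simp only: Q_def e_def)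
  qed

  have sq\<phi>: "\<phi>\<^sup>2 = (norm F0)\<^sup>2 * Q\<^sup>2" by (simp add: \<phi>_def power_mult_distrib)
  show "inner_ratio (ball 0 1) (1 - g1) (incident_wave f n (k_s mu rho \<omega>)) u \<ge> real n * (\<delta> / 4)"
    unfolding inner_ratio_def k_def[symmetric] inc
  proof (rule ratio_lower_bound[where c = "(norm F0)\<^sup>2" and Q = Q and \<kappa> = "3 / 10 * \<delta>\<^sup>2"])
    have "(4 / 5 * \<delta> * \<phi>)\<^sup>2 \<le> (norm a)\<^sup>2" using ab_lower \<delta> \<phi> by (intro power_mono) auto
    then have "(4 / 5 * \<delta> * \<phi>)\<^sup>2 * (16 / 25 * (real n)\<^sup>2 / (2 * real n + 1) * (3 / 4))
        \<le> (norm a)\<^sup>2 * (16 / 25 * (real n)\<^sup>2 / (2 * real n + 1) * (3 / 4))"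
      by (intro mult_right_mono) auto
    moreover have "3 / 10 * \<delta>\<^sup>2 * (norm F0)\<^sup>2 * Q\<^sup>2 * (real n)\<^sup>2 / (2 * real n + 1)
        \<le> (4 / 5 * \<delta> * \<phi>)\<^sup>2 * (16 / 25 * (real n)\<^sup>2 / (2 * real n + 1) * (3 / 4))"
    proof -
      have "(4 / 5 * \<delta> * \<phi>)\<^sup>2 * (16 / 25 * (real n)\<^sup>2 / (2 * real n + 1) * (3 / 4))
        = 192 / 625 * (\<delta>\<^sup>2 * (norm F0)\<^sup>2 * Q\<^sup>2 * (real n)\<^sup>2 / (2 * real n + 1))"
      proof -
        have "(4 / 5 * \<delta> * \<phi>)\<^sup>2 = 16 / 25 * (\<delta>\<^sup>2 * (norm F0)\<^sup>2 * Q\<^sup>2)"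
          by (simp add: power_mult_distrib sq\<phi> power_divide)
        moreover have "16 / 25 * A * (16 / 25 * B / C * (3 / 4)) = 192 / 625 * (A * B / C)" for A B C :: real
          by simp
        ultimately show ?thesis by (simp only:)
      qed
      moreover have "3 / 10 * (\<delta>\<^sup>2 * (norm F0)\<^sup>2 * Q\<^sup>2 * (real n)\<^sup>2 / (2 * real n + 1))
        \<le> 192 / 625 * (\<delta>\<^sup>2 * (norm F0)\<^sup>2 * Q\<^sup>2 * (real n)\<^sup>2 / (2 * real n + 1))"
        by (intro mult_right_mono) auto
      ultimately show ?thesis by simp
    qed
    ultimately have "3 / 10 * \<delta>\<^sup>2 * (norm F0)\<^sup>2 * Q\<^sup>2 * (real n)\<^sup>2 / (2 * real n + 1)
        \<le> (norm a)\<^sup>2 * (16 / 25 * (real n)\<^sup>2 / (2 * real n + 1) * (3 / 4))"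
      by (rule order_trans[rotated])
    also have "\<dots> = (norm a)\<^sup>2 * (16 / 25) * (real n)\<^sup>2 / (2 * real n + 1) * (3 / 4)" by simp
    also note inner
    finally show "3 / 10 * \<delta>\<^sup>2 * (norm F0)\<^sup>2 * Q\<^sup>2 * (real n)\<^sup>2 / (2 * real n + 1)
        \<le> (L2norm (inner_layer (ball 0 1) (1 - g1)) (vgrad u))\<^sup>2 * Q" .
    show "121 / 100 * (\<delta> / 4)\<^sup>2 \<le> 3 / 10 * \<delta>\<^sup>2" by (simp add: power_divide)
  qed (use wave Q \<delta> L2nn in \<open>auto simp: Q_def\<close>)
  show "outer_ratio (ball 0 1) R (g2 - 1) (incident_wave f n (k_s mu rho \<omega>))
      (\<lambda>x. u x - incident_wave f n (k_s mu rho \<omega>) x) \<ge> real n * (1 / 9)"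
    unfolding outer_ratio_def k_def[symmetric] inc
  proof (rule ratio_lower_bound[where c = "(norm F0)\<^sup>2" and Q = Q and \<kappa> = "3 / 40"])
    have "(2 / 5 * \<phi>)\<^sup>2 \<le> (norm b)\<^sup>2" using b_lower \<phi> by (intro power_mono) auto
    then have "(2 / 5 * \<phi>)\<^sup>2 * (16 / 25 * (real n)\<^sup>2 / (2 * real n + 1) * (3 / 4))
        \<le> (norm b)\<^sup>2 * (16 / 25 * (real n)\<^sup>2 / (2 * real n + 1) * (3 / 4))"
      by (intro mult_right_mono) auto
    moreover have "3 / 40 * (norm F0)\<^sup>2 * Q\<^sup>2 * (real n)\<^sup>2 / (2 * real n + 1)
        \<le> (2 / 5 * \<phi>)\<^sup>2 * (16 / 25 * (real n)\<^sup>2 / (2 * real n + 1) * (3 / 4))"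
    proof -
      have "(2 / 5 * \<phi>)\<^sup>2 * (16 / 25 * (real n)\<^sup>2 / (2 * real n + 1) * (3 / 4))
        = 48 / 625 * ((norm F0)\<^sup>2 * Q\<^sup>2 * (real n)\<^sup>2 / (2 * real n + 1))"
      proof -
        have "(2 / 5 * \<phi>)\<^sup>2 = 4 / 25 * ((norm F0)\<^sup>2 * Q\<^sup>2)"
          by (simp add: power_mult_distrib sq\<phi> power_divide)
        moreover have "4 / 25 * A * (16 / 25 * B / C * (3 / 4)) = 48 / 625 * (A * B / C)" for A B C :: real
          by simp
        ultimately show ?thesis by (simp only:)
      qed
      moreover have "3 / 40 * ((norm F0)\<^sup>2 * Q\<^sup>2 * (real n)\<^sup>2 / (2 * real n + 1))
        \<le> 48 / 625 * ((norm F0)\<^sup>2 * Q\<^sup>2 * (real n)\<^sup>2 / (2 * real n + 1))"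
        by (intro mult_right_mono) auto
      ultimately show ?thesis by simp
    qed
    ultimately have "3 / 40 * (norm F0)\<^sup>2 * Q\<^sup>2 * (real n)\<^sup>2 / (2 * real n + 1)
        \<le> (norm b)\<^sup>2 * (16 / 25 * (real n)\<^sup>2 / (2 * real n + 1) * (3 / 4))"
      by (rule order_trans[rotated])
    also have "\<dots> = (norm b)\<^sup>2 * (16 / 25) * (real n)\<^sup>2 / (2 * real n + 1) * (3 / 4)" by simp
    also note outer
    finally show "3 / 40 * (norm F0)\<^sup>2 * Q\<^sup>2 * (real n)\<^sup>2 / (2 * real n + 1)
        \<le> (L2norm (outer_layer (ball 0 1) R (g2 - 1)) (vgrad (\<lambda>x. u x - regular_wave F0 n k x)))\<^sup>2 * Q" .
    show "121 / 100 * (1 / 9)\<^sup>2 \<le> (3 / 40 :: real)" by (simp add: power_divide)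
  qed (use wave Q L2nn in \<open>auto simp: Q_def\<close>)
qed

text \<open>Translates the logarithmic thresholds for n into powers; ln g < 0 reverses the
  inequality.\<close>

lemma power_le_of_ln_ratio:
  assumes g: "0 < g" "g < 1" and l: "0 < l" and m: "real m \<ge> ln l / ln g"
  shows "g ^ m \<le> l"
proof -
  have "ln g < 0" using g by simp
  then have "real m * ln g \<le> ln l" using m by (simp add: neg_divide_le_eq)
  then have "ln (g ^ m) \<le> ln l" using g by (simp add: ln_realpow)
  then show ?thesis using g l by simp
qed

theorem theorem4p1:
  fixes lam mu rho K :: real
  assumes "mu > 0" and "3 * lam + 2 * mu > 0" and "rho > 0"
  shows "\<exists>\<delta>\<^sub>0>0. \<exists>\<epsilon>\<^sub>0>0. \<exists>\<omega>\<^sub>0>0. \<forall>R \<gamma>1 \<gamma>2.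
    0 < \<gamma>1 \<and> \<gamma>1 < 1 \<and> 1 < \<gamma>2 \<and> \<gamma>2 < R \<longrightarrow>
    (\<exists>loc\<^sub>0>0. \<forall>(\<delta>::real) (\<epsilon>::real) (\<omega>::real) (loc::real) (f::complex) (n::nat) (u::cfield).
      let D = ball (0::real^3) 1;
          ui = incident_wave f n (k_s mu rho \<omega>);
          us = (\<lambda>x. u x - ui x);
          n1 = \<lfloor>(ln loc / ln \<gamma>1 - 3) / 2\<rfloor> + 1;
          n2 = \<lfloor>(1 - ln loc / ln \<gamma>2) / 2\<rfloor> + 1
      in
        0 < \<delta> \<and> \<delta> < \<delta>\<^sub>0 \<and> 0 < \<epsilon> \<and> \<epsilon> < \<epsilon>\<^sub>0 \<and> sqrt (\<delta> / \<epsilon>) < 1 \<and>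
        0 < \<omega> \<and> \<omega> < \<omega>\<^sub>0 \<and> 0 < loc \<and> loc < loc\<^sub>0 \<and>
        real n \<ge> max (max (of_int n1) (of_int n2)) (1 / \<delta>\<^sup>2) \<and>
        f \<noteq> 0 \<and>
        scattering_solution D (\<lambda>y. y) lam mu rho (lam / \<delta>) (mu / \<delta>) (rho / \<epsilon>) \<omega> ui u
        \<longrightarrow>
        inner_ratio D (1 - \<gamma>1) ui u \<ge> real n * \<delta> / (4 * sqrt pi) \<and>
        real n * \<delta> / (4 * sqrt pi) \<ge> K \<and>
        outer_ratio D R (\<gamma>2 - 1) ui us \<ge> real n / (9 * sqrt pi) \<and>
        real n / (9 * sqrt pi) \<ge> K \<and>
        surface_resonance K D R (1 - \<gamma>1) (\<gamma>2 - 1) ui u)"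
proof -
  \<comment> \<open>Chosen so that n \<delta> >= M puts both lower bounds above K; the summand 1
    makes M positive for every K.\<close>
  define M where "M = 4 * sqrt pi * (\<bar>K\<bar> + 1)"
  have sp: "sqrt pi \<ge> 1" using pi_gt3 by simp
  have M: "M > 0" "4 * sqrt pi * K \<le> M"
    using sp by (auto simp: M_def intro!: mult_pos_pos mult_left_mono)
  \<comment> \<open>1/10 is what the transmission estimate asks for; 1/M ensures 1/\<delta> >=
    M.\<close>
  define d0 where "d0 = min (1 / 10) (1 / M)"
  \<comment> \<open>The frequency at which the shear wave number equals 1/40.\<close>
  define w0 where "w0 = 1 / (40 * sqrt (rho / mu))"
  have d0: "d0 > 0" using M by (simp add: d0_def)
  have w0: "w0 > 0" using assms by (simp add: w0_def)
  show ?thesis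
    unfolding Let_def
  proof (rule exI[of _ d0], rule conjI[OF d0], rule exI[of _ 1], rule conjI[OF zero_less_one],
      rule exI[of _ w0], rule conjI[OF w0], intro allI impI, elim conjE)
    fix R g1 g2 :: real
    assume g1: "0 < g1" "g1 < 1" and g2: "1 < g2" "g2 < R"
    show "\<exists>loc\<^sub>0>0. \<forall>\<delta> \<epsilon> \<omega> loc f n u.
        0 < \<delta> \<and> \<delta> < d0 \<and> 0 < \<epsilon> \<and> \<epsilon> < 1 \<and> sqrt (\<delta> / \<epsilon>) < 1 \<and> 0 < \<omega> \<and> \<omega> < w0 \<and> 0 < loc \<and> loc < loc\<^sub>0 \<and>
        real n \<ge> max (max (of_int (\<lfloor>(ln loc / ln g1 - 3) / 2\<rfloor> + 1)) (of_int (\<lfloor>(1 - ln loc / ln g2) / 2\<rfloor> + 1))) (1 / \<delta>\<^sup>2) \<and>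
        f \<noteq> 0 \<and>
        scattering_solution (ball 0 1) (\<lambda>y. y) lam mu rho (lam / \<delta>) (mu / \<delta>) (rho / \<epsilon>) \<omega>
          (incident_wave f n (k_s mu rho \<omega>)) u \<longrightarrow>
        inner_ratio (ball 0 1) (1 - g1) (incident_wave f n (k_s mu rho \<omega>)) u \<ge> real n * \<delta> / (4 * sqrt pi) \<and>
        real n * \<delta> / (4 * sqrt pi) \<ge> K \<and>
        outer_ratio (ball 0 1) R (g2 - 1) (incident_wave f n (k_s mu rho \<omega>))
          (\<lambda>x. u x - incident_wave f n (k_s mu rho \<omega>) x) \<ge> real n / (9 * sqrt pi) \<and>
        real n / (9 * sqrt pi) \<ge> K \<and>
        surface_resonance K (ball 0 1) R (1 - g1) (g2 - 1) (incident_wave f n (k_s mu rho \<omega>)) u"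
    \<comment> \<open>n >= n1 yields g1^(2n+3) <= loc, and the factor g1^2 turns this into g1^(2n+1)
      <= 1/4. For the outer layer loc < 1/4 suffices, which follows from g1 < 1.\<close>
    proof (rule exI[of _ "g1\<^sup>2 / 4"], rule conjI, use g1 in simp, intro allI impI, elim conjE)
      fix \<delta> \<epsilon> \<omega> loc :: real and f :: complex and n :: nat and u :: cfield
      let ?ui = "incident_wave f n (k_s mu rho \<omega>)"
      assume \<delta>: "0 < \<delta>" "\<delta> < d0" and \<epsilon>: "0 < \<epsilon>" "\<epsilon> < 1" "sqrt (\<delta> / \<epsilon>) < 1" and \<omega>: "0 < \<omega>" "\<omega> < w0"
        and loc: "0 < loc" "loc < g1\<^sup>2 / 4"
        and n: "max (max (of_int (\<lfloor>(ln loc / ln g1 - 3) / 2\<rfloor> + 1)) (of_int (\<lfloor>(1 - ln loc / ln g2) / 2\<rfloor> + 1))) (1 / \<delta>\<^sup>2) \<le> real n"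
        and f: "f \<noteq> 0"
        and sol: "scattering_solution (ball 0 1) (\<lambda>y. y) lam mu rho (lam / \<delta>) (mu / \<delta>) (rho / \<epsilon>) \<omega> ?ui u"
      have \<delta>10: "\<delta> \<le> 1 / 10" and \<delta>M: "\<delta> * M \<le> 1"
        using \<delta> M by (auto simp: d0_def field_simps)
      have n\<delta>: "real n * \<delta>\<^sup>2 \<ge> 1" using n \<delta> by (simp add: divide_le_eq)
      have "\<delta>\<^sup>2 \<le> 1 / 100" using power_mono[OF \<delta>10, of 2] \<delta> by (simp add: power2_eq_square)
      then have "real n * \<delta>\<^sup>2 \<le> real n * (1 / 100)" by (intro mult_left_mono) auto
      then have n100: "n \<ge> 100" using n\<delta> by simp
      \<comment> \<open>n \<delta> >= 1/\<delta> >= M, from n >= 1/\<delta>^2 and the choice of the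
        threshold.\<close>
      have nM: "M \<le> real n * \<delta>"
      proof -
        have "M * \<delta> \<le> real n * \<delta> * \<delta>" using n\<delta> \<delta>M by (simp add: power2_eq_square mult_ac)
        then show ?thesis using \<delta>(1) by (rule mult_right_le_imp_le)
      qed
      have \<delta>\<epsilon>: "\<delta> \<le> \<epsilon>" using \<epsilon> by (simp add: divide_less_eq)
      have ks: "k_s mu rho \<omega> \<le> 1 / 40"
      proof -
        have "sqrt (rho / mu) > 0" using assms by simp
        moreover from this have "\<omega> * sqrt (rho / mu) \<le> w0 * sqrt (rho / mu)"
          using \<omega> by (intro mult_right_mono) auto
        ultimately show ?thesis using assms(1,3) by (simp add: k_s_def w0_def)
      qed
      have g1p: "g1 ^ (2 * n + 1) \<le> 1 / 4"
      proof -
        \<comment> \<open>The floor plus 1 exceeds its argument, so 2n + 3 >= ln loc / ln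
          g1.\<close>
        have "(ln loc / ln g1 - 3) / 2 \<le> real n" using n by linarith
        then have "g1 ^ (2 * n + 3) \<le> loc" by (intro power_le_of_ln_ratio[OF g1 loc(1)]) simp
        also have "g1 ^ (2 * n + 3) = g1 ^ (2 * n + 1) * g1\<^sup>2"
          by (simp add: power_add power2_eq_square power3_eq_cube)
        finally have "g1 ^ (2 * n + 1) * g1\<^sup>2 \<le> 1 / 4 * g1\<^sup>2" using loc by simp
        then show ?thesis by (rule mult_right_le_imp_le) (use g1 in simp)
      qed
      have g2p: "(1 / g2) ^ (2 * n + 1) \<le> 1 / 4"
      proof -
        \<comment> \<open>Likewise 2n - 1 >= -ln loc / ln g2 = ln loc / ln (1/g2), which suits the
          base 1/g2 < 1.\<close>
        have "(1 - ln loc / ln g2) / 2 \<le> real n" using n by linarith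
        then have "(1 / g2) ^ (2 * n - 1) \<le> loc"
          using g2 n100 by (intro power_le_of_ln_ratio[OF _ _ loc(1)]) (auto simp: ln_div of_nat_diff)
        moreover have "(1 / g2) ^ (2 * n + 1) \<le> (1 / g2) ^ (2 * n - 1)"
          using g2 by (intro power_decreasing) auto
        moreover have "g1\<^sup>2 \<le> 1" using g1 by (simp add: power_le_one)
        ultimately show ?thesis using loc by linarith
      qed
      note bounds = resonance_bounds[OF n100 assms(1,3) \<delta>(1) \<delta>10 \<epsilon>(1) \<delta>\<epsilon> \<omega>(1) ks f g1 g1p g2 g2p sol]
      \<comment> \<open>\<open>resonance_bounds\<close> proves the estimate without the factor
        1/sqrt(pi), which is at most 1.\<close>
      have inner: "real n * \<delta> / (4 * sqrt pi) \<le> inner_ratio (ball 0 1) (1 - g1) ?ui u"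
      proof (rule order_trans[OF _ bounds(1)])
        have "real n * \<delta> / (4 * sqrt pi) \<le> real n * \<delta> / (4 * 1)"
          using sp \<delta> by (intro divide_left_mono mult_left_mono) auto
        then show "real n * \<delta> / (4 * sqrt pi) \<le> real n * (\<delta> / 4)" by simp
      qed
      have outer: "real n / (9 * sqrt pi) \<le> outer_ratio (ball 0 1) R (g2 - 1) ?ui (\<lambda>x. u x - ?ui x)"
      proof (rule order_trans[OF _ bounds(2)])
        have "real n / (9 * sqrt pi) \<le> real n / (9 * 1)"
          using sp by (intro divide_left_mono mult_left_mono) auto
        then show "real n / (9 * sqrt pi) \<le> real n * (1 / 9)" by simp
      qed
      have K1: "K \<le> real n * \<delta> / (4 * sqrt pi)"
        using M(2) nM sp by (simp add: le_divide_eq mult_ac)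
      have K2: "K \<le> real n / (9 * sqrt pi)"
      proof -
        have "real n * \<delta> \<le> real n * (1 / 10)" using \<delta>10 by (intro mult_left_mono) auto
        then have "real n \<ge> 10 * M" using nM by simp
        moreover have "9 * sqrt pi * K \<le> 10 * M"
          using M by linarith
        ultimately show ?thesis using sp by (simp add: le_divide_eq mult_ac)
      qed
      show "real n * \<delta> / (4 * sqrt pi) \<le> inner_ratio (ball 0 1) (1 - g1) ?ui u \<and>
        K \<le> real n * \<delta> / (4 * sqrt pi) \<and>
        real n / (9 * sqrt pi) \<le> outer_ratio (ball 0 1) R (g2 - 1) ?ui (\<lambda>x. u x - ?ui x) \<and>
        K \<le> real n / (9 * sqrt pi) \<and>
        surface_resonance K (ball 0 1) R (1 - g1) (g2 - 1) ?ui u"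
        using inner outer K1 K2 order_trans[OF K1 inner] order_trans[OF K2 outer]
        by (simp add: surface_resonance_def)
    qed
  qed
qed

end
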